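(* Let $k$ be a field of characteristic $p\geq 3$, let $r\geq 1$, and let $A$ be a finite-dimensional Hopf superalgebra quotient of $\mathbb{P}_r$. Then $A$ is isomorphic (as a Hopf superalgebra) to the group algebra of one of the following: (1) $\mathbb{G}_{a(s)}$ for some integer $0\leq s\leq r$; (2) $\mathbb{G}_{a(s)}\times\mathbb{G}_a^-$ for some integer $0\leq s\leq r$; or (3) $\mathbb{M}_{s;f,\eta}$ for some $1\leq s\leq r$, some inseparable $p$-polynomial $0\neq f\in k[T]$, and some $\eta\in k$. In other words, $A$ is isomorphic to the group algebra of a multiparameter $k$-supergroup scheme.
   Context: "Super" means $\mathbb{Z}_2$-graded. The group algebra of a finite $k$-supergroup scheme $G$ (with finite-dimensional commutative coordinate Hopf superalgebra $k[G]$) is the dual Hopf superalgebra $kG=\mathrm{Hom}_k(k[G],k)$. For $r\geq 1$, $\mathbb{P}_r=k[u_0,\ldots,u_{r-1},v]/\langle u_0^p,\ldots,u_{r-2}^p,u_{r-1}^p+v^2\rangle$, commutative in the ordinary (non-super) sense, with $u_i$ even and $v$ odd. For $0\leq\ell<p^r$ with base-$p$ digits $\ell=\sum_i\ell_ip^i$ put $\gamma_\ell=\prod_iu_i^{\ell_i}/\ell_i!$. $\mathbb{P}_r$ is a Hopf superalgebra with coproduct $\Delta(\gamma_\ell)=\sum_{i+j=\ell}\gamma_i\otimes\gamma_j$ for $0\leq\ell<p^r$, $u_{r-1}^p$ and $v$ primitive, and antipode $S(\gamma_\ell)=(-1)^\ell\gamma_\ell$, $S(v)=-v$. $\mathbb{G}_{a(s)}$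 ($s\ge1$) is the $s$-th Frobenius kernel of the additive group scheme; its group algebra is $\mathbb{P}_s/\langle v\rangle$; $\mathbb{G}_{a(0)}$ is trivial with group algebra $k$. $\mathbb{G}_a^-$ is the purely odd additive supergroup scheme, with group algebra $k[v]/\langle v^2\rangle$, $v$ odd and primitive. The group algebra of a product is the tensor product of group algebras. An inseparable $p$-polynomial is a polynomial $f=\sum_{i=1}^tc_iT^{p^i}\in k[T]$ (no linear term). For such $f\neq0$ and $\eta\in k$, $\mathbb{M}_{s;f,\eta}$ is the finite supergroup scheme with group algebra $\mathbb{P}_s/\langle f(u_{s-1})+\eta u_0\rangle$. A multiparameter $k$-supergroup scheme is one isomorphic to $\mathbb{G}_{a(s)}$ or $\mathbb{G}_{a(s)}\times\mathbb{G}_a^-$ for some $s\in\mathbb{N}=\{0,1,2,\ldots\}$, or $\mathbb{M}_{s;f,\eta}$ for some $s\geq1$, some inseparable $p$-polynomial $0\neq f\in k[T]$, and some $\eta\in k$. *)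

theory Defs
  imports
    "HOL-Library.Poly_Mapping"
    "HOL-Library.Z2"
    "HOL-Computational_Algebra.Computational_Algebra"
    "HOL-Algebra.QuotRing"
    "HOL-Algebra.Module"
    "HOL-Algebra.Algebraic_Closure_Type"
begin

text \<open>These constants are hidden by their library theory.\<close>

abbreviation (input) keys where "keys \<equiv> Poly_Mapping.keys"
abbreviation (input) lookup where "lookup \<equiv> Poly_Mapping.lookup"
abbreviation (input) single where "single \<equiv> Poly_Mapping.single"

section \<open>Superalgebras\<close>

text \<open>The base field is a type of class \<^class>\<open>field\<close>. The modules and rings over it are
  HOL-Algebra structures, so the field also has to be available as a structure.\<close>

abbreviation base_field :: "'k::field ring" (\<open>\<K>\<close>)
  where "\<K> \<equiv> ring_of_type_algebra"

text \<open>The degrees of a super (that is, \<open>\<int>\<^sub>2\<close>-graded) space are the elements of the field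
  \<^typ>\<open>bit\<close> with two elements.\<close>

record ('k, 'a) superalg = "('k, 'a) module" +
  part :: "bit \<Rightarrow> 'a set"

locale superalgebra = module \<K> A + ring A
  for A :: "('k::field, 'a, 'm) superalg_scheme" (structure) +
  assumes smult_mult_left:
      "\<lbrakk>x \<in> carrier A; y \<in> carrier A\<rbrakk> \<Longrightarrow> (c \<odot> x) \<otimes> y = c \<odot> (x \<otimes> y)"
    and smult_mult_right:
      "\<lbrakk>x \<in> carrier A; y \<in> carrier A\<rbrakk> \<Longrightarrow> x \<otimes> (c \<odot> y) = c \<odot> (x \<otimes> y)"
    and part_submodule: "submodule (part A i) \<K> A"
    and part_Int: "part A 0 \<inter> part A 1 = {\<zero>}"
    and part_sum: "x \<in> carrier A \<Longrightarrow> \<exists>y\<in>part A 0. \<exists>z\<in>part A 1. x = y \<oplus> z"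
    and one_part: "\<one> \<in> part A 0"
    and mult_part: "\<lbrakk>x \<in> part A i; y \<in> part A j\<rbrakk> \<Longrightarrow> x \<otimes> y \<in> part A (i + j)"

definition component :: "('k, 'a, 'm) superalg_scheme \<Rightarrow> bit \<Rightarrow> 'a \<Rightarrow> 'a"
  where "component A i x =
    (THE y. y \<in> part A i \<and> (\<exists>z\<in>part A (i + 1). x = y \<oplus>\<^bsub>A\<^esub> z))"

definition koszul :: "bit \<Rightarrow> bit \<Rightarrow> 'k::field"
  where "koszul i j = (if i = 1 \<and> j = 1 then - 1 else 1)"

definition lin_map :: "('k, 'a, 'm) module_scheme \<Rightarrow> ('k, 'b, 'n) module_scheme \<Rightarrow> ('a \<Rightarrow> 'b) \<Rightarrow> bool"
  where "lin_map M N f \<longleftrightarrow>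
    f \<in> carrier M \<rightarrow> carrier N \<and>
    (\<forall>x\<in>carrier M. \<forall>y\<in>carrier M. f (x \<oplus>\<^bsub>M\<^esub> y) = f x \<oplus>\<^bsub>N\<^esub> f y) \<and>
    (\<forall>c. \<forall>x\<in>carrier M. f (c \<odot>\<^bsub>M\<^esub> x) = c \<odot>\<^bsub>N\<^esub> f x)"

definition even_map :: "('k, 'a, 'm) superalg_scheme \<Rightarrow> ('k, 'b, 'n) superalg_scheme \<Rightarrow> ('a \<Rightarrow> 'b) \<Rightarrow> bool"
  where "even_map A B f \<longleftrightarrow> lin_map A B f \<and> (\<forall>i. f ` part A i \<subseteq> part B i)"

definition superalg_hom :: "('k, 'a, 'm) superalg_scheme \<Rightarrow> ('k, 'b, 'n) superalg_scheme \<Rightarrow> ('a \<Rightarrow> 'b) \<Rightarrow> bool"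
  where "superalg_hom A B f \<longleftrightarrow> even_map A B f \<and> f \<in> ring_hom A B"

definition finite_dim :: "('k, 'a, 'm) module_scheme \<Rightarrow> bool"
  where "finite_dim M \<longleftrightarrow> (\<exists>B. finite B \<and> B \<subseteq> carrier M \<and>
    (\<forall>x\<in>carrier M. \<exists>c. x = (\<Oplus>\<^bsub>M\<^esub>b\<in>B. c b \<odot>\<^bsub>M\<^esub> b)))"

definition base_superalg :: "('k::field, 'k) superalg"
  where "base_superalg = module.extend (ring.extend \<K> (module.fields (*)))
    (superalg.fields (\<lambda>i. if i = 0 then UNIV else {0}))"

definition quot_superalg :: "('k, 'a, 'm) superalg_scheme \<Rightarrow> 'a set \<Rightarrow> ('k, 'a set) superalg"
  where "quot_superalg A I = module.extend
    (ring.extend (A Quot I) (module.fields (\<lambda>c Z. \<Union>x\<in>Z. I +>\<^bsub>A\<^esub> (c \<odot>\<^bsub>A\<^esub> x))))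
    (superalg.fields (\<lambda>i. (\<lambda>x. I +>\<^bsub>A\<^esub> x) ` part A i))"


section \<open>Tensor products\<close>

text \<open>The tensor product of \<open>A\<close> and \<open>B\<close> is the quotient of the free vector space on
  \<open>carrier A \<times> carrier B\<close> by the span of the bilinearity relations. Free vector spaces are
  rendered by \<^typ>\<open>'s \<Rightarrow>\<^sub>0 'k\<close>, restricted to the elements with the right support.\<close>

definition fscale :: "'k \<Rightarrow> ('s \<Rightarrow>\<^sub>0 'k) \<Rightarrow> ('s \<Rightarrow>\<^sub>0 'k::field)"
  where "fscale c = Poly_Mapping.map ((*) c)"

lemma lookup_fscale [simp]: "lookup (fscale c t) s = c * lookup t s"
  by (simp add: fscale_def Poly_Mapping.map.rep_eq when_def)

lemma vector_space_fscale: "vector_space fscale"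
  by unfold_locales (rule poly_mapping_eqI, simp add: lookup_add algebra_simps)+

text \<open>The linear extension of a map defined on the basis.\<close>

definition fextend :: "('s \<Rightarrow> ('t \<Rightarrow>\<^sub>0 'k)) \<Rightarrow> ('s \<Rightarrow>\<^sub>0 'k) \<Rightarrow> ('t \<Rightarrow>\<^sub>0 'k::field)"
  where "fextend g x = (\<Sum>s\<in>keys x. fscale (lookup x s) (g s))"

definition tensor_rel ::
    "('k::field, 'a, 'm) module_scheme \<Rightarrow> ('k, 'b, 'n) module_scheme \<Rightarrow> ('a \<times> 'b \<Rightarrow>\<^sub>0 'k) set"
  where "tensor_rel M N =
    {single (a \<oplus>\<^bsub>M\<^esub> a', b) 1 - single (a, b) 1 - single (a', b) 1 |a a' b.
        a \<in> carrier M \<and> a' \<in> carrier M \<and> b \<in> carrier N} \<union>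
    {single (a, b \<oplus>\<^bsub>N\<^esub> b') 1 - single (a, b) 1 - single (a, b') 1 |a b b'.
        a \<in> carrier M \<and> b \<in> carrier N \<and> b' \<in> carrier N} \<union>
    {single (c \<odot>\<^bsub>M\<^esub> a, b) 1 - single (a, b) c |c a b. a \<in> carrier M \<and> b \<in> carrier N} \<union>
    {single (a, c \<odot>\<^bsub>N\<^esub> b) 1 - single (a, b) c |c a b. a \<in> carrier M \<and> b \<in> carrier N}"

definition tclass ::
    "('k::field, 'a, 'm) module_scheme \<Rightarrow> ('k, 'b, 'n) module_scheme \<Rightarrow>
      ('a \<times> 'b \<Rightarrow>\<^sub>0 'k) \<Rightarrow> ('a \<times> 'b \<Rightarrow>\<^sub>0 'k) set"
  where "tclass M N t = {t'. t' - t \<in> module.span fscale (tensor_rel M N)}"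

definition pure ::
    "('k::field, 'a, 'm) module_scheme \<Rightarrow> ('k, 'b, 'n) module_scheme \<Rightarrow>
      'a \<Rightarrow> 'b \<Rightarrow> ('a \<times> 'b \<Rightarrow>\<^sub>0 'k) set"
  where "pure M N a b = tclass M N (single (a, b) 1)"

text \<open>The product is determined by
  \<open>(a \<otimes> b) (a' \<otimes> b') = (-1)\<^bsup>|b| |a'|\<^esup> a a' \<otimes> b b'\<close> for homogeneous \<open>b\<close> and \<open>a'\<close>; the sums over
  \<open>i\<close> and \<open>j\<close> extend this to arbitrary \<open>b\<close> and \<open>a'\<close>.\<close>

definition tensor_mult ::
    "('k::field, 'a, 'm) superalg_scheme \<Rightarrow> ('k, 'b, 'n) superalg_scheme \<Rightarrow>
      ('a \<times> 'b \<Rightarrow>\<^sub>0 'k) \<Rightarrow> ('a \<times> 'b \<Rightarrow>\<^sub>0 'k) \<Rightarrow> ('a \<times> 'b \<Rightarrow>\<^sub>0 'k)"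
  where "tensor_mult A B x y =
    fextend (\<lambda>(a, b). fextend (\<lambda>(a', b'). \<Sum>i\<in>{0, 1}. \<Sum>j\<in>{0, 1}.
      single (a \<otimes>\<^bsub>A\<^esub> component A j a', component B i b \<otimes>\<^bsub>B\<^esub> b') (koszul i j)) y) x"

definition tensor ::
    "('k::field, 'a, 'm) superalg_scheme \<Rightarrow> ('k, 'b, 'n) superalg_scheme \<Rightarrow>
      ('k, ('a \<times> 'b \<Rightarrow>\<^sub>0 'k) set) superalg"
  where "tensor A B = \<lparr>
    carrier = {tclass A B t |t. keys t \<subseteq> carrier A \<times> carrier B},
    monoid.mult = (\<lambda>Y Z. \<Union>x\<in>Y. \<Union>y\<in>Z. tclass A B (tensor_mult A B x y)),
    one = pure A B \<one>\<^bsub>A\<^esub> \<one>\<^bsub>B\<^esub>,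
    ring.zero = tclass A B 0,
    add = (\<lambda>Y Z. \<Union>x\<in>Y. \<Union>y\<in>Z. tclass A B (x + y)),
    module.smult = (\<lambda>c Z. \<Union>x\<in>Z. tclass A B (fscale c x)),
    part = (\<lambda>n. {tclass A B t |t. keys t \<subseteq> (\<Union>i. part A i \<times> part B (n - i))})\<rparr>"

text \<open>The linear map out of a tensor product that is induced by a bilinear map \<open>\<beta>\<close>.\<close>

definition tlift ::
    "('k::field, 'c, 'm) module_scheme \<Rightarrow> ('a \<Rightarrow> 'b \<Rightarrow> 'c) \<Rightarrow> ('a \<times> 'b \<Rightarrow>\<^sub>0 'k) set \<Rightarrow> 'c"
  where "tlift M \<beta> Z = (let x = (SOME x. x \<in> Z) in
    \<Oplus>\<^bsub>M\<^esub>s\<in>keys x. lookup x s \<odot>\<^bsub>M\<^esub> \<beta> (fst s) (snd s))"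

text \<open>The tensor product \<open>f \<otimes> g\<close> of two even linear maps with codomains \<open>A\<close> and \<open>B\<close>.\<close>

definition tmap ::
    "('k::field, 'c, 'm) superalg_scheme \<Rightarrow> ('k, 'd, 'n) superalg_scheme \<Rightarrow>
      ('a \<Rightarrow> 'c) \<Rightarrow> ('b \<Rightarrow> 'd) \<Rightarrow> ('a \<times> 'b \<Rightarrow>\<^sub>0 'k) set \<Rightarrow> ('c \<times> 'd \<Rightarrow>\<^sub>0 'k) set"
  where "tmap A B f g = tlift (tensor A B) (\<lambda>a b. pure A B (f a) (g b))"

text \<open>The associativity isomorphism \<open>(A \<otimes> B) \<otimes> C \<rightarrow> A \<otimes> (B \<otimes> C)\<close>.\<close>

definition tassoc ::
    "('k::field, 'a, 'l) superalg_scheme \<Rightarrow> ('k, 'b, 'm) superalg_scheme \<Rightarrow>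
      ('k, 'c, 'n) superalg_scheme \<Rightarrow> (('a \<times> 'b \<Rightarrow>\<^sub>0 'k) set \<times> 'c \<Rightarrow>\<^sub>0 'k) set \<Rightarrow>
      ('a \<times> ('b \<times> 'c \<Rightarrow>\<^sub>0 'k) set \<Rightarrow>\<^sub>0 'k) set"
  where "tassoc A B C = (let T = tensor A (tensor B C) in
    tlift T (\<lambda>Z c. tlift T (\<lambda>a b. pure A (tensor B C) a (pure B C b c)) Z))"


section \<open>Hopf superalgebras\<close>

record (overloaded) ('k, 'a) hopf_superalg = "('k, 'a) superalg" +
  comult :: "'a \<Rightarrow> ('a \<times> 'a \<Rightarrow>\<^sub>0 'k) set"
  counit :: "'a \<Rightarrow> 'k"
  antipode :: "'a \<Rightarrow> 'a"

locale hopf_superalgebra = superalgebra H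
  for H :: "('k::field, 'a, 'm) hopf_superalg_scheme" (structure) +
  assumes comult_hom: "superalg_hom H (tensor H H) (comult H)"
    and counit_hom: "superalg_hom H base_superalg (counit H)"
    and coassoc: "x \<in> carrier H \<Longrightarrow>
      tassoc H H H (tmap (tensor H H) H (comult H) id (comult H x)) =
      tmap H (tensor H H) id (comult H) (comult H x)"
    and counit_left: "x \<in> carrier H \<Longrightarrow>
      tlift H (\<lambda>a b. counit H a \<odot> b) (comult H x) = x"
    and counit_right: "x \<in> carrier H \<Longrightarrow>
      tlift H (\<lambda>a b. counit H b \<odot> a) (comult H x) = x"
    and antipode_even: "even_map H H (antipode H)"
    and antipode_left: "x \<in> carrier H \<Longrightarrow>
      tlift H (\<lambda>a b. antipode H a \<otimes> b) (comult H x) = counit H x \<odot> \<one>"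
    and antipode_right: "x \<in> carrier H \<Longrightarrow>
      tlift H (\<lambda>a b. a \<otimes> antipode H b) (comult H x) = counit H x \<odot> \<one>"

definition hopf_hom ::
    "('k::field, 'a, 'm) hopf_superalg_scheme \<Rightarrow> ('k, 'b, 'n) hopf_superalg_scheme \<Rightarrow> ('a \<Rightarrow> 'b) \<Rightarrow> bool"
  where "hopf_hom H H' f \<longleftrightarrow> superalg_hom H H' f \<and>
    (\<forall>x\<in>carrier H. comult H' (f x) = tmap H' H' f f (comult H x)) \<and>
    (\<forall>x\<in>carrier H. counit H' (f x) = counit H x) \<and>
    (\<forall>x\<in>carrier H. antipode H' (f x) = f (antipode H x))"

definition hopf_iso ::
    "('k::field, 'a, 'm) hopf_superalg_scheme \<Rightarrow> ('k, 'b, 'n) hopf_superalg_scheme \<Rightarrow> bool"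
    (infix \<open>\<cong>\<^sub>H\<close> 50)
  where "H \<cong>\<^sub>H H' \<longleftrightarrow> (\<exists>f. hopf_hom H H' f \<and> bij_betw f (carrier H) (carrier H'))"

definition base_hopf :: "('k::field, 'k) hopf_superalg"
  where "base_hopf = superalg.extend base_superalg
    (hopf_superalg.fields (\<lambda>c. pure base_superalg base_superalg c 1) id id)"

text \<open>The Hopf superalgebra structure of a quotient by a homogeneous Hopf ideal \<open>I\<close>. The operations
  do not depend on the representatives chosen.\<close>

definition quot_hopf :: "('k::field, 'a) hopf_superalg \<Rightarrow> 'a set \<Rightarrow> ('k, 'a set) hopf_superalg"
  where "quot_hopf H I = (let Q = quot_superalg H I; q = (\<lambda>x. I +>\<^bsub>H\<^esub> x) in
    superalg.extend Q (hopf_superalg.fields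
      (\<lambda>Z. tmap Q Q q q (comult H (SOME x. x \<in> Z)))
      (\<lambda>Z. counit H (SOME x. x \<in> Z))
      (\<lambda>Z. q (antipode H (SOME x. x \<in> Z)))))"

text \<open>On homogeneous tensors, writing \<open>\<Delta> a = \<Sum> a\<^sub>1 \<otimes> a\<^sub>2\<close> and \<open>\<Delta> b = \<Sum> b\<^sub>1 \<otimes> b\<^sub>2\<close>, the coproduct of
  \<open>a \<otimes> b\<close> is \<open>\<Sum> (-1)\<^bsup>|a\<^sub>2| |b\<^sub>1|\<^esup> (a\<^sub>1 \<otimes> b\<^sub>1) \<otimes> (a\<^sub>2 \<otimes> b\<^sub>2)\<close>.\<close>

definition tensor_hopf ::
    "('k::field, 'a) hopf_superalg \<Rightarrow> ('k, 'b) hopf_superalg \<Rightarrow>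
      ('k, ('a \<times> 'b \<Rightarrow>\<^sub>0 'k) set) hopf_superalg"
  where "tensor_hopf A B = (let T = tensor A B; TT = tensor T T in
    superalg.extend T (hopf_superalg.fields
      (tlift TT (\<lambda>a b. tlift TT (\<lambda>a1 a2. tlift TT (\<lambda>b1 b2.
        \<Oplus>\<^bsub>TT\<^esub>i\<in>{0, 1}. \<Oplus>\<^bsub>TT\<^esub>j\<in>{0, 1}. koszul i j \<odot>\<^bsub>TT\<^esub>
          pure T T (pure A B a1 (component B j b1)) (pure A B (component A i a2) b2))
        (comult B b)) (comult A a)))
      (tlift base_superalg (\<lambda>a b. counit A a * counit B b))
      (tmap A B (antipode A) (antipode B))))"


section \<open>Polynomials in \<open>u\<^sub>0, \<dots>, u\<^bsub>r-1\<^esub>, v\<close> and their quotients\<close>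

datatype pvar = U nat | V

type_synonym 'k pvpoly = "(pvar \<Rightarrow>\<^sub>0 nat) \<Rightarrow>\<^sub>0 'k"

definition pvar :: "pvar \<Rightarrow> 'k::field pvpoly"
  where "pvar x = single (single x 1) 1"

definition pconst :: "'k::field \<Rightarrow> 'k pvpoly"
  where "pconst c = single 0 c"

definition poly_superalg :: "nat \<Rightarrow> ('k::field, 'k pvpoly) superalg"
  where "poly_superalg r =
    (let S = {f. \<forall>m\<in>keys f. keys m \<subseteq> insert V (U ` {..<r})} in \<lparr>
      carrier = S, monoid.mult = (*), one = 1, ring.zero = 0, add = (+),
      module.smult = (\<lambda>c f. pconst c * f),
      part = (\<lambda>i. {f \<in> S. \<forall>m\<in>keys f. of_nat (lookup m V) = i})\<rparr>)"

definition pclass :: "nat \<Rightarrow> 'k::field pvpoly set \<Rightarrow> 'k pvpoly \<Rightarrow> 'k pvpoly set"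
  where "pclass r rels f = Idl\<^bsub>poly_superalg r\<^esub> rels +>\<^bsub>poly_superalg r\<^esub> f"

definition presented_superalg :: "nat \<Rightarrow> 'k::field pvpoly set \<Rightarrow> ('k, 'k pvpoly set) superalg"
  where "presented_superalg r rels = quot_superalg (poly_superalg r) (Idl\<^bsub>poly_superalg r\<^esub> rels)"

text \<open>The Hopf structure on a quotient of \<open>k[u\<^sub>0, \<dots>, u\<^bsub>r-1\<^esub>, v]\<close> for which \<open>v\<close> is primitive, the
  coproduct of \<open>u\<^sub>i\<close> is \<open>du i\<close>, and the antipode negates each generator. The coproduct is the algebra
  map with these values on the generators. The antipode is linear and satisfies
  \<open>S(xy) = (-1)\<^bsup>|x| |y|\<^esup> S(y) S(x)\<close>, so that \<open>S(v\<^sup>n) = (-1)\<^bsup>n(n-1)/2\<^esup> S(v)\<^sup>n\<close>: it is not an algebra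
  map, although the algebra is commutative, and it scales every monomial by a sign. The counit is
  the constant coefficient.\<close>

definition comult_monomial ::
    "nat \<Rightarrow> 'k::field pvpoly set \<Rightarrow> (nat \<Rightarrow> ('k pvpoly set \<times> 'k pvpoly set \<Rightarrow>\<^sub>0 'k) set) \<Rightarrow>
      (pvar \<Rightarrow>\<^sub>0 nat) \<Rightarrow> ('k pvpoly set \<times> 'k pvpoly set \<Rightarrow>\<^sub>0 'k) set"
  where "comult_monomial r rels du m =
    (let Q = presented_superalg r rels; T = tensor Q Q; v = pclass r rels (pvar V);
         dv = pure Q Q v \<one>\<^bsub>Q\<^esub> \<oplus>\<^bsub>T\<^esub> pure Q Q \<one>\<^bsub>Q\<^esub> v
     in foldr (\<lambda>i y. (du i [^]\<^bsub>T\<^esub> lookup m (U i)) \<otimes>\<^bsub>T\<^esub> y) [0..<r] (dv [^]\<^bsub>T\<^esub> lookup m V))"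

definition antipode_sign :: "nat \<Rightarrow> (pvar \<Rightarrow>\<^sub>0 nat) \<Rightarrow> 'k::field"
  where "antipode_sign r m =
    (\<Prod>i<r. (- 1) ^ lookup m (U i)) * (- 1) ^ (lookup m V choose 2) * (- 1) ^ lookup m V"

definition presented_hopf ::
    "nat \<Rightarrow> 'k::field pvpoly set \<Rightarrow> (nat \<Rightarrow> ('k pvpoly set \<times> 'k pvpoly set \<Rightarrow>\<^sub>0 'k) set) \<Rightarrow>
      ('k, 'k pvpoly set) hopf_superalg"
  where "presented_hopf r rels du =
    (let Q = presented_superalg r rels; T = tensor Q Q in
     superalg.extend Q (hopf_superalg.fields
      (\<lambda>Z. let f = (SOME f. f \<in> Z) in
        \<Oplus>\<^bsub>T\<^esub>m\<in>keys f. lookup f m \<odot>\<^bsub>T\<^esub> comult_monomial r rels du m)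
      (\<lambda>Z. lookup (SOME f. f \<in> Z) 0)
      (\<lambda>Z. let f = (SOME f. f \<in> Z) in
        pclass r rels (\<Sum>m\<in>keys f. single m (antipode_sign r m * lookup f m)))))"


section \<open>The Hopf superalgebras \<open>\<P>\<^sub>r\<close>\<close>

text \<open>The characteristic \<open>p\<close> is \<^term>\<open>CHAR('k::field)\<close>.\<close>

definition PP_rels :: "nat \<Rightarrow> 'k::field pvpoly set"
  where "PP_rels r = (\<lambda>i. pvar (U i) ^ CHAR('k)) ` {..<r - 1} \<union>
    {pvar (U (r - 1)) ^ CHAR('k) + pvar V ^ 2}"

definition pgamma :: "nat \<Rightarrow> nat \<Rightarrow> 'k::field pvpoly"
  where "pgamma r l = (\<Prod>i<r. let d = l div CHAR('k) ^ i mod CHAR('k) in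
    pconst (1 / of_nat (fact d)) * pvar (U i) ^ d)"

text \<open>As \<open>u\<^sub>i\<close> is \<open>\<gamma>\<^sub>l\<close> for \<open>l = p\<^sup>i\<close> and each \<open>\<gamma>\<^sub>l\<close> is a scalar multiple of a product of the
  \<open>u\<^sub>i\<close>, the coproduct, being multiplicative, is determined by
  \<open>\<Delta>(\<gamma>\<^sub>l) = \<Sum>\<^bsub>j\<le>l\<^esub> \<gamma>\<^sub>j \<otimes> \<gamma>\<^bsub>l-j\<^esub>\<close> for \<open>l = p\<^sup>i\<close> with \<open>i < r\<close>, and this formula then holds for all
  \<open>l < p\<^sup>r\<close>. Likewise \<open>S(u\<^sub>i) = - u\<^sub>i\<close> gives \<open>S(\<gamma>\<^sub>l) = (-1)\<^sup>l \<gamma>\<^sub>l\<close>: as \<open>p\<close> is odd, \<open>l\<close> has the parity of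
  the sum of its base-\<open>p\<close> digits.\<close>

definition comult_gamma :: "nat \<Rightarrow> nat \<Rightarrow> ('k::field pvpoly set \<times> 'k pvpoly set \<Rightarrow>\<^sub>0 'k) set"
  where "comult_gamma r l =
    (let Q = presented_superalg r (PP_rels r) in
      \<Oplus>\<^bsub>tensor Q Q\<^esub>j\<in>{..l}. pure Q Q
        (pclass r (PP_rels r) (pgamma r j)) (pclass r (PP_rels r) (pgamma r (l - j))))"

definition PP :: "nat \<Rightarrow> ('k::field, 'k pvpoly set) hopf_superalg"
  where "PP r = presented_hopf r (PP_rels r) (\<lambda>i. comult_gamma r (CHAR('k) ^ i))"

definition PP_quot :: "nat \<Rightarrow> 'k::field pvpoly \<Rightarrow> ('k, 'k pvpoly set set) hopf_superalg"
  where "PP_quot r f = quot_hopf (PP r) (Idl\<^bsub>PP r\<^esub> {pclass r (PP_rels r) f})"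


section \<open>Group algebras of the multiparameter supergroup schemes\<close>

text \<open>Finite supergroup schemes enter only through their group algebras. Those of \<open>\<G>\<^bsub>a(0)\<^esub>\<close> and
  \<open>\<G>\<^bsub>a(s)\<^esub>\<close> for \<open>s \<ge> 1\<close> live on different types, which is why the corresponding isomorphism
  classes, rather than the group algebras, are indexed by \<open>s\<close>.\<close>

definition kGa :: "nat \<Rightarrow> ('k::field, 'k pvpoly set set) hopf_superalg"
  where "kGa s = PP_quot s (pvar V)"

definition kGa_minus :: "('k::field, 'k pvpoly set) hopf_superalg"
  where "kGa_minus = presented_hopf 0 {pvar V ^ 2} (\<lambda>i. undefined)"

definition iso_kGa :: "('k::field, 'a) hopf_superalg \<Rightarrow> nat \<Rightarrow> bool"
  where "iso_kGa A s \<longleftrightarrow>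
    (if s = 0 then A \<cong>\<^sub>H (base_hopf :: ('k, 'k) hopf_superalg)
     else A \<cong>\<^sub>H (kGa s :: ('k, 'k pvpoly set set) hopf_superalg))"

definition iso_kGa_times_minus :: "('k::field, 'a) hopf_superalg \<Rightarrow> nat \<Rightarrow> bool"
  where "iso_kGa_times_minus A s \<longleftrightarrow>
    (if s = 0 then A \<cong>\<^sub>H tensor_hopf (base_hopf :: ('k, 'k) hopf_superalg) kGa_minus
     else A \<cong>\<^sub>H tensor_hopf (kGa s :: ('k, 'k pvpoly set set) hopf_superalg) kGa_minus)"

definition inseparable_p_poly :: "'k::field poly \<Rightarrow> bool"
  where "inseparable_p_poly f \<longleftrightarrow> (\<exists>t c. f = (\<Sum>i = 1..t. monom (c i) (CHAR('k) ^ i)))"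

definition kM :: "nat \<Rightarrow> 'k::field poly \<Rightarrow> 'k \<Rightarrow> ('k, 'k pvpoly set set) hopf_superalg"
  where "kM s f \<eta> =
    PP_quot s (poly (map_poly pconst f) (pvar (U (s - 1))) + pconst \<eta> * pvar (U 0))"

definition multiparameter_group_algebra :: "('k::field, 'a) hopf_superalg \<Rightarrow> bool"
  where "multiparameter_group_algebra A \<longleftrightarrow>
    (\<exists>s. iso_kGa A s) \<or> (\<exists>s. iso_kGa_times_minus A s) \<or>
    (\<exists>s f \<eta>. 1 \<le> s \<and> inseparable_p_poly f \<and> f \<noteq> 0 \<and> A \<cong>\<^sub>H kM s f \<eta>)"

end

theory Submission
  imports Defs "HOL-Library.Product_Plus"
begin

text \<open>Let \<open>e\<close> be the evaluation of polynomials in \<open>u\<^sub>0, \<dots>, u\<^bsub>s-1\<^esub>, v\<close> in \<open>A\<close>, with kernel \<open>K\<close>. If \<open>u\<^sub>0\<close> is in \<open>K\<close>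
  and \<open>s \<ge> 2\<close>, then \<open>A\<close> is a quotient of \<open>\<P>\<^bsub>s-1\<^esub>\<close>, so we may assume that \<open>u\<^sub>0 \<notin> K\<close> (for \<open>s = 1\<close> what is left is
  \<open>k\<close> or \<open>k[v]/v\<^sup>2\<close>). Modulo \<open>K\<close>, polynomials are combinations of \<open>\<gamma>\<^sub>j v\<^sup>i\<close> with \<open>j < p\<^sup>s\<close>. The coproduct of such a
  product contains a tensor of two smaller ones, unless it is \<open>1\<close>, \<open>u\<^sub>0\<close>, \<open>v\<close> or \<open>v\<^bsup>2p^i\<^esup>\<close>; hence a
  relation of least degree involves only these, and by parity and the counit it has the form
  \<open>\<Sum>\<^sub>i b\<^sub>i v\<^bsup>2p^i\<^esup> + \<eta> u\<^sub>0 = 0\<close>. As \<open>v\<^sup>2 = - u\<^bsub>s-1\<^esub>\<^sup>p\<close>, this is an equation \<open>f(u\<^bsub>s-1\<^esub>) = \<eta> u\<^sub>0\<close> with \<open>f\<close> an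
  inseparable \<open>p\<close>-polynomial, and by minimality it generates \<open>K\<close>.\<close>

section \<open>Free vector spaces\<close>

text \<open>The tensor product carries Koszul signs, so the coproduct is not a map of commutative
  rings. It is nevertheless computed in the commutative ring \<open>'k dpoly\<close>, where an
  exponent pair stands for a tensor of two monomials (\<open>th\<close>): the signs cancel the cross
  terms in the square of v \<otimes> 1 + 1 \<otimes> v, and its powers are replaced by
  \<open>om\<close>. The price is that \<open>Delta\<close> is multiplicative only for left factors
  that are even in v. No basis of P_r is ever established. The structure maps of the quotients are
  defined at chosen representatives; they are shown to respect the relations after evaluation in
  \<open>A\<close>. Independence is proved in \<open>A\<close> itself: a relation is tested against
  functionals dual to the basis elements of smaller degree, whose independence is the induction
  hypothesis. Divided powers replace monomials because all coefficients of their coproducts are 1.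
  The finite dimension of \<open>A\<close> provides a relation among the v^(2p^i). Replacing v^2 by
  -u_(s-1)^p turns the exponent i into i + 1, which is why f has no linear term.\<close>

lemma base_field_simps [simp]:
  "carrier (\<K> :: 'k::field ring) = UNIV"
  "x \<oplus>\<^bsub>(\<K> :: 'k::field ring)\<^esub> y = x + y"
  "x \<otimes>\<^bsub>(\<K> :: 'k::field ring)\<^esub> y = x * y"
  "\<zero>\<^bsub>(\<K> :: 'k::field ring)\<^esub> = 0"
  "\<one>\<^bsub>(\<K> :: 'k::field ring)\<^esub> = 1"
  by (simp_all add: ring_of_type_algebra_def)

interpretation fs: vector_space "fscale :: 'k::field \<Rightarrow> ('s \<Rightarrow>\<^sub>0 'k) \<Rightarrow> _"
  by (rule vector_space_fscale)

lemma fscale_single [simp]: "fscale c (single s d) = single s (c * d)"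
  by (rule poly_mapping_eqI) (simp add: lookup_single when_def)

lemma poly_mapping_expand:
  "x = (\<Sum>s\<in>keys x. single s (lookup x s))"
  by (rule poly_mapping_eqI) (auto simp: lookup_sum lookup_single when_def in_keys_iff)

lemma fextend_superset:
  "finite S \<Longrightarrow> keys x \<subseteq> S \<Longrightarrow> fextend g x = (\<Sum>s\<in>S. fscale (lookup x s) (g s))"
  unfolding fextend_def by (rule sum.mono_neutral_left) (auto simp: in_keys_iff)

lemma fextend_0 [simp]: "fextend g 0 = 0"
  by (simp add: fextend_def)

lemma fextend_single [simp]: "fextend g (single s c) = fscale c (g s)"
  by (cases "c = 0") (simp_all add: fextend_def)

lemma fextend_add: "fextend g (x + y) = fextend g x + fextend g y"
proof -
  have *: "finite (keys x \<union> keys y)" "keys (x + y) \<subseteq> keys x \<union> keys y"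
    by (auto simp: keys_add)
  show ?thesis
    by (subst (1 2 3) fextend_superset[OF *(1)])
      (use * in \<open>auto simp: lookup_add fs.scale_left_distrib sum.distrib\<close>)
qed

lemma fextend_fscale: "fextend g (fscale c x) = fscale c (fextend g x)"
proof -
  have *: "keys (fscale c x) \<subseteq> keys x"
    by (auto simp: in_keys_iff)
  show ?thesis
    by (subst fextend_superset[OF _ *]) (auto simp: fextend_def fs.scale_sum_right)
qed

lemma fextend_minus: "fextend g (- x) = - fextend g x"
proof -
  have "- x = fscale (- 1) x"
    by (rule poly_mapping_eqI) simp
  moreover have "fscale (- 1) (fextend g x) = - fextend g x"
    by (rule poly_mapping_eqI) simp
  ultimately show ?thesis by (simp only: fextend_fscale)
qed

lemma fextend_diff: "fextend g (x - y) = fextend g x - fextend g y"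
  using fextend_add[of g x "- y"] by (simp add: fextend_minus)

lemma fextend_sum: "fextend g (\<Sum>i\<in>I. F i) = (\<Sum>i\<in>I. fextend g (F i))"
  by (induction I rule: infinite_finite_induct) (simp_all add: fextend_add)

lemma fextend_cong: "(\<And>s. s \<in> keys x \<Longrightarrow> g s = h s) \<Longrightarrow> fextend g x = fextend h x"
  by (simp add: fextend_def)

lemma fextend_fextend: "fextend g (fextend h x) = fextend (\<lambda>s. fextend g (h s)) x"
  by (simp add: fextend_def[of h] fextend_def[of "\<lambda>s. fextend g (h s)"] fextend_sum fextend_fscale)

lemma fextend_sum_fun: "fextend (\<lambda>s. \<Sum>i\<in>I. g i s) x = (\<Sum>i\<in>I. fextend (g i) x)"
  unfolding fextend_def by (subst sum.swap) (simp add: fs.scale_sum_right)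

lemma fextend_fscale_fun: "fextend (\<lambda>s. fscale c (g s)) x = fscale c (fextend g x)"
  by (simp add: fextend_def fs.scale_sum_right mult.commute)

lemma fextend_swap:
  "fextend (\<lambda>s. fextend (\<lambda>t. g s t) y) x = fextend (\<lambda>t. fextend (\<lambda>s. g s t) x) y"
  unfolding fextend_def fs.scale_sum_right by (subst sum.swap) (simp only: fs.scale_scale mult.commute)

lemma keys_fscale: "keys (fscale c x) \<subseteq> keys x"
  by (auto simp: in_keys_iff)

lemma keys_fextend:
  assumes "\<And>s. s \<in> keys x \<Longrightarrow> keys (g s) \<subseteq> T"
  shows "keys (fextend g x) \<subseteq> T"
proof -
  have "keys (fextend g x) \<subseteq> (\<Union>s\<in>keys x. keys (fscale (lookup x s) (g s)))"
    unfolding fextend_def by (rule keys_sum)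
  also have "\<dots> \<subseteq> T"
    by (intro UN_least order.trans[OF keys_fscale] assms)
  finally show ?thesis .
qed

lemma fextend_in_subspace:
  assumes "fs.subspace W" "\<And>s. s \<in> keys x \<Longrightarrow> g s \<in> W"
  shows "fextend g x \<in> W"
  unfolding fextend_def using assms by (auto intro: fs.subspace_sum fs.subspace_scale)

lemma fextend_span:
  assumes "fs.subspace W" "\<And>t. t \<in> R \<Longrightarrow> fextend g t \<in> W" "t \<in> fs.span R"
  shows "fextend g t \<in> W"
  using assms(3)
proof (induction rule: fs.span_induct_alt)
  case base
  then show ?case using assms(1) by (simp add: fs.subspace_0)
next
  case (step c x y)
  then show ?case
    by (simp add: fextend_add fextend_fscale assms fs.subspace_add fs.subspace_scale)
qed

section \<open>Tensor products of modules\<close>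

abbreviation Wt where "Wt M N \<equiv> fs.span (tensor_rel M N)"

lemma in_tclass: "t' \<in> tclass M N t \<longleftrightarrow> t' - t \<in> Wt M N"
  by (simp add: tclass_def)

lemma tclass_eq_iff: "tclass M N t = tclass M N t' \<longleftrightarrow> t - t' \<in> Wt M N"
proof
  assume "tclass M N t = tclass M N t'"
  moreover have "t \<in> tclass M N t"
    by (simp add: in_tclass fs.span_zero)
  ultimately show "t - t' \<in> Wt M N"
    by (simp add: in_tclass)
next
  assume *: "t - t' \<in> Wt M N"
  have "x - t \<in> Wt M N \<longleftrightarrow> x - t' \<in> Wt M N" for x
    using fs.span_add[OF *, of "x - t"] fs.span_diff[OF _ *, of "x - t'"] by auto
  then show "tclass M N t = tclass M N t'"
    by (auto simp: in_tclass)
qed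

lemma tclass_self: "t \<in> tclass M N t"
  by (simp add: in_tclass fs.span_zero)

lemma carrier_tensor: "carrier (tensor M N) = {tclass M N t |t. keys t \<subseteq> carrier M \<times> carrier N}"
  by (simp add: tensor_def)

lemma tclass_in_tensor: "keys t \<subseteq> carrier M \<times> carrier N \<Longrightarrow> tclass M N t \<in> carrier (tensor M N)"
  by (auto simp: carrier_tensor)

lemma tensor_zero [simp]: "\<zero>\<^bsub>tensor M N\<^esub> = tclass M N 0"
  by (simp add: tensor_def)

lemma UN_const_eq: "A \<noteq> {} \<Longrightarrow> (\<And>x. x \<in> A \<Longrightarrow> F x = c) \<Longrightarrow> (\<Union>x\<in>A. F x) = c"
  by auto

lemma tensor_add [simp]: "tclass M N t \<oplus>\<^bsub>tensor M N\<^esub> tclass M N t' = tclass M N (t + t')"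
proof -
  have "tclass M N (x + y) = tclass M N (t + t')" if "x \<in> tclass M N t" "y \<in> tclass M N t'" for x y
  proof -
    have "(x - t) + (y - t') \<in> Wt M N"
      using that by (auto simp: in_tclass intro: fs.span_add)
    then show ?thesis
      by (simp add: tclass_eq_iff algebra_simps)
  qed
  then have "(\<Union>x\<in>tclass M N t. \<Union>y\<in>tclass M N t'. tclass M N (x + y)) = tclass M N (t + t')"
    by (intro UN_const_eq) (use tclass_self in blast)+
  then show ?thesis by (simp add: tensor_def)
qed

lemma tensor_smult [simp]: "c \<odot>\<^bsub>tensor M N\<^esub> tclass M N t = tclass M N (fscale c t)"
proof -
  have "tclass M N (fscale c x) = tclass M N (fscale c t)" if "x \<in> tclass M N t" for x
    using that fs.span_scale[of "x - t" _ c]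
    by (simp add: tclass_eq_iff in_tclass fs.scale_right_diff_distrib)
  then have "(\<Union>x\<in>tclass M N t. tclass M N (fscale c x)) = tclass M N (fscale c t)"
    by (intro UN_const_eq) (use tclass_self in blast)+
  then show ?thesis by (simp add: tensor_def)
qed

lemma tensor_cases:
  assumes "z \<in> carrier (tensor M N)"
  obtains t where "z = tclass M N t" "keys t \<subseteq> carrier M \<times> carrier N"
  using assms by (auto simp: carrier_tensor)

lemma keys_add_subset: "keys s \<subseteq> C \<Longrightarrow> keys t \<subseteq> C \<Longrightarrow> keys (s + t) \<subseteq> C"
  using keys_add[of s t] by blast

lemma keys_diff_subset: "keys s \<subseteq> C \<Longrightarrow> keys t \<subseteq> C \<Longrightarrow> keys (s - t) \<subseteq> C"
  for s t :: "'s \<Rightarrow>\<^sub>0 'k::field"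
  using keys_diff[of s t] by blast

lemma keys_single_subset: "s \<in> C \<Longrightarrow> keys (single s c) \<subseteq> C"
  by auto

lemma keys_fscale_subset: "keys s \<subseteq> C \<Longrightarrow> keys (fscale c s) \<subseteq> C"
  using keys_fscale[of c s] by blast

lemma keys_uminus_subset: "keys s \<subseteq> C \<Longrightarrow> keys (- s) \<subseteq> C" for s :: "'s \<Rightarrow>\<^sub>0 'k::field"
  by (auto simp: in_keys_iff)

lemmas keys_subset_intros = keys_add_subset keys_diff_subset keys_single_subset keys_fscale_subset
  keys_uminus_subset

lemma module_tensor: "module \<K> (tensor M N)"
proof (rule moduleI)
  note in_T = tclass_in_tensor[OF keys_add_subset] tclass_in_tensor[OF keys_fscale_subset]
    tclass_in_tensor[OF keys_uminus_subset]
  show "abelian_group (tensor M N)"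
  proof (rule abelian_groupI)
    fix x assume "x \<in> carrier (tensor M N)"
    then obtain t where t: "x = tclass M N t" "keys t \<subseteq> carrier M \<times> carrier N"
      by (rule tensor_cases)
    show "\<exists>y\<in>carrier (tensor M N). y \<oplus>\<^bsub>tensor M N\<^esub> x = \<zero>\<^bsub>tensor M N\<^esub>"
      by (rule bexI[of _ "tclass M N (- t)"]) (use t in_T in auto)
  next
    show "\<zero>\<^bsub>tensor M N\<^esub> \<in> carrier (tensor M N)"
      by (auto intro: tclass_in_tensor)
  qed (elim tensor_cases, simp add: in_T ac_simps)+
  show "cring (\<K> :: 'a ring)" by (rule cring_from_type_algebra)
  show "c \<odot>\<^bsub>tensor M N\<^esub> x \<in> carrier (tensor M N)" if "x \<in> carrier (tensor M N)" for c x
    using that by (elim tensor_cases) (simp add: in_T)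
qed (elim tensor_cases, simp add: fs.scale_left_distrib fs.scale_right_distrib)+

lemma finsum_tensor:
  assumes "\<And>s. s \<in> S \<Longrightarrow> keys (F s) \<subseteq> carrier M \<times> carrier N" "finite S"
  shows "(\<Oplus>\<^bsub>tensor M N\<^esub>s\<in>S. tclass M N (F s)) = tclass M N (\<Sum>s\<in>S. F s)"
proof -
  interpret module \<K> "tensor M N" by (rule module_tensor)
  show ?thesis
    using assms(2,1)
  proof (induction rule: finite_induct)
    case (insert x S)
    then show ?case
      by (subst finsum_insert) (auto intro!: tclass_in_tensor)
  qed simp
qed

subsection \<open>Maps out of a tensor product\<close>

definition bilin ::
    "('k::field, 'a, 'l) module_scheme \<Rightarrow> ('k, 'b, 'm) module_scheme \<Rightarrow> ('k, 'c, 'n) module_scheme \<Rightarrow>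
      ('a \<Rightarrow> 'b \<Rightarrow> 'c) \<Rightarrow> bool"
  where "bilin M N P \<beta> \<longleftrightarrow> (\<forall>b\<in>carrier N. lin_map M P (\<lambda>a. \<beta> a b)) \<and> (\<forall>a\<in>carrier M. lin_map N P (\<beta> a))"

text \<open>The linear extension of \<open>g\<close> with values in a module that is given as a
  structure; it is the very sum that \<open>tlift\<close> evaluates at its chosen
  representative.\<close>

definition flin :: "('k::field, 'c, 'n) module_scheme \<Rightarrow> ('s \<Rightarrow> 'c) \<Rightarrow> ('s \<Rightarrow>\<^sub>0 'k) \<Rightarrow> 'c"
  where "flin P g x = (\<Oplus>\<^bsub>P\<^esub>s\<in>keys x. lookup x s \<odot>\<^bsub>P\<^esub> g s)"

section \<open>Linear extensions with values in a module\<close>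

context
  fixes P :: "('k::field, 'c, 'n) module_scheme" (structure) and g :: "'s \<Rightarrow> 'c" and Y :: "'s set"
  assumes P: "module \<K> P" and g: "g \<in> Y \<rightarrow> carrier P"
begin

interpretation module \<K> P by (rule P)

lemma g_closed: "s \<in> Y \<Longrightarrow> g s \<in> carrier P"
  using g by auto

lemma cg_closed: "s \<in> Y \<Longrightarrow> c \<odot> g s \<in> carrier P"
  using g_closed by simp

lemma flin_closed: "keys x \<subseteq> Y \<Longrightarrow> flin P g x \<in> carrier P"
  unfolding flin_def by (rule finsum_closed) (use cg_closed in blast)

lemma flin_superset:
  assumes "finite S" "keys x \<subseteq> S" "S \<subseteq> Y"
  shows "flin P g x = (\<Oplus>s\<in>S. lookup x s \<odot> g s)"
  unfolding flin_def using assms cg_closed smult_l_null[OF g_closed]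
  by (intro add.finprod_mono_neutral_cong_left) (auto simp: in_keys_iff subset_iff)

lemma flin_add:
  assumes "keys x \<subseteq> Y" "keys y \<subseteq> Y"
  shows "flin P g (x + y) = flin P g x \<oplus> flin P g y"
proof -
  have *: "finite (keys x \<union> keys y)" "keys (x + y) \<subseteq> keys x \<union> keys y" "keys x \<union> keys y \<subseteq> Y"
    using assms by (auto simp: keys_add)
  have "flin P g (x + y) = (\<Oplus>s\<in>keys x \<union> keys y. lookup (x + y) s \<odot> g s)"
    by (rule flin_superset) (use * in auto)
  also have "\<dots> = (\<Oplus>s\<in>keys x \<union> keys y. lookup x s \<odot> g s \<oplus> lookup y s \<odot> g s)"
  proof (rule finsum_cong'[OF refl])
    show "(\<lambda>s. lookup x s \<odot> g s \<oplus> lookup y s \<odot> g s) \<in> keys x \<union> keys y \<rightarrow> carrier P"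
      using *(3) cg_closed by blast
    show "lookup (x + y) s \<odot> g s = lookup x s \<odot> g s \<oplus> lookup y s \<odot> g s"
      if "s \<in> keys x \<union> keys y" for s
      using smult_l_distr[of "lookup x s" "lookup y s" "g s"] g_closed[of s] *(3) that
      by (auto simp: lookup_add)
  qed
  also have "\<dots> = (\<Oplus>s\<in>keys x \<union> keys y. lookup x s \<odot> g s) \<oplus> (\<Oplus>s\<in>keys x \<union> keys y. lookup y s \<odot> g s)"
    using *(3) cg_closed by (intro finsum_addf) blast+
  also have "(\<Oplus>s\<in>keys x \<union> keys y. lookup x s \<odot> g s) = flin P g x"
    by (rule flin_superset[symmetric]) (use * in auto)
  also have "(\<Oplus>s\<in>keys x \<union> keys y. lookup y s \<odot> g s) = flin P g y"
    by (rule flin_superset[symmetric]) (use * in auto)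
  finally show ?thesis .
qed

lemma flin_fscale:
  assumes "keys x \<subseteq> Y"
  shows "flin P g (fscale c x) = c \<odot> flin P g x"
proof -
  have "flin P g (fscale c x) = (\<Oplus>s\<in>keys x. lookup (fscale c x) s \<odot> g s)"
    by (rule flin_superset) (use keys_fscale[of c x] assms in auto)
  also have "\<dots> = (\<Oplus>s\<in>keys x. c \<odot> (lookup x s \<odot> g s))"
    using assms cg_closed smult_assoc1[OF _ _ g_closed] by (intro finsum_cong') auto
  also have "\<dots> = c \<odot> flin P g x"
    unfolding flin_def using assms cg_closed g_closed by (intro finsum_smult_ldistr[symmetric]) auto
  finally show ?thesis .
qed

lemma flin_0: "flin P g 0 = \<zero>"
  by (simp add: flin_def)

lemma flin_single:
  assumes "s \<in> Y"
  shows "flin P g (single s c) = c \<odot> g s"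
proof -
  have "flin P g (single s c) = (\<Oplus>s'\<in>{s}. lookup (single s c) s' \<odot> g s')"
    by (rule flin_superset) (use assms in auto)
  then show ?thesis
    using cg_closed[OF assms] by (simp add: finsum_insert Pi_iff)
qed

lemma flin_minus:
  assumes "keys x \<subseteq> Y"
  shows "flin P g (- x) = \<ominus> flin P g x"
proof (rule minus_equality[symmetric])
  show "flin P g (- x) \<oplus> flin P g x = \<zero>"
    using assms flin_add[of "- x" x] by (simp add: flin_0 in_keys_iff subset_iff)
qed (use assms in \<open>auto intro!: flin_closed simp: in_keys_iff\<close>)

lemma flin_diff:
  assumes "keys x \<subseteq> Y" "keys y \<subseteq> Y"
  shows "flin P g (x - y) = flin P g x \<ominus> flin P g y"
  using flin_add[of x "- y"] assms by (simp add: flin_minus a_minus_def in_keys_iff subset_iff)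

text \<open>Additivity of \<open>flin\<close> is available only for elements supported in
  \<open>Y\<close>, so the induction over the span carries the support along.\<close>

lemma flin_span_eq_zero:
  assumes "t \<in> fs.span R" "\<And>t. t \<in> R \<Longrightarrow> keys t \<subseteq> Y" "\<And>t. t \<in> R \<Longrightarrow> flin P g t = \<zero>"
  shows "keys t \<subseteq> Y \<and> flin P g t = \<zero>"
  using assms(1)
proof (induction rule: fs.span_induct_alt)
  case base
  then show ?case by (simp add: flin_0)
next
  case (step c x y)
  from step(1) have x: "keys (fscale c x) \<subseteq> Y" "flin P g (fscale c x) = \<zero>"
    using assms(2,3) by (simp_all add: keys_fscale_subset flin_fscale)
  with step show ?case
    by (simp add: flin_add keys_add_subset)
qed

end

lemma module_smult_0: "module \<K> M \<Longrightarrow> a \<in> carrier M \<Longrightarrow> 0 \<odot>\<^bsub>M\<^esub> a = \<zero>\<^bsub>M\<^esub>"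
  using module.smult_l_null[of \<K> M a] by simp

lemma lin_mapD:
  assumes "lin_map M N f"
  shows "x \<in> carrier M \<Longrightarrow> f x \<in> carrier N"
    and "x \<in> carrier M \<Longrightarrow> y \<in> carrier M \<Longrightarrow> f (x \<oplus>\<^bsub>M\<^esub> y) = f x \<oplus>\<^bsub>N\<^esub> f y"
    and "x \<in> carrier M \<Longrightarrow> f (c \<odot>\<^bsub>M\<^esub> x) = c \<odot>\<^bsub>N\<^esub> f x"
  using assms by (auto simp: lin_map_def)

lemma lin_mapI:
  assumes "\<And>x. x \<in> carrier M \<Longrightarrow> f x \<in> carrier N"
    and "\<And>x y. x \<in> carrier M \<Longrightarrow> y \<in> carrier M \<Longrightarrow> f (x \<oplus>\<^bsub>M\<^esub> y) = f x \<oplus>\<^bsub>N\<^esub> f y"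
    and "\<And>c x. x \<in> carrier M \<Longrightarrow> f (c \<odot>\<^bsub>M\<^esub> x) = c \<odot>\<^bsub>N\<^esub> f x"
  shows "lin_map M N f"
  using assms by (auto simp: lin_map_def)

context
  fixes M :: "('k::field, 'a, 'm) module_scheme" and N :: "('k, 'b, 'n) module_scheme"
  assumes M: "module \<K> M" and N: "module \<K> N"
begin

interpretation M: module \<K> M by (rule M)
interpretation N: module \<K> N by (rule N)

lemma keys_tensor_rel: 
  assumes "t \<in> tensor_rel M N"
  shows "keys t \<subseteq> carrier M \<times> carrier N"
proof -
  have 1: "keys (single s 1 - single s' 1 - single s'' 1 :: _ \<Rightarrow>\<^sub>0 'k) \<subseteq> carrier M \<times> carrier N"
    if "s \<in> carrier M \<times> carrier N" "s' \<in> carrier M \<times> carrier N" "s'' \<in> carrier M \<times> carrier N"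
    for s s' s''
    by (intro keys_subset_intros that)
  have 2: "keys (single s 1 - single s' c :: _ \<Rightarrow>\<^sub>0 'k) \<subseteq> carrier M \<times> carrier N"
    if "s \<in> carrier M \<times> carrier N" "s' \<in> carrier M \<times> carrier N" for s s' c
    by (intro keys_subset_intros that)
  show ?thesis
    using assms unfolding tensor_rel_def
    by (elim UnE CollectE exE conjE) (simp_all only: 1 2 SigmaI M.a_closed N.a_closed
        M.smult_closed N.smult_closed UNIV_I base_field_simps)
qed

text \<open>\<open>tlift\<close> evaluates at a representative picked by \<open>SOME\<close>. Two
  representatives differ by an element of the span of the bilinearity relations, and a bilinear map
  kills each of these, so every representative \<open>t\<close> gives the value.\<close>

lemma tlift_tclass:
  assumes P: "module \<K> P" and \<beta>: "bilin M N P \<beta>" and t: "keys t \<subseteq> carrier M \<times> carrier N"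
  shows "tlift P \<beta> (tclass M N t) = flin P (\<lambda>s. \<beta> (fst s) (snd s)) t"
proof -
  interpret P: module \<K> P by (rule P)
  let ?Y = "carrier M \<times> carrier N"
  let ?g = "\<lambda>s. \<beta> (fst s) (snd s)"
  have g: "?g \<in> ?Y \<rightarrow> carrier P"
  proof
    fix s assume "s \<in> ?Y"
    then have "lin_map M P (\<lambda>a. \<beta> a (snd s))" "fst s \<in> carrier M"
      using \<beta> by (auto simp: bilin_def)
    then show "?g s \<in> carrier P" by (rule lin_mapD)
  qed
  note flin = flin_diff[OF P g] flin_add[OF P g] flin_single[OF P g] flin_closed[OF P g]
  define x where "x = (SOME x. x \<in> tclass M N t)"
  have bl: "\<beta> (a \<oplus>\<^bsub>M\<^esub> a') b = \<beta> a b \<oplus>\<^bsub>P\<^esub> \<beta> a' b" "\<beta> a (b \<oplus>\<^bsub>N\<^esub> b') = \<beta> a b \<oplus>\<^bsub>P\<^esub> \<beta> a b'"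
    "\<beta> (c \<odot>\<^bsub>M\<^esub> a) b = c \<odot>\<^bsub>P\<^esub> \<beta> a b" "\<beta> a (c \<odot>\<^bsub>N\<^esub> b) = c \<odot>\<^bsub>P\<^esub> \<beta> a b" "\<beta> a b \<in> carrier P"
    if "a \<in> carrier M" "a' \<in> carrier M" "b \<in> carrier N" "b' \<in> carrier N" for a a' b b' c
    using \<beta>[unfolded bilin_def, THEN conjunct1, rule_format, OF that(3)]
      \<beta>[unfolded bilin_def, THEN conjunct2, rule_format, OF that(1)] that
    using lin_mapD[of M P "\<lambda>a. \<beta> a b"] lin_mapD[of N P "\<beta> a"] by simp_all
  have cancel: "x \<oplus>\<^bsub>P\<^esub> y \<ominus>\<^bsub>P\<^esub> x \<ominus>\<^bsub>P\<^esub> y = \<zero>\<^bsub>P\<^esub>" if "x \<in> carrier P" "y \<in> carrier P" for x y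
  proof -
    have "x \<oplus>\<^bsub>P\<^esub> y \<ominus>\<^bsub>P\<^esub> x = y"
      using that by (simp add: P.a_comm[of x y] P.minus_eq P.a_assoc P.r_neg)
    then show ?thesis using that by (simp add: P.minus_eq P.r_neg)
  qed
  have one: "1 \<odot>\<^bsub>P\<^esub> x = x" if "x \<in> carrier P" for x
    using P.smult_one that by simp
  have cs: "c \<odot>\<^bsub>P\<^esub> \<beta> a b \<in> carrier P" if "a \<in> carrier M" "b \<in> carrier N" for a b c
    using P.smult_closed[OF _ bl(5)[OF that(1) that(1) that(2) that(2)]] by simp
  have f3: "flin P ?g (single (a, b) 1 - single (a', b') 1 - single (a'', b'') 1)
      = \<beta> a b \<ominus>\<^bsub>P\<^esub> \<beta> a' b' \<ominus>\<^bsub>P\<^esub> \<beta> a'' b''"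
    if "a \<in> carrier M" "b \<in> carrier N" "a' \<in> carrier M" "b' \<in> carrier N" "a'' \<in> carrier M" "b'' \<in> carrier N"
    for a a' a'' b b' b''
  proof -
    have "keys (single (a, b) (1::'k) - single (a', b') 1) \<subseteq> ?Y"
      by (intro keys_subset_intros) (use that in auto)
    then show ?thesis
      using that by (simp add: flin(1,3) one bl(5))
  qed
  have f2: "flin P ?g (single (a, b) 1 - single (a', b') c) = \<beta> a b \<ominus>\<^bsub>P\<^esub> c \<odot>\<^bsub>P\<^esub> \<beta> a' b'"
    if "a \<in> carrier M" "b \<in> carrier N" "a' \<in> carrier M" "b' \<in> carrier N" for a a' b b' c
    using that by (simp add: flin(1,3) one bl(5))
  have "x - t \<in> Wt M N"
    using someI[of "\<lambda>x. x \<in> tclass M N t", OF tclass_self] by (simp add: x_def in_tclass)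
  \<comment> \<open>The statement on the keys matters too: the chosen \<open>x\<close> is only known
    to be congruent to \<open>t\<close>, and this places its support in the carriers.\<close>
  then have *: "keys (x - t) \<subseteq> ?Y \<and> flin P ?g (x - t) = \<zero>\<^bsub>P\<^esub>"
  proof (rule flin_span_eq_zero[OF P g])
    fix t assume t: "t \<in> tensor_rel M N"
    then show "keys t \<subseteq> ?Y" by (rule keys_tensor_rel)
    show "flin P ?g t = \<zero>\<^bsub>P\<^esub>"
      using t unfolding tensor_rel_def
    proof (elim UnE CollectE exE conjE)
      fix a a' b assume "t = single (a \<oplus>\<^bsub>M\<^esub> a', b) 1 - single (a, b) 1 - single (a', b) 1"
        "a \<in> carrier M" "a' \<in> carrier M" "b \<in> carrier N"
      then show ?thesis by (simp add: f3 bl cancel)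
    next
      fix a b b' assume "t = single (a, b \<oplus>\<^bsub>N\<^esub> b') 1 - single (a, b) 1 - single (a, b') 1"
        "a \<in> carrier M" "b \<in> carrier N" "b' \<in> carrier N"
      then show ?thesis by (simp add: f3 bl cancel)
    next
      fix c a b assume "t = single (c \<odot>\<^bsub>M\<^esub> a, b) 1 - single (a, b) c" "a \<in> carrier M" "b \<in> carrier N"
      then show ?thesis by (simp add: f2 bl cs P.r_neg P.minus_eq)
    next
      fix c a b assume "t = single (a, c \<odot>\<^bsub>N\<^esub> b) 1 - single (a, b) c" "a \<in> carrier M" "b \<in> carrier N"
      then show ?thesis by (simp add: f2 bl cs P.r_neg P.minus_eq)
    qed
  qed
  have kx: "keys x \<subseteq> ?Y"
    using * t keys_add[of "x - t" t] by auto
  have "flin P ?g x = flin P ?g ((x - t) + t)" by simp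
  also have "\<dots> = flin P ?g t"
    using * t by (subst flin(2)) (auto simp: flin)
  finally show ?thesis
    by (simp add: tlift_def Let_def x_def flin_def)
qed

end

text \<open>Sums in a tensor product may be formed on representatives; this is how lifts with values
  in a tensor product are evaluated.\<close>

lemma flin_tensor:
  assumes "\<And>s. s \<in> keys t \<Longrightarrow> keys (F s) \<subseteq> carrier A \<times> carrier B"
    and "\<And>s. s \<in> keys t \<Longrightarrow> g s = tclass A B (F s)"
  shows "flin (tensor A B) g t = tclass A B (fextend F t)"
proof -
  interpret T: module \<K> "tensor A B" by (rule module_tensor)
  have cl: "tclass A B (fscale (lookup t s) (F s)) \<in> carrier (tensor A B)" if "s \<in> keys t" for s
    by (intro tclass_in_tensor keys_fscale_subset assms(1) that)
  have "flin (tensor A B) g t = (\<Oplus>\<^bsub>tensor A B\<^esub>s\<in>keys t. tclass A B (fscale (lookup t s) (F s)))"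
    unfolding flin_def by (rule T.finsum_cong') (use assms(2) cl in auto)
  also have "\<dots> = tclass A B (\<Sum>s\<in>keys t. fscale (lookup t s) (F s))"
    by (intro finsum_tensor keys_fscale_subset assms(1)) simp_all
  finally show ?thesis by (simp add: fextend_def)
qed

lemma pure_add_left:
  assumes "a \<in> carrier M" "a' \<in> carrier M" "b \<in> carrier N"
  shows "pure M N (a \<oplus>\<^bsub>M\<^esub> a') b = pure M N a b \<oplus>\<^bsub>tensor M N\<^esub> pure M N a' b"
proof -
  have "single (a \<oplus>\<^bsub>M\<^esub> a', b) 1 - single (a, b) 1 - single (a', b) 1 \<in> Wt M N"
    using assms by (intro fs.span_base) (unfold tensor_rel_def, blast)
  then show ?thesis by (simp add: pure_def tclass_eq_iff diff_diff_eq)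
qed

lemma pure_add_right:
  assumes "a \<in> carrier M" "b \<in> carrier N" "b' \<in> carrier N"
  shows "pure M N a (b \<oplus>\<^bsub>N\<^esub> b') = pure M N a b \<oplus>\<^bsub>tensor M N\<^esub> pure M N a b'"
proof -
  have "single (a, b \<oplus>\<^bsub>N\<^esub> b') 1 - single (a, b) 1 - single (a, b') 1 \<in> Wt M N"
    using assms by (intro fs.span_base) (unfold tensor_rel_def, blast)
  then show ?thesis by (simp add: pure_def tclass_eq_iff diff_diff_eq)
qed

lemma pure_smult_left:
  assumes "a \<in> carrier M" "b \<in> carrier N"
  shows "pure M N (c \<odot>\<^bsub>M\<^esub> a) b = c \<odot>\<^bsub>tensor M N\<^esub> pure M N a b"
proof -
  have "single (c \<odot>\<^bsub>M\<^esub> a, b) 1 - single (a, b) c \<in> Wt M N"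
    using assms by (intro fs.span_base) (unfold tensor_rel_def, blast)
  then show ?thesis by (simp add: pure_def tclass_eq_iff)
qed

lemma pure_smult_right:
  assumes "a \<in> carrier M" "b \<in> carrier N"
  shows "pure M N a (c \<odot>\<^bsub>N\<^esub> b) = c \<odot>\<^bsub>tensor M N\<^esub> pure M N a b"
proof -
  have "single (a, c \<odot>\<^bsub>N\<^esub> b) 1 - single (a, b) c \<in> Wt M N"
    using assms by (intro fs.span_base) (unfold tensor_rel_def, blast)
  then show ?thesis by (simp add: pure_def tclass_eq_iff)
qed

lemma pure_closed: "a \<in> carrier M \<Longrightarrow> b \<in> carrier N \<Longrightarrow> pure M N a b \<in> carrier (tensor M N)"
  unfolding pure_def by (rule tclass_in_tensor) auto

lemma bilin_pure: "bilin M N (tensor M N) (pure M N)"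
  unfolding bilin_def lin_map_def
  by (simp add: Pi_iff pure_add_left pure_add_right pure_smult_left pure_smult_right pure_closed)

lemma bilin_compose:
  assumes "lin_map M A f" "lin_map N B g" "bilin A B P \<beta>"
  shows "bilin M N P (\<lambda>a b. \<beta> (f a) (g b))"
  using assms unfolding bilin_def lin_map_def by (simp add: Pi_iff)

lemma tmap_tclass:
  assumes "module \<K> M" "module \<K> N" "lin_map M A f" "lin_map N B g" "keys t \<subseteq> carrier M \<times> carrier N"
  shows "tmap A B f g (tclass M N t) = tclass A B (fextend (\<lambda>s. single (f (fst s), g (snd s)) 1) t)"
  unfolding tmap_def
  using assms
  by (subst tlift_tclass[OF assms(1,2) module_tensor bilin_compose[OF assms(3,4) bilin_pure]])
    (auto intro!: flin_tensor simp: pure_def lin_map_def)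

section \<open>Superalgebras\<close>

lemma bit_add_1_neq [simp]: "i + 1 \<noteq> (i::bit)" "i \<noteq> i + 1"
  by (cases i; simp)+

lemma bit_add_1_1 [simp]: "i + 1 + 1 = (i::bit)"
  by (cases i) simp_all

lemma bit_neqD: "i \<noteq> j \<Longrightarrow> j = i + (1::bit)"
  by (cases i; cases j) simp_all

context superalgebra
begin

lemma smult_closed' [simp, intro]: "x \<in> carrier A \<Longrightarrow> c \<odot> x \<in> carrier A"
  using smult_closed[of c x] by simp

lemma smult_l_distr': "x \<in> carrier A \<Longrightarrow> (c + d) \<odot> x = c \<odot> x \<oplus> d \<odot> x"
  using smult_l_distr[of c d x] by simp

lemma smult_r_distr': "x \<in> carrier A \<Longrightarrow> y \<in> carrier A \<Longrightarrow> c \<odot> (x \<oplus> y) = c \<odot> x \<oplus> c \<odot> y"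
  using smult_r_distr[of c x y] by simp

lemma smult_assoc' : "x \<in> carrier A \<Longrightarrow> (c * d) \<odot> x = c \<odot> (d \<odot> x)"
  using smult_assoc1[of c d x] by simp

lemma smult_1' [simp]: "x \<in> carrier A \<Longrightarrow> 1 \<odot> x = x"
  using smult_one[of x] by simp

lemma smult_0_l [simp]: "x \<in> carrier A \<Longrightarrow> 0 \<odot> x = \<zero>"
  using smult_l_null[of x] by simp

lemma smult_0_r [simp]: "c \<odot> \<zero> = \<zero>"
  using smult_r_null[of c] by simp

lemma smult_minus_r: "x \<in> carrier A \<Longrightarrow> c \<odot> (\<ominus> x) = \<ominus> (c \<odot> x)"
  using smult_r_minus[of c x] by simp

lemma part_subset: "part A i \<subseteq> carrier A"
  using submodule.axioms(1)[OF part_submodule] subgroup.subset by fastforce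

lemma part_carrier: "x \<in> part A i \<Longrightarrow> x \<in> carrier A"
  using part_subset by blast

lemma part_add: "x \<in> part A i \<Longrightarrow> y \<in> part A i \<Longrightarrow> x \<oplus> y \<in> part A i"
  using subgroup.m_closed[OF submodule.axioms(1)[OF part_submodule]] by simp

lemma part_zero: "\<zero> \<in> part A i"
  using subgroup.one_closed[OF submodule.axioms(1)[OF part_submodule]] by simp

lemma part_smult: "x \<in> part A i \<Longrightarrow> c \<odot> x \<in> part A i"
  using submodule.smult_closed[OF part_submodule, of c x i] by simp

lemma part_minus: "x \<in> part A i \<Longrightarrow> \<ominus> x \<in> part A i"
  using subgroup.m_inv_closed[OF submodule.axioms(1)[OF part_submodule]] by (simp add: a_inv_def)

lemma part_decomp_unique:
  assumes "y \<in> part A i" "z \<in> part A (i + 1)" "y' \<in> part A i" "z' \<in> part A (i + 1)"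
    and "y \<oplus> z = y' \<oplus> z'"
  shows "y = y'"
proof -
  have c: "y \<in> carrier A" "z \<in> carrier A" "y' \<in> carrier A" "z' \<in> carrier A"
    using assms part_carrier by blast+
  have "y \<ominus> y' = (y \<oplus> z) \<ominus> (z \<oplus> y')"
    using c by algebra
  also have "\<dots> = (y' \<oplus> z') \<ominus> (z \<oplus> y')"
    by (simp add: assms)
  also have "\<dots> = z' \<ominus> z"
    using c by algebra
  finally have eq: "y \<ominus> y' = z' \<ominus> z" .
  have "y \<ominus> y' \<in> part A i" "z' \<ominus> z \<in> part A (i + 1)"
    using assms by (simp_all add: minus_eq part_add part_minus)
  then have "y \<ominus> y' \<in> part A 0 \<inter> part A 1"
    unfolding eq[symmetric] by (cases i) simp_all
  then have "y \<ominus> y' = \<zero>"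
    using part_Int by simp
  then show ?thesis
    using c by (simp add: r_right_minus_eq)
qed

lemma component_unique:
  assumes "y \<in> part A i" "z \<in> part A (i + 1)" "x = y \<oplus> z"
  shows "component A i x = y"
  unfolding component_def
  by (rule the_equality) (use assms part_decomp_unique in blast)+

lemma component:
  assumes "x \<in> carrier A"
  shows "component A i x \<in> part A i" and "x = component A i x \<oplus> component A (i + 1) x"
proof -
  obtain y z where yz: "y \<in> part A 0" "z \<in> part A 1" "x = y \<oplus> z"
    using part_sum[OF assms] by blast
  have c0: "component A 0 x = y"
    by (rule component_unique[OF yz(1) _ yz(3)]) (use yz in simp)
  have c1: "component A 1 x = z"
    by (rule component_unique[of _ _ y]) (use yz part_carrier in \<open>simp_all add: a_comm\<close>)
  show "component A i x \<in> part A i" "x = component A i x \<oplus> component A (i + 1) x"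
    using yz c0 c1 part_carrier[OF yz(1)] part_carrier[OF yz(2)] by (cases i; simp add: a_comm)+
qed

lemma component_closed [simp]: "x \<in> carrier A \<Longrightarrow> component A i x \<in> carrier A"
  using component(1) part_carrier by blast

lemma component_part: "x \<in> part A j \<Longrightarrow> component A i x = (if i = j then x else \<zero>)"
  using component_unique[of x j \<zero> x] component_unique[of \<zero> i x x]
    part_zero part_carrier[of x j] by (auto dest: bit_neqD)

lemma lin_component: "lin_map A A (component A i)"
proof (rule lin_mapI)
  fix x y assume c: "x \<in> carrier A" "y \<in> carrier A"
  have "x \<oplus> y = (component A i x \<oplus> component A (i + 1) x) \<oplus> (component A i y \<oplus> component A (i + 1) y)"
    using component(2)[OF c(1)] component(2)[OF c(2)] by simp
  also have "\<dots> = (component A i x \<oplus> component A i y) \<oplus> (component A (i + 1) x \<oplus> component A (i + 1) y)"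
    using c by (simp add: a_ac)
  finally show "component A i (x \<oplus> y) = component A i x \<oplus> component A i y"
    using c component(1) by (intro component_unique[of _ _ "component A (i + 1) x \<oplus> component A (i + 1) y"])
      (auto intro: part_add)
next
  fix c x assume x: "x \<in> carrier A"
  have "c \<odot> x = c \<odot> component A i x \<oplus> c \<odot> component A (i + 1) x"
    using component(2)[OF x, of i] x smult_r_distr'[of "component A i x" "component A (i + 1) x" c] by simp
  then show "component A i (c \<odot> x) = c \<odot> component A i x"
    using x component(1) by (intro component_unique[of _ _ "c \<odot> component A (i + 1) x"]) (auto intro: part_smult)
qed simp

lemma lin_mult_left: "a \<in> carrier A \<Longrightarrow> lin_map A A (\<lambda>x. a \<otimes> x)"
  by (rule lin_mapI) (simp_all add: r_distr smult_mult_right)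

lemma lin_mult_right: "a \<in> carrier A \<Longrightarrow> lin_map A A (\<lambda>x. x \<otimes> a)"
  by (rule lin_mapI) (simp_all add: l_distr smult_mult_left)

end

lemma lin_map_compose: "lin_map M N f \<Longrightarrow> lin_map N P g \<Longrightarrow> lin_map M P (\<lambda>x. g (f x))"
  unfolding lin_map_def by (simp add: Pi_iff)

text \<open>The homogeneity relation with scalar 0 does it: it reads (0 \<odot> 0, b) - 0 (0, b),
  and 0 \<odot> 0 is 0.\<close>

lemma Wt_zero_left:
  assumes "module \<K> M" "b \<in> carrier N" 
  shows "single (\<zero>\<^bsub>M\<^esub>, b) c \<in> Wt M N"
proof -
  interpret module \<K> M by fact
  have "single (0 \<odot>\<^bsub>M\<^esub> \<zero>\<^bsub>M\<^esub>, b) 1 - single (\<zero>\<^bsub>M\<^esub>, b) 0 \<in> Wt M N"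
    using assms by (intro fs.span_base) (unfold tensor_rel_def, blast)
  then have "fscale c (single (\<zero>\<^bsub>M\<^esub>, b) 1) \<in> Wt M N"
    by (intro fs.span_scale) (simp add: module_smult_0[OF assms(1)])
  then show ?thesis by simp
qed

lemma Wt_zero_right:
  assumes "module \<K> N" "a \<in> carrier M" 
  shows "single (a, \<zero>\<^bsub>N\<^esub>) c \<in> Wt M N"
proof -
  interpret module \<K> N by fact
  have "single (a, 0 \<odot>\<^bsub>N\<^esub> \<zero>\<^bsub>N\<^esub>) 1 - single (a, \<zero>\<^bsub>N\<^esub>) 0 \<in> Wt M N"
    using assms by (intro fs.span_base) (unfold tensor_rel_def, blast)
  then have "fscale c (single (a, \<zero>\<^bsub>N\<^esub>) 1) \<in> Wt M N"
    by (intro fs.span_scale) (simp add: module_smult_0[OF assms(1)])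
  then show ?thesis by simp
qed

text \<open>A pair of linear maps carries each bilinearity relation to \<open>c\<close> times a
  relation of the same kind. The coefficient \<open>c\<close> is there for the Koszul signs in
  \<open>tm\<close>.\<close>

lemma fextend_pair_Wt:
  assumes \<phi>: "lin_map M A \<phi>" and \<psi>: "lin_map N B \<psi>" and t: "t \<in> Wt M N"
  shows "fextend (\<lambda>s. single (\<phi> (fst s), \<psi> (snd s)) c) t \<in> Wt A B"
proof (rule fextend_span[OF fs.subspace_span _ t])
  let ?F = "fextend (\<lambda>s. single (\<phi> (fst s), \<psi> (snd s)) c)"
  have *: "fscale c t \<in> Wt A B" if "t \<in> tensor_rel A B" for t
    using that by (intro fs.span_scale fs.span_base)
  note lin = lin_mapD[OF \<phi>] lin_mapD[OF \<psi>]
  fix t assume "t \<in> tensor_rel M N"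
  from this[unfolded tensor_rel_def] show "?F t \<in> Wt A B"
  proof (elim UnE CollectE exE conjE)
    fix a a' b assume t: "t = single (a \<oplus>\<^bsub>M\<^esub> a', b) 1 - single (a, b) 1 - single (a', b) 1"
      and c: "a \<in> carrier M" "a' \<in> carrier M" "b \<in> carrier N"
    have "?F t = fscale c (single (\<phi> a \<oplus>\<^bsub>A\<^esub> \<phi> a', \<psi> b) 1 - single (\<phi> a, \<psi> b) 1 - single (\<phi> a', \<psi> b) 1)"
      using lin c by (simp add: t fextend_diff fs.scale_right_diff_distrib)
    then show ?thesis using lin c by (simp only:) (rule *, unfold tensor_rel_def, blast)
  next
    fix a b b' assume t: "t = single (a, b \<oplus>\<^bsub>N\<^esub> b') 1 - single (a, b) 1 - single (a, b') 1"
      and c: "a \<in> carrier M" "b \<in> carrier N" "b' \<in> carrier N"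
    have "?F t = fscale c (single (\<phi> a, \<psi> b \<oplus>\<^bsub>B\<^esub> \<psi> b') 1 - single (\<phi> a, \<psi> b) 1 - single (\<phi> a, \<psi> b') 1)"
      using lin c by (simp add: t fextend_diff fs.scale_right_diff_distrib)
    then show ?thesis using lin c by (simp only:) (rule *, unfold tensor_rel_def, blast)
  next
    fix d a b assume t: "t = single (d \<odot>\<^bsub>M\<^esub> a, b) 1 - single (a, b) d" and c: "a \<in> carrier M" "b \<in> carrier N"
    have "?F t = fscale c (single (d \<odot>\<^bsub>A\<^esub> \<phi> a, \<psi> b) 1 - single (\<phi> a, \<psi> b) d)"
      using lin c by (simp add: t fextend_diff fs.scale_right_diff_distrib mult.commute)
    then show ?thesis using lin c by (simp only:) (rule *, unfold tensor_rel_def, blast)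
  next
    fix d a b assume t: "t = single (a, d \<odot>\<^bsub>N\<^esub> b) 1 - single (a, b) d" and c: "a \<in> carrier M" "b \<in> carrier N"
    have "?F t = fscale c (single (\<phi> a, d \<odot>\<^bsub>B\<^esub> \<psi> b) 1 - single (\<phi> a, \<psi> b) d)"
      using lin c by (simp add: t fextend_diff fs.scale_right_diff_distrib mult.commute)
    then show ?thesis using lin c by (simp only:) (rule *, unfold tensor_rel_def, blast)
  qed
qed

subsection \<open>The product of a tensor product\<close>

definition tm where
  "tm A B s s' = (\<Sum>i\<in>{0, 1}. \<Sum>j\<in>{0, 1}.
      single (fst s \<otimes>\<^bsub>A\<^esub> component A j (fst s'), component B i (snd s) \<otimes>\<^bsub>B\<^esub> snd s') (koszul i j))"

lemma tensor_mult_tm: "tensor_mult A B x y = fextend (\<lambda>s. fextend (\<lambda>s'. tm A B s s') y) x"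
  by (simp add: tensor_mult_def tm_def case_prod_beta')

lemma tensor_mult_add_left: "tensor_mult A B (x + x') y = tensor_mult A B x y + tensor_mult A B x' y"
  by (simp add: tensor_mult_tm fextend_add)

lemma fextend_add_fun: "fextend (\<lambda>s. g s + h s) x = fextend g x + fextend h x"
  by (simp add: fextend_def fs.scale_right_distrib sum.distrib)

lemma tensor_mult_add_right: "tensor_mult A B x (y + y') = tensor_mult A B x y + tensor_mult A B x y'"
  by (simp add: tensor_mult_tm fextend_add fextend_add_fun)

lemma tensor_mult_sum_left: "tensor_mult A B (\<Sum>i\<in>I. F i) y = (\<Sum>i\<in>I. tensor_mult A B (F i) y)"
  by (simp add: tensor_mult_tm fextend_sum)

lemma tensor_mult_sum_right: "tensor_mult A B x (\<Sum>i\<in>I. F i) = (\<Sum>i\<in>I. tensor_mult A B x (F i))"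
  by (simp add: tensor_mult_tm fextend_sum fextend_sum_fun)

context
  fixes A :: "('k::field, 'a, 'l) superalg_scheme" and B :: "('k, 'b, 'm) superalg_scheme"
  assumes A: "superalgebra A" and B: "superalgebra B"
begin

interpretation A: superalgebra A by (rule A)
interpretation B: superalgebra B by (rule B)

text \<open>For a fixed basis element on the right, the product is a sum over \<open>i\<close> and
  \<open>j\<close> of maps that act linearly on each slot of the left factor, so
  \<open>fextend_pair_Wt\<close> applies to every summand. Swapping the two extensions brings the
  product into that form.\<close>

lemma tensor_mult_Wt_left:
  assumes "x \<in> Wt A B" "keys y \<subseteq> carrier A \<times> carrier B"
  shows "tensor_mult A B x y \<in> Wt A B"
proof -
  have "fextend (\<lambda>s. tm A B s s') x \<in> Wt A B" if "s' \<in> carrier A \<times> carrier B" for s'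
    unfolding tm_def fextend_sum_fun
    by (intro fs.span_sum fextend_pair_Wt[OF A.lin_mult_right lin_map_compose[OF B.lin_component B.lin_mult_right]])
      (use that assms in auto)
  then show ?thesis
    unfolding tensor_mult_tm fextend_swap[of _ _ x]
    by (rule fextend_in_subspace[OF fs.subspace_span]) (use assms in auto)
qed

lemma tensor_mult_Wt_right:
  assumes "keys x \<subseteq> carrier A \<times> carrier B" "y \<in> Wt A B"
  shows "tensor_mult A B x y \<in> Wt A B"
proof -
  have "fextend (tm A B s) y \<in> Wt A B" if "s \<in> carrier A \<times> carrier B" for s
    unfolding tm_def fextend_sum_fun
    by (intro fs.span_sum fextend_pair_Wt[OF lin_map_compose[OF A.lin_component A.lin_mult_left] B.lin_mult_left])
      (use that assms in auto)
  then show ?thesis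
    unfolding tensor_mult_tm
    by (rule fextend_in_subspace[OF fs.subspace_span]) (use assms in auto)
qed

text \<open>Representatives are exchanged one factor at a time, the right one against
  \<open>x'\<close> and then the left one against \<open>y\<close>.\<close>

lemma tensor_times [simp]:
  assumes x: "keys x \<subseteq> carrier A \<times> carrier B" and y: "keys y \<subseteq> carrier A \<times> carrier B"
  shows "tclass A B x \<otimes>\<^bsub>tensor A B\<^esub> tclass A B y = tclass A B (tensor_mult A B x y)"
proof -
  have "tclass A B (tensor_mult A B x' y') = tclass A B (tensor_mult A B x y)"
    if "x' \<in> tclass A B x" "y' \<in> tclass A B y" for x' y'
  proof -
    have W: "x' - x \<in> Wt A B" "y' - y \<in> Wt A B"
      using that by (auto simp: in_tclass)
    \<comment> \<open>\<open>tensor_mult_Wt_right\<close> wants its left factor supported in the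
      carriers; \<open>x'\<close> is, because the bilinearity relations are.\<close>
    have W_keys: "keys t \<subseteq> carrier A \<times> carrier B" if t: "t \<in> Wt A B" for t
      using t
    proof (induction rule: fs.span_induct_alt)
      case (step c x y)
      have "keys x \<subseteq> carrier A \<times> carrier B"
        by (rule keys_tensor_rel[OF A.module_axioms B.module_axioms step(1)])
      with step(2) show ?case by (intro keys_add_subset keys_fscale_subset)
    qed simp
    have "keys (x' - x + x) \<subseteq> carrier A \<times> carrier B"
      by (rule keys_add_subset[OF W_keys[OF W(1)] x])
    then have x': "keys x' \<subseteq> carrier A \<times> carrier B" by simp
    have "tensor_mult A B x' y' - tensor_mult A B x y
        = tensor_mult A B x' (y' - y) + tensor_mult A B (x' - x) y"
      using tensor_mult_add_right[of A B x' "y' - y" y] tensor_mult_add_left[of A B "x' - x" x y]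
      by (simp add: algebra_simps)
    also have "\<dots> \<in> Wt A B"
      by (intro fs.span_add tensor_mult_Wt_right tensor_mult_Wt_left x' y W)
    finally show ?thesis by (simp add: tclass_eq_iff)
  qed
  then have "(\<Union>x'\<in>tclass A B x. \<Union>y'\<in>tclass A B y. tclass A B (tensor_mult A B x' y'))
      = tclass A B (tensor_mult A B x y)"
    by (intro UN_const_eq) (use tclass_self in blast)+
  then show ?thesis by (simp add: tensor_def)
qed

text \<open>This holds only modulo the relations: the other three choices of components leave terms
  with a slot \<open>\<zero>\<close>, which are not zero in the free vector space.\<close>

lemma tensor_mult_single:
  assumes "a \<in> carrier A" "b \<in> part B i" "a' \<in> part A j" "b' \<in> carrier B"
  shows "tensor_mult A B (single (a, b) c) (single (a', b') d)
      - single (a \<otimes>\<^bsub>A\<^esub> a', b \<otimes>\<^bsub>B\<^esub> b') (c * d * koszul i j) \<in> Wt A B"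
proof -
  have c: "b \<in> carrier B" "a' \<in> carrier A"
    using assms A.part_carrier B.part_carrier by blast+
  let ?S = "\<lambda>i' j'. single (a \<otimes>\<^bsub>A\<^esub> component A j' a', component B i' b \<otimes>\<^bsub>B\<^esub> b') (c * (d * koszul i' j'))"
  have z: "?S i' j' \<in> Wt A B" if "i' \<noteq> i \<or> j' \<noteq> j" for i' j'
    using that assms c by (auto simp: A.component_part B.component_part
        intro!: Wt_zero_left[OF A.module_axioms] Wt_zero_right[OF B.module_axioms])
  have "tensor_mult A B (single (a, b) c) (single (a', b') d) = (\<Sum>i'\<in>{0, 1}. \<Sum>j'\<in>{0, 1}. ?S i' j')"
    by (simp add: tensor_mult_tm tm_def fs.scale_right_distrib mult.assoc)
  also have "\<dots> = (\<Sum>s\<in>{0, 1} \<times> {0, 1}. ?S (fst s) (snd s))"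
    by (subst sum.cartesian_product) (simp add: case_prod_beta')
  also have "\<dots> = ?S i j + (\<Sum>s\<in>{0, 1} \<times> {0, 1} - {(i, j)}. ?S (fst s) (snd s))"
    by (subst sum.remove[of _ "(i, j)"]) (cases i; cases j; simp)+
  also have "?S i j = single (a \<otimes>\<^bsub>A\<^esub> a', b \<otimes>\<^bsub>B\<^esub> b') (c * d * koszul i j)"
    using assms by (simp add: A.component_part B.component_part mult.assoc)
  finally have "tensor_mult A B (single (a, b) c) (single (a', b') d)
      - single (a \<otimes>\<^bsub>A\<^esub> a', b \<otimes>\<^bsub>B\<^esub> b') (c * d * koszul i j)
      = (\<Sum>s\<in>{0, 1} \<times> {0, 1} - {(i, j)}. ?S (fst s) (snd s))" by simp
  also have "\<dots> \<in> Wt A B"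
    by (intro fs.span_sum z) auto
  finally show ?thesis .
qed

end

subsection \<open>Quotients\<close>

text \<open>The superalgebra axioms read only these fields. So they pass from a quotient to a Hopf
  superalgebra built on top of it, which is a record of a different type.\<close>

lemma superalgebra_cong:
  assumes "superalgebra Q"
    and "carrier H = carrier Q" "monoid.mult H = monoid.mult Q" "one H = one Q" "ring.zero H = ring.zero Q"
      "add H = add Q" "module.smult H = module.smult Q" "part H = part Q"
  shows "superalgebra H"
proof -
  have "superalgebra H = superalgebra Q"
    unfolding superalgebra_def superalgebra_axioms_def Module.module_def module_axioms_def ring_def
      ring_axioms_def abelian_group_def abelian_group_axioms_def abelian_monoid_def comm_group_def
      comm_monoid_def comm_monoid_axioms_def group_def group_axioms_def monoid_def Units_def
      submodule_def submodule_axioms_def subgroup_def m_inv_def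
    by (simp only: partial_object.select_convs monoid.select_convs assms(2-))
  then show ?thesis using assms(1) by simp
qed

locale superalgebra_ideal = superalgebra A + ideal I A
  for A :: "('k::field, 'a, 'm) superalg_scheme" (structure) and I
begin

abbreviation Q where "Q \<equiv> quot_superalg A I"
abbreviation q where "q x \<equiv> I +>\<^bsub>A\<^esub> x"

text \<open>Scalars act through c \<odot> 1, so a ring ideal is a subspace.\<close>

lemma I_smult: "x \<in> I \<Longrightarrow> c \<odot> x \<in> I"
  using I_l_closed[of x "c \<odot> \<one>"] smult_mult_left[of \<one> x c] by (simp add: Icarr)

lemma q_eq_iff: "x \<in> carrier A \<Longrightarrow> y \<in> carrier A \<Longrightarrow> q x = q y \<longleftrightarrow> x \<ominus> y \<in> I"
  using quotient_eq_iff_same_a_r_cos[OF is_ideal] by simp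

lemma q_self: "x \<in> carrier A \<Longrightarrow> x \<in> q x"
  by (rule a_rcos_self)

lemma in_qD:
  assumes "x \<in> carrier A" "y \<in> q x"
  shows "y \<in> carrier A" and "q y = q x"
proof -
  obtain h where h: "h \<in> I" "y = h \<oplus> x"
    using assms(2) by (auto simp: a_r_coset_def')
  then show y: "y \<in> carrier A" using assms(1) Icarr by simp
  have "y \<ominus> x = h"
    using h assms(1) Icarr by (simp add: minus_eq a_assoc r_neg)
  with h y assms(1) show "q y = q x" by (simp add: q_eq_iff)
qed

lemma quot_carrier: "carrier Q = q ` carrier A"
  by (auto simp: quot_superalg_def module.defs ring.defs superalg.defs FactRing_def A_RCOSETS_def'
      a_r_coset_def)

lemma quot_part: "part Q i = q ` part A i"
  by (simp add: quot_superalg_def module.defs ring.defs superalg.defs)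

lemma quot_one: "\<one>\<^bsub>Q\<^esub> = q \<one>"
  by (simp add: quot_superalg_def module.defs ring.defs superalg.defs FactRing_def)

lemma quot_zero: "\<zero>\<^bsub>Q\<^esub> = q \<zero>"
  using a_rcos_zero[OF is_ideal additive_subgroup.zero_closed[OF additive_subgroup_axioms]]
  by (simp add: quot_superalg_def module.defs ring.defs superalg.defs FactRing_def)

lemma quot_mult: "x \<in> carrier A \<Longrightarrow> y \<in> carrier A \<Longrightarrow> q x \<otimes>\<^bsub>Q\<^esub> q y = q (x \<otimes> y)"
  by (simp add: quot_superalg_def module.defs ring.defs superalg.defs FactRing_def rcoset_mult_add)

lemma quot_add: "x \<in> carrier A \<Longrightarrow> y \<in> carrier A \<Longrightarrow> q x \<oplus>\<^bsub>Q\<^esub> q y = q (x \<oplus> y)"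
  by (simp add: quot_superalg_def module.defs ring.defs superalg.defs FactRing_def a_rcos_sum)

lemma quot_smult:
  assumes x: "x \<in> carrier A"
  shows "c \<odot>\<^bsub>Q\<^esub> q x = q (c \<odot> x)"
proof -
  have "q (c \<odot> z) = q (c \<odot> x)" if "z \<in> q x" for z
  proof -
    have z: "z \<in> carrier A" "z \<ominus> x \<in> I"
      using in_qD[OF x that] q_eq_iff x by auto
    have "c \<odot> z \<ominus> c \<odot> x = c \<odot> (z \<ominus> x)"
      using x z by (simp add: minus_eq smult_r_distr' smult_minus_r)
    then show ?thesis
      using I_smult[OF z(2)] x z by (simp add: q_eq_iff)
  qed
  then have "(\<Union>z\<in>q x. q (c \<odot> z)) = q (c \<odot> x)"
    by (intro UN_const_eq) (use q_self[OF x] in blast)+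
  then show ?thesis
    by (simp add: quot_superalg_def module.defs ring.defs superalg.defs)
qed

lemmas quot_simps = quot_carrier quot_part quot_one quot_zero quot_mult quot_add quot_smult

lemma ring_quot: "ring Q"
proof (rule ringI)
  show "abelian_group Q"
  proof (rule abelian_groupI)
    fix x assume "x \<in> carrier Q"
    then obtain a where a: "a \<in> carrier A" "x = q a" by (auto simp: quot_carrier)
    show "\<exists>y\<in>carrier Q. y \<oplus>\<^bsub>Q\<^esub> x = \<zero>\<^bsub>Q\<^esub>"
      by (rule bexI[of _ "q (\<ominus> a)"]) (use a in \<open>auto simp: quot_simps l_neg\<close>)
  qed (auto simp: quot_simps a_ac)
  show "Group.monoid Q"
    by (rule monoidI) (auto simp: quot_simps m_assoc)
qed (auto simp: quot_simps l_distr r_distr)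

lemma module_quot: "module \<K> Q"
proof (rule moduleI)
  show "abelian_group Q" by (rule ring.is_abelian_group[OF ring_quot])
  show "cring (\<K> :: 'k ring)" by (rule cring_from_type_algebra)
qed (auto simp: quot_simps smult_l_distr' smult_r_distr' smult_assoc')

lemma lin_q: "lin_map A Q q"
  by (rule lin_mapI) (auto simp: quot_simps)

text \<open>The assumption says that \<open>I\<close> is homogeneous. This separates the two parts
  of the quotient: if an even \<open>a\<close> and an odd \<open>b\<close> have the same class, then
  \<open>a\<close> is a component of a - b, an element of \<open>I\<close>.\<close>

lemma superalgebra_quot:
  assumes "\<And>x i. x \<in> I \<Longrightarrow> component A i x \<in> I"
  shows "superalgebra Q"
proof -
  interpret Q: ring Q by (rule ring_quot)
  interpret Q: Module.module \<K> Q by (rule module_quot)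
  have "submodule (part Q i) \<K> Q" for i
  proof (rule Q.submoduleI)
    fix x assume "x \<in> part Q i"
    then obtain a where a: "a \<in> part A i" "x = q a" by (auto simp: quot_part)
    have "\<ominus>\<^bsub>Q\<^esub> x = q (\<ominus> a)"
      by (rule Q.minus_equality) (use a part_carrier in \<open>auto simp: quot_simps l_neg\<close>)
    then show "\<ominus>\<^bsub>Q\<^esub> x \<in> part Q i" using part_minus a by (auto simp: quot_part)
  qed (auto simp: quot_simps part_carrier part_zero part_add part_smult intro!: imageI)
  moreover have "part Q 0 \<inter> part Q 1 = {\<zero>\<^bsub>Q\<^esub>}"
  proof -
    have "x = \<zero>\<^bsub>Q\<^esub>" if x0: "x \<in> part Q 0" and x1: "x \<in> part Q 1" for x
    proof -
      obtain a where a: "a \<in> part A 0" "x = q a" using x0 unfolding quot_part by blast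
      obtain b where b: "b \<in> part A 1" "x = q b" using x1 unfolding quot_part by blast
      note ab = a(1) b(1) a(2) trans[OF a(2)[symmetric] b(2)]
      then have c: "a \<in> carrier A" "b \<in> carrier A" using part_carrier by auto
      have "component A 0 (a \<oplus> (\<ominus> b)) = a"
        by (rule component_unique) (use ab part_minus in auto)
      moreover have "a \<oplus> (\<ominus> b) \<in> I"
        using ab c by (simp add: q_eq_iff minus_eq)
      ultimately have "a \<in> I" using assms by metis
      then show ?thesis using c by (simp add: a(2) quot_zero q_eq_iff minus_eq)
    qed
    moreover have "\<zero>\<^bsub>Q\<^esub> \<in> part Q i" for i
      by (auto simp: quot_simps intro!: imageI part_zero)
    ultimately show ?thesis by blast
  qed
  moreover have "\<exists>y\<in>part Q 0. \<exists>z\<in>part Q 1. x = y \<oplus>\<^bsub>Q\<^esub> z" if x: "x \<in> carrier Q" for x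
  proof -
    obtain a where a: "a \<in> carrier A" "x = q a" using x unfolding quot_carrier by blast
    obtain y z where "y \<in> part A 0" "z \<in> part A 1" "a = y \<oplus> z" using part_sum[OF a(1)] by blast
    then show ?thesis
      using a part_carrier by (intro bexI[of _ "q y"] bexI[of _ "q z"]) (auto simp: quot_simps)
  qed
  moreover have "x \<otimes>\<^bsub>Q\<^esub> y \<in> part Q (i + j)" if x: "x \<in> part Q i" and y: "y \<in> part Q j" for x y i j
  proof -
    obtain a where a: "a \<in> part A i" "x = q a" using x unfolding quot_part by blast
    obtain b where b: "b \<in> part A j" "y = q b" using y unfolding quot_part by blast
    show ?thesis
      unfolding a(2) b(2) quot_mult[OF part_carrier[OF a(1)] part_carrier[OF b(1)]] quot_part
      by (intro imageI mult_part a b)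
  qed
  moreover have "\<one>\<^bsub>Q\<^esub> \<in> part Q 0"
    using one_part by (auto simp: quot_one quot_part)
  moreover have "(c \<odot>\<^bsub>Q\<^esub> x) \<otimes>\<^bsub>Q\<^esub> y = c \<odot>\<^bsub>Q\<^esub> (x \<otimes>\<^bsub>Q\<^esub> y)" "x \<otimes>\<^bsub>Q\<^esub> (c \<odot>\<^bsub>Q\<^esub> y) = c \<odot>\<^bsub>Q\<^esub> (x \<otimes>\<^bsub>Q\<^esub> y)"
    if x: "x \<in> carrier Q" and y: "y \<in> carrier Q" for c x y
  proof -
    obtain a where a: "a \<in> carrier A" "x = q a" using x unfolding quot_carrier by blast
    obtain b where b: "b \<in> carrier A" "y = q b" using y unfolding quot_carrier by blast
    show "(c \<odot>\<^bsub>Q\<^esub> x) \<otimes>\<^bsub>Q\<^esub> y = c \<odot>\<^bsub>Q\<^esub> (x \<otimes>\<^bsub>Q\<^esub> y)" "x \<otimes>\<^bsub>Q\<^esub> (c \<odot>\<^bsub>Q\<^esub> y) = c \<odot>\<^bsub>Q\<^esub> (x \<otimes>\<^bsub>Q\<^esub> y)"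
      using a(1) b(1) by (simp_all add: a(2) b(2) quot_mult quot_smult smult_mult_left smult_mult_right)
  qed
  ultimately show ?thesis
    by (intro superalgebra.intro superalgebra_axioms.intro module_quot ring_quot)
qed

end

section \<open>Polynomials\<close>

lemma fscale_eq_mult: "fscale c x = single 0 c * x"
  by (simp add: fscale_def mult_map_scale_conv_mult)

lemma fscale_mult_left: "fscale c x * y = fscale c (x * y)"
  and fscale_mult_right: "x * fscale c y = fscale c (x * y)"
  for x y :: "'n::comm_monoid_add \<Rightarrow>\<^sub>0 'k::field"
  by (simp_all add: fscale_eq_mult ac_simps)

text \<open>Three different functions are allowed, and the law is asked for only on exponents that
  occur, because \<open>Delta\<close> and \<open>sgnp\<close> obey product rules only for special
  left factors.\<close>

lemma fextend_mult:
  fixes x :: "'m::comm_monoid_add \<Rightarrow>\<^sub>0 'k::field" and h :: "'m \<Rightarrow> 'n::comm_monoid_add \<Rightarrow>\<^sub>0 'k"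
  assumes "\<And>m n. m \<in> keys x \<Longrightarrow> n \<in> keys y \<Longrightarrow> h (m + n) = h1 m * h2 n"
  shows "fextend h (x * y) = fextend h1 x * fextend h2 y"
proof -
  have "x * y = (\<Sum>m\<in>keys x. \<Sum>n\<in>keys y. single (m + n) (lookup x m * lookup y n))"
    by (subst (1) poly_mapping_expand[of x], subst (1) poly_mapping_expand[of y])
      (simp add: sum_product mult_single)
  then have "fextend h (x * y) = (\<Sum>m\<in>keys x. \<Sum>n\<in>keys y. fscale (lookup x m * lookup y n) (h (m + n)))"
    by (simp only: fextend_sum fextend_single)
  also have "\<dots> = (\<Sum>m\<in>keys x. \<Sum>n\<in>keys y. fscale (lookup x m) (h1 m) * fscale (lookup y n) (h2 n))"
    using assms by (intro sum.cong refl) (simp add: fscale_mult_left fscale_mult_right mult.commute)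
  finally show ?thesis by (simp add: fextend_def sum_product)
qed

definition mval :: "('v \<Rightarrow> 'b::comm_monoid_mult) \<Rightarrow> ('v \<Rightarrow>\<^sub>0 nat) \<Rightarrow> 'b"
  where "mval \<phi> m = (\<Prod>x\<in>keys m. \<phi> x ^ lookup m x)"

lemma mval_superset:
  "finite S \<Longrightarrow> keys m \<subseteq> S \<Longrightarrow> mval \<phi> m = (\<Prod>x\<in>S. \<phi> x ^ lookup m x)"
  unfolding mval_def by (rule prod.mono_neutral_left) (auto simp: in_keys_iff)

lemma mval_0 [simp]: "mval \<phi> 0 = 1"
  by (simp add: mval_def)

lemma mval_single [simp]: "mval \<phi> (single x n) = \<phi> x ^ n"
  by (subst mval_superset[of "{x}"]) auto

lemma mval_add: "mval \<phi> (m + n) = mval \<phi> m * mval \<phi> n"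
proof -
  have *: "finite (keys m \<union> keys n)" "keys (m + n) \<subseteq> keys m \<union> keys n"
    by (auto simp: keys_add)
  show ?thesis
    using * by (simp add: mval_superset[of "keys m \<union> keys n"] lookup_add power_add prod.distrib)
qed

lemma pconst_eq: "pconst = single 0"
  by (simp add: pconst_def fun_eq_iff)

lemma pconst_simps [simp]: "pconst 0 = 0" "pconst 1 = 1" "pconst (a + b) = pconst a + pconst b"
  "pconst (a * b) = pconst a * pconst b" "pconst (- a) = - pconst a"
  by (simp_all add: pconst_def single_add mult_single single_uminus)

lemma pvar_power: "pvar x ^ n = single (single x n) 1"
  by (induction n) (auto simp: pvar_def mult_single single_add[symmetric] add.commute)

lemma mval_pvar: "mval pvar m = single m 1"
proof -
  have "finite S \<Longrightarrow> (\<Prod>x\<in>S. single (single x (f x)) (1::'a)) = single (\<Sum>x\<in>S. single x (f x)) 1" for S f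
    by (induction S rule: finite_induct) (simp_all add: mult_single)
  from this[of "keys m" "lookup m"] show ?thesis
    by (simp add: mval_def pvar_power poly_mapping_expand[of m, symmetric])
qed

text \<open>Polynomials as the algebra generated by constants and variables; identities between
  algebra maps and the existence of normal forms are proved this way.\<close>

lemma pvpoly_induct [case_names const var add mult]:
  fixes f :: "'k::field pvpoly"
  assumes c: "\<And>c. P (pconst c)" and v: "\<And>x. P (pvar x)"
    and a: "\<And>f g. P f \<Longrightarrow> P g \<Longrightarrow> P (f + g)" and m: "\<And>f g. P f \<Longrightarrow> P g \<Longrightarrow> P (f * g)"
  shows "P f"
proof -
  have pw: "P (pvar x ^ n)" for x n
    using c[of 1] by (induction n) (auto intro: v m)
  have pp: "P (\<Prod>x\<in>S. pvar x ^ g x)" if "finite S" for S g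
    using that by (induction S rule: finite_induct) (use c[of 1] in \<open>auto intro: pw m\<close>)
  have pm: "P (single n d)" for n d
  proof -
    have "single n d = pconst d * mval pvar n"
      by (simp add: mval_pvar pconst_def mult_single)
    then show ?thesis using c m pp by (simp add: mval_def)
  qed
  have ps: "P (\<Sum>x\<in>S. single x (g x))" if "finite S" for S g
    using that by (induction S rule: finite_induct) (use c[of 0] in \<open>auto intro: pm a\<close>)
  show ?thesis
    by (subst poly_mapping_expand) (simp add: ps)
qed

lemma fextend_1: "h 0 = 1 \<Longrightarrow> fextend h (1 :: 'm::zero \<Rightarrow>\<^sub>0 'k::field) = 1"
  unfolding single_one[symmetric] fextend_single by simp

subsection \<open>Renaming the variables\<close>

text \<open>Raising the indices of the u_i serves two purposes: the base-\<open>p\<close> recursion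
  of the divided powers, and the passage from s to s - 1 variables when u_0 vanishes.\<close>

definition shvar :: "pvar \<Rightarrow> pvar"
  where "shvar x = (case x of U i \<Rightarrow> U (Suc i) | V \<Rightarrow> V)"

definition shmon :: "(pvar \<Rightarrow>\<^sub>0 nat) \<Rightarrow> (pvar \<Rightarrow>\<^sub>0 nat)"
  where "shmon m = (\<Sum>x\<in>keys m. single (shvar x) (lookup m x))"

lemma inj_shvar: "inj shvar"
  by (auto simp: inj_def shvar_def split: pvar.splits)

lemma shmon_add: "shmon (m + n) = shmon m + shmon n"
  unfolding shmon_def by (rule setsum_keys_plus_distrib) (simp_all add: single_add)

lemma shmon_0 [simp]: "shmon 0 = 0"
  by (simp add: shmon_def)

lemma shmon_single [simp]: "shmon (single x n) = single (shvar x) n"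
  by (cases "n = 0") (simp_all add: shmon_def)

lemma lookup_shmon_shvar: "lookup (shmon m) (shvar x) = lookup m x"
  by (auto simp: shmon_def lookup_sum lookup_single when_def inj_eq[OF inj_shvar] in_keys_iff)

lemma lookup_shmon [simp]:
  "lookup (shmon m) (U (Suc i)) = lookup m (U i)" "lookup (shmon m) V = lookup m V"
  "lookup (shmon m) (U 0) = 0"
  using lookup_shmon_shvar[of m "U i"] lookup_shmon_shvar[of m V]
  by (auto simp: shvar_def shmon_def lookup_sum lookup_single when_def split: pvar.splits)

lemma inj_shmon: "inj shmon"
  by (rule injI, rule poly_mapping_eqI) (metis lookup_shmon_shvar)

definition shift :: "'k::field pvpoly \<Rightarrow> 'k pvpoly"
  where "shift = fextend (\<lambda>m. single (shmon m) 1)"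

lemma shift_add: "shift (f + g) = shift f + shift g"
  by (simp add: shift_def fextend_add)

lemma shift_single [simp]: "shift (single m c) = single (shmon m) c"
  by (simp add: shift_def)

lemma shift_mult: "shift (f * g) = shift f * shift g"
  unfolding shift_def by (rule fextend_mult) (simp add: shmon_add mult_single)

lemma shift_const [simp]: "shift (pconst c) = pconst c"
  by (simp add: pconst_def)

lemma shift_1 [simp]: "shift 1 = 1"
  using shift_const[of 1] by (simp del: shift_const)

lemma shift_0 [simp]: "shift 0 = 0"
  by (simp add: shift_def)

lemma shift_pvar: "shift (pvar x) = pvar (shvar x)"
  by (simp add: pvar_def)

lemma shift_pvar_simps [simp]: "shift (pvar (U i)) = pvar (U (Suc i))" "shift (pvar V) = pvar V"
  by (simp_all add: shift_pvar shvar_def)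

lemma shift_power: "shift (f ^ n) = shift f ^ n"
  by (induction n) (simp_all add: shift_mult)

lemma shift_prod: "shift (\<Prod>i\<in>I. f i) = (\<Prod>i\<in>I. shift (f i))"
  by (induction I rule: infinite_finite_induct) (simp_all add: shift_mult)

lemma lookup_shift: "lookup (shift f) (shmon m) = lookup f m"
  by (auto simp: shift_def fextend_def lookup_sum lookup_single when_def inj_eq[OF inj_shmon] in_keys_iff
      cong: if_cong)

text \<open>An algebra retraction onto the polynomials in u_0, ..., u_(r-1), v that sends the other
  variables to 0. It makes evaluations total on all polynomials.\<close>

definition trunc :: "nat \<Rightarrow> 'k::field pvpoly \<Rightarrow> 'k pvpoly"
  where "trunc r = fextend (\<lambda>m. if keys m \<subseteq> insert V (U ` {..<r}) then single m 1 else 0)"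

lemma keys_add_nat: "keys (m + n) = keys m \<union> keys n" for m n :: "'v \<Rightarrow>\<^sub>0 nat"
  by (auto simp: in_keys_iff lookup_add)

lemma trunc_add: "trunc r (f + g) = trunc r f + trunc r g"
  by (simp add: trunc_def fextend_add)

lemma trunc_mult: "trunc r (f * g) = trunc r f * trunc r g"
  unfolding trunc_def by (rule fextend_mult) (auto simp: keys_add_nat mult_single)

lemma trunc_const [simp]: "trunc r (pconst c) = pconst c"
  by (simp add: trunc_def pconst_def fscale_eq_mult)

lemma trunc_1 [simp]: "trunc r 1 = 1"
  using trunc_const[of r 1] by (simp del: trunc_const)

lemma trunc_eq: "(\<And>m. m \<in> keys f \<Longrightarrow> keys m \<subseteq> insert V (U ` {..<r})) \<Longrightarrow> trunc r f = f"
  unfolding trunc_def fextend_def by (subst (3) poly_mapping_expand) simp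

lemma keys_trunc: "m \<in> keys (trunc r f) \<Longrightarrow> keys m \<subseteq> insert V (U ` {..<r}) \<and> m \<in> keys f"
proof -
  assume "m \<in> keys (trunc r f)"
  then have "m \<in> (\<Union>n\<in>keys f. keys (fscale (lookup f n) (if keys n \<subseteq> insert V (U ` {..<r}) then single n 1 else 0)))"
    unfolding trunc_def fextend_def using keys_sum by (rule rev_subsetD)
  then show ?thesis by (auto split: if_splits)
qed

lemma trunc_pvar: "trunc r (pvar x) = (if x \<in> insert V (U ` {..<r}) then pvar x else 0)"
  by (simp add: trunc_def pvar_def)

section \<open>Ideals and congruences\<close>

text \<open>Ideals of a ring given by a type class; congruence modulo \<open>K\<close> is written
  \<open>a - b \<in> K\<close> throughout.\<close>

definition pideal :: "'b::comm_ring_1 set \<Rightarrow> bool"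
  where "pideal K \<longleftrightarrow> 0 \<in> K \<and> (\<forall>a\<in>K. \<forall>b\<in>K. a + b \<in> K) \<and> (\<forall>a\<in>K. \<forall>c. a * c \<in> K)"

lemma pideal_rules:
  assumes "pideal K"
  shows pideal_0: "0 \<in> K"
    and pideal_add: "a \<in> K \<Longrightarrow> b \<in> K \<Longrightarrow> a + b \<in> K"
    and pideal_mult_right: "a \<in> K \<Longrightarrow> a * c \<in> K"
    and pideal_mult_left: "a \<in> K \<Longrightarrow> c * a \<in> K"
    and pideal_minus: "a \<in> K \<Longrightarrow> - a \<in> K"
    and pideal_diff: "a \<in> K \<Longrightarrow> b \<in> K \<Longrightarrow> a - b \<in> K"
proof -
  show *: "0 \<in> K" "\<And>a b. a \<in> K \<Longrightarrow> b \<in> K \<Longrightarrow> a + b \<in> K" "\<And>a c. a \<in> K \<Longrightarrow> a * c \<in> K"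
    using assms by (auto simp: pideal_def)
  show "c * a \<in> K" if "a \<in> K" for a c
    using *(3)[OF that, of c] by (simp add: mult.commute)
  show m: "- a \<in> K" if "a \<in> K" for a
    using *(3)[OF that, of "- 1"] by simp
  show "a - b \<in> K" if "a \<in> K" "b \<in> K" for a b
    using *(2)[OF that(1) m[OF that(2)]] by simp
qed

lemma pideal_sum: "pideal K \<Longrightarrow> (\<And>i. i \<in> I \<Longrightarrow> f i \<in> K) \<Longrightarrow> (\<Sum>i\<in>I. f i) \<in> K"
  by (induction I rule: infinite_finite_induct) (auto simp: pideal_0 pideal_add)

lemma cong_trans': "pideal K \<Longrightarrow> a - b \<in> K \<Longrightarrow> b - c \<in> K \<Longrightarrow> a - c \<in> K"
  using pideal_add[of K "a - b" "b - c"] by simp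

lemma cong_mult': 
  assumes "pideal K" "a - b \<in> K" "c - d \<in> K"
  shows "a * c - b * d \<in> K"
proof -
  have "a * c - b * d = (a - b) * c + b * (c - d)" by (simp add: algebra_simps)
  then show ?thesis using assms by (simp add: pideal_rules)
qed

lemma cong_power': "pideal K \<Longrightarrow> a - b \<in> K \<Longrightarrow> a ^ n - b ^ n \<in> K"
  by (induction n) (auto simp: pideal_0 intro: cong_mult')

lemma cong_prod': "pideal K \<Longrightarrow> (\<And>i. i \<in> I \<Longrightarrow> f i - g i \<in> K) \<Longrightarrow> (\<Prod>i\<in>I. f i) - (\<Prod>i\<in>I. g i) \<in> K"
  by (induction I rule: infinite_finite_induct) (auto simp: pideal_0 intro: cong_mult')

lemma cong_sum': "pideal K \<Longrightarrow> (\<And>i. i \<in> I \<Longrightarrow> f i - g i \<in> K) \<Longrightarrow> (\<Sum>i\<in>I. f i) - (\<Sum>i\<in>I. g i) \<in> K"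
  using pideal_sum[of K I "\<lambda>i. f i - g i"] by (simp add: sum_subtractf)

lemma cong_mem': "pideal K \<Longrightarrow> a - b \<in> K \<Longrightarrow> b \<in> K \<Longrightarrow> a \<in> K"
  using pideal_add[of K "a - b" b] by simp

section \<open>Divided powers in characteristic p\<close>

lemma CHAR_poly_mapping [simp]: "CHAR('n::comm_monoid_add \<Rightarrow>\<^sub>0 'k::field) = CHAR('k)"
proof (rule CHAR_eqI)
  show "of_nat CHAR('k) = (0 :: 'n \<Rightarrow>\<^sub>0 'k)"
    by (simp flip: single_of_nat)
  fix n assume "of_nat n = (0 :: 'n \<Rightarrow>\<^sub>0 'k)"
  then have "lookup (of_nat n :: 'n \<Rightarrow>\<^sub>0 'k) 0 = 0" by simp
  then have "of_nat n = (0 :: 'k)" by (simp add: lookup_of_nat)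
  then show "CHAR('k) dvd n" by (simp add: of_nat_eq_0_iff_char_dvd)
qed

text \<open>Lucas' theorem, by comparing coefficients in (1 + X)^(p a + a0) = (1 + X^p)^a (1 +
  X)^a0.\<close>

lemma choose_Lucas:
  fixes p :: nat
  defines "p \<equiv> CHAR('k::field)"
  assumes p: "0 < p" and lt: "a0 < p" "c0 < p"
  shows "(of_nat ((p * a + a0) choose (p * c + c0)) :: 'k) = of_nat (a choose c) * of_nat (a0 choose c0)"
proof -
  let ?B = "\<lambda>n. [:1, 1:] ^ n :: 'k poly"
  have prime: "prime CHAR('k poly)" and Cp: "CHAR('k poly) = p"
    using p prime_CHAR_semidom[where ?'a = 'k] by (simp_all add: p_def)
  have coeff_B: "coeff (?B n) k = of_nat (n choose k)" for n k
  proof -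
    have "?B n = (\<Sum>k\<le>n. monom (of_nat (n choose k)) k)"
    proof -
      have "[:1, 1:] = monom 1 1 + (1 :: 'k poly)" by (simp add: monom_altdef one_pCons)
      then have "?B n = (monom 1 1 + 1) ^ n" by simp
      also have "\<dots> = (\<Sum>k\<le>n. of_nat (n choose k) * monom 1 1 ^ k * 1 ^ (n - k))"
        by (rule binomial_ring)
      finally show ?thesis by (simp add: monom_power of_nat_monom mult_monom)
    qed
    then show ?thesis by (auto simp: coeff_sum binomial_eq_0 not_le)
  qed
  have "?B (p * a + a0) = (?B p) ^ a * ?B a0"
    by (simp add: power_add power_mult)
  also have "?B p = monom 1 p + 1"
  proof -
    have "[:1, 1:] = monom 1 1 + (1 :: 'k poly)" by (simp add: monom_altdef one_pCons)
    then show ?thesis using freshmans_dream[OF prime Cp[symmetric], of "monom 1 1" 1] by (simp add: monom_power)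
  qed
  also have "(monom 1 p + 1) ^ a = (\<Sum>j\<le>a. monom (of_nat (a choose j)) (p * j))"
    by (subst binomial_ring) (simp add: monom_power of_nat_monom mult_monom)
  finally have "coeff (?B (p * a + a0)) (p * c + c0)
      = coeff ((\<Sum>j\<le>a. monom (of_nat (a choose j)) (p * j)) * ?B a0) (p * c + c0)" by simp
  also have "\<dots> = (\<Sum>j\<le>a. if p * j \<le> p * c + c0 then of_nat (a choose j) * of_nat (a0 choose (p * c + c0 - p * j)) else 0)"
    unfolding sum_distrib_right coeff_sum coeff_monom_mult coeff_B by (intro sum.cong refl) auto
  \<comment> \<open>Only j = c contributes: for larger j the exponent p j is too big, and for
    smaller j the exponent left to the second factor exceeds its degree a0.\<close>
  also have "\<dots> = (\<Sum>j\<le>a. if j = c then of_nat (a choose c) * of_nat (a0 choose c0) else 0)"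
  proof (rule sum.cong[OF refl])
    fix j
    have 1: "\<not> p * j \<le> p * c + c0" if "j > c"
    proof -
      have "p * c + c0 < p * Suc c" using lt by simp
      also have "\<dots> \<le> p * j" using that by (intro mult_le_mono2) simp
      finally show ?thesis by simp
    qed
    have 2: "a0 < p * c + c0 - p * j" if "j < c"
    proof -
      have "p * Suc j \<le> p * c" using that by (intro mult_le_mono2) simp
      then show ?thesis using lt by simp
    qed
    show "(if p * j \<le> p * c + c0 then of_nat (a choose j) * of_nat (a0 choose (p * c + c0 - p * j)) else 0)
        = (if j = c then of_nat (a choose c) * of_nat (a0 choose c0) else (0::'k))"
      using 1 2 by (cases j c rule: linorder_cases) (auto simp: binomial_eq_0)
  qed
  also have "\<dots> = of_nat (a choose c) * of_nat (a0 choose c0)"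
    by (simp add: binomial_eq_0)
  finally show ?thesis by (simp add: coeff_B)
qed

text \<open>Lucas removes the last digits of both numbers \<open>e\<close> times. The last digit of
  the lower number is 0 each time, so no factor arises, and in the end \<open>m\<close> choose 1
  remains.\<close>

lemma choose_power:
  fixes p :: nat
  defines "p \<equiv> CHAR('k::field)"
  assumes p: "0 < p" and "l < p ^ e"
  shows "(of_nat ((l + m * p ^ e) choose p ^ e) :: 'k) = of_nat m"
  using assms(3)
proof (induction e arbitrary: l)
  case (Suc e)
  have "l + m * p ^ Suc e = p * (l div p + m * p ^ e) + l mod p"
    by (simp add: algebra_simps)
  moreover have "l div p < p ^ e"
    using Suc.prems by (simp add: less_mult_imp_div_less mult.commute)
  moreover have "l mod p < p" using p by simp
  ultimately show ?case
    using choose_Lucas[where ?'k = 'k, of "l mod p" 0 "l div p + m * p ^ e" "p ^ e"] Suc.IH p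
    by (simp add: p_def)
qed simp

text \<open>The witness is the highest power of \<open>p\<close> dividing \<open>a\<close>: its
  binomial coefficient is the cofactor \<open>m\<close>, which is prime to \<open>p\<close>. This
  decides which even powers of v are indecomposable.\<close>

lemma choose_not_prime_power:
  fixes p :: nat
  defines "p \<equiv> CHAR('k::field)"
  assumes p: "0 < p" and a: "0 < a" "\<And>e. a \<noteq> p ^ e"
  shows "\<exists>i. 0 < i \<and> i < a \<and> (of_nat (a choose i) :: 'k) \<noteq> 0"
proof -
  have prime: "prime p" using p prime_CHAR_semidom[where ?'a = 'k] by (simp add: p_def)
  define e where "e = multiplicity p a"
  define m where "m = a div p ^ e"
  have am: "a = m * p ^ e" by (simp add: m_def e_def multiplicity_dvd)
  have nd: "\<not> p dvd m"
    using a multiplicity_decompose[of a p] prime not_prime_unit by (auto simp: m_def e_def)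
  have "m \<noteq> 1" using am a(2)[of e] by auto
  moreover have "m \<noteq> 0" using am a by auto
  ultimately have "p ^ e < a" using am p by simp
  moreover have "(of_nat (a choose p ^ e) :: 'k) = of_nat m"
    using choose_power[where ?'k = 'k, of 0 e m] p am by (simp add: p_def)
  moreover have "(of_nat m :: 'k) \<noteq> 0" using nd by (simp add: of_nat_eq_0_iff_char_dvd p_def)
  ultimately show ?thesis using p by (intro exI[of _ "p ^ e"]) simp
qed

text \<open>\<open>pgamma r l\<close> does not depend on \<open>r\<close> once l < p^r, and r = l is
  large enough because l < 2^l \<le> p^l.\<close>

definition gam :: "nat \<Rightarrow> 'k::field pvpoly"
  where "gam l = pgamma l l"

lemma pgamma_Suc_eq: 
  assumes "l < CHAR('k::field) ^ r"
  shows "pgamma (Suc r) l = (pgamma r l :: 'k pvpoly)"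
  using assms by (simp add: pgamma_def Let_def)

lemma pgamma_eq_gam:
  assumes "l < CHAR('k::field) ^ r" "2 \<le> CHAR('k)"
  shows "pgamma r l = (gam l :: 'k pvpoly)"
proof -
  have *: "pgamma (r + n) l = (pgamma r l :: 'k pvpoly)" if "l < CHAR('k) ^ r" for r n
  proof (induction n)
    case (Suc n)
    have "CHAR('k) ^ r \<le> CHAR('k) ^ (r + n)" using assms(2) by (intro power_increasing) auto
    with that Suc show ?case by (simp add: pgamma_Suc_eq)
  qed simp
  have "l < 2 ^ l" by simp
  also have "(2::nat) ^ l \<le> CHAR('k) ^ l" using assms(2) by (rule power_mono) simp
  finally have l: "l < CHAR('k) ^ l" .
  show ?thesis
    using *[OF assms(1), of l] *[OF l, of r] by (simp add: gam_def add.commute)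
qed

lemma gam_0 [simp]: "gam 0 = 1"
  by (simp add: gam_def pgamma_def)

text \<open>The lowest digit of \<open>l\<close> is split off; the other digits move down one place
  while their variables move up one index. Both \<open>gam_mult\<close> and the removal of u_0 rest
  on this form.\<close>

lemma gam_rec:
  fixes p :: nat
  defines "p \<equiv> CHAR('k::field)"
  assumes "2 \<le> p"
  shows "gam l = pconst (1 / of_nat (fact (l mod p))) * pvar (U 0) ^ (l mod p) * shift (gam (l div p) :: 'k pvpoly)"
proof -
  have "l < 2 ^ l" by simp
  also have "(2::nat) ^ l \<le> p ^ l" using assms(2) by (rule power_mono) simp
  finally have l: "l < p ^ l" .
  have l1: "l < p ^ Suc l"
    using l assms(2) by (simp add: less_le_trans[of l "p ^ l"])
  have l2: "l div p < p ^ l" using l div_le_dividend le_less_trans by blast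
  have "gam l = (pgamma (Suc l) l :: 'k pvpoly)"
    using l1 assms by (simp add: pgamma_eq_gam)
  also have "\<dots> = pconst (1 / of_nat (fact (l mod p))) * pvar (U 0) ^ (l mod p) *
      (\<Prod>i<l. let d = l div p ^ Suc i mod p in pconst (1 / of_nat (fact d)) * pvar (U (Suc i)) ^ d)"
    unfolding pgamma_def p_def by (subst prod.lessThan_Suc_shift) (simp add: Let_def)
  also have "(\<Prod>i<l. let d = l div p ^ Suc i mod p in pconst (1 / of_nat (fact d)) * pvar (U (Suc i)) ^ d)
      = shift (pgamma l (l div p) :: 'k pvpoly)"
    by (simp add: pgamma_def p_def Let_def shift_prod shift_mult shift_power div_mult2_eq)
  also have "pgamma l (l div p) = (gam (l div p) :: 'k pvpoly)"
    using l2 assms by (simp add: pgamma_eq_gam)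
  finally show ?thesis .
qed

text \<open>Induction over the digits, from the lowest. Without a carry the factorials yield the
  binomial coefficient of the lowest digits, and the rest is the claim for the higher ones. With a
  carry both terms vanish modulo \<open>K\<close>, the product because of u_0^p and the binomial
  coefficient by Lucas. The variable u_(s-1) has no relation here; \<open>a + b < p ^ s\<close>
  excludes a carry out of its digit.\<close>

lemma gam_mult:
  fixes p :: nat and K :: "'k::field pvpoly set"
  defines "p \<equiv> CHAR('k)"
  assumes p: "2 \<le> p" and "pideal K" "\<And>i. Suc i < s \<Longrightarrow> pvar (U i) ^ p \<in> K" "a + b < p ^ s"
  shows "gam a * gam b - pconst (of_nat ((a + b) choose a)) * gam (a + b) \<in> K"
  using assms(3-)
proof (induction s arbitrary: K a b)
  case 0
  then have "a = 0" "b = 0" by auto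
  with 0 show ?case by (simp add: pideal_0)
next
  case (Suc s)
  note K = Suc.prems(1)
  define a0 a1 b0 b1 where ab: "a0 = a mod p" "a1 = a div p" "b0 = b mod p" "b1 = b div p"
  have a: "a = p * a1 + a0" and b: "b = p * b1 + b0" by (simp_all add: ab)
  have lt: "a0 < p" "b0 < p" using p by (simp_all add: ab)
  define iv where "iv n = pconst (1 / of_nat (fact n) :: 'k)" for n
  have ga: "gam a = iv a0 * pvar (U 0) ^ a0 * shift (gam a1 :: 'k pvpoly)"
    and gb: "gam b = iv b0 * pvar (U 0) ^ b0 * shift (gam b1 :: 'k pvpoly)"
    using gam_rec[where ?'k = 'k, of a] gam_rec[where ?'k = 'k, of b] p by (simp_all only: ab p_def iv_def)
  have prod: "gam a * gam b = iv a0 * iv b0 * pvar (U 0) ^ (a0 + b0) * shift (gam a1 * gam b1 :: 'k pvpoly)"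
    by (simp add: ga gb shift_mult power_add ac_simps)
  have ab1: "a1 + b1 < p ^ s"
  proof -
    have "p * (a1 + b1) \<le> a + b" by (simp add: a b algebra_simps)
    also have "\<dots> < p * p ^ s" using Suc.prems by simp
    finally show ?thesis using p by simp
  qed
  show ?case
  proof (cases "a0 + b0 < p")
    case True
    \<comment> \<open>The preimage under \<open>shift\<close> turns the relations for u_(i+1) into
      relations for u_i, as the induction hypothesis requires.\<close>
    let ?K = "{f. shift f \<in> K}"
    have "gam a1 * gam b1 - pconst (of_nat ((a1 + b1) choose a1)) * gam (a1 + b1) \<in> ?K"
    proof (rule Suc.IH)
      show "pideal ?K" using K by (auto simp: pideal_def shift_add shift_mult)
      show "pvar (U i) ^ p \<in> ?K" if "Suc i < s" for i
        using Suc.prems(2)[of "Suc i"] that by (simp add: shift_power)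
    qed (fact ab1)
    then have IH: "shift (gam a1 * gam b1) - shift (pconst (of_nat ((a1 + b1) choose a1)) * gam (a1 + b1)) \<in> K"
      by (simp add: shift_def fextend_diff)
    have sum: "(a + b) mod p = a0 + b0" "(a + b) div p = a1 + b1"
    proof -
      have "a + b = (a0 + b0) + p * (a1 + b1)" by (simp add: a b algebra_simps)
      then show "(a + b) mod p = a0 + b0" "(a + b) div p = a1 + b1"
        using True by simp_all
    qed
    have fa: "of_nat (fact n) \<noteq> (0::'k)" if "n < p" for n
      using that prime_dvd_fact_iff[of p n] prime_CHAR_semidom[where ?'a = 'k] p
      by (simp add: of_nat_eq_0_iff_char_dvd p_def)
    have "of_nat ((a + b) choose a) = (of_nat ((a1 + b1) choose a1) * of_nat ((a0 + b0) choose a0) :: 'k)"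
      using choose_Lucas[where ?'k = 'k, of "a0 + b0" a0 "a1 + b1" a1] True lt p
      by (simp add: a b p_def algebra_simps)
    also have "of_nat ((a0 + b0) choose a0) = (of_nat (fact (a0 + b0)) / (of_nat (fact a0) * of_nat (fact b0)) :: 'k)"
    proof -
      have "fact a0 * fact b0 * ((a0 + b0) choose a0) = (fact (a0 + b0) :: nat)"
        using binomial_fact_lemma[of a0 "a0 + b0"] by simp
      then have "of_nat (fact a0) * of_nat (fact b0) * of_nat ((a0 + b0) choose a0) = (of_nat (fact (a0 + b0)) :: 'k)"
        by (metis of_nat_mult)
      then show ?thesis using fa lt by (simp add: field_simps)
    qed
    finally have ch: "of_nat ((a + b) choose a) * (1 / of_nat (fact (a0 + b0)))
      = (of_nat ((a1 + b1) choose a1) * (1 / of_nat (fact a0)) * (1 / of_nat (fact b0)) :: 'k)"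
      using fa[OF True] by simp
    have gr: "gam (a + b) = pconst (1 / of_nat (fact (a0 + b0))) * pvar (U 0) ^ (a0 + b0)
        * shift (gam (a1 + b1) :: 'k pvpoly)"
      using gam_rec[where ?'k = 'k, of "a + b"] p unfolding sum p_def[symmetric] by blast
    have "pconst (of_nat ((a + b) choose a)) * gam (a + b)
        = pconst (of_nat ((a + b) choose a) * (1 / of_nat (fact (a0 + b0)))) * pvar (U 0) ^ (a0 + b0)
          * shift (gam (a1 + b1) :: 'k pvpoly)"
      by (simp only: gr pconst_simps(4) mult.assoc)
    also have "\<dots> = iv a0 * iv b0 * pvar (U 0) ^ (a0 + b0)
          * shift (pconst (of_nat ((a1 + b1) choose a1)) * gam (a1 + b1) :: 'k pvpoly)"
      unfolding ch iv_def pconst_simps(4) shift_mult shift_const by (simp only: ac_simps)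
    finally have "gam a * gam b - pconst (of_nat ((a + b) choose a)) * gam (a + b)
        = iv a0 * iv b0 * pvar (U 0) ^ (a0 + b0) * (shift (gam a1 * gam b1)
            - shift (pconst (of_nat ((a1 + b1) choose a1)) * gam (a1 + b1)))"
      unfolding prod by (simp only: right_diff_distrib)
    with pideal_mult_left[OF K IH] show ?thesis by simp
  next
    case False
    \<comment> \<open>With s = 0 only one digit is left, and \<open>a + b < p\<close> leaves no room
      for a carry.\<close>
    have "s \<noteq> 0"
    proof
      assume "s = 0"
      with ab1 Suc.prems(3) a b False show False by auto
    qed
    then have "pvar (U 0) ^ p \<in> K" using Suc.prems(2) by simp
    moreover have "pvar (U 0) ^ (a0 + b0) = pvar (U 0) ^ p * (pvar (U 0) ^ (a0 + b0 - p) :: 'k pvpoly)"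
      using False by (simp flip: power_add)
    ultimately have "gam a * gam b \<in> K"
      unfolding prod using K by (auto intro: pideal_mult_left pideal_mult_right)
    moreover have "(of_nat ((a + b) choose a) :: 'k) = 0"
    proof -
      have eq: "a + b = p * (a1 + b1 + 1) + (a0 + b0 - p)" using False by (simp add: a b algebra_simps)
      have "a0 + b0 - p < p" "a0 + b0 - p < a0" using lt False by simp_all
      then have "(of_nat ((p * (a1 + b1 + 1) + (a0 + b0 - p)) choose (p * a1 + a0)) :: 'k) = 0"
        using choose_Lucas[where ?'k = 'k, of "a0 + b0 - p" a0 "a1 + b1 + 1" a1] lt p
        by (simp add: p_def binomial_eq_0)
      then show ?thesis unfolding a[symmetric] eq[symmetric] .
    qed
    ultimately show ?thesis by simp
  qed
qed

section \<open>Polynomials in two sets of variables\<close>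

text \<open>The commutative ring k[x] \<otimes> k[x], without signs. They come back in
  \<open>th\<close>, where this ring is compared with the tensor product of superalgebras.\<close>

type_synonym 'k dpoly = "((pvar \<Rightarrow>\<^sub>0 nat) \<times> (pvar \<Rightarrow>\<^sub>0 nat)) \<Rightarrow>\<^sub>0 'k"

definition incl1 :: "'k::field pvpoly \<Rightarrow> 'k dpoly"
  where "incl1 = fextend (\<lambda>m. single (m, 0) 1)"

definition incl2 :: "'k::field pvpoly \<Rightarrow> 'k dpoly"
  where "incl2 = fextend (\<lambda>m. single (0, m) 1)"

definition tens :: "'k::field pvpoly \<Rightarrow> 'k pvpoly \<Rightarrow> 'k dpoly"
  where "tens f g = incl1 f * incl2 g"

lemma incl_add: "incl1 (f + g) = incl1 f + incl1 g" "incl2 (f + g) = incl2 f + incl2 g"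
  by (simp_all add: incl1_def incl2_def fextend_add)

lemma incl_diff: "incl1 (f - g) = incl1 f - incl1 g" "incl2 (f - g) = incl2 f - incl2 g"
  by (simp_all add: incl1_def incl2_def fextend_diff)

lemma incl_single [simp]: "incl1 (single m c) = single (m, 0) c" "incl2 (single m c) = single (0, m) c"
  by (simp_all add: incl1_def incl2_def)

lemma incl_mult: "incl1 (f * g) = incl1 f * incl1 g" "incl2 (f * g) = incl2 f * incl2 g"
  unfolding incl1_def incl2_def by (rule fextend_mult, simp add: mult_single)+

lemma incl_1 [simp]: "incl1 1 = 1" "incl2 1 = 1"
  unfolding incl1_def incl2_def by (rule fextend_1, simp add: zero_prod_def[symmetric])+

lemma incl_0 [simp]: "incl1 0 = 0" "incl2 0 = 0"
  by (simp_all add: incl1_def incl2_def)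

lemma incl_of_nat [simp]: "incl1 (of_nat n) = of_nat n" "incl2 (of_nat n) = of_nat n"
  by (induction n) (simp_all add: incl_add)

lemma incl_power: "incl1 (f ^ n) = incl1 f ^ n" "incl2 (f ^ n) = incl2 f ^ n"
  by (induction n) (simp_all add: incl_mult)

lemma tens_mult: "tens f g * tens f' g' = tens (f * f') (g * g')"
  by (simp add: tens_def incl_mult ac_simps)

lemma tens_single [simp]: "tens (single m c) (single n d) = single (m, n) (c * d)"
  by (simp add: tens_def mult_single)

lemma tens_power: "tens f g ^ n = tens (f ^ n) (g ^ n)"
  by (simp add: tens_def incl_power power_mult_distrib)

lemma tens_1 [simp]: "tens 1 1 = 1"
  by (simp add: tens_def)

lemma tens_eq_fextend: "tens f g = fextend (\<lambda>m. fextend (\<lambda>n. single (m, n) 1) g) f"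
proof -
  have "tens f g = fextend (\<lambda>m. single (m, 0) 1 * incl2 g) f"
    unfolding tens_def incl1_def fextend_def[of _ f] by (simp add: sum_distrib_right fscale_mult_left[symmetric])
  also have "\<dots> = fextend (\<lambda>m. fextend (\<lambda>n. single (m, n) 1) g) f"
    unfolding incl2_def fextend_def[of _ g]
    by (simp add: sum_distrib_left fscale_mult_right mult_single)
  finally show ?thesis .
qed

text \<open>A functional given by its values on the basis, encoded as an extension into the free
  vector space on one point so that the rules for \<open>fextend\<close> apply.\<close>

definition lsum :: "('s \<Rightarrow> 'k) \<Rightarrow> ('s \<Rightarrow>\<^sub>0 'k::field) \<Rightarrow> 'k"
  where "lsum G x = lookup (fextend (\<lambda>s. single () (G s)) x) ()"

lemma lsum_simps [simp]:
  "lsum G (x + y) = lsum G x + lsum G y" "lsum G (x - y) = lsum G x - lsum G y"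
  "lsum G 0 = 0" "lsum G (single s c) = c * G s" "lsum G (fscale c x) = c * lsum G x"
  by (simp_all add: lsum_def fextend_add fextend_diff fextend_fscale lookup_add lookup_minus)

lemma lsum_sum: "lsum G (\<Sum>i\<in>I. F i) = (\<Sum>i\<in>I. lsum G (F i))"
  by (simp add: lsum_def fextend_sum lookup_sum)

lemma lsum_fextend: "lsum G (fextend h x) = lsum (\<lambda>s. lsum G (h s)) x"
  by (simp add: fextend_def lsum_sum lsum_def[of "\<lambda>s. lsum G (h s)"] lookup_sum)

lemma lsum_eq: "lsum G x = (\<Sum>s\<in>keys x. lookup x s * G s)"
  by (subst (1) poly_mapping_expand[of x]) (simp only: lsum_sum lsum_simps)

lemma lsum_mult_fun: "lsum (\<lambda>s. G s * c) x = lsum G x * c"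
  by (simp add: lsum_eq sum_distrib_right mult.assoc)

lemma lsum_tens: "lsum (\<lambda>(m, n). G m * H n) (tens f g) = lsum G f * lsum H g"
proof -
  have "lsum (\<lambda>(m, n). G m * H n) (fextend (\<lambda>n. single (m, n) 1) g) = G m * lsum H g" for m
    using lsum_mult_fun[of H "G m" g] by (simp add: lsum_fextend mult.commute)
  then show ?thesis
    by (simp add: tens_eq_fextend lsum_fextend lsum_mult_fun)
qed

section \<open>The coproduct on polynomials\<close>

text \<open>The polynomial form of the coproduct of \<gamma>_l.\<close>

definition cop :: "nat \<Rightarrow> 'k::field dpoly"
  where "cop l = (\<Sum>j\<le>l. tens (gam j) (gam (l - j)))"

text \<open>The powers of \<open>v \<otimes> 1 + 1 \<otimes> v\<close> for the product with Koszul signs, written in the commutative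
  ring of polynomials in two sets of variables.\<close>

definition om :: "nat \<Rightarrow> 'k::field dpoly"
  where "om n = (tens (pvar V ^ 2) 1 + tens 1 (pvar V ^ 2)) ^ (n div 2)
    * (tens (pvar V) 1 + tens 1 (pvar V)) ^ (n mod 2)"

text \<open>The powers of v are kept apart as \<open>om\<close>, because with signs the coproduct of
  v^n is not the n-th power of that of v in the commutative ring.\<close>

definition dmon :: "(pvar \<Rightarrow>\<^sub>0 nat) \<Rightarrow> 'k::field dpoly"
  where "dmon m = mval (\<lambda>x. case x of U i \<Rightarrow> cop (CHAR('k) ^ i) | V \<Rightarrow> 1) m * om (lookup m V)"

definition Delta :: "'k::field pvpoly \<Rightarrow> 'k dpoly"
  where "Delta = fextend dmon"

definition even_v :: "'k::field pvpoly \<Rightarrow> bool"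
  where "even_v f \<longleftrightarrow> (\<forall>m\<in>keys f. even (lookup m V))"

lemma om_add: "even a \<Longrightarrow> om (a + n) = om a * om n"
  by (auto simp: om_def power_add div_add elim!: evenE)

lemma om_0 [simp]: "om 0 = 1"
  by (simp add: om_def)

lemma dmon_0 [simp]: "dmon 0 = 1"
  by (simp add: dmon_def)

lemma dmon_add: "even (lookup m V) \<Longrightarrow> dmon (m + n) = dmon m * dmon n"
  by (simp add: dmon_def mval_add lookup_add om_add ac_simps)

lemma Delta_add: "Delta (f + g) = Delta f + Delta g"
  by (simp add: Delta_def fextend_add)

lemma Delta_fscale: "Delta (fscale c f) = fscale c (Delta f)"
  by (simp add: Delta_def fextend_fscale)

lemma Delta_sum: "Delta (\<Sum>i\<in>I. F i) = (\<Sum>i\<in>I. Delta (F i))"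
  by (simp add: Delta_def fextend_sum)

text \<open>The restriction comes from \<open>om_add\<close>: \<open>om 1 * om 1\<close> contains
  the cross terms v \<otimes> v, which \<open>om 2\<close> lacks.\<close>

lemma Delta_mult: "even_v f \<Longrightarrow> Delta (f * g) = Delta f * Delta g"
  unfolding Delta_def by (rule fextend_mult) (auto simp: even_v_def dmon_add)

lemma even_v_mult: "even_v f \<Longrightarrow> even_v g \<Longrightarrow> even_v (f * g)"
  unfolding even_v_def by (auto dest!: subsetD[OF keys_mult] simp: lookup_add)

lemma even_v_add: "even_v f \<Longrightarrow> even_v g \<Longrightarrow> even_v (f + g)"
  unfolding even_v_def by (auto dest!: subsetD[OF keys_add])

lemma even_v_const [simp]: "even_v (pconst c)"
  by (auto simp: even_v_def pconst_def)

lemma even_v_1 [simp]: "even_v 1"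
  using even_v_const[of 1] by (simp del: even_v_const)

lemma even_v_U [simp]: "even_v (pvar (U i))"
  by (auto simp: even_v_def pvar_def lookup_single)

lemma even_v_V2 [simp]: "even_v (pvar V ^ 2)"
  by (auto simp: even_v_def pvar_power lookup_single)

lemma even_v_power: "even_v f \<Longrightarrow> even_v (f ^ n)"
  by (induction n) (auto intro: even_v_mult)

lemma even_v_prod: "(\<And>i. i \<in> I \<Longrightarrow> even_v (f i)) \<Longrightarrow> even_v (\<Prod>i\<in>I. f i)"
  by (induction I rule: infinite_finite_induct) (auto intro: even_v_mult)

lemma even_v_pgamma: "even_v (pgamma r l)"
  unfolding pgamma_def Let_def by (intro even_v_prod even_v_mult even_v_power even_v_const even_v_U)

lemma even_v_gam: "even_v (gam l)"
  unfolding gam_def by (rule even_v_pgamma)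

lemma Delta_const: "Delta (pconst c) = single 0 c"
  by (simp add: Delta_def pconst_def fscale_eq_mult)

lemma Delta_1 [simp]: "Delta 1 = 1"
  using Delta_const[of 1] by simp

lemma Delta_power: "even_v f \<Longrightarrow> Delta (f ^ n) = Delta f ^ n"
  by (induction n) (simp_all add: Delta_mult)

lemma Delta_U [simp]: "Delta (pvar (U i)) = (cop (CHAR('k) ^ i) :: 'k::field dpoly)"
  by (simp add: Delta_def pvar_def dmon_def lookup_single)

lemma Delta_V_power: "Delta (pvar V ^ n) = om n"
  by (simp add: Delta_def pvar_power dmon_def)

lemma cop_0 [simp]: "cop 0 = 1"
  by (simp add: cop_def)

text \<open>The coefficient of v^i \<otimes> v^(n-i) in the n-th power of v \<otimes> 1 + 1
  \<otimes> v with Koszul signs, that is, the Gaussian binomial coefficient at q = -1.\<close>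

definition sb :: "nat \<Rightarrow> nat \<Rightarrow> nat"
  where "sb n i = (if even n \<and> odd i then 0 else n div 2 choose i div 2)"

lemma sum_atMost_even_odd: "(\<Sum>i\<le>2 * a. F i) = (\<Sum>k\<le>a. F (2 * k)) + (\<Sum>k<a. F (2 * k + 1))"
  "(\<Sum>i\<le>2 * a + 1. F i) = (\<Sum>k\<le>a. F (2 * k) + F (2 * k + 1))"
  for F :: "nat \<Rightarrow> 'b::comm_monoid_add"
proof -
  show 1: "(\<Sum>i\<le>2 * a. F i) = (\<Sum>k\<le>a. F (2 * k)) + (\<Sum>k<a. F (2 * k + 1))"
    by (induction a) (simp_all add: ac_simps)
  have "(\<Sum>k\<le>a. F (2 * k + 1)) = (\<Sum>k<a. F (2 * k + 1)) + F (2 * a + 1)"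
    by (simp only: lessThan_Suc_atMost[symmetric] sum.lessThan_Suc)
  then show "(\<Sum>i\<le>2 * a + 1. F i) = (\<Sum>k\<le>a. F (2 * k) + F (2 * k + 1))"
    using 1 by (simp add: sum.distrib ac_simps)
qed

text \<open>The sum is split by the parity of i. For odd n the neighbours 2k and 2k + 1 share the
  coefficient a choose k and together form one multiple of v \<otimes> 1 + 1 \<otimes> v.\<close>

lemma om_expand: "om n = (\<Sum>i\<le>n. of_nat (sb n i) * tens (pvar V ^ i) (pvar V ^ (n - i)))"
proof -
  define a where "a = n div 2"
  define w :: "nat \<Rightarrow> 'a dpoly" where "w k = of_nat (a choose k) * tens (pvar V ^ (2 * k)) (pvar V ^ (2 * (a - k)))" for k
  have w: "(tens (pvar V ^ 2) 1 + tens 1 (pvar V ^ 2)) ^ a = (\<Sum>k\<le>a. w k)"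
    by (simp add: binomial_ring w_def tens_power tens_mult mult.assoc power_mult)
  show ?thesis
  proof (cases "even n")
    case True
    then have n: "n = 2 * a" by (simp add: a_def)
    have "(\<Sum>i\<le>n. of_nat (sb n i) * tens (pvar V ^ i) (pvar V ^ (n - i))) = (\<Sum>k\<le>a. w k)"
      unfolding n sum_atMost_even_odd by (simp add: sb_def w_def right_diff_distrib')
    then show ?thesis using w True by (simp add: om_def a_def[symmetric])
  next
    case False
    then have n: "n = 2 * a + 1" by (simp add: a_def)
    have "(\<Sum>i\<le>n. of_nat (sb n i) * tens (pvar V ^ i) (pvar V ^ (n - i)))
        = (\<Sum>k\<le>a. w k * (tens (pvar V) 1 + tens 1 (pvar V)))"
      unfolding n sum_atMost_even_odd
    proof (rule sum.cong[OF refl])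
      fix k assume "k \<in> {..a}"
      then have k: "2 * a + 1 - 2 * k = Suc (2 * (a - k))" "2 * a + 1 - (2 * k + 1) = 2 * (a - k)" by auto
      show "of_nat (sb (2 * a + 1) (2 * k)) * tens (pvar V ^ (2 * k)) (pvar V ^ (2 * a + 1 - 2 * k)) +
          of_nat (sb (2 * a + 1) (2 * k + 1)) * tens (pvar V ^ (2 * k + 1)) (pvar V ^ (2 * a + 1 - (2 * k + 1)))
        = w k * (tens (pvar V) 1 + tens 1 (pvar V))"
        unfolding k by (simp add: sb_def w_def distrib_left tens_mult mult.assoc mult.commute[of _ "pvar V"])
    qed
    then show ?thesis using w False by (simp add: om_def a_def[symmetric] sum_distrib_right odd_iff_mod_2_eq_one)
  qed
qed

subsection \<open>Coproducts of divided powers\<close>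

lemma sum_group_add:
  fixes F :: "nat \<Rightarrow> nat \<Rightarrow> 'b::comm_monoid_add"
  shows "(\<Sum>i\<le>a. \<Sum>j\<le>b. F i j) = (\<Sum>m\<le>a + b. \<Sum>i | i \<le> a \<and> i \<le> m \<and> m - i \<le> b. F i (m - i))"
proof -
  have "(\<Sum>i\<le>a. \<Sum>j\<le>b. F i j) = (\<Sum>x\<in>{..a} \<times> {..b}. F (fst x) (snd x))"
    by (simp add: sum.cartesian_product case_prod_beta')
  also have "\<dots> = (\<Sum>m\<le>a + b. \<Sum>x | x \<in> {..a} \<times> {..b} \<and> fst x + snd x = m. F (fst x) (snd x))"
    by (rule sum.group[symmetric]) auto
  also have "\<dots> = (\<Sum>m\<le>a + b. \<Sum>i | i \<le> a \<and> i \<le> m \<and> m - i \<le> b. F i (m - i))"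
    by (intro sum.cong refl sum.reindex_bij_witness[of _ "\<lambda>i. (i, _ - i)" fst]) auto
  finally show ?thesis .
qed

text \<open>\<open>K\<close> stands for relations in one copy of the algebra and \<open>L\<close>
  for relations in its tensor square. Only the p-th powers below u_(s-1) are taken to vanish: that
  u_(s-1)^p is primitive is to follow from these alone.\<close>

locale char_p_ideal =
  fixes K :: "'k::field pvpoly set" and L :: "'k dpoly set" and s :: nat and p :: nat
  assumes p_def: "p = CHAR('k)" and p2: "2 \<le> p"
    and K: "pideal K" and L: "pideal L"
    and KL: "f \<in> K \<Longrightarrow> incl1 f \<in> L" "f \<in> K \<Longrightarrow> incl2 f \<in> L"
    and u_p: "\<And>i. Suc i < s \<Longrightarrow> pvar (U i) ^ p \<in> K"
begin

lemma prime_p: "prime p"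
  using p2 prime_CHAR_semidom[where ?'a = 'k] by (simp add: p_def)

lemma cong_tens: 
  assumes "f - f' \<in> K" "g - g' \<in> K"
  shows "tens f g - tens f' g' \<in> L"
  unfolding tens_def using assms KL[of "f - f'"] KL[of "g - g'"]
  by (intro cong_mult' L) (simp_all add: incl_diff)

text \<open>The products are grouped by the total index m of the left slot; for each m the
  coefficients add up to the same binomial coefficient, by Vandermonde's identity.\<close>

lemma cop_mult:
  assumes "a + b < p ^ s"
  shows "cop a * cop b - of_nat ((a + b) choose a) * cop (a + b) \<in> L"
proof -
  have gm: "gam i * gam j - of_nat ((i + j) choose i) * gam (i + j) \<in> K" if "i + j < p ^ s" for i j
    using gam_mult[of K s i j] p2 K u_p that by (simp add: p_def pconst_def)
  let ?F = "\<lambda>i j. tens (of_nat ((i + j) choose i) * gam (i + j)) (of_nat ((a + b - (i + j)) choose (a - i)) * gam (a + b - (i + j))) :: 'k dpoly"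
  let ?G = "\<lambda>m. tens (gam m) (gam (a + b - m)) :: 'k dpoly"
  have "cop a * cop b = (\<Sum>i\<le>a. \<Sum>j\<le>b. tens (gam i * gam j) (gam (a - i) * gam (b - j)) :: 'k dpoly)"
    by (simp add: cop_def sum_product tens_mult)
  moreover have "(\<Sum>i\<le>a. \<Sum>j\<le>b. tens (gam i * gam j) (gam (a - i) * gam (b - j))) - (\<Sum>i\<le>a. \<Sum>j\<le>b. ?F i j) \<in> L"
  proof (intro cong_sum' L cong_tens)
    fix i j assume ij: "i \<in> {..a}" "j \<in> {..b}"
    show "gam i * gam j - of_nat ((i + j) choose i) * gam (i + j) \<in> K"
      by (rule gm) (use ij assms in auto)
    have eq: "a - i + (b - j) = a + b - (i + j)" using ij by auto
    show "gam (a - i) * gam (b - j) - of_nat ((a + b - (i + j)) choose (a - i)) * gam (a + b - (i + j)) \<in> K"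
      using gm[of "a - i" "b - j"] assms unfolding eq by simp
  qed
  moreover have "(\<Sum>i\<le>a. \<Sum>j\<le>b. ?F i j) = of_nat ((a + b) choose a) * cop (a + b)"
  proof -
    have F: "?F i (m - i) = of_nat ((m choose i) * ((a + b - m) choose (a - i))) * ?G m" if "i \<le> m" for i m
      using that by (simp add: tens_def incl_mult ac_simps)
    have "(\<Sum>i\<le>a. \<Sum>j\<le>b. ?F i j) = (\<Sum>m\<le>a + b. \<Sum>i | i \<le> a \<and> i \<le> m \<and> m - i \<le> b. ?F i (m - i))"
      by (rule sum_group_add)
    also have "\<dots> = (\<Sum>m\<le>a + b. \<Sum>i | i \<le> a \<and> i \<le> m \<and> m - i \<le> b.
        of_nat ((m choose i) * ((a + b - m) choose (a - i))) * ?G m)"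
      by (intro sum.cong refl F) auto
    also have "\<dots> = (\<Sum>m\<le>a + b. of_nat ((a + b) choose a) * ?G m)"
    proof (rule sum.cong[OF refl])
      fix m assume m: "m \<in> {..a + b}"
      \<comment> \<open>The summands added on the right vanish, since one of their binomial
        coefficients is 0.\<close>
      have "(\<Sum>i | i \<le> a \<and> i \<le> m \<and> m - i \<le> b. (m choose i) * ((a + b - m) choose (a - i)))
          = (\<Sum>i\<le>a. (m choose i) * ((a + b - m) choose (a - i)))"
        by (rule sum.mono_neutral_left) (use m in \<open>auto simp: binomial_eq_0_iff\<close>)
      also have "\<dots> = (a + b) choose a"
        using vandermonde[of m "a + b - m" a] m by simp
      finally show "(\<Sum>i | i \<le> a \<and> i \<le> m \<and> m - i \<le> b. of_nat ((m choose i) * ((a + b - m) choose (a - i))) * ?G m)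
          = of_nat ((a + b) choose a) * ?G m"
        by (simp only: sum_distrib_right[symmetric] of_nat_sum[symmetric])
    qed
    also have "\<dots> = of_nat ((a + b) choose a) * cop (a + b)"
      by (simp add: cop_def sum_distrib_left)
    finally show ?thesis .
  qed
  ultimately show ?thesis by simp
qed

text \<open>By \<open>choose_power\<close> the step from d to d + 1 contributes the factor d + 1;
  all the steps together give d!.\<close>

lemma cop_mult_power:
  assumes "l < p ^ e" "l + d * p ^ e < p ^ s"
  shows "cop l * cop (p ^ e) ^ d - of_nat (fact d) * cop (l + d * p ^ e) \<in> L"
  using assms(2)
proof (induction d)
  case (Suc d)
  have lt: "l + d * p ^ e < p ^ s" and lt': "(l + d * p ^ e) + p ^ e < p ^ s"
    using Suc.prems by auto
  have eq: "l + Suc d * p ^ e = (l + d * p ^ e) + p ^ e" by simp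
  have "(of_nat ((l + d * p ^ e + p ^ e) choose (l + d * p ^ e)) :: 'k) = of_nat (Suc d)"
    using choose_power[where ?'k = 'k, of l e "Suc d"] assms(1) p2 binomial_symmetric[of "p ^ e" "l + d * p ^ e + p ^ e"]
    by (simp add: p_def algebra_simps)
  then have c: "(of_nat ((l + d * p ^ e + p ^ e) choose (l + d * p ^ e)) :: 'k dpoly) = of_nat (Suc d)"
    by (simp only: single_of_nat[symmetric])
  have "cop l * cop (p ^ e) ^ Suc d - of_nat (fact (Suc d)) * cop (l + Suc d * p ^ e)
      = (cop l * cop (p ^ e) ^ d - of_nat (fact d) * cop (l + d * p ^ e)) * cop (p ^ e)
        + of_nat (fact d) * (cop (l + d * p ^ e) * cop (p ^ e) - of_nat (Suc d) * cop (l + Suc d * p ^ e) :: 'k dpoly)"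
    by (simp add: algebra_simps)
  moreover have "cop (l + d * p ^ e) * cop (p ^ e) - of_nat (Suc d) * cop (l + Suc d * p ^ e) \<in> L"
    using cop_mult[OF lt'] unfolding c eq .
  ultimately show ?case using Suc.IH[OF lt] L by (simp add: pideal_rules del: of_nat_Suc)
qed (simp add: pideal_0[OF L])

text \<open>\<open>Delta\<close> is prescribed on the u_i only. The formula for \<gamma>_l follows
  by adding digits at the top: if d is the highest digit, \<gamma>_l is \<gamma>_(l0) u_r^d / d!,
  and d! is invertible because d < p.\<close>

lemma Delta_gam:
  assumes "l < p ^ s"
  shows "Delta (gam l) - cop l \<in> L"
proof -
  have "Delta (pgamma r l) - cop l \<in> L" if "r \<le> s" "l < p ^ r" for r l
    using that
  proof (induction r arbitrary: l)
    case 0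
    then show ?case by (simp add: pgamma_def pideal_0[OF L])
  next
    case (Suc r)
    define d l0 where "d = l div p ^ r" and "l0 = l mod p ^ r"
    have l: "l = l0 + d * p ^ r" by (simp only: d_def l0_def mod_div_mult_eq)
    have l0: "l0 < p ^ r" using p2 by (simp add: l0_def)
    have d: "d < p" unfolding d_def using Suc.prems by (intro less_mult_imp_div_less) (simp add: mult.commute)
    have dig: "l div p ^ i mod p = l0 div p ^ i mod p" if "i < r" for i
    proof -
      obtain j where j: "r = i + Suc j" using \<open>i < r\<close> less_imp_Suc_add by auto
      have "l = l0 + p ^ i * (p * (d * p ^ j))" unfolding l j by (simp add: power_add ac_simps)
      then have "l div p ^ i = l0 div p ^ i + p * (d * p ^ j)"
        using p2 by simp
      then show ?thesis by simp
    qed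
    have "pgamma (Suc r) l = pgamma r l0 * (pconst (1 / of_nat (fact d)) * pvar (U r) ^ d :: 'k pvpoly)"
      using dig d by (simp add: pgamma_def p_def[symmetric] Let_def d_def[symmetric])
    then have "Delta (pgamma (Suc r) l) = Delta (pgamma r l0) * (single 0 (1 / of_nat (fact d)) * cop (p ^ r) ^ d :: 'k dpoly)"
      by (simp add: Delta_mult even_v_pgamma even_v_mult even_v_power Delta_power Delta_const p_def)
    moreover have "Delta (pgamma r l0) * (single 0 (1 / of_nat (fact d)) * cop (p ^ r) ^ d :: 'k dpoly)
       - cop l0 * (single 0 (1 / of_nat (fact d)) * cop (p ^ r) ^ d) \<in> L"
      using Suc.IH[OF _ l0] Suc.prems by (intro cong_mult' L) (simp_all add: pideal_0[OF L])
    moreover have "cop l0 * (single 0 (1 / of_nat (fact d)) * cop (p ^ r) ^ d) - cop l \<in> L"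
    proof -
      have "l0 + d * p ^ r < p ^ s"
        using Suc.prems p2 unfolding l by (meson less_le_trans power_increasing order.trans one_le_numeral)
      then have "cop l0 * cop (p ^ r) ^ d - of_nat (fact d) * cop l \<in> L"
        using cop_mult_power[OF l0] unfolding l by blast
      then have "single 0 (1 / of_nat (fact d)) * (cop l0 * cop (p ^ r) ^ d - of_nat (fact d) * cop l) \<in> L"
        by (rule pideal_mult_left[OF L])
      moreover have "single 0 (1 / of_nat (fact d)) * of_nat (fact d) = (1 :: 'k dpoly)"
      proof -
        have "of_nat (fact d) \<noteq> (0::'k)"
          using d prime_dvd_fact_iff[OF prime_p, of d] by (simp add: of_nat_eq_0_iff_char_dvd p_def)
        then show ?thesis by (simp add: single_of_nat[symmetric] mult_single del: single_of_nat)
      qed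
      ultimately show ?thesis
        by (simp add: right_diff_distrib mult.assoc[symmetric]) (simp add: ac_simps)
    qed
    ultimately show ?case using cong_trans'[OF L] by simp
  qed
  from this[OF order.refl assms] show ?thesis
    using assms p2 by (simp add: p_def pgamma_eq_gam)
qed

lemma Delta_gam_V:
  assumes "l < p ^ s"
  shows "Delta (gam l * pvar V ^ n)
    - (\<Sum>j\<le>l. \<Sum>i\<le>n. of_nat (sb n i) * tens (gam j * pvar V ^ i) (gam (l - j) * pvar V ^ (n - i))) \<in> L"
proof -
  have "Delta (gam l * pvar V ^ n) - cop l * om n \<in> L"
    using Delta_gam[OF assms]
    by (simp add: Delta_mult even_v_gam Delta_V_power left_diff_distrib[symmetric] pideal_mult_right[OF L])
  also have "cop l * om n = (\<Sum>j\<le>l. \<Sum>i\<le>n. of_nat (sb n i) * tens (gam j * pvar V ^ i) (gam (l - j) * pvar V ^ (n - i)))"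
    unfolding cop_def om_expand sum_product by (simp add: tens_mult[symmetric] ac_simps)
  finally show ?thesis .
qed

lemma gam_p_power: "gam (p ^ i) = (pvar (U i) :: 'k pvpoly)"
proof -
  have "p ^ i < p ^ Suc i" using p2 by simp
  then have "gam (p ^ i) = (pgamma (Suc i) (p ^ i) :: 'k pvpoly)"
    using p2 by (simp add: pgamma_eq_gam p_def)
  also have "\<dots> = (\<Prod>k<i. 1) * pvar (U i)"
  proof -
    have "p ^ i div p ^ k mod p = 0" if "k < i" for k
      using that p2 by (simp add: power_diff[symmetric])
    then show ?thesis
      using p2 by (simp add: pgamma_def p_def[symmetric] Let_def)
  qed
  finally show ?thesis by simp
qed

text \<open>\<gamma>_j is a multiple of some u_k with k < i, and k is then below s - 1, so that
  u_k^p vanishes modulo \<open>K\<close>.\<close>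

lemma gam_power_mem:
  assumes "0 < j" "j < p ^ i" "i < s"
  shows "gam j ^ p \<in> K"
proof -
  have g: "gam j = (pgamma i j :: 'k pvpoly)" using assms p2 by (simp add: pgamma_eq_gam p_def)
  \<comment> \<open>If all digits below position i were 0, p^i would divide j, which is too small
    for that.\<close>
  have "\<exists>k<i. j div p ^ k mod p \<noteq> 0"
  proof (rule ccontr)
    assume *: "\<not> ?thesis"
    have "p ^ k dvd j" if "k \<le> i" for k
      using that
    proof (induction k)
      case (Suc k)
      then obtain c where c: "j = p ^ k * c" by (auto simp: dvd_def)
      have "j div p ^ k mod p = 0" using * Suc.prems by auto
      moreover have "j div p ^ k = c" using p2 unfolding c by simp
      ultimately have "c mod p = 0" by simp
      then show ?case unfolding c by (simp add: mod_eq_0_iff_dvd mult.commute)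
    qed simp
    from this[of i] assms show False by (auto dest: dvd_imp_le)
  qed
  then obtain k d where k: "k < i" "d = j div p ^ k mod p" "d \<noteq> 0" by blast
  have "pgamma i j = (pconst (1 / of_nat (fact d)) * pvar (U k) ^ d)
      * (\<Prod>k\<in>{..<i} - {k}. let d = j div p ^ k mod p in pconst (1 / of_nat (fact d)) * pvar (U k) ^ d :: 'k pvpoly)"
    unfolding pgamma_def p_def[symmetric] using k by (subst prod.remove[of _ k]) (auto simp: Let_def)
  moreover have "(pvar (U k) ^ d) ^ p \<in> K"
  proof -
    obtain d' where d': "d = Suc d'" using k(3) by (cases d) auto
    have "(pvar (U k) ^ d) ^ p = pvar (U k) ^ p * ((pvar (U k) ^ d') ^ p :: 'k pvpoly)"
      by (simp add: d' power_mult_distrib)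
    moreover have "pvar (U k) ^ p \<in> K" using u_p[of k] k assms by simp
    ultimately show ?thesis by (simp only: pideal_mult_right[OF K])
  qed
  ultimately show ?thesis
    unfolding g by (simp add: power_mult_distrib pideal_mult_left[OF K] pideal_mult_right[OF K])
qed

text \<open>In characteristic p the p-th power of a sum is taken termwise, and the middle terms of
  the coproduct of u_i vanish by \<open>gam_power_mem\<close>. So u_i^p is primitive, also for i = s
  - 1.\<close>

lemma Delta_U_power:
  assumes "i < s"
  shows "Delta (pvar (U i) ^ p) - (incl1 (pvar (U i) ^ p) + incl2 (pvar (U i) ^ p)) \<in> L"
proof -
  have "Delta (pvar (U i) ^ p) = (cop (p ^ i) ^ p :: 'k dpoly)"
    by (simp add: Delta_power p_def)
  also have "\<dots> = (\<Sum>j\<le>p ^ i. tens (gam j ^ p) (gam (p ^ i - j) ^ p))"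
    unfolding cop_def using prime_p by (subst freshmans_dream_sum) (simp_all add: p_def tens_power)
  also have "\<dots> = (\<Sum>j\<in>{0<..<p ^ i}. tens (gam j ^ p) (gam (p ^ i - j) ^ p))
      + (incl1 (pvar (U i) ^ p) + incl2 (pvar (U i) ^ p))"
  proof -
    have pos: "0 < p ^ i" using p2 by simp
    then have "{..p ^ i} = insert 0 (insert (p ^ i) {0<..<p ^ i})" by auto
    moreover have "0 \<noteq> p ^ i" using pos by simp
    ultimately show ?thesis
      by (simp add: gam_p_power tens_def add.commute)
  qed
  finally have "Delta (pvar (U i) ^ p) - (incl1 (pvar (U i) ^ p) + incl2 (pvar (U i) ^ p))
      = (\<Sum>j\<in>{0<..<p ^ i}. tens (gam j ^ p) (gam (p ^ i - j) ^ p) :: 'k dpoly)" by simp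
  also have "\<dots> \<in> L"
    unfolding tens_def using gam_power_mem assms
    by (intro pideal_sum[OF L] pideal_mult_right[OF L] KL) auto
  finally show ?thesis .
qed

end

section \<open>Superalgebras presented by generators and relations\<close>

lemma of_nat_bit: "(of_nat n :: bit) = (if even n then 0 else 1)"
  by (induction n) auto

abbreviation mons :: "nat \<Rightarrow> (pvar \<Rightarrow>\<^sub>0 nat) set"
  where "mons r \<equiv> {m. keys m \<subseteq> insert V (U ` {..<r})}"

definition polys :: "nat \<Rightarrow> 'k::field pvpoly set"
  where "polys r = {f. keys f \<subseteq> mons r}"

definition vpar :: "bit \<Rightarrow> 'k::field pvpoly \<Rightarrow> bool"
  where "vpar i f \<longleftrightarrow> (\<forall>m\<in>keys f. of_nat (lookup m V) = i)"

lemma poly_superalg_simps [simp]: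
  "carrier (poly_superalg r) = (polys r :: 'k::field pvpoly set)"
  "f \<oplus>\<^bsub>poly_superalg r\<^esub> g = f + g"
  "f \<otimes>\<^bsub>poly_superalg r\<^esub> g = f * g"
  "\<one>\<^bsub>poly_superalg r\<^esub> = 1"
  "\<zero>\<^bsub>poly_superalg r\<^esub> = 0"
  "c \<odot>\<^bsub>poly_superalg r\<^esub> f = pconst c * f"
  "part (poly_superalg r) i = {f \<in> polys r. vpar i f}"
  by (auto simp: poly_superalg_def Let_def polys_def vpar_def)

lemma polys_add: "f \<in> polys r \<Longrightarrow> g \<in> polys r \<Longrightarrow> f + g \<in> polys r"
  by (simp add: polys_def keys_add_subset)

lemma polys_uminus: "f \<in> polys r \<Longrightarrow> - f \<in> polys r"
  by (simp add: polys_def keys_uminus_subset)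

lemma polys_mult: "f \<in> polys r \<Longrightarrow> g \<in> polys r \<Longrightarrow> f * g \<in> polys r"
proof -
  assume fg: "f \<in> polys r" "g \<in> polys r"
  have "keys (f * g) \<subseteq> {m + n |m n. m \<in> keys f \<and> n \<in> keys g}" by (rule keys_mult)
  also have "\<dots> \<subseteq> mons r"
  proof safe
    fix m n x assume "m \<in> keys f" "n \<in> keys g" and x: "x \<in> keys (m + n)" "x \<notin> U ` {..<r}"
    then have "keys m \<subseteq> insert V (U ` {..<r})" "keys n \<subseteq> insert V (U ` {..<r})"
      using fg unfolding polys_def by blast+
    with x show "x = V" unfolding keys_add_nat by blast
  qed
  finally show ?thesis by (simp add: polys_def)
qed

lemma polys_0 [simp]: "0 \<in> polys r"
  by (simp add: polys_def)

lemma polys_const [simp]: "pconst c \<in> polys r"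
  by (auto simp: polys_def pconst_def)

lemma polys_1 [simp]: "1 \<in> polys r"
  using polys_const[of 1 r] by (simp del: polys_const)

lemma polys_U: "i < r \<Longrightarrow> pvar (U i) \<in> polys r"
  by (auto simp: polys_def pvar_def)

lemma polys_V [simp]: "pvar V \<in> polys r"
  by (auto simp: polys_def pvar_def)

lemma polys_power: "f \<in> polys r \<Longrightarrow> f ^ n \<in> polys r"
  by (induction n) (auto intro: polys_mult)

lemma polys_prod: "(\<And>i. i \<in> I \<Longrightarrow> f i \<in> polys r) \<Longrightarrow> (\<Prod>i\<in>I. f i) \<in> polys r"
  by (induction I rule: infinite_finite_induct) (auto intro: polys_mult)

lemma polys_sum: "(\<And>i. i \<in> I \<Longrightarrow> f i \<in> polys r) \<Longrightarrow> (\<Sum>i\<in>I. f i) \<in> polys r"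
  by (induction I rule: infinite_finite_induct) (auto intro: polys_add)

lemma polys_pgamma: "r \<le> r' \<Longrightarrow> pgamma r l \<in> polys r'"
  unfolding pgamma_def Let_def by (intro polys_prod polys_mult polys_power polys_const polys_U) auto

lemma trunc_polys: "f \<in> polys r \<Longrightarrow> trunc r f = f"
  by (rule trunc_eq) (auto simp: polys_def)

lemma trunc_in_polys: "trunc r f \<in> polys r"
  using keys_trunc[of _ r f] by (auto simp: polys_def)

lemma vpar_trunc: "vpar i f \<Longrightarrow> vpar i (trunc r f)"
  using keys_trunc[of _ r f] by (auto simp: vpar_def)

lemma vpar_mult: "vpar i f \<Longrightarrow> vpar j g \<Longrightarrow> vpar (i + j) (f * g)"
proof -
  assume fg: "vpar i f" "vpar j g"
  have "keys (f * g) \<subseteq> {m + n |m n. m \<in> keys f \<and> n \<in> keys g}" by (rule keys_mult)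
  then show ?thesis using fg by (auto simp: vpar_def lookup_add)
qed

lemma vpar_add: "vpar i f \<Longrightarrow> vpar i g \<Longrightarrow> vpar i (f + g)"
  unfolding vpar_def using keys_add[of f g] by blast

lemma vpar_uminus: "vpar i f \<Longrightarrow> vpar i (- f)"
  unfolding vpar_def by (simp add: in_keys_iff)

lemma vpar_const: "vpar 0 (pconst c)"
  by (simp add: vpar_def pconst_def)

lemma vpar_smult: "vpar i f \<Longrightarrow> vpar i (pconst c * f)"
  using vpar_mult[OF vpar_const[of c], of i f] by (simp only: add_0)

lemma vpar_single: "of_nat (lookup m V) = i \<Longrightarrow> vpar i (single m c)"
  by (simp add: vpar_def)

lemma vpar_0_iff: "vpar 0 f \<longleftrightarrow> even_v f"
  by (simp add: vpar_def even_v_def of_nat_bit)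

text \<open>Parity projections that are defined for all polynomials; on \<open>polys r\<close> they
  are the components of the superalgebra.\<close>

definition pp :: "bit \<Rightarrow> 'k::field pvpoly \<Rightarrow> 'k pvpoly"
  where "pp i = fextend (\<lambda>m. if of_nat (lookup m V) = i then single m 1 else 0)"

lemma keys_pp: "m \<in> keys (pp i f) \<Longrightarrow> m \<in> keys f \<and> of_nat (lookup m V) = i"
proof -
  have "keys (pp i f) \<subseteq> {m \<in> keys f. of_nat (lookup m V) = i}"
    unfolding pp_def by (rule keys_fextend) auto
  then show "m \<in> keys (pp i f) \<Longrightarrow> ?thesis" by blast
qed

lemma pp_sum: "pp i f + pp (i + 1) f = f"
proof -
  have "pp i f + pp (i + 1) f = fextend (\<lambda>m. single m 1) f"
    unfolding pp_def fextend_add_fun[symmetric] by (rule fextend_cong) (auto dest: bit_neqD)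
  then show ?thesis by (simp add: fextend_def poly_mapping_expand[symmetric])
qed

lemma pp_in: "f \<in> polys r \<Longrightarrow> pp i f \<in> polys r \<and> vpar i (pp i f)"
  using keys_pp[of _ i f] by (auto simp: polys_def vpar_def)

lemma vpar_both: "vpar 0 f \<Longrightarrow> vpar 1 f \<Longrightarrow> f = 0"
  by (rule poly_mapping_eqI) (auto simp: vpar_def in_keys_iff)

lemma abelian_group_poly: "abelian_group (poly_superalg r)"
  by (rule abelian_groupI) (auto intro: polys_add simp: ac_simps intro!: bexI[of _ "- _"] polys_uminus)

lemma ring_poly: "ring (poly_superalg r)"
  by (rule ringI[OF abelian_group_poly]) (auto intro!: monoidI polys_mult simp: algebra_simps)

lemma module_poly: "module \<K> (poly_superalg r)"
  by (rule moduleI[OF cring_from_type_algebra abelian_group_poly])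
    (auto intro: polys_mult simp: algebra_simps)

lemma a_inv_poly: "f \<in> polys r \<Longrightarrow> \<ominus>\<^bsub>poly_superalg r\<^esub> f = - f"
  by (rule abelian_group.minus_equality[OF abelian_group_poly]) (auto intro: polys_uminus)

lemma a_minus_poly: "f \<in> polys r \<Longrightarrow> g \<in> polys r \<Longrightarrow> f \<ominus>\<^bsub>poly_superalg r\<^esub> g = f - g"
  by (simp add: a_minus_def a_inv_poly)

lemma superalgebra_poly: "superalgebra (poly_superalg r :: ('k::field, 'k pvpoly) superalg)"
proof (intro superalgebra.intro superalgebra_axioms.intro module_poly ring_poly)
  let ?R = "poly_superalg r :: ('k, 'k pvpoly) superalg"
  show "submodule (part ?R i) \<K> ?R" for i
    by (rule module.submoduleI[OF module_poly])
      (auto simp: a_inv_poly intro: polys_add vpar_add polys_uminus vpar_uminus polys_mult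
        vpar_smult, simp add: vpar_def)
  show "part ?R 0 \<inter> part ?R 1 = {\<zero>\<^bsub>?R\<^esub>}"
    using vpar_both by (auto simp: vpar_def)
  show "\<exists>y\<in>part ?R 0. \<exists>z\<in>part ?R 1. x = y \<oplus>\<^bsub>?R\<^esub> z" if "x \<in> carrier ?R" for x
    by (rule bexI[of _ "pp 0 x"], rule bexI[of _ "pp 1 x"])
      (use that pp_sum[of 0 x] in \<open>auto simp: pp_in\<close>)
  show "x \<otimes>\<^bsub>?R\<^esub> y \<in> part ?R (i + j)" if "x \<in> part ?R i" "y \<in> part ?R j" for x y i j
    using that polys_mult vpar_mult unfolding poly_superalg_simps by blast
qed (auto simp: algebra_simps vpar_const[of 1, simplified] intro: polys_mult)

lemma component_poly: "f \<in> polys r \<Longrightarrow> component (poly_superalg r) i f = pp i f"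
  using pp_in[of f r] pp_sum[of i f]
  by (intro superalgebra.component_unique[OF superalgebra_poly, of _ _ _ "pp (i + 1) f"]) simp_all

lemma ideal_polyI:
  assumes "I \<subseteq> polys r" "0 \<in> I" "\<And>f g. f \<in> I \<Longrightarrow> g \<in> I \<Longrightarrow> f + g \<in> I"
    "\<And>f g. f \<in> I \<Longrightarrow> g \<in> polys r \<Longrightarrow> f * g \<in> I"
  shows "ideal I (poly_superalg r)"
proof -
  have neg: "- f \<in> I" if "f \<in> I" for f
    using assms(4)[OF that, of "- 1"] polys_uminus[OF polys_1[of r]] by simp
  show ?thesis
  proof (rule idealI[OF ring_poly])
    interpret abelian_group "poly_superalg r" by (rule abelian_group_poly)
    show "subgroup I (add_monoid (poly_superalg r))"
    proof (rule add.subgroupI)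
      fix f assume f: "f \<in> I"
      then have "\<ominus>\<^bsub>poly_superalg r\<^esub> f = - f" using assms(1) by (intro a_inv_poly) blast
      then show "\<ominus>\<^bsub>poly_superalg r\<^esub> f \<in> I" using neg[OF f] by simp
    qed (use assms in auto)
  qed (use assms(4) in \<open>auto simp: mult.commute\<close>)
qed

lemma lookup_mult_0: "lookup (f * g) 0 = lookup f 0 * lookup g 0" for f g :: "'k::field pvpoly"
proof -
  \<comment> \<open>The indicator of the exponent 0 is extended into
    \<open>nat \<Rightarrow>\<^sub>0 'k\<close>, a ring containing k, so that
    \<open>fextend_mult\<close> yields multiplicativity.\<close>
  have 0: "fextend (\<lambda>m. 1 when m = 0) h = single (0::nat) (lookup h 0)" for h :: "'k pvpoly"
    by (rule poly_mapping_eqI)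
      (auto simp: fextend_def lookup_sum lookup_single when_def lookup_one in_keys_iff if_distrib cong: if_cong)
  have z: "m + n = 0 \<longleftrightarrow> m = 0 \<and> n = (0 :: pvar \<Rightarrow>\<^sub>0 nat)" for m n
    by (auto simp: poly_mapping_eq_iff fun_eq_iff lookup_add)
  have "fextend (\<lambda>m. 1 when m = 0) (f * g)
      = fextend (\<lambda>m. 1 when m = 0) f * (fextend (\<lambda>m. 1 when m = 0) g :: nat \<Rightarrow>\<^sub>0 'k)"
    by (rule fextend_mult) (auto simp: when_def z)
  then have "single (0::nat) (lookup (f * g) 0) = single 0 (lookup f 0 * lookup g 0)"
    unfolding 0 by (simp add: mult_single)
  then show ?thesis by (metis lookup_single_eq)
qed

text \<open>Even relations generate a homogeneous ideal, so the quotient is graded; relations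
  without constant term let the constant coefficient, which is the counit, pass to the
  quotient.\<close>

locale presentation =
  fixes r :: nat and rels :: "'k::field pvpoly set"
  assumes rels: "\<rho> \<in> rels \<Longrightarrow> \<rho> \<in> polys r \<and> even_v \<rho> \<and> lookup \<rho> 0 = 0"
begin

abbreviation R where "R \<equiv> poly_superalg r :: ('k, 'k pvpoly) superalg"
abbreviation J where "J \<equiv> Idl\<^bsub>R\<^esub> rels"
abbreviation Qp where "Qp \<equiv> presented_superalg r rels"
abbreviation cl where "cl \<equiv> pclass r rels"

lemma rels_subset: "rels \<subseteq> carrier R"
  using rels by auto

lemma ideal_J: "ideal J R"
  by (rule ring.genideal_ideal[OF ring_poly rels_subset])

lemma J_minimal: "ideal I R \<Longrightarrow> rels \<subseteq> I \<Longrightarrow> J \<subseteq> I"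
  by (rule ring.genideal_minimal[OF ring_poly])

lemma rels_J: "rels \<subseteq> J"
  by (rule ring.genideal_self[OF ring_poly rels_subset])

sublocale si: superalgebra_ideal R J
  by (intro superalgebra_ideal.intro superalgebra_poly ideal_J)

lemma J_polys: "f \<in> J \<Longrightarrow> f \<in> polys r"
  using si.Icarr by simp

lemma J_add: "f \<in> J \<Longrightarrow> g \<in> J \<Longrightarrow> f + g \<in> J"
  using si.a_closed[of f g] by simp

lemma J_mult: "f \<in> J \<Longrightarrow> g \<in> polys r \<Longrightarrow> f * g \<in> J"
  using si.I_r_closed[of f g] by simp

text \<open>The polynomials whose parity components lie in \<open>J\<close> form an ideal, and it
  contains the relations because these are even.\<close>

lemma J_component: "f \<in> J \<Longrightarrow> component R i f \<in> J"
proof -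
  let ?I = "{f \<in> polys r. \<forall>i. pp i f \<in> J}"
  have pp_add: "pp i (f + g) = pp i f + pp i g" for i and f g :: "'k pvpoly"
    by (simp add: pp_def fextend_add)
  have pp_mult: "pp i (f * g) = pp i f * pp 0 g + pp (i + 1) f * pp 1 g" if "f \<in> polys r" "g \<in> polys r" for i and f g :: "'k pvpoly"
  proof -
    have *: "component R i ((pp i f * pp 0 g + pp (i + 1) f * pp 1 g) + (pp i f * pp 1 g + pp (i + 1) f * pp 0 g))
        = pp i f * pp 0 g + pp (i + 1) f * pp 1 g"
      using pp_in[OF that(1)] pp_in[OF that(2)] vpar_mult[of i "pp i f" 0 "pp 0 g"] vpar_mult[of i "pp i f" 1 "pp 1 g"]
        vpar_mult[of "i + 1" "pp (i + 1) f" 0 "pp 0 g"] vpar_mult[of "i + 1" "pp (i + 1) f" 1 "pp 1 g"]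
      by (intro si.component_unique[of _ _ "pp i f * pp 1 g + pp (i + 1) f * pp 0 g"])
        (auto intro: polys_add polys_mult vpar_add)
    have "f * g = (pp i f + pp (i + 1) f) * (pp 0 g + pp 1 g)"
      using pp_sum[of i f] pp_sum[of 0 g] by simp
    also have "\<dots> = (pp i f * pp 0 g + pp (i + 1) f * pp 1 g) + (pp i f * pp 1 g + pp (i + 1) f * pp 0 g)"
      by (simp add: algebra_simps)
    finally show ?thesis
      using * component_poly[OF polys_mult[OF that], of i] by simp
  qed
  have "ideal ?I R"
    by (rule ideal_polyI)
      (auto simp: pp_add pp_mult pp_in polys_add polys_mult J_add J_mult,
        auto simp: pp_def additive_subgroup.zero_closed[OF si.additive_subgroup_axioms, simplified])
  moreover have "rels \<subseteq> ?I"
  proof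
    fix \<rho> assume \<rho>: "\<rho> \<in> rels"
    have "pp i \<rho> = (if i = 0 then \<rho> else 0)" for i
      using si.component_part[of \<rho> 0 i] rels[OF \<rho>] component_poly[of \<rho> r i] by (simp add: vpar_0_iff)
    moreover have "0 \<in> J" using additive_subgroup.zero_closed[OF si.additive_subgroup_axioms] by simp
    ultimately show "\<rho> \<in> ?I" using rels[OF \<rho>] \<rho> rels_J by auto
  qed
  ultimately have "J \<subseteq> ?I" by (rule J_minimal)
  then show "f \<in> J \<Longrightarrow> ?thesis" using component_poly[OF J_polys] by auto
qed

lemma superalgebra_Qp: "superalgebra Qp"
  unfolding presented_superalg_def by (rule si.superalgebra_quot) (rule J_component)

lemma cl_eq: "cl f = si.q f"
  by (simp add: pclass_def)

lemma cl_eq_iff: "f \<in> polys r \<Longrightarrow> g \<in> polys r \<Longrightarrow> cl f = cl g \<longleftrightarrow> f - g \<in> J"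
  using si.q_eq_iff[of f g] by (simp add: cl_eq a_minus_poly)

lemma Qp_simps:
  "carrier Qp = cl ` polys r" "part Qp i = cl ` {f \<in> polys r. vpar i f}" "\<one>\<^bsub>Qp\<^esub> = cl 1" "\<zero>\<^bsub>Qp\<^esub> = cl 0"
  "f \<in> polys r \<Longrightarrow> g \<in> polys r \<Longrightarrow> cl f \<otimes>\<^bsub>Qp\<^esub> cl g = cl (f * g)"
  "f \<in> polys r \<Longrightarrow> g \<in> polys r \<Longrightarrow> cl f \<oplus>\<^bsub>Qp\<^esub> cl g = cl (f + g)"
  "f \<in> polys r \<Longrightarrow> c \<odot>\<^bsub>Qp\<^esub> cl f = cl (pconst c * f)"
  using si.quot_simps by (simp_all add: presented_superalg_def cl_eq)

lemma SOME_cl: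
  assumes "f \<in> polys r"
  shows "(SOME g. g \<in> cl f) \<in> polys r" "cl (SOME g. g \<in> cl f) = cl f"
proof -
  have "(SOME g. g \<in> cl f) \<in> cl f"
    by (rule someI[of _ f]) (use assms si.q_self in \<open>simp add: cl_eq\<close>)
  then show "(SOME g. g \<in> cl f) \<in> polys r" "cl (SOME g. g \<in> cl f) = cl f"
    using si.in_qD[of f "SOME g. g \<in> cl f"] assms by (simp_all add: cl_eq)
qed

lemma J_lookup_0: "f \<in> J \<Longrightarrow> lookup f 0 = 0"
proof -
  let ?I = "{f \<in> polys r. lookup f 0 = 0}"
  have "ideal ?I R"
    by (rule ideal_polyI) (auto intro: polys_add polys_mult simp: lookup_add lookup_mult_0)
  then have "J \<subseteq> ?I" by (rule J_minimal) (use rels in auto)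
  then show "f \<in> J \<Longrightarrow> ?thesis" by auto
qed

end

section \<open>Evaluating polynomials in two sets of variables\<close>

text \<open>The domain is the ring in all the variables u_i, so evaluations are total and their laws
  carry no side conditions.\<close>

definition ev_hom :: "('k::field, 'a, 'm) superalg_scheme \<Rightarrow> ('k pvpoly \<Rightarrow> 'a) \<Rightarrow> bool"
  where "ev_hom A e \<longleftrightarrow> (\<forall>f. e f \<in> carrier A) \<and> (\<forall>f g. e (f + g) = e f \<oplus>\<^bsub>A\<^esub> e g) \<and>
    (\<forall>f g. e (f * g) = e f \<otimes>\<^bsub>A\<^esub> e g) \<and> e 1 = \<one>\<^bsub>A\<^esub> \<and> (\<forall>c f. e (pconst c * f) = c \<odot>\<^bsub>A\<^esub> e f) \<and>
    (\<forall>i f. vpar i f \<longrightarrow> e f \<in> part A i)"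

lemma ev_homD:
  assumes "ev_hom A e"
  shows "e f \<in> carrier A" "e (f + g) = e f \<oplus>\<^bsub>A\<^esub> e g" "e (f * g) = e f \<otimes>\<^bsub>A\<^esub> e g" "e 1 = \<one>\<^bsub>A\<^esub>"
    "e (pconst c * f) = c \<odot>\<^bsub>A\<^esub> e f" "vpar i f \<Longrightarrow> e f \<in> part A i" "e (fscale c f) = c \<odot>\<^bsub>A\<^esub> e f"
  using assms by (auto simp: ev_hom_def fscale_eq_mult pconst_eq)

text \<open>The map e \<otimes> e on the commutative tensor square, on the level of representatives;
  \<open>th\<close> passes to the class. It is linear, but multiplicative only up to Koszul
  signs.\<close>

definition thp :: "('k pvpoly \<Rightarrow> 'a) \<Rightarrow> 'k::field dpoly \<Rightarrow> ('a \<times> 'a \<Rightarrow>\<^sub>0 'k)"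
  where "thp e = fextend (\<lambda>s. single (e (single (fst s) 1), e (single (snd s) 1)) 1)"

definition th :: "('k::field, 'a, 'm) superalg_scheme \<Rightarrow> ('k pvpoly \<Rightarrow> 'a) \<Rightarrow> 'k dpoly \<Rightarrow> ('a \<times> 'a \<Rightarrow>\<^sub>0 'k) set"
  where "th A e x = tclass A A (thp e x)"

lemma thp_add: "thp e (x + y) = thp e x + thp e y"
  by (simp add: thp_def fextend_add)

lemma thp_diff: "thp e (x - y) = thp e x - thp e y"
  by (simp add: thp_def fextend_diff)

lemma thp_fscale: "thp e (fscale c x) = fscale c (thp e x)"
  by (simp add: thp_def fextend_fscale)

lemma thp_single: "thp e (single s c) = single (e (single (fst s) 1), e (single (snd s) 1)) c"
  by (simp add: thp_def)

lemma keys_thp: "(\<And>f. e f \<in> C) \<Longrightarrow> keys (thp e x) \<subseteq> C \<times> C"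
  unfolding thp_def by (rule keys_fextend) auto

lemma th_closed: "(\<And>f. e f \<in> carrier A) \<Longrightarrow> th A e x \<in> carrier (tensor A A)"
  unfolding th_def by (intro tclass_in_tensor keys_thp)

lemma th_eq_iff: "th A e x = th A e y \<longleftrightarrow> thp e (x - y) \<in> Wt A A"
  by (simp add: th_def tclass_eq_iff thp_diff)

text \<open>Together with \<open>fstpar\<close> this controls the Koszul sign of a product, which
  depends on the second slot of the left factor and the first slot of the right factor.\<close>

definition sndpar :: "bit \<Rightarrow> 'k::field dpoly \<Rightarrow> bool"
  where "sndpar i x \<longleftrightarrow> (\<forall>s\<in>keys x. of_nat (lookup (snd s) V) = i)"

definition fstpar :: "bit \<Rightarrow> 'k::field dpoly \<Rightarrow> bool"
  where "fstpar i x \<longleftrightarrow> (\<forall>s\<in>keys x. of_nat (lookup (fst s) V) = i)"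

lemma keys_mult_cases:
  assumes "s \<in> keys (x * y :: 'k::field dpoly)"
  obtains a b where "a \<in> keys x" "b \<in> keys y" "s = a + b"
  using assms keys_mult[of x y] by blast

lemma sndpar_mult:
  assumes "sndpar i x" "sndpar j y"
  shows "sndpar (i + j) (x * y)"
  unfolding sndpar_def
proof
  fix s assume "s \<in> keys (x * y)"
  then obtain a b where "a \<in> keys x" "b \<in> keys y" "s = a + b" by (rule keys_mult_cases)
  moreover from this have "of_nat (lookup (snd a) V) = i" "of_nat (lookup (snd b) V) = j"
    using assms unfolding sndpar_def by blast+
  ultimately show "of_nat (lookup (snd s) V) = i + j" by (simp add: lookup_add)
qed

lemma sndpar_add: "sndpar i x \<Longrightarrow> sndpar i y \<Longrightarrow> sndpar i (x + y)"
  unfolding sndpar_def using keys_add[of x y] by blast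

lemma sndpar_sum: "(\<And>a. a \<in> I \<Longrightarrow> sndpar i (F a)) \<Longrightarrow> sndpar i (\<Sum>a\<in>I. F a)"
  unfolding sndpar_def using keys_sum[of F I] by blast

lemma sndpar_1 [simp]: "sndpar 0 1"
  by (simp add: sndpar_def zero_prod_def)

lemma sndpar_power: "sndpar 0 x \<Longrightarrow> sndpar 0 (x ^ n)"
  using sndpar_mult[of 0 x 0] by (induction n) auto

lemma keys_tens: "keys (tens f g) \<subseteq> keys f \<times> keys g"
  unfolding tens_eq_fextend by (intro keys_fextend) auto

lemma sndpar_tens: "vpar i g \<Longrightarrow> sndpar i (tens f g)"
  using keys_tens[of f g] by (auto simp: sndpar_def vpar_def)

lemma fstpar_tens: "vpar i f \<Longrightarrow> fstpar i (tens f g)"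
  using keys_tens[of f g] by (auto simp: fstpar_def vpar_def)

lemma sndpar_cop: "sndpar 0 (cop l)"
  unfolding cop_def by (intro sndpar_sum sndpar_tens) (simp add: vpar_0_iff even_v_gam)

lemma vpar_V: "vpar 1 (pvar V)"
  by (simp add: vpar_def pvar_def)

lemma sndpar_om: "even n \<Longrightarrow> sndpar 0 (om n)"
proof -
  have "sndpar 0 ((tens (pvar V ^ 2) 1 + tens 1 (pvar V ^ 2)) ^ (n div 2) :: 'a dpoly)"
    by (intro sndpar_power sndpar_add sndpar_tens) (simp_all add: vpar_0_iff)
  then show "even n \<Longrightarrow> ?thesis" by (auto simp: om_def elim!: evenE)
qed

text \<open>A map that is linear only modulo \<open>W\<close>, like f \<mapsto> (e f, e g) into the
  free vector space, is still determined modulo \<open>W\<close> by its values on monomials.\<close>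

lemma fextend_approx:
  fixes h :: "('m \<Rightarrow>\<^sub>0 'k::field) \<Rightarrow> ('s \<Rightarrow>\<^sub>0 'k)"
  assumes W: "fs.subspace W" and add: "\<And>f g. h (f + g) - h f - h g \<in> W"
    and scale: "\<And>c f. h (fscale c f) - fscale c (h f) \<in> W"
  shows "fextend (\<lambda>m. h (single m 1)) f - h f \<in> W"
proof -
  let ?F = "fextend (\<lambda>m. h (single m 1))"
  have mono: "?F (single m d) - h (single m d) \<in> W" for m d
    using fs.subspace_neg[OF W scale[of d "single m 1"]] by simp
  have plus: "?F (f + g) - h (f + g) \<in> W" if "?F f - h f \<in> W" "?F g - h g \<in> W" for f g
  proof -
    have "?F (f + g) - h (f + g) = (?F f - h f) + (?F g - h g) - (h (f + g) - h f - h g)"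
      by (simp add: fextend_add algebra_simps)
    also have "\<dots> \<in> W"
      by (intro fs.subspace_diff[OF W fs.subspace_add[OF W that] add])
    finally show ?thesis .
  qed
  have "?F (\<Sum>m\<in>S. single m (g m)) - h (\<Sum>m\<in>S. single m (g m)) \<in> W" if "finite S" for S g
    using that
  proof (induction S rule: finite_induct)
    case empty
    show ?case using mono[of _ 0] by simp
  next
    case (insert m S)
    then show ?case using plus[OF mono insert.IH] by simp
  qed
  from this[of "keys f" "lookup f"] show ?thesis by (simp add: poly_mapping_expand[symmetric])
qed

lemma Wt_bilinear:
  assumes "a \<in> carrier M" "b \<in> carrier N"
  shows "a' \<in> carrier M \<Longrightarrow> single (a \<oplus>\<^bsub>M\<^esub> a', b) 1 - single (a, b) 1 - single (a', b) 1 \<in> Wt M N"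
    and "b' \<in> carrier N \<Longrightarrow> single (a, b \<oplus>\<^bsub>N\<^esub> b') 1 - single (a, b) 1 - single (a, b') 1 \<in> Wt M N"
    and "single (c \<odot>\<^bsub>M\<^esub> a, b) 1 - single (a, b) c \<in> Wt M N"
    and "single (a, c \<odot>\<^bsub>N\<^esub> b) 1 - single (a, b) c \<in> Wt M N"
  using assms by (intro fs.span_base; unfold tensor_rel_def; blast)+

lemma Wt_trans: "x - y \<in> Wt M N \<Longrightarrow> y - z \<in> Wt M N \<Longrightarrow> x - z \<in> Wt M N"
  using fs.span_add[of "x - y" _ "y - z"] by simp

text \<open>The approximation is made in one slot at a time: in the right one while the left one is
  a monomial, and then in the left one.\<close>

lemma thp_tens:
  assumes e: "ev_hom A e"
  shows "thp e (tens f g) - single (e f, e g) 1 \<in> Wt A A"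
proof -
  note e_closed = ev_homD(1)[OF e] and W = Wt_bilinear[OF e_closed e_closed]
  have r: "fextend (\<lambda>n. single (e f, e (single n 1)) 1) g - single (e f, e g) 1 \<in> Wt A A" for f g
    by (rule fextend_approx[where h = "\<lambda>g. single (e f, e g) 1", OF fs.subspace_span])
      (use W e_closed in \<open>simp_all add: ev_homD(2,7)[OF e]\<close>)
  have l: "fextend (\<lambda>m. single (e (single m 1), e g) 1) f - single (e f, e g) 1 \<in> Wt A A" for f g
    by (rule fextend_approx[where h = "\<lambda>f. single (e f, e g) 1", OF fs.subspace_span])
      (use W e_closed in \<open>simp_all add: ev_homD(2,7)[OF e]\<close>)
  have "thp e (tens f g) = fextend (\<lambda>m. fextend (\<lambda>n. single (e (single m 1), e (single n 1)) 1) g) f"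
    by (simp add: tens_eq_fextend thp_def fextend_fextend)
  moreover have "\<dots> - fextend (\<lambda>m. single (e (single m 1), e g) 1) f \<in> Wt A A"
  proof -
    have "\<dots> - fextend (\<lambda>m. single (e (single m 1), e g) 1) f
        = fextend (\<lambda>m. fextend (\<lambda>n. single (e (single m 1), e (single n 1)) 1) g - single (e (single m 1), e g) 1) f"
      unfolding fextend_def[of _ f] by (simp add: fs.scale_right_diff_distrib sum_subtractf)
    also have "\<dots> \<in> Wt A A" by (rule fextend_in_subspace[OF fs.subspace_span r])
    finally show ?thesis .
  qed
  ultimately show ?thesis using Wt_trans[OF _ l] by simp
qed

lemma th_tens: "ev_hom A e \<Longrightarrow> th A e (tens f g) = pure A A (e f) (e g)"
  using thp_tens by (simp add: th_def pure_def tclass_eq_iff)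

text \<open>With the two relevant parities fixed, every pair of monomials contributes the same sign,
  so the signed product is a scalar multiple of the commutative one.\<close>

lemma fstpar_sndpar_mult_sign:
  fixes A :: "('k::field, 'a, 'm) superalg_scheme"
  assumes A: "superalgebra A" and e: "ev_hom A e" and x: "sndpar i x" and y: "fstpar j y"
  shows "tensor_mult A A (thp e x) (thp e y) - fscale (koszul i j) (thp e (x * y)) \<in> Wt A A"
proof -
  note e_closed = ev_homD(1)[OF e]
  have xy: "x * y = (\<Sum>s\<in>keys x. \<Sum>t\<in>keys y. single (s + t) (lookup x s * lookup y t))"
    by (subst (1) poly_mapping_expand[of x], subst (1) poly_mapping_expand[of y])
      (simp add: sum_product mult_single)
  have thp_sum: "thp e (\<Sum>i\<in>I. F i) = (\<Sum>i\<in>I. thp e (F i))" for F :: "_ \<Rightarrow> 'k dpoly" and I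
    by (simp add: thp_def fextend_sum)
  have "tensor_mult A A (thp e x) (thp e y)
      = (\<Sum>s\<in>keys x. \<Sum>t\<in>keys y. tensor_mult A A (thp e (single s (lookup x s))) (thp e (single t (lookup y t))))"
    by (subst (1) poly_mapping_expand[of x], subst (1) poly_mapping_expand[of y])
      (simp only: thp_sum tensor_mult_sum_left tensor_mult_sum_right, rule sum.swap)
  moreover have "fscale (koszul i j) (thp e (x * y))
      = (\<Sum>s\<in>keys x. \<Sum>t\<in>keys y. fscale (koszul i j) (thp e (single (s + t) (lookup x s * lookup y t))))"
    unfolding xy by (simp only: thp_sum fs.scale_sum_right)
  moreover have "tensor_mult A A (thp e (single s c)) (thp e (single t d))
      - fscale (koszul i j) (thp e (single (s + t) (c * d))) \<in> Wt A A" if st: "s \<in> keys x" "t \<in> keys y" for s t c d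
  proof -
    have 1: "e (single (snd s) 1) \<in> part A i"
      using x st(1) by (intro ev_homD(6)[OF e] vpar_single) (auto simp: sndpar_def)
    have 2: "e (single (fst t) 1) \<in> part A j"
      using y st(2) by (intro ev_homD(6)[OF e] vpar_single) (auto simp: fstpar_def)
    have m: "e (single (m + n) 1) = e (single m 1) \<otimes>\<^bsub>A\<^esub> e (single n 1)" for m n
      using ev_homD(3)[OF e, of "single m 1" "single n 1"] by (simp add: mult_single)
    show ?thesis
      using tensor_mult_single[OF A A e_closed[of "single (fst s) 1"] 1 2 e_closed[of "single (snd t) 1"], of c d]
      by (simp add: thp_single m mult.commute mult.left_commute)
  qed
  ultimately show ?thesis
    by (simp add: sum_subtractf[symmetric] fs.span_sum)
qed

text \<open>An even second slot on the left produces no sign, whatever the parity of the first slot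
  of \<open>y\<close>; hence \<open>y\<close> is split by that parity.\<close>

lemma th_mult:
  assumes A: "superalgebra A" and e: "ev_hom A e" and x: "sndpar 0 x"
  shows "th A e x \<otimes>\<^bsub>tensor A A\<^esub> th A e y = th A e (x * y)"
proof -
  define y0 y1 where "y0 = fextend (\<lambda>s. if even (lookup (fst s) V) then single s 1 else 0) y"
    and "y1 = fextend (\<lambda>s. if odd (lookup (fst s) V) then single s 1 else 0) y"
  have "y0 + y1 = fextend (\<lambda>s. single s 1) y"
    unfolding y0_def y1_def fextend_add_fun[symmetric] by (rule fextend_cong) simp
  then have y: "y = y0 + y1" by (simp add: fextend_def poly_mapping_expand[symmetric])
  have "keys y0 \<subseteq> {s. even (lookup (fst s) V)}" "keys y1 \<subseteq> {s. odd (lookup (fst s) V)}"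
    unfolding y0_def y1_def by (rule keys_fextend; simp)+
  then have par: "fstpar 0 y0" "fstpar 1 y1"
    by (auto simp: fstpar_def of_nat_bit)
  have "tensor_mult A A (thp e x) (thp e y) - thp e (x * y)
      = (tensor_mult A A (thp e x) (thp e y0) - fscale (koszul 0 0) (thp e (x * y0)))
      + (tensor_mult A A (thp e x) (thp e y1) - fscale (koszul 0 1) (thp e (x * y1)))"
    by (simp add: y thp_add tensor_mult_add_right koszul_def distrib_left)
  also have "\<dots> \<in> Wt A A"
    by (intro fs.span_add fstpar_sndpar_mult_sign A e x par)
  finally show ?thesis
    unfolding th_def using ev_homD(1)[OF e]
    by (subst tensor_times[OF A A]) (auto simp: tclass_eq_iff intro!: keys_thp)
qed

text \<open>This justifies \<open>om\<close>. Only the step from an odd power is delicate; there the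
  mixed terms cancel because (1 \<otimes> v)(v \<otimes> 1) is -(v \<otimes> v).\<close>

lemma th_V_power:
  fixes A :: "('k::field, 'a, 'm) superalg_scheme"
  assumes A: "superalgebra A" and e: "ev_hom A e"
  shows "(th A e (tens (pvar V) 1 + tens 1 (pvar V))) [^]\<^bsub>tensor A A\<^esub> n = th A e (om n)"
proof (induction n)
  case 0
  then show ?case
    using th_tens[OF e, of 1 1] ev_homD(4)[OF e] by (simp add: tensor_def)
next
  case (Suc n)
  let ?v = "tens (pvar V) 1" and ?v' = "tens 1 (pvar V)"
  show ?case
  proof (cases "even n")
    case True
    then have "om n * (?v + ?v') = (om (Suc n) :: 'k dpoly)" by (auto simp: om_def elim!: evenE)
    then show ?thesis using th_mult[OF A e sndpar_om[OF True]] by (simp add: Suc.IH)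
  next
    case False
    define x where "x = (om (n - 1) :: 'k dpoly)"
    have x: "sndpar 0 x" unfolding x_def by (rule sndpar_om) (use False in simp)
    obtain b where n: "n = 2 * b + 1" using False by (auto elim: oddE)
    have nd: "n div 2 = b" "n mod 2 = 1" "Suc n div 2 = Suc b" "Suc n mod 2 = 0" "(n - 1) div 2 = b" "(n - 1) mod 2 = 0"
      by (simp_all add: n)
    have w: "tens (pvar V ^ 2) 1 = ?v * (?v :: 'k dpoly)" "tens 1 (pvar V ^ 2) = ?v' * (?v' :: 'k dpoly)"
      by (simp_all add: tens_mult power2_eq_square)
    have xb: "x = (?v * ?v + ?v' * ?v') ^ b"
      unfolding x_def om_def nd w by simp
    have omn: "om n = x * ?v + x * ?v'" and omS: "om (Suc n) = x * (?v * ?v) + x * (?v' * ?v')"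
      unfolding om_def nd w xb power_Suc power_one_right power_0 mult_1_right
      by (simp_all only: distrib_left[symmetric] mult.commute[of "_ + _" "_ ^ b"])
    have c1: "vpar 0 (1 :: 'k pvpoly)" by (simp add: vpar_0_iff)
    have sp: "sndpar 0 (x * ?v)" "sndpar 1 (x * ?v')"
      using sndpar_mult[OF x sndpar_tens[OF c1, of "pvar V"]] sndpar_mult[OF x sndpar_tens[OF vpar_V, of 1]] by simp_all
    have fp: "fstpar 1 (?v :: 'k dpoly)" "fstpar 0 (?v' :: 'k dpoly)"
      using fstpar_tens[OF vpar_V, of 1] fstpar_tens[OF c1, of "pvar V"] by simp_all
    note sg = fstpar_sndpar_mult_sign[OF A e]
    \<comment> \<open>Of the four products only that of 1 \<otimes> v with v \<otimes> 1 has sign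
      -1, and it cancels the other mixed term.\<close>
    have "tensor_mult A A (thp e (om n)) (thp e (?v + ?v')) - thp e (om (Suc n))
        = (tensor_mult A A (thp e (x * ?v)) (thp e ?v) - fscale (koszul 0 1) (thp e (x * ?v * ?v)))
        + (tensor_mult A A (thp e (x * ?v)) (thp e ?v') - fscale (koszul 0 0) (thp e (x * ?v * ?v')))
        + ((tensor_mult A A (thp e (x * ?v')) (thp e ?v) - fscale (koszul 1 1) (thp e (x * ?v' * ?v)))
        + (tensor_mult A A (thp e (x * ?v')) (thp e ?v') - fscale (koszul 1 0) (thp e (x * ?v' * ?v'))))"
    proof -
      have "fscale (- 1) z = - z" for z :: "'a \<times> 'a \<Rightarrow>\<^sub>0 'k"
        by (rule poly_mapping_eqI) simp
      then show ?thesis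
        unfolding omn omS
        by (simp add: thp_add tensor_mult_add_right tensor_mult_add_left koszul_def mult.assoc[symmetric])
          (simp only: ac_simps)
    qed
    also have "\<dots> \<in> Wt A A"
      by (intro fs.span_add sg sp fp)
    finally show ?thesis
      using ev_homD(1)[OF e] unfolding nat_pow_Suc Suc.IH unfolding th_def
      by (subst tensor_times[OF A A]) (auto simp: tclass_eq_iff intro!: keys_thp)
  qed
qed

lemma th_power:
  assumes A: "superalgebra A" and e: "ev_hom A e" and x: "sndpar 0 x"
  shows "(th A e x) [^]\<^bsub>tensor A A\<^esub> (n::nat) = th A e (x ^ n)"
proof (induction n)
  case 0
  then show ?case
    using th_tens[OF e, of 1 1] ev_homD(4)[OF e] by (simp add: tensor_def)
next
  case (Suc n)
  then show ?case
    using th_mult[OF A e sndpar_power[OF x], of n x] by (simp add: mult.commute)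
qed

section \<open>Structure maps of a presented Hopf superalgebra\<close>

context presentation
begin

text \<open>The class map, made total by \<open>trunc\<close>, so that it is an evaluation in the
  sense of \<open>ev_hom\<close>.\<close>

definition ecl :: "'k pvpoly \<Rightarrow> 'k pvpoly set"
  where "ecl f = cl (trunc r f)"

lemma ecl_polys: "f \<in> polys r \<Longrightarrow> ecl f = cl f"
  by (simp add: ecl_def trunc_polys)

lemma ev_hom_ecl: "ev_hom Qp ecl"
  unfolding ev_hom_def ecl_def
  using trunc_in_polys
  by (auto simp: Qp_simps trunc_add trunc_mult vpar_trunc)

text \<open>The factors coming from the u_i have an even second slot and stand on the left, so
  \<open>th_mult\<close> absorbs them one by one; the power of v is the rightmost factor.\<close>

lemma comult_monomial_eq:
  assumes du: "\<And>i. i < r \<Longrightarrow> du i = th Qp ecl (cop (CHAR('k) ^ i))" and m: "m \<in> mons r"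
  shows "comult_monomial r rels du m = th Qp ecl (dmon m)"
proof -
  note A = superalgebra_Qp and e = ev_hom_ecl
  let ?c = "\<lambda>i. cop (CHAR('k) ^ i) :: 'k dpoly"
  have dv: "pure Qp Qp (cl (pvar V)) \<one>\<^bsub>Qp\<^esub> \<oplus>\<^bsub>tensor Qp Qp\<^esub> pure Qp Qp \<one>\<^bsub>Qp\<^esub> (cl (pvar V))
      = th Qp ecl (tens (pvar V) 1 + tens 1 (pvar V))"
  proof -
    have "cl (pvar V) = ecl (pvar V)" "\<one>\<^bsub>Qp\<^esub> = ecl 1"
      by (simp_all add: ecl_polys Qp_simps)
    then show ?thesis
      by (simp only: th_tens[OF e, symmetric]) (simp add: th_def thp_add)
  qed
  have "foldr (\<lambda>i y. (du i [^]\<^bsub>tensor Qp Qp\<^esub> lookup m (U i)) \<otimes>\<^bsub>tensor Qp Qp\<^esub> y) xs (th Qp ecl z)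
      = th Qp ecl (prod_list (map (\<lambda>i. ?c i ^ lookup m (U i)) xs) * z)" if "set xs \<subseteq> {..<r}" for xs z
    using that
  proof (induction xs)
    case (Cons i xs)
    then show ?case
      by (simp add: du th_power[OF A e sndpar_cop] th_mult[OF A e sndpar_power[OF sndpar_cop]] mult.assoc)
  qed simp
  then have "comult_monomial r rels du m = th Qp ecl (prod_list (map (\<lambda>i. ?c i ^ lookup m (U i)) [0..<r]) * om (lookup m V))"
    unfolding comult_monomial_def Let_def dv th_V_power[OF A e] by (simp add: atLeast0LessThan)
  also have "prod_list (map (\<lambda>i. ?c i ^ lookup m (U i)) [0..<r]) = (\<Prod>i<r. ?c i ^ lookup m (U i))"
    by (simp add: prod.distinct_set_conv_list[symmetric] atLeast0LessThan)
  also have "\<dots> = mval (\<lambda>x. case x of U i \<Rightarrow> ?c i | V \<Rightarrow> 1) m"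
  proof -
    have "mval (\<lambda>x. case x of U i \<Rightarrow> ?c i | V \<Rightarrow> 1) m
        = (\<Prod>x\<in>insert V (U ` {..<r}). (case x of U i \<Rightarrow> ?c i | V \<Rightarrow> 1) ^ lookup m x)"
      using m by (intro mval_superset) auto
    also have "\<dots> = (\<Prod>x\<in>U ` {..<r}. (case x of U i \<Rightarrow> ?c i | V \<Rightarrow> 1) ^ lookup m x)"
      by (subst prod.insert) auto
    also have "\<dots> = (\<Prod>i<r. ?c i ^ lookup m (U i))"
      by (subst prod.reindex) (auto simp: inj_on_def)
    finally show ?thesis by simp
  qed
  finally show ?thesis by (simp add: dmon_def)
qed

lemma presented_hopf_simps:
  "carrier (presented_hopf r rels du) = carrier Qp" "monoid.mult (presented_hopf r rels du) = monoid.mult Qp"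
  "one (presented_hopf r rels du) = one Qp" "ring.zero (presented_hopf r rels du) = ring.zero Qp"
  "add (presented_hopf r rels du) = add Qp" "module.smult (presented_hopf r rels du) = module.smult Qp"
  "part (presented_hopf r rels du) = part Qp"
  by (simp_all add: presented_hopf_def Let_def superalg.defs hopf_superalg.defs)

lemma superalgebra_presented_hopf: "superalgebra (presented_hopf r rels du)"
  by (rule superalgebra_cong[OF superalgebra_Qp]) (simp_all add: presented_hopf_simps)

text \<open>The structure maps are defined at a representative picked by choice, so their values are
  described by one polynomial \<open>f\<close> in the class and not by all of them.\<close>

lemma comult_presented:
  assumes du: "\<And>i. i < r \<Longrightarrow> du i = th Qp ecl (cop (CHAR('k) ^ i))" and Z: "Z \<in> carrier Qp"
  obtains f where "f \<in> polys r" "cl f = Z" "comult (presented_hopf r rels du) Z = th Qp ecl (Delta f)"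
    "counit (presented_hopf r rels du) Z = lookup f 0"
    "antipode (presented_hopf r rels du) Z = cl (\<Sum>m\<in>keys f. single m (antipode_sign r m * lookup f m))"
proof -
  define f where "f = (SOME f. f \<in> Z)"
  obtain g where g: "g \<in> polys r" "Z = cl g" using Z by (auto simp: Qp_simps)
  have f: "f \<in> polys r" "cl f = Z"
    using SOME_cl[OF g(1)] by (simp_all add: f_def g)
  have "comult (presented_hopf r rels du) Z = flin (tensor Qp Qp) (comult_monomial r rels du) f"
    by (simp add: presented_hopf_def Let_def superalg.defs hopf_superalg.defs f_def[symmetric] flin_def)
  also have "\<dots> = tclass Qp Qp (fextend (\<lambda>m. thp ecl (dmon m)) f)"
  proof (rule flin_tensor)
    fix m assume "m \<in> keys f"
    then have "m \<in> mons r" using f unfolding polys_def by blast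
    then show "comult_monomial r rels du m = tclass Qp Qp (thp ecl (dmon m))"
      using comult_monomial_eq[OF du] by (simp add: th_def)
    show "keys (thp ecl (dmon m)) \<subseteq> carrier Qp \<times> carrier Qp"
      by (rule keys_thp) (rule ev_homD(1)[OF ev_hom_ecl])
  qed
  also have "fextend (\<lambda>m. thp ecl (dmon m)) f = thp ecl (Delta f)"
    by (simp add: thp_def Delta_def fextend_fextend)
  finally have "comult (presented_hopf r rels du) Z = th Qp ecl (Delta f)" by (simp add: th_def)
  then show ?thesis
    using f by (intro that[of f])
      (simp_all add: presented_hopf_def Let_def superalg.defs hopf_superalg.defs f_def[symmetric])
qed

end

section \<open>Hopf superalgebras with a system of generators\<close>

text \<open>The antipode on polynomials. It is not multiplicative: it sends both v and v^2 to their
  negatives.\<close>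

definition sgnp :: "nat \<Rightarrow> 'k::field pvpoly \<Rightarrow> 'k pvpoly"
  where "sgnp s = fextend (\<lambda>m. single m (antipode_sign s m))"

lemma sgnp_eq: "(\<Sum>m\<in>keys f. single m (antipode_sign s m * lookup f m)) = sgnp s f"
  by (simp add: sgnp_def fextend_def mult.commute)

lemma sgnp_add: "sgnp s (f + g) = sgnp s f + sgnp s g"
  by (simp add: sgnp_def fextend_add)

lemma sgnp_polys: "f \<in> polys r \<Longrightarrow> sgnp s f \<in> polys r"
proof -
  have "keys (sgnp s f) \<subseteq> keys f" unfolding sgnp_def by (rule keys_fextend) auto
  then show "f \<in> polys r \<Longrightarrow> ?thesis" by (auto simp: polys_def)
qed

text \<open>Multiplication by each monomial of \<rho> flips the sign. This is the case for u_i^p, as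
  p is odd, and for v^2, so the relation mixing the two is carried to its negative as well.\<close>

lemma sgnp_mult:
  fixes \<rho> f :: "'k::field pvpoly"
  assumes "\<And>m n. m \<in> keys \<rho> \<Longrightarrow> antipode_sign s (m + n) = (- antipode_sign s n :: 'k)"
  shows "sgnp s (\<rho> * f) = - \<rho> * sgnp s f"
proof -
  have "sgnp s (\<rho> * f) = fextend (\<lambda>m. - single m 1) \<rho> * fextend (\<lambda>m. single m (antipode_sign s m)) f"
    unfolding sgnp_def by (rule fextend_mult) (simp add: assms mult_single single_uminus)
  also have "fextend (\<lambda>m. - single m 1) \<rho> = - \<rho>"
    using fextend_minus[of "\<lambda>m. single m 1" \<rho>]
    by (simp add: fextend_def poly_mapping_expand[symmetric] single_uminus[symmetric] sum_negf)
  finally show ?thesis by (simp add: sgnp_def)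
qed

lemma antipode_sign_U:
  assumes "i < s" "odd n"
  shows "antipode_sign s (single (U i) n + m) = - antipode_sign s m"
proof -
  have "(\<Prod>j<s. (- 1) ^ lookup (single (U i) n + m) (U j)) = (\<Prod>j<s. if j = i then - 1 else 1) * (\<Prod>j<s. (- 1 :: 'a) ^ lookup m (U j))"
    using assms(2) unfolding prod.distrib[symmetric]
    by (intro prod.cong refl) (simp add: lookup_add lookup_single power_add)
  also have "(\<Prod>j<s. if j = i then - 1 else 1) = (- 1 :: 'a)"
    using assms(1) by (simp add: prod.delta)
  finally show ?thesis by (simp add: antipode_sign_def lookup_add lookup_single)
qed

text \<open>If the exponent n of v grows by 2, n choose 2 grows by the odd number 2n + 1.\<close>

lemma antipode_sign_V2: "antipode_sign s (single V 2 + m) = - antipode_sign s m"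
proof -
  have "(lookup m V + 2) choose 2 = (lookup m V choose 2) + (2 * lookup m V + 1)"
    using binomial_Suc_Suc[of "Suc (lookup m V)" 1] binomial_Suc_Suc[of "lookup m V" 1]
    by (simp add: numeral_2_eq_2)
  then have "(- 1 :: 'a) ^ ((lookup m V + 2) choose 2) = - ((- 1) ^ (lookup m V choose 2))"
    by (simp only: power_add power_mult) simp
  then show ?thesis
    by (simp add: antipode_sign_def lookup_add lookup_single add.commute)
qed

lemma antipode_sign_shmon: "antipode_sign (Suc s) (shmon m) = antipode_sign s m"
  unfolding antipode_sign_def by (subst prod.lessThan_Suc_shift) simp

subsection \<open>The ideal of relations in two sets of variables\<close>

text \<open>The kernel of \<open>th A e\<close> is not visibly an ideal, since \<open>th\<close> is
  multiplicative only up to signs; so the largest ideal inside it is taken.\<close>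

definition Lid :: "('k::field, 'a, 'm) superalg_scheme \<Rightarrow> ('k pvpoly \<Rightarrow> 'a) \<Rightarrow> 'k dpoly set"
  where "Lid A e = {x. \<forall>z. thp e (x * z) \<in> Wt A A}"

lemma thp_0 [simp]: "thp e 0 = 0"
  by (simp add: thp_def)

lemma pideal_Lid: "pideal (Lid A e)"
  unfolding pideal_def Lid_def
  by (auto simp: distrib_right thp_add fs.span_add fs.span_zero mult.assoc)

lemma LidD: "x \<in> Lid A e \<Longrightarrow> thp e x \<in> Wt A A"
  unfolding Lid_def by (drule CollectD, drule spec[of _ 1]) simp

lemma th_cong: "x - y \<in> Lid A e \<Longrightarrow> th A e x = th A e y"
  by (simp add: th_eq_iff LidD)

lemma ev_hom_zero:
  assumes "superalgebra A" "ev_hom A e"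
  shows "e 0 = \<zero>\<^bsub>A\<^esub>"
proof -
  interpret superalgebra A by fact
  show ?thesis using ev_homD(5)[OF assms(2), of 0 0] ev_homD(1)[OF assms(2)] by simp
qed

lemma ev_hom_uminus:
  assumes "superalgebra A" "ev_hom A e"
  shows "e (- f) = \<ominus>\<^bsub>A\<^esub> e f"
proof -
  interpret superalgebra A by fact
  have "e (- f) \<oplus>\<^bsub>A\<^esub> e f = \<zero>\<^bsub>A\<^esub>"
    using ev_homD(2)[OF assms(2), of "- f" f] ev_hom_zero[OF assms] by simp
  then show ?thesis using ev_homD(1)[OF assms(2)] by (metis minus_equality)
qed

lemma ev_hom_diff:
  assumes "superalgebra A" "ev_hom A e"
  shows "e (f - g) = e f \<ominus>\<^bsub>A\<^esub> e g"
  using ev_homD(2)[OF assms(2), of f "- g"] ev_hom_uminus[OF assms] by (simp add: a_minus_def)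

lemma ev_hom_eq_iff:
  assumes "superalgebra A" "ev_hom A e"
  shows "e f = e g \<longleftrightarrow> e (f - g) = \<zero>\<^bsub>A\<^esub>"
proof -
  interpret superalgebra A by fact
  show ?thesis using ev_homD(1)[OF assms(2)] by (simp add: ev_hom_diff[OF assms] r_right_minus_eq)
qed

definition Kid :: "('k::field, 'a, 'm) superalg_scheme \<Rightarrow> ('k pvpoly \<Rightarrow> 'a) \<Rightarrow> 'k pvpoly set"
  where "Kid A e = {f. e f = \<zero>\<^bsub>A\<^esub>}"

lemma pideal_Kid:
  assumes "superalgebra A" "ev_hom A e"
  shows "pideal (Kid A e)"
proof -
  interpret superalgebra A by fact
  show ?thesis
    unfolding pideal_def Kid_def
    using ev_homD(1)[OF assms(2)] by (simp add: ev_hom_zero[OF assms] ev_homD(2,3)[OF assms(2)])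
qed

text \<open>By linearity it suffices to multiply by monomials. These act on each slot separately,
  and the slot of \<open>f\<close> stays in the kernel of \<open>e\<close>.\<close>

lemma incl_Lid:
  assumes A: "superalgebra A" and e: "ev_hom A e" and f: "f \<in> Kid A e"
  shows "incl1 f \<in> Lid A e" "incl2 f \<in> Lid A e"
proof -
  interpret superalgebra A by fact
  have z: "thp e (x * z) \<in> Wt A A" if x: "\<And>m n. thp e (x * single (m, n) 1) \<in> Wt A A" for x z
  proof -
    have "x * z = fextend (\<lambda>s. x * single s 1) z"
      by (subst (1) poly_mapping_expand[of z])
        (simp add: fextend_def sum_distrib_left fscale_mult_right[symmetric])
    then have "thp e (x * z) = fextend (\<lambda>s. thp e (x * single s 1)) z"
      by (simp add: thp_def fextend_fextend)
    also have "\<dots> \<in> Wt A A"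
      by (rule fextend_in_subspace[OF fs.subspace_span]) (use x in auto)
    finally show ?thesis .
  qed
  have K: "e (f * g) = \<zero>\<^bsub>A\<^esub>" for g
    using pideal_mult_right[OF pideal_Kid[OF A e] f, of g] by (simp add: Kid_def)
  have t: "thp e (tens a b) \<in> Wt A A" if "e a = \<zero>\<^bsub>A\<^esub> \<or> e b = \<zero>\<^bsub>A\<^esub>" for a b
  proof -
    have "single (e a, e b) 1 \<in> Wt A A"
      using that Wt_zero_left[OF module_axioms ev_homD(1)[OF e, of b]]
        Wt_zero_right[OF module_axioms ev_homD(1)[OF e, of a]] by auto
    from fs.span_add[OF thp_tens[OF e, of a b] this] show ?thesis by simp
  qed
  have 1: "incl1 f * single (m, n) 1 = tens (f * single m 1) (single n 1)" for m n
    using tens_mult[of f 1 "single m 1" "single n 1"] by (simp add: tens_def mult_single)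
  have 2: "incl2 f * single (m, n) 1 = tens (single m 1) (f * single n 1)" for m n
    using tens_mult[of 1 f "single m 1" "single n 1"] by (simp add: tens_def mult_single)
  show "incl1 f \<in> Lid A e" "incl2 f \<in> Lid A e"
    unfolding Lid_def by (rule CollectI, rule allI, rule z, simp add: 1 2 t K)+
qed

text \<open>This lets a linear map between algebras be absorbed into the evaluation.\<close>

lemma tmap_th:
  assumes "module \<K> M" "lin_map M B h" "\<And>f. e f \<in> carrier M"
  shows "tmap B B h h (th M e x) = th B (\<lambda>f. h (e f)) x"
proof -
  have keys: "keys (thp e x) \<subseteq> carrier M \<times> carrier M" by (rule keys_thp[OF assms(3)])
  show ?thesis
    unfolding th_def tmap_tclass[OF assms(1,1,2,2) keys] by (simp add: thp_def fextend_fextend)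
qed

text \<open>A Hopf superalgebra and its underlying superalgebra are different records; the tensor
  relations see only their common module fields.\<close>

lemma tclass_cong:
  assumes "carrier M = carrier M'" "add M = add M'" "module.smult M = module.smult M'"
  shows "tclass M M = tclass M' M'"
  using assms by (simp add: tclass_def tensor_rel_def fun_eq_iff)

subsection \<open>The defining relations\<close>

lemma PP_rels_cases:
  assumes "\<rho> \<in> PP_rels s"
  obtains i where "Suc i < s" "\<rho> = pvar (U i) ^ CHAR('k::field)"
  | "\<rho> = (pvar (U (s - 1)) ^ CHAR('k) + pvar V ^ 2 :: 'k pvpoly)"
proof -
  from assms consider "\<rho> \<in> (\<lambda>i. pvar (U i) ^ CHAR('k)) ` {..<s - 1}"
    | "\<rho> = pvar (U (s - 1)) ^ CHAR('k) + pvar V ^ 2"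
    unfolding PP_rels_def by blast
  then show thesis
  proof cases
    case 1
    then obtain i where "i < s - 1" "\<rho> = pvar (U i) ^ CHAR('k)" by blast
    then show thesis using that(1)[of i] by simp
  qed (rule that(2))
qed

lemma presentation_PP: "3 \<le> CHAR('k) \<Longrightarrow> 1 \<le> s \<Longrightarrow> presentation s (PP_rels s :: 'k::field pvpoly set)"
proof
  fix \<rho> :: "'k pvpoly" assume a: "3 \<le> CHAR('k)" "1 \<le> s" "\<rho> \<in> PP_rels s"
  have 0: "single x n \<noteq> (0 :: pvar \<Rightarrow>\<^sub>0 nat)" if "n \<noteq> 0" for x n
    using that by (metis lookup_single_eq lookup_zero)
  have pw: "lookup (pvar x ^ n) 0 = (0::'k)" if "n \<noteq> 0" for x n
    using 0[OF that, of x] by (simp add: pvar_power lookup_single)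
  from a(3) show "\<rho> \<in> polys s \<and> even_v \<rho> \<and> lookup \<rho> 0 = 0"
    by (rule PP_rels_cases)
      (use a in \<open>simp_all add: polys_add polys_power polys_U even_v_add even_v_power[OF even_v_U] lookup_add pw\<close>)
qed

lemma sgnp_PP_rels:
  assumes "\<rho> \<in> PP_rels s" "odd CHAR('k::field)" "1 \<le> s"
  shows "sgnp s (\<rho> * f) = - \<rho> * (sgnp s f :: 'k pvpoly)"
proof -
  have u: "sgnp s (pvar (U i) ^ CHAR('k) * f) = - (pvar (U i) ^ CHAR('k)) * sgnp s f" if "i < s" for i
  proof (rule sgnp_mult)
    fix m n assume "m \<in> keys (pvar (U i) ^ CHAR('k) :: 'k pvpoly)"
    then have "m = single (U i) CHAR('k)" by (simp add: pvar_power)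
    then show "antipode_sign s (m + n) = (- antipode_sign s n :: 'k)"
      by (simp only: antipode_sign_U[OF that assms(2)])
  qed
  have v: "sgnp s (pvar V ^ 2 * f) = - (pvar V ^ 2) * sgnp s f"
  proof (rule sgnp_mult)
    fix m n assume "m \<in> keys (pvar V ^ 2 :: 'k pvpoly)"
    then have "m = single V 2" by (simp add: pvar_power)
    then show "antipode_sign s (m + n) = (- antipode_sign s n :: 'k)"
      by (simp only: antipode_sign_V2)
  qed
  from assms(1) show ?thesis
  proof (rule PP_rels_cases)
    assume \<rho>: "\<rho> = pvar (U (s - 1)) ^ CHAR('k) + pvar V ^ 2"
    have "s - 1 < s" using assms(3) by simp
    then have "sgnp s (\<rho> * f) = - (pvar (U (s - 1)) ^ CHAR('k)) * sgnp s f + - (pvar V ^ 2) * sgnp s f"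
      unfolding \<rho> distrib_right sgnp_add u v by (simp only: u)
    then show ?thesis unfolding \<rho> minus_add_distrib distrib_right .
  next
    fix i assume i: "Suc i < s" "\<rho> = pvar (U i) ^ CHAR('k)"
    show ?thesis unfolding i(2) by (rule u[OF Suc_lessD[OF i(1)]])
  qed
qed

text \<open>The homomorphism from P_s is replaced by an evaluation of polynomials, with the
  structure maps of \<open>A\<close> expressed by \<open>Delta\<close>, the constant coefficient and
  \<open>sgnp\<close>. In this form, dropping a vanishing u_0 is a renaming of variables.\<close>

locale hopf_eval = hopf_superalgebra A for A :: "('k::field, 'a) hopf_superalg" (structure) +
  fixes s p :: nat and e :: "'k pvpoly \<Rightarrow> 'a"
  assumes char: "p = CHAR('k)" and p3: "3 \<le> p" and s1: "1 \<le> s"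
    and e: "ev_hom A e" and surj: "range e = carrier A"
    and vanish: "s \<le> i \<Longrightarrow> e (pvar (U i)) = \<zero>"
    and rels: "\<rho> \<in> PP_rels s \<Longrightarrow> e \<rho> = \<zero>"
    and comult_e: "f \<in> polys s \<Longrightarrow> comult A (e f) = th A e (Delta f)"
    and counit_e: "f \<in> polys s \<Longrightarrow> counit A (e f) = lookup f 0"
    and antipode_e: "f \<in> polys s \<Longrightarrow> antipode A (e f) = e (sgnp s f)"
begin

abbreviation K where "K \<equiv> Kid A e"
abbreviation L where "L \<equiv> Lid A e"

lemma superalgebra_A: "superalgebra A"
  by (rule superalgebra_axioms)

lemma in_K: "f \<in> K \<longleftrightarrow> e f = \<zero>"
  by (simp add: Kid_def)

lemma u_p_K: "Suc i < s \<Longrightarrow> pvar (U i) ^ p \<in> K"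
  using rels[of "pvar (U i) ^ p"] by (simp add: PP_rels_def in_K char)

lemma u_v_K: "pvar (U (s - 1)) ^ p + pvar V ^ 2 \<in> K"
  using rels[of "pvar (U (s - 1)) ^ p + pvar V ^ 2"] by (simp add: PP_rels_def in_K char)

sublocale ci: char_p_ideal K L s p
  by unfold_locales
    (use char p3 pideal_Kid[OF superalgebra_A e] pideal_Lid incl_Lid[OF superalgebra_A e] u_p_K in auto)

sublocale P: presentation s "PP_rels s :: 'k pvpoly set"
  by (rule presentation_PP) (use char p3 s1 in auto)

lemma e_eq_iff: "e f = e g \<longleftrightarrow> f - g \<in> K"
  using ev_hom_eq_iff[OF superalgebra_A e] by (simp add: in_K)

lemma e_trunc: "e (trunc s f) = e f"
proof (induction f rule: pvpoly_induct)
  case (var x)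
  show ?case
  proof (cases "x \<in> insert V (U ` {..<s})")
    case False
    then obtain i where "x = U i" "s \<le> i" by (cases x) (auto simp: not_less image_iff)
    then show ?thesis using False vanish ev_hom_zero[OF superalgebra_A e] by (simp add: trunc_pvar)
  qed (simp add: trunc_pvar)
qed (simp_all add: trunc_add trunc_mult ev_homD(2,3)[OF e])

lemma J_K: "P.J \<subseteq> K"
proof -
  have "ideal (K \<inter> polys s) P.R"
    by (rule ideal_polyI) (use ci.K in \<open>auto simp: pideal_rules polys_add polys_mult\<close>)
  moreover have "PP_rels s \<subseteq> K \<inter> polys s" using rels P.rels by (auto simp: in_K)
  ultimately show ?thesis using P.J_minimal by blast
qed

end

subsection \<open>Quotients of \<open>\<P>\<^sub>r\<close>\<close>

lemma comult_gamma_eq: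
  assumes "presentation r (PP_rels r :: 'k::field pvpoly set)" "l < CHAR('k) ^ r" "2 \<le> CHAR('k)"
  shows "comult_gamma r l = th (presented_superalg r (PP_rels r)) (presentation.ecl r (PP_rels r)) (cop l :: 'k dpoly)"
proof -
  interpret presentation r "PP_rels r :: 'k pvpoly set" by fact
  have e: "ev_hom Qp ecl" by (rule ev_hom_ecl)
  have g: "cl (pgamma r j) = ecl (gam j)" if "j \<le> l" for j
  proof -
    have "pgamma r j = (gam j :: 'k pvpoly)" using that assms(2,3) by (intro pgamma_eq_gam) auto
    then show ?thesis using ecl_polys[OF polys_pgamma[OF order.refl, of r j]] by simp
  qed
  have "comult_gamma r l = (\<Oplus>\<^bsub>tensor Qp Qp\<^esub>j\<in>{..l}. tclass Qp Qp (single (cl (pgamma r j), cl (pgamma r (l - j))) 1))"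
    by (simp add: comult_gamma_def Let_def pure_def)
  also have "\<dots> = tclass Qp Qp (\<Sum>j\<le>l. single (cl (pgamma r j), cl (pgamma r (l - j))) 1)"
    by (rule finsum_tensor) (auto simp: Qp_simps polys_pgamma)
  also have "\<dots> = th Qp ecl (cop l)"
  proof -
    have "thp ecl (cop l) - (\<Sum>j\<le>l. single (cl (pgamma r j), cl (pgamma r (l - j))) 1)
        = (\<Sum>j\<le>l. thp ecl (tens (gam j) (gam (l - j))) - single (ecl (gam j), ecl (gam (l - j))) 1)"
      unfolding cop_def sum_subtractf using g by (simp add: thp_def fextend_sum)
    also have "\<dots> \<in> Wt Qp Qp" by (intro fs.span_sum thp_tens e)
    finally show ?thesis unfolding th_def tclass_eq_iff using fs.span_neg by fastforce
  qed
  finally show ?thesis .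
qed

lemma comult_PP:
  fixes Z :: "'k::field pvpoly set"
  assumes P: "presentation r (PP_rels r :: 'k pvpoly set)" and p: "2 \<le> CHAR('k)"
    and Z: "Z \<in> carrier (PP r :: ('k, 'k pvpoly set) hopf_superalg)"
  obtains f where "f \<in> polys r" "pclass r (PP_rels r) f = Z"
    "comult (PP r) Z = th (presented_superalg r (PP_rels r)) (presentation.ecl r (PP_rels r)) (Delta f)"
    "counit (PP r) Z = lookup f 0"
    "antipode (PP r) Z = pclass r (PP_rels r) (sgnp r f)"
proof -
  interpret presentation r "PP_rels r :: 'k pvpoly set" by fact
  have du: "comult_gamma r (CHAR('k) ^ i) = th Qp ecl (cop (CHAR('k) ^ i))" if "i < r" for i
    using that p by (intro comult_gamma_eq P p power_strict_increasing) auto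
  have "Z \<in> carrier Qp" using Z by (simp add: PP_def presented_hopf_simps)
  from comult_presented[OF du this, unfolded PP_def[symmetric] sgnp_eq] that show ?thesis by blast
qed

text \<open>Modulo \<open>L\<close> each relation is primitive: the u_i^p are so by
  \<open>Delta_U_power\<close>, and v^2 is by the definition of \<open>om\<close>. Primitive
  elements of \<open>K\<close> have their coproduct in \<open>L\<close>.\<close>

lemma Delta_PP_rels:
  assumes ci: "char_p_ideal K L s p" and s: "1 \<le> s" and uv: "pvar (U (s - 1)) ^ p + pvar V ^ 2 \<in> K"
    and \<rho>: "\<rho> \<in> PP_rels s"
  shows "Delta (\<rho> :: 'k::field pvpoly) \<in> L"
proof -
  interpret char_p_ideal K L s p by fact
  from \<rho> show ?thesis
  proof (rule PP_rels_cases)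
    fix i assume i: "Suc i < s" "\<rho> = pvar (U i) ^ CHAR('k)"
    have "incl1 (pvar (U i) ^ p) + incl2 (pvar (U i) ^ p) \<in> L"
      by (intro pideal_add[OF L] KL u_p i)
    with Delta_U_power[of i] i show ?thesis using cong_mem'[OF L] by (simp add: p_def)
  next
    assume r: "\<rho> = pvar (U (s - 1)) ^ CHAR('k) + pvar V ^ 2"
    let ?\<rho> = "pvar (U (s - 1)) ^ p + pvar V ^ 2 :: 'k pvpoly"
    have "Delta ?\<rho> - (incl1 ?\<rho> + incl2 ?\<rho>)
        = Delta (pvar (U (s - 1)) ^ p) - (incl1 (pvar (U (s - 1)) ^ p) + incl2 (pvar (U (s - 1)) ^ p))"
      by (simp add: Delta_add Delta_V_power om_def incl_add tens_def)
    also have "\<dots> \<in> L" by (rule Delta_U_power) (use s in simp)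
    finally have "Delta ?\<rho> - (incl1 ?\<rho> + incl2 ?\<rho>) \<in> L" .
    moreover have "incl1 ?\<rho> + incl2 ?\<rho> \<in> L" by (intro pideal_add[OF L] KL uv)
    ultimately show ?thesis using cong_mem'[OF L] by (simp add: r p_def)
  qed
qed

text \<open>\<open>F\<close> is merely additive, as \<open>Delta\<close> and \<open>sgnp\<close>
  need not be multiplicative; so all multiples of a relation are tested. The f with F (f g) in
  \<open>L\<close> for all g form an ideal.\<close>

lemma ideal_mult_criterion:
  fixes rels :: "'k::field pvpoly set"
  assumes "presentation r rels" "pideal L"
    and F: "\<And>f g. F (f + g) = F f + F g" and 0: "\<And>\<rho> g. \<rho> \<in> rels \<Longrightarrow> F (\<rho> * g) \<in> L"
    and f: "f \<in> Idl\<^bsub>poly_superalg r\<^esub> rels"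
  shows "F f \<in> L"
proof -
  interpret presentation r rels by fact
  let ?M = "{f \<in> polys r. \<forall>g. F (f * g) \<in> L}"
  have F0: "F 0 = 0" using F[of 0 0] by simp
  have "ideal ?M R"
    by (rule ideal_polyI)
      (auto simp: F0 pideal_0[OF assms(2)] polys_add polys_mult distrib_right F pideal_add[OF assms(2)] mult.assoc)
  moreover have "rels \<subseteq> ?M" using rels 0 by auto
  ultimately have "J \<subseteq> ?M" by (rule J_minimal)
  with f have "F (f * 1) \<in> L" by blast
  then show ?thesis by simp
qed

text \<open>The structure maps of P_r are known at one representative of each class. Since
  \<open>Delta\<close> and \<open>sgnp\<close> carry the ideal of relations into
  \<open>Lid A e\<close> and \<open>Kid A e\<close>, the formulas hold in \<open>A\<close> for every
  representative.\<close>

theorem hopf_eval_of_hom: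
  fixes A :: "('k::field, 'a) hopf_superalg"
  assumes p: "CHAR('k) = p" "3 \<le> p" and r: "1 \<le> r" and A: "hopf_superalgebra A"
    and \<pi>: "hopf_hom (PP r) A \<pi>" "\<pi> ` carrier (PP r :: ('k, 'k pvpoly set) hopf_superalg) = carrier A"
  shows "hopf_eval A r p (\<lambda>f. \<pi> (presentation.ecl r (PP_rels r) f))"
proof -
  interpret hopf_superalgebra A by fact
  have P: "presentation r (PP_rels r :: 'k pvpoly set)" using p r by (intro presentation_PP) auto
  interpret presentation r "PP_rels r :: 'k pvpoly set" by (rule P)
  have A': "superalgebra A" by unfold_locales
  define e where "e f = \<pi> (ecl f)" for f
  have PPc: "carrier (PP r) = carrier Qp" and PPs: "monoid.mult (PP r) = monoid.mult Qp"
    "one (PP r) = one Qp" "ring.zero (PP r) = ring.zero Qp" "add (PP r) = add Qp" "module.smult (PP r) = module.smult Qp"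
    "part (PP r) = part Qp"
    by (simp_all add: PP_def presented_hopf_simps)
  have "superalg_hom (PP r) A \<pi>" using \<pi>(1) by (simp add: hopf_hom_def)
  then have lin: "lin_map Qp A \<pi>" and par': "\<And>i. \<pi> ` part Qp i \<subseteq> part A i" and hom: "\<pi> \<in> ring_hom Qp A"
    by (simp_all add: superalg_hom_def even_map_def lin_map_def ring_hom_def PPc PPs)
  have par: "\<pi> x \<in> part A i" if "x \<in> part Qp i" for i x
    using par'[of i] that by blast
  have ehom: "ev_hom A e"
    unfolding ev_hom_def e_def
    using ev_homD[OF ev_hom_ecl] lin_mapD[OF lin] par ring_hom_mult[OF hom] ring_hom_one[OF hom] by simp
  have ecl_range: "range ecl = carrier Qp"
  proof
    show "range ecl \<subseteq> carrier Qp" using ev_homD(1)[OF ev_hom_ecl] by blast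
    show "carrier Qp \<subseteq> range ecl"
    proof
      fix x assume "x \<in> carrier Qp"
      then obtain f where "f \<in> polys r" "x = cl f" unfolding Qp_simps by blast
      then have "x = ecl f" by (simp add: ecl_polys)
      then show "x \<in> range ecl" by blast
    qed
  qed
  have e_cl: "e f = \<pi> (cl f)" if "f \<in> polys r" for f
    using that by (simp add: e_def ecl_polys)
  have relz: "e \<rho> = \<zero>\<^bsub>A\<^esub>" if "\<rho> \<in> PP_rels r" for \<rho>
  proof -
    have \<rho>: "\<rho> \<in> polys r" "\<rho> \<in> J" using that rels rels_J by auto
    then have "cl \<rho> = cl 0" by (simp add: cl_eq_iff)
    then have "e \<rho> = e 0" using \<rho> by (simp add: e_cl)
    then show ?thesis using ev_hom_zero[OF A' ehom] by simp
  qed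
  have uv: "pvar (U (r - 1)) ^ p + pvar V ^ 2 \<in> Kid A e"
    using relz[of "pvar (U (r - 1)) ^ p + pvar V ^ 2"] by (simp add: PP_rels_def Kid_def p)
  have up: "pvar (U i) ^ p \<in> Kid A e" if "Suc i < r" for i
    using relz[of "pvar (U i) ^ p"] that by (simp add: PP_rels_def Kid_def p)
  have ci: "char_p_ideal (Kid A e) (Lid A e) r p"
    by unfold_locales (use p pideal_Kid[OF A' ehom] pideal_Lid incl_Lid[OF A' ehom] up in auto)
  have DJ: "Delta f \<in> Lid A e" if "f \<in> J" for f
    by (rule ideal_mult_criterion[OF P pideal_Lid Delta_add _ that])
      (use rels Delta_PP_rels[OF ci r uv] in \<open>auto simp: Delta_mult intro!: pideal_mult_right[OF pideal_Lid]\<close>)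
  have SJ: "sgnp r f \<in> Kid A e" if "f \<in> J" for f
  proof (rule ideal_mult_criterion[OF P pideal_Kid[OF A' ehom] sgnp_add _ that])
    have "odd p" using p prime_CHAR_semidom[where ?'a = 'k] prime_odd_nat[of p] by auto
    then show "sgnp r (\<rho> * g) \<in> Kid A e" if "\<rho> \<in> PP_rels r" for \<rho> g
      using that relz p r
      by (simp add: sgnp_PP_rels) (rule pideal_minus[OF pideal_Kid[OF A' ehom]], rule pideal_mult_right[OF pideal_Kid[OF A' ehom]], simp add: Kid_def)
  qed
  have key: "comult A (e f) = th A e (Delta f) \<and> counit A (e f) = lookup f 0 \<and> antipode A (e f) = e (sgnp r f)"
    if f: "f \<in> polys r" for f
  proof -
    have Z: "cl f \<in> carrier (PP r)" using f by (simp add: PPc Qp_simps)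
    obtain g where g: "g \<in> polys r" "cl g = cl f" "comult (PP r) (cl f) = th Qp ecl (Delta g)"
      "counit (PP r) (cl f) = lookup g 0" "antipode (PP r) (cl f) = cl (sgnp r g)"
      by (rule comult_PP[OF P _ Z]) (use p in auto)
    have fg: "f - g \<in> J" using f g(1,2) cl_eq_iff by metis
    have H: "comult A (\<pi> (cl f)) = tmap A A \<pi> \<pi> (comult (PP r) (cl f))" "counit A (\<pi> (cl f)) = counit (PP r) (cl f)"
      "antipode A (\<pi> (cl f)) = \<pi> (antipode (PP r) (cl f))"
      using \<pi>(1) Z by (auto simp: hopf_hom_def)
    have "tmap A A \<pi> \<pi> (th Qp ecl (Delta g)) = th A e (Delta g)"
      unfolding e_def
      by (rule tmap_th[OF superalgebra.axioms(1)[OF superalgebra_Qp] lin]) (rule ev_homD(1)[OF ev_hom_ecl])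
    also have "\<dots> = th A e (Delta f)"
    proof (rule th_cong)
      have "Delta g - Delta f = - Delta (f - g)" by (simp add: Delta_def fextend_diff)
      then show "Delta g - Delta f \<in> Lid A e" using pideal_minus[OF pideal_Lid DJ[OF fg]] by simp
    qed
    finally have 1: "comult A (e f) = th A e (Delta f)" using H g f by (simp add: e_cl)
    have 2: "counit A (e f) = lookup f 0" using H g f J_lookup_0[OF fg] by (simp add: e_cl lookup_minus)
    have "sgnp r f - sgnp r g \<in> Kid A e" using SJ[OF fg] by (simp add: sgnp_def fextend_diff)
    then have "e (sgnp r f) = e (sgnp r g)" using ev_hom_eq_iff[OF A' ehom] by (simp add: Kid_def)
    then have 3: "antipode A (e f) = e (sgnp r f)" using H g f by (simp add: e_cl sgnp_polys)
    from 1 2 3 show ?thesis by blast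
  qed
  have "hopf_eval A r p e"
  proof (intro hopf_eval.intro hopf_eval_axioms.intro A)
    show "range e = carrier A"
    proof -
      have "range e = \<pi> ` range ecl" unfolding e_def by blast
      then show ?thesis unfolding ecl_range using \<pi>(2) by (simp only: PPc)
    qed
    show "e (pvar (U i)) = \<zero>\<^bsub>A\<^esub>" if "r \<le> i" for i
    proof -
      have "trunc r (pvar (U i)) = (0 :: 'k pvpoly)" using that by (auto simp: trunc_pvar)
      then have "e (pvar (U i)) = e 0" by (simp add: e_def ecl_def trunc_def)
      then show ?thesis using ev_hom_zero[OF A' ehom] by simp
    qed
  qed (use p r ehom relz key in auto)
  then show ?thesis by (simp add: e_def[abs_def])
qed

section \<open>Shifting the variables when u_0 vanishes\<close>

lemma keys_shift: "keys (shift f) = shmon ` keys f"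
proof -
  have "keys (shift f) \<subseteq> shmon ` keys f" unfolding shift_def by (rule keys_fextend) auto
  moreover have "shmon m \<in> keys (shift f)" if "m \<in> keys f" for m
    using that by (simp add: in_keys_iff lookup_shift)
  ultimately show ?thesis by blast
qed

lemma keys_shmon: "keys (shmon m) = shvar ` keys m"
proof
  show "keys (shmon m) \<subseteq> shvar ` keys m"
    unfolding shmon_def by (rule order.trans[OF keys_sum]) (auto split: if_splits)
qed (auto simp: in_keys_iff lookup_shmon_shvar)

lemma shift_polys:
  assumes "f \<in> polys s"
  shows "shift f \<in> polys (Suc s)"
proof -
  have "shmon m \<in> mons (Suc s)" if "m \<in> keys f" for m
  proof -
    have "keys m \<subseteq> insert V (U ` {..<s})" using assms that unfolding polys_def by blast
    then have "shvar ` keys m \<subseteq> shvar ` insert V (U ` {..<s})" by (rule image_mono)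
    also have "\<dots> \<subseteq> insert V (U ` {..<Suc s})" by (auto simp: shvar_def)
    finally show ?thesis by (simp add: keys_shmon)
  qed
  then have "keys (shift f) \<subseteq> mons (Suc s)" unfolding keys_shift by blast
  then show ?thesis by (simp add: polys_def)
qed

lemma vpar_shift: "vpar i f \<Longrightarrow> vpar i (shift f)"
  by (auto simp: vpar_def keys_shift)

lemma mval_shmon: "mval \<phi> (shmon m) = mval (\<lambda>x. \<phi> (shvar x)) m"
  unfolding mval_def keys_shmon prod.reindex[OF inj_on_subset[OF inj_shvar subset_UNIV]]
  by (simp add: lookup_shmon_shvar)

definition shift2 :: "'k::field dpoly \<Rightarrow> 'k dpoly"
  where "shift2 = fextend (\<lambda>s. single (shmon (fst s), shmon (snd s)) 1)"

lemma shift2_add: "shift2 (x + y) = shift2 x + shift2 y"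
  by (simp add: shift2_def fextend_add)

lemma shift2_mult: "shift2 (x * y) = shift2 x * shift2 y"
  unfolding shift2_def by (rule fextend_mult) (simp add: shmon_add mult_single)

lemma shift2_1 [simp]: "shift2 1 = 1"
  unfolding shift2_def by (rule fextend_1) (simp add: zero_prod_def[symmetric])

lemma shift2_power: "shift2 (x ^ n) = shift2 x ^ n"
  by (induction n) (simp_all add: shift2_mult)

lemma shift2_prod: "shift2 (\<Prod>i\<in>I. f i) = (\<Prod>i\<in>I. shift2 (f i))"
  by (induction I rule: infinite_finite_induct) (simp_all add: shift2_mult)

lemma shift2_sum: "shift2 (\<Sum>i\<in>I. f i) = (\<Sum>i\<in>I. shift2 (f i))"
  by (simp add: shift2_def fextend_sum)

lemma shift2_tens: "shift2 (tens f g) = tens (shift f) (shift g)"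
proof -
  have "shift2 (incl1 f) = incl1 (shift f)" "shift2 (incl2 g) = incl2 (shift g)"
    by (simp_all add: shift2_def incl1_def incl2_def shift_def fextend_fextend)
  then show ?thesis by (simp add: tens_def shift2_mult)
qed

lemma shift2_om: "shift2 (om n) = om n"
  by (simp add: om_def shift2_mult shift2_power shift2_add shift2_tens shift_power)

lemma thp_shift: "thp (\<lambda>f. e (shift f)) x = thp e (shift2 x)"
  by (simp add: thp_def shift2_def fextend_fextend)

context hopf_eval
begin

text \<open>The map sends \<open>e f\<close> to \<open>h' f\<close>, which is well defined and
  injective by \<open>eq\<close>. For the Hopf structure one polynomial per element is enough, and
  that is what structure maps defined at chosen representatives provide.\<close>

lemma iso_of_ev_hom:
  fixes T :: "('k, 'b) hopf_superalg"
  assumes h': "ev_hom T h'" and eq: "\<And>f g. h' f = h' g \<longleftrightarrow> e f = e g" and range: "carrier T = range h'"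
    and struct: "\<And>x. x \<in> carrier A \<Longrightarrow> \<exists>f\<in>polys s. x = e f \<and> comult T (h' f) = th T h' (Delta f) \<and>
      counit T (h' f) = lookup f 0 \<and> antipode T (h' f) = h' (sgnp s f)"
  shows "A \<cong>\<^sub>H T"
proof -
  define h where "h a = h' (SOME f. e f = a)" for a
  have h_e: "h (e f) = h' f" for f
  proof -
    have "e (SOME f'. e f' = e f) = e f" by (rule someI[of "\<lambda>f'. e f' = e f" f]) simp
    then show ?thesis unfolding h_def using eq by blast
  qed
  have car: "\<exists>f. a = e f" if "a \<in> carrier A" for a using that surj by blast
  have lin: "lin_map A T h"
  proof (rule lin_mapI)
    fix x y assume "x \<in> carrier A" "y \<in> carrier A"
    then obtain f f' where "x = e f" "y = e f'" using car by blast
    then show "h (x \<oplus> y) = h x \<oplus>\<^bsub>T\<^esub> h y"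
      by (simp only: ev_homD(2)[OF e, symmetric] h_e ev_homD(2)[OF h'])
  next
    fix x c assume "x \<in> carrier A"
    then obtain f where x: "x = e f" using car by blast
    show "h x \<in> carrier T" by (simp only: x h_e ev_homD(1)[OF h'])
    show "h (c \<odot> x) = c \<odot>\<^bsub>T\<^esub> h x"
      by (simp only: x ev_homD(5)[OF e, symmetric] h_e ev_homD(5)[OF h'])
  qed
  have even: "h x \<in> part T i" if x: "x \<in> part A i" for x i
  proof -
    obtain f where f: "x = e f" using car part_carrier[OF x] by blast
    \<comment> \<open>A homogeneous \<open>x\<close> may come from an inhomogeneous
      \<open>f\<close>, which is therefore replaced by its parity component.\<close>
    have "component A i x = e (pp i f)"
    proof (rule component_unique)
      show "e (pp i f) \<in> part A i" "e (pp (i + 1) f) \<in> part A (i + 1)"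
        using pp_in[of "trunc s f" s] keys_pp[of _ _ f] by (auto intro!: ev_homD(6)[OF e] simp: vpar_def)
      show "x = e (pp i f) \<oplus> e (pp (i + 1) f)"
        by (simp only: f ev_homD(2)[OF e, symmetric] pp_sum)
    qed
    then have "x = e (pp i f)" using component_part[OF x, of i] by simp
    moreover have "vpar i (pp i f)" using keys_pp[of _ i f] by (auto simp: vpar_def)
    ultimately show ?thesis by (simp only: h_e ev_homD(6)[OF h'])
  qed
  have mult: "h \<in> ring_hom A T"
  proof (rule ring_hom_memI)
    fix x y assume "x \<in> carrier A" "y \<in> carrier A"
    then obtain f f' where xy: "x = e f" "y = e f'" using car by blast
    show "h x \<in> carrier T" by (simp only: xy h_e ev_homD(1)[OF h'])
    show "h (x \<otimes> y) = h x \<otimes>\<^bsub>T\<^esub> h y"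
      by (simp only: xy ev_homD(3)[OF e, symmetric] h_e ev_homD(3)[OF h'])
    show "h (x \<oplus> y) = h x \<oplus>\<^bsub>T\<^esub> h y"
      by (simp only: xy ev_homD(2)[OF e, symmetric] h_e ev_homD(2)[OF h'])
  next
    show "h \<one> = \<one>\<^bsub>T\<^esub>"
      by (simp only: ev_homD(4)[OF e, symmetric] h_e ev_homD(4)[OF h'])
  qed
  have hopf: "comult T (h x) = tmap T T h h (comult A x) \<and> counit T (h x) = counit A x \<and>
      antipode T (h x) = h (antipode A x)" if x: "x \<in> carrier A" for x
  proof -
    obtain f where f: "f \<in> polys s" "x = e f" "comult T (h' f) = th T h' (Delta f)"
      "counit T (h' f) = lookup f 0" "antipode T (h' f) = h' (sgnp s f)"
      using struct[OF x] by blast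
    have "tmap T T h h (th A e (Delta f)) = th T (\<lambda>f. h (e f)) (Delta f)"
      by (rule tmap_th[OF module_axioms lin]) (rule ev_homD(1)[OF e])
    then show ?thesis
      unfolding f(2) comult_e[OF f(1)] counit_e[OF f(1)] antipode_e[OF f(1)] h_e f(3-5) by simp
  qed
  have "hopf_hom A T h"
    unfolding hopf_hom_def superalg_hom_def even_map_def using lin even mult hopf by blast
  moreover have "bij_betw h (carrier A) (carrier T)"
  proof (rule bij_betwI')
    fix x y assume "x \<in> carrier A" "y \<in> carrier A"
    then obtain f f' where "x = e f" "y = e f'" using car by blast
    then show "(h x = h y) = (x = y)" by (simp only: h_e eq)
  next
    fix x assume "x \<in> carrier A"
    then show "h x \<in> carrier T" by (rule lin_mapD(1)[OF lin])
  next
    fix y assume "y \<in> carrier T"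
    then obtain f where "y = h' f" unfolding range by blast
    then have "y = h (e f)" by (simp only: h_e)
    then show "\<exists>x\<in>carrier A. y = h x" using ev_homD(1)[OF e] by blast
  qed
  ultimately show ?thesis unfolding hopf_iso_def by blast
qed

text \<open>The lowest digit of j is nonzero, so \<gamma>_j is a multiple of u_0.\<close>

lemma gam_u0:
  assumes "e (pvar (U 0)) = \<zero>" "\<not> p dvd j"
  shows "gam j \<in> K"
proof -
  have "j mod p \<noteq> 0" using assms(2) by (simp add: dvd_eq_mod_eq_0)
  then obtain d where d: "j mod p = Suc d" using not0_implies_Suc by blast
  have "pvar (U 0) \<in> K" using assms by (simp add: in_K)
  then have "pvar (U 0) * (pconst (1 / of_nat (fact (j mod p))) * pvar (U 0) ^ d * shift (gam (j div p))) \<in> K"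
    by (rule pideal_mult_right[OF ci.K])
  moreover have "gam j = pconst (1 / of_nat (fact (j mod p))) * pvar (U 0) ^ (j mod p) * shift (gam (j div p) :: 'k pvpoly)"
    using gam_rec[where ?'k = 'k, of j] p3 by (simp add: char)
  ultimately show ?thesis by (simp add: d ac_simps)
qed

lemma gam_dvd: "gam (p * j) = shift (gam j :: 'k pvpoly)"
  using gam_rec[where ?'k = 'k, of "p * j"] p3 by (simp add: char)

text \<open>Terms whose left index is not divisible by p contain u_0 and die. The others are
  \<gamma>_(pj) \<otimes> \<gamma>_(p(l-j)), the shifted terms of the coproduct of \<gamma>_l; so
  u_(i+1) takes over the role of u_i.\<close>

lemma cop_shift:
  assumes "e (pvar (U 0)) = \<zero>"
  shows "cop (p * l) - shift2 (cop l) \<in> L"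
proof -
  let ?T = "\<lambda>j. tens (gam j) (gam (p * l - j)) :: 'k dpoly"
  have "cop (p * l) = (\<Sum>j | j \<le> p * l \<and> \<not> p dvd j. ?T j) + (\<Sum>j | j \<le> p * l \<and> p dvd j. ?T j)"
    unfolding cop_def by (subst sum.union_disjoint[symmetric]) (auto intro!: sum.cong)
  also have "{j. j \<le> p * l \<and> p dvd j} = (\<lambda>j. p * j) ` {..l}"
    using p3 by (auto simp: dvd_def)
  also have "sum ?T ((\<lambda>j. p * j) ` {..l}) = (\<Sum>j\<le>l. ?T (p * j))"
    using p3 by (subst sum.reindex) (auto simp: inj_on_def)
  also have "\<dots> = shift2 (cop l)"
    unfolding cop_def by (simp add: shift2_sum shift2_tens gam_dvd right_diff_distrib'[symmetric])
  finally have "cop (p * l) - shift2 (cop l) = (\<Sum>j | j \<le> p * l \<and> \<not> p dvd j. ?T j)" by simp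
  also have "\<dots> \<in> L"
    unfolding tens_def
    by (intro pideal_sum[OF ci.L] pideal_mult_right[OF ci.L] ci.KL gam_u0 assms) auto
  finally show ?thesis .
qed

text \<open>On the generators this is \<open>cop_shift\<close>; congruences then pass through
  powers, products and linear combinations.\<close>

lemma Delta_shift:
  assumes "e (pvar (U 0)) = \<zero>"
  shows "Delta (shift f) - shift2 (Delta f) \<in> L"
proof -
  have 1: "dmon (shmon m) - shift2 (dmon m) \<in> L" for m
  proof -
    let ?\<phi> = "\<lambda>x. case x of U i \<Rightarrow> cop (CHAR('k) ^ i) | V \<Rightarrow> (1 :: 'k dpoly)"
    have \<phi>: "?\<phi> (shvar x) - shift2 (?\<phi> x) \<in> L" for x
      using cop_shift[OF assms] by (cases x) (simp_all add: shvar_def pideal_0[OF ci.L] char)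
    have "mval (\<lambda>x. ?\<phi> (shvar x)) m - mval (\<lambda>x. shift2 (?\<phi> x)) m \<in> L"
      unfolding mval_def by (intro cong_prod' cong_power' ci.L \<phi>)
    then have "(mval (\<lambda>x. ?\<phi> (shvar x)) m - mval (\<lambda>x. shift2 (?\<phi> x)) m) * om (lookup m V) \<in> L"
      by (rule pideal_mult_right[OF ci.L])
    moreover have "shift2 (mval ?\<phi> m) = mval (\<lambda>x. shift2 (?\<phi> x)) m"
      by (simp add: mval_def shift2_prod shift2_power)
    ultimately show ?thesis
      by (simp add: dmon_def mval_shmon shift2_mult shift2_om left_diff_distrib)
  qed
  have "Delta (shift f) - shift2 (Delta f) = (\<Sum>m\<in>keys f. fscale (lookup f m) (dmon (shmon m) - shift2 (dmon m)))"
    unfolding Delta_def shift_def shift2_def fextend_fextend fextend_def[of _ f]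
    by (simp add: fextend_sum fextend_fscale sum_subtractf fs.scale_right_diff_distrib)
  also have "\<dots> \<in> L"
    unfolding fscale_eq_mult by (intro pideal_sum[OF ci.L] pideal_mult_left[OF ci.L] 1)
  finally show ?thesis .
qed

text \<open>The bound s \<ge> 2 leaves a variable u_(s-1) other than u_0 for the relation with
  v^2.\<close>

lemma hopf_eval_shift:
  assumes s: "2 \<le> s" and u0: "e (pvar (U 0)) = \<zero>"
  shows "hopf_eval A (s - 1) p (\<lambda>f. e (shift f))"
proof -
  have Suc: "s = Suc (s - 1)" using s by simp
  have z: "e 0 = \<zero>" by (rule ev_hom_zero[OF superalgebra_A e])
  \<comment> \<open>Surjectivity survives the shift because u_0 can be replaced by 0 in every
    polynomial.\<close>
  have ex: "\<exists>f'. e f = e (shift f')" for f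
  proof (induction f rule: pvpoly_induct)
    case (const c)
    then show ?case by (intro exI[of _ "pconst c"]) simp
  next
    case (var x)
    show ?case
    proof (cases x)
      case (U i)
      then show ?thesis
      proof (cases i)
        case 0
        then show ?thesis using U u0 z by (intro exI[of _ 0]) simp
      next
        case (Suc i')
        then show ?thesis using U by (intro exI[of _ "pvar (U i')"]) simp
      qed
    next
      case V
      then show ?thesis by (intro exI[of _ "pvar V"]) simp
    qed
  next
    case (add f g)
    then obtain f' g' where "e f = e (shift f')" "e g = e (shift g')" by blast
    then have "e (f + g) = e (shift (f' + g'))" by (simp add: ev_homD(2)[OF e] shift_add)
    then show ?case by blast
  next
    case (mult f g)
    then obtain f' g' where "e f = e (shift f')" "e g = e (shift g')" by blast
    then have "e (f * g) = e (shift (f' * g'))" by (simp add: ev_homD(3)[OF e] shift_mult)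
    then show ?case by blast
  qed
  show ?thesis
  proof (intro hopf_eval.intro hopf_eval_axioms.intro)
    show "hopf_superalgebra A" by unfold_locales
    show "ev_hom A (\<lambda>f. e (shift f))"
      using ev_homD[OF e] unfolding ev_hom_def
      by (simp add: shift_add shift_mult vpar_shift)
    show "range (\<lambda>f. e (shift f)) = carrier A"
      unfolding surj[symmetric]
    proof (intro equalityI subsetI)
      fix a assume "a \<in> range e"
      then obtain f f' where "a = e f" "e f = e (shift f')" using ex by blast
      then have "a = e (shift f')" by simp
      then show "a \<in> range (\<lambda>f. e (shift f))" by blast
    qed blast
    show "e (shift (pvar (U i))) = \<zero>" if "s - 1 \<le> i" for i
      using vanish[of "Suc i"] that by simp
    show "e (shift \<rho>) = \<zero>" if "\<rho> \<in> PP_rels (s - 1)" for \<rho>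
      using that
    proof (rule PP_rels_cases)
      fix i assume "Suc i < s - 1" "\<rho> = pvar (U i) ^ CHAR('k)"
      then show ?thesis using rels[of "pvar (U (Suc i)) ^ CHAR('k)"] by (simp add: PP_rels_def shift_power)
    next
      assume \<rho>: "\<rho> = pvar (U (s - 1 - 1)) ^ CHAR('k) + pvar V ^ 2"
      have "Suc (s - 1 - 1) = s - 1" using s by simp
      then have "shift \<rho> = pvar (U (s - 1)) ^ CHAR('k) + pvar V ^ 2"
        by (simp only: \<rho> shift_add shift_power shift_pvar_simps)
      then show ?thesis by (intro rels) (simp add: PP_rels_def)
    qed
    fix f :: "'k pvpoly" assume f: "f \<in> polys (s - 1)"
    then have sf: "shift f \<in> polys s" using shift_polys[OF f] s by simp
    show "comult A (e (shift f)) = th A (\<lambda>f. e (shift f)) (Delta f)"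
      using th_cong[OF Delta_shift[OF u0]] by (simp add: comult_e[OF sf] th_def thp_shift)
    show "counit A (e (shift f)) = lookup f 0"
      using lookup_shift[of f 0] by (simp add: counit_e[OF sf])
    have "antipode_sign s (shmon m) = (antipode_sign (s - 1) m :: 'k)" for m
      using antipode_sign_shmon[of "s - 1" m] Suc by simp
    then have "sgnp s (shift f) = shift (sgnp (s - 1) f)"
      by (simp add: sgnp_def shift_def fextend_fextend)
    then show "antipode A (e (shift f)) = e (shift (sgnp (s - 1) f))"
      by (simp add: antipode_e[OF sf])
  qed (use char p3 s in auto)
qed

end

section \<open>Quotients of P_s by one further relation\<close>

context hopf_eval
begin

abbreviation H where "H \<equiv> PP s :: ('k, 'k pvpoly set) hopf_superalg"

lemma H_simps:
  "carrier H = carrier P.Qp" "monoid.mult H = monoid.mult P.Qp" "one H = one P.Qp" "ring.zero H = ring.zero P.Qp"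
  "add H = add P.Qp" "module.smult H = module.smult P.Qp" "part H = part P.Qp"
  by (simp_all add: PP_def P.presented_hopf_simps)

lemma superalgebra_H: "superalgebra H"
  unfolding PP_def by (rule P.superalgebra_presented_hopf)

lemma ev_hom_ecl_H: "ev_hom H P.ecl"
  using P.ev_hom_ecl unfolding ev_hom_def H_simps .

lemma e_ecl: "P.ecl f = P.ecl g \<Longrightarrow> e f = e g"
proof -
  assume "P.ecl f = P.ecl g"
  then have "trunc s f - trunc s g \<in> P.J"
    by (simp add: P.ecl_def P.cl_eq_iff[OF trunc_in_polys trunc_in_polys])
  then have "e (trunc s f) = e (trunc s g)" using J_K e_eq_iff by blast
  then show ?thesis by (simp add: e_trunc)
qed

lemma H_carrier: "carrier H = range P.ecl"
proof
  show "range P.ecl \<subseteq> carrier H" using ev_homD(1)[OF ev_hom_ecl_H] by blast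
  show "carrier H \<subseteq> range P.ecl"
  proof
    fix x assume "x \<in> carrier H"
    then obtain f where "f \<in> polys s" "x = P.cl f" unfolding H_simps P.Qp_simps by blast
    then have "x = P.ecl f" by (simp add: P.ecl_polys)
    then show "x \<in> range P.ecl" by blast
  qed
qed

lemma ideal_image_K: "ideal (P.ecl ` K) H"
proof -
  interpret H: superalgebra H by (rule superalgebra_H)
  note hom = ev_homD[OF ev_hom_ecl_H] and K = ci.K
  show ?thesis
  proof (rule idealI)
    show "ring H" by unfold_locales
    show "subgroup (P.ecl ` K) (add_monoid H)"
    proof (rule H.add.subgroupI)
      show "P.ecl ` K \<subseteq> carrier H" using hom(1) by blast
      show "P.ecl ` K \<noteq> {}" using pideal_0[OF K] by blast
      show "\<ominus>\<^bsub>H\<^esub> x \<in> P.ecl ` K" if x: "x \<in> P.ecl ` K" for x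
      proof -
        from x obtain f where f: "f \<in> K" "x = P.ecl f" by blast
        then have "\<ominus>\<^bsub>H\<^esub> x = P.ecl (- f)" by (simp add: ev_hom_uminus[OF superalgebra_H ev_hom_ecl_H])
        then show ?thesis using pideal_minus[OF K f(1)] by blast
      qed
      show "x \<oplus>\<^bsub>H\<^esub> y \<in> P.ecl ` K" if x: "x \<in> P.ecl ` K" and y: "y \<in> P.ecl ` K" for x y
      proof -
        from x y obtain f g where fg: "f \<in> K" "x = P.ecl f" "g \<in> K" "y = P.ecl g" by blast
        then have "x \<oplus>\<^bsub>H\<^esub> y = P.ecl (f + g)" by (simp add: hom)
        then show ?thesis using pideal_add[OF K fg(1,3)] by blast
      qed
    qed
    fix a x assume a: "a \<in> P.ecl ` K" and x: "x \<in> carrier H"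
    from a obtain f where f: "f \<in> K" "a = P.ecl f" by blast
    from x obtain g where g: "x = P.ecl g" unfolding H_carrier by blast
    have "x \<otimes>\<^bsub>H\<^esub> a = P.ecl (g * f)" "a \<otimes>\<^bsub>H\<^esub> x = P.ecl (f * g)" using f g by (simp_all add: hom)
    then show "x \<otimes>\<^bsub>H\<^esub> a \<in> P.ecl ` K" "a \<otimes>\<^bsub>H\<^esub> x \<in> P.ecl ` K"
      using pideal_mult_left[OF K f(1)] pideal_mult_right[OF K f(1)] by blast+
  qed
qed

text \<open>The kernel of the evaluation in P_s modulo \<open>g\<close>, to be compared with the
  kernel \<open>K\<close> of the evaluation in \<open>A\<close>.\<close>

definition Nid :: "'k pvpoly \<Rightarrow> 'k pvpoly set"
  where "Nid g = {f. P.ecl f \<in> Idl\<^bsub>H\<^esub> {P.cl g}}"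

context
  fixes g :: "'k pvpoly"
  assumes g: "g \<in> polys s" "e g = \<zero>"
begin

abbreviation "I \<equiv> Idl\<^bsub>H\<^esub> {P.cl g}"

lemma cl_g: "{P.cl g} \<subseteq> carrier H"
  using g by (auto simp: H_simps P.Qp_simps)

lemma superalgebra_ideal_I: "superalgebra_ideal H I"
  by (intro superalgebra_ideal.intro superalgebra_H ring.genideal_ideal superalgebra.axioms(2)[OF superalgebra_H] cl_g)

interpretation qi: superalgebra_ideal H I
  by (rule superalgebra_ideal_I)

lemma I_K: "I \<subseteq> P.ecl ` K"
proof (rule ring.genideal_minimal[OF superalgebra.axioms(2)[OF superalgebra_H] ideal_image_K])
  show "{P.cl g} \<subseteq> P.ecl ` K" using g P.ecl_polys[of g] by (auto simp: in_K)
qed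

lemma Nid_K: "Nid g \<subseteq> K"
proof
  fix f assume "f \<in> Nid g"
  then obtain f' where "f' \<in> K" "P.ecl f = P.ecl f'" using I_K by (auto simp: Nid_def)
  then show "f \<in> K" using e_ecl[of f f'] by (simp add: in_K)
qed

lemma pideal_Nid: "pideal (Nid g)"
proof -
  note hom = ev_homD[OF ev_hom_ecl_H]
  have "P.ecl 0 \<in> I"
    using additive_subgroup.zero_closed[OF qi.additive_subgroup_axioms] ev_hom_zero[OF superalgebra_H ev_hom_ecl_H] by simp
  then show ?thesis
    unfolding pideal_def Nid_def
    using qi.a_closed qi.I_r_closed[OF _ hom(1)] by (simp add: hom)
qed

lemma J_Nid: "P.J \<subseteq> Nid g"
proof
  fix f assume f: "f \<in> P.J"
  then have "P.ecl f = P.ecl 0"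
    using P.J_polys[OF f] P.ecl_polys by (simp add: P.cl_eq_iff)
  then show "f \<in> Nid g" using pideal_0[OF pideal_Nid] by (simp add: Nid_def)
qed

lemma g_Nid: "g \<in> Nid g"
  using ring.genideal_self[OF superalgebra.axioms(2)[OF superalgebra_H] cl_g] g
  by (simp add: Nid_def P.ecl_polys)

text \<open>\<open>Nid g\<close> lies in \<open>K\<close> because \<open>g\<close> does;
  \<open>ker\<close> is the converse. So both evaluations have the same kernel, and
  \<open>iso_of_ev_hom\<close> applies.\<close>

theorem iso_PP_quot:
  assumes ker: "\<And>f. f \<in> K \<Longrightarrow> f \<in> Nid g"
  shows "A \<cong>\<^sub>H PP_quot s g"
proof -
  let ?Q = "quot_superalg H I"
  define qe where "qe f = qi.q (P.ecl f)" for f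
  note hom = ev_homD[OF ev_hom_ecl_H]
  have qe_eq: "qe f = qe f' \<longleftrightarrow> e f = e f'" for f f'
  proof -
    have "qe f = qe f' \<longleftrightarrow> P.ecl f \<ominus>\<^bsub>H\<^esub> P.ecl f' \<in> I"
      unfolding qe_def by (rule qi.q_eq_iff) (rule hom(1))+
    also have "P.ecl f \<ominus>\<^bsub>H\<^esub> P.ecl f' = P.ecl (f - f')"
      by (rule ev_hom_diff[OF superalgebra_H ev_hom_ecl_H, symmetric])
    also have "\<dots> \<in> I \<longleftrightarrow> f - f' \<in> K"
      using ker[of "f - f'"] Nid_K by (auto simp: Nid_def)
    finally show ?thesis by (simp add: e_eq_iff)
  qed
  have H': "carrier (PP_quot s g) = carrier ?Q" "monoid.mult (PP_quot s g) = monoid.mult ?Q"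
    "one (PP_quot s g) = one ?Q" "ring.zero (PP_quot s g) = ring.zero ?Q" "add (PP_quot s g) = add ?Q"
    "module.smult (PP_quot s g) = module.smult ?Q" "part (PP_quot s g) = part ?Q"
    "comult (PP_quot s g) = (\<lambda>Z. tmap ?Q ?Q qi.q qi.q (comult H (SOME x. x \<in> Z)))"
    "counit (PP_quot s g) = (\<lambda>Z. counit H (SOME x. x \<in> Z))"
    "antipode (PP_quot s g) = (\<lambda>Z. qi.q (antipode H (SOME x. x \<in> Z)))"
    by (simp_all add: PP_quot_def quot_hopf_def Let_def superalg.defs hopf_superalg.defs)
  have qe: "qe f \<in> carrier ?Q" "qe (f + f') = qe f \<oplus>\<^bsub>?Q\<^esub> qe f'" "qe (f * f') = qe f \<otimes>\<^bsub>?Q\<^esub> qe f'"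
    "qe 1 = \<one>\<^bsub>?Q\<^esub>" "vpar i f \<Longrightarrow> qe f \<in> part ?Q i" for f f' i
    using hom by (auto simp: qe_def qi.quot_simps)
  have qe_smult: "qe (pconst c * f) = c \<odot>\<^bsub>?Q\<^esub> qe f" for c f
    unfolding qe_def hom(5) by (rule qi.quot_smult[OF hom(1), symmetric])
  have ev_qe: "ev_hom (PP_quot s g) qe"
    unfolding ev_hom_def H' by (intro conjI allI impI qe qe_smult)
  show ?thesis
  proof (rule iso_of_ev_hom[OF ev_qe qe_eq])
    show "carrier (PP_quot s g) = range qe"
      unfolding H' qi.quot_carrier H_carrier by (auto simp: qe_def)
  next
    fix x assume "x \<in> carrier A"
    then obtain f where f: "x = e f" using surj by blast
    \<comment> \<open>Two choices are nested here: \<open>W\<close> represents the coset in P_s, and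
      \<open>f'\<close> represents the class \<open>W\<close>.\<close>
    define W where "W = (SOME y. y \<in> qe f)"
    have "W \<in> qi.q (P.ecl f)"
      unfolding W_def qe_def by (rule someI) (rule qi.q_self[OF hom(1)])
    then have W: "W \<in> carrier H" "qi.q W = qe f"
      using qi.in_qD[OF hom(1)] by (auto simp: qe_def)
    obtain f' where f': "f' \<in> polys s" "P.cl f' = W" "comult H W = th P.Qp P.ecl (Delta f')"
      "counit H W = lookup f' 0" "antipode H W = P.cl (sgnp s f')"
      by (rule comult_PP[OF P.presentation_axioms _ W(1)]) (use p3 char in auto)
    have eq: "qe f' = qe f" using W f' by (simp add: qe_def P.ecl_polys)
    have lq: "lin_map P.Qp ?Q qi.q"
      using qi.lin_q by (simp add: lin_map_def H_simps)
    have "comult (PP_quot s g) (qe f') = tmap ?Q ?Q qi.q qi.q (th P.Qp P.ecl (Delta f'))"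
      by (simp only: H' eq W_def[symmetric] f')
    also have "\<dots> = th ?Q qe (Delta f')"
      unfolding qe_def
      by (rule tmap_th[OF superalgebra.axioms(1)[OF P.superalgebra_Qp] lq]) (rule ev_homD(1)[OF P.ev_hom_ecl])
    also have "\<dots> = th (PP_quot s g) qe (Delta f')"
      unfolding th_def by (rule fun_cong[OF tclass_cong]) (simp_all add: H')
    finally have comult: "comult (PP_quot s g) (qe f') = th (PP_quot s g) qe (Delta f')" .
    have counit: "counit (PP_quot s g) (qe f') = lookup f' 0"
      unfolding H' eq W_def[symmetric] by (rule f'(4))
    have "antipode (PP_quot s g) (qe f') = qe (sgnp s f')"
      unfolding H' eq W_def[symmetric] f'(5) unfolding qe_def P.ecl_polys[OF sgnp_polys[OF f'(1)]] ..
    moreover have "x = e f'" using eq by (simp add: f qe_eq)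
    ultimately show "\<exists>f\<in>polys s. x = e f \<and> comult (PP_quot s g) (qe f) = th (PP_quot s g) qe (Delta f) \<and>
        counit (PP_quot s g) (qe f) = lookup f 0 \<and> antipode (PP_quot s g) (qe f) = qe (sgnp s f)"
      using f'(1) comult counit by blast
  qed
qed

end

end

section \<open>Linear independence\<close>

text \<open>A basis of \<open>C\<close> stays independent when \<open>x\<close> is added to it, and
  the functional is prescribed there.\<close>

lemma exists_functional:
  fixes C :: "('s \<Rightarrow>\<^sub>0 'k::field) set"
  assumes C: "fs.subspace C" and x: "x \<notin> C"
  obtains g where "\<And>a b. g (a + b) = g a + g b" "\<And>c a. g (fscale c a) = c * g a"
    "\<And>a. a \<in> C \<Longrightarrow> g a = 0" "g x = (1::'k)"
proof -
  interpret vk: vector_space "(*) :: 'k \<Rightarrow> 'k \<Rightarrow> 'k"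
    by unfold_locales (simp_all add: algebra_simps)
  interpret vp: vector_space_pair "fscale :: 'k \<Rightarrow> ('s \<Rightarrow>\<^sub>0 'k) \<Rightarrow> _" "(*) :: 'k \<Rightarrow> 'k \<Rightarrow> 'k" ..
  obtain B where B: "B \<subseteq> C" "fs.independent B" "C \<subseteq> fs.span B"
    using fs.maximal_independent_subset[of C] by blast
  have "x \<notin> fs.span B" using x fs.span_minimal[OF B(1) C] by blast
  then have "fs.independent (insert x B)" using B(2) by (rule fs.independent_insertI)
  then obtain g where g: "Vector_Spaces.linear fscale (*) g" "\<forall>y\<in>insert x B. g y = (if y = x then 1 else 0)"
    using vp.linear_independent_extend[of "insert x B" "\<lambda>y. if y = x then 1 else 0"] by blast
  have gB: "g b = 0" if "b \<in> B" for b using g(2) B(1) x that by auto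
  interpret g: Vector_Spaces.linear fscale "(*)" g by (rule g(1))
  have "g a = 0" if "a \<in> C" for a
    using vp.linear_eq_0_on_span[OF g(1) gB] B(3) that by blast
  with g(2) show ?thesis by (intro that[of g]) (simp_all add: g.add g.scale)
qed

definition bas :: "nat \<times> nat \<Rightarrow> 'k::field pvpoly"
  where "bas x = gam (fst x) * pvar V ^ snd x"

definition comb :: "(nat \<times> nat) set \<Rightarrow> (nat \<times> nat \<Rightarrow> 'k) \<Rightarrow> 'k::field pvpoly"
  where "comb D c = (\<Sum>x\<in>D. fscale (c x) (bas x))"

lemma comb_add: "comb D (\<lambda>x. c x + d x) = comb D c + comb D d"
  by (simp add: comb_def fs.scale_left_distrib sum.distrib)

lemma comb_diff: "comb D (\<lambda>x. c x - d x) = comb D c - comb D d"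
  by (simp add: comb_def fs.scale_left_diff_distrib sum_subtractf)

lemma comb_scale: "comb D (\<lambda>x. a * c x) = fscale a (comb D c)"
  by (simp add: comb_def fs.scale_sum_right)

lemma comb_single: "finite D \<Longrightarrow> x \<in> D \<Longrightarrow> comb D (\<lambda>y. if y = x then 1 else 0) = bas x"
  by (simp add: comb_def if_distrib[of "\<lambda>c. fscale c _"] sum.delta cong: if_cong)

lemma comb_0 [simp]: "comb D (\<lambda>_. 0) = 0"
  by (simp add: comb_def)

text \<open>The condition says that \<open>bas a \<otimes> bas (x - a)\<close> occurs in the coproduct of \<open>bas x\<close>.\<close>

definition decomposes :: "'k::field itself \<Rightarrow> nat \<times> nat \<Rightarrow> nat \<times> nat \<Rightarrow> bool"
  where "decomposes _ x a \<longleftrightarrow> fst a \<le> fst x \<and> snd a \<le> snd x \<and> a \<noteq> (0, 0) \<and> a \<noteq> x \<and>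
    (of_nat (sb (snd x) (snd a)) :: 'k) \<noteq> 0"

lemma lsum_Wt:
  assumes \<phi>: "\<And>a b. a \<in> carrier M \<Longrightarrow> b \<in> carrier M \<Longrightarrow> \<phi> (a \<oplus>\<^bsub>M\<^esub> b) = \<phi> a + \<phi> b"
      "\<And>c a. a \<in> carrier M \<Longrightarrow> \<phi> (c \<odot>\<^bsub>M\<^esub> a) = c * \<phi> a"
    and \<psi>: "\<And>a b. a \<in> carrier N \<Longrightarrow> b \<in> carrier N \<Longrightarrow> \<psi> (a \<oplus>\<^bsub>N\<^esub> b) = \<psi> a + \<psi> b"
      "\<And>c a. a \<in> carrier N \<Longrightarrow> \<psi> (c \<odot>\<^bsub>N\<^esub> a) = c * \<psi> a"
    and t: "t \<in> Wt M N"
  shows "lsum (\<lambda>s. \<phi> (fst s) * \<psi> (snd s)) t = (0 :: 'k::field)"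
  using t
proof (induction rule: fs.span_induct_alt)
  case (step c x y)
  from step(1) have "lsum (\<lambda>s. \<phi> (fst s) * \<psi> (snd s)) x = 0"
    unfolding tensor_rel_def
    by (elim UnE CollectE exE conjE; simp only: lsum_simps fst_conv snd_conv \<phi> \<psi>; simp add: algebra_simps)
  with step(2) show ?case by simp
qed simp

context hopf_eval
begin

lemma K_subspace: "fs.subspace K"
  unfolding fs.subspace_def fscale_eq_mult
  using pideal_0[OF ci.K] pideal_add[OF ci.K] pideal_mult_left[OF ci.K] by blast

text \<open>Functionals that vanish on \<open>K\<close> factor through \<open>e\<close>, and their
  product is defined on the tensor square of \<open>A\<close>. Pairing with it takes the place of
  independence of pure tensors.\<close>

lemma coproduct_functional:
  fixes g1 g2 :: "'k pvpoly \<Rightarrow> 'k"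
  assumes g1: "\<And>a b. g1 (a + b) = g1 a + g1 b" "\<And>c a. g1 (fscale c a) = c * g1 a" "\<And>a. a \<in> K \<Longrightarrow> g1 a = 0"
    and g2: "\<And>a b. g2 (a + b) = g2 a + g2 b" "\<And>c a. g2 (fscale c a) = c * g2 a" "\<And>a. a \<in> K \<Longrightarrow> g2 a = 0"
    and x: "thp e x \<in> Wt A A"
  shows "lsum (\<lambda>(m, n). g1 (single m 1) * g2 (single n 1)) x = 0"
proof -
  have func: "\<exists>\<phi>. (\<forall>f. \<phi> (e f) = g f)"
    if g: "\<And>a b. g (a + b) = g a + g b" "\<And>c a. g (fscale c a) = c * g a" "\<And>a. a \<in> K \<Longrightarrow> g a = 0"
    for g :: "'k pvpoly \<Rightarrow> 'k"
  proof (intro exI allI)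
    fix f
    have "e (SOME f'. e f' = e f) = e f" by (rule someI[of "\<lambda>f'. e f' = e f" f]) simp
    then have "(SOME f'. e f' = e f) - f \<in> K" by (simp add: e_eq_iff)
    then have "g ((SOME f'. e f' = e f) - f) = 0" by (rule g(3))
    then show "(\<lambda>a. g (SOME f'. e f' = a)) (e f) = g f"
      using g(1)[of "(SOME f'. e f' = e f) - f" f] by simp
  qed
  obtain \<phi> where \<phi>: "\<And>f. \<phi> (e f) = g1 f" using func[OF g1] by blast
  obtain \<psi> where \<psi>: "\<And>f. \<psi> (e f) = g2 f" using func[OF g2] by blast
  have car: "\<exists>f. a = e f" if "a \<in> carrier A" for a using that surj by blast
  have add: "\<chi> (a \<oplus> b) = \<chi> a + \<chi> b" and sc: "\<chi> (c \<odot> a) = c * \<chi> a"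
    if g: "\<And>f. \<chi> (e f) = g f" "\<And>a b. g (a + b) = g a + g b" "\<And>c a. g (fscale c a) = c * g a"
      and ab: "a \<in> carrier A" "b \<in> carrier A" for \<chi> and g :: "'k pvpoly \<Rightarrow> 'k" and a b c
  proof -
    obtain f f' where f: "a = e f" "b = e f'" using car ab by blast
    show "\<chi> (a \<oplus> b) = \<chi> a + \<chi> b" by (simp only: f ev_homD(2)[OF e, symmetric] g)
    show "\<chi> (c \<odot> a) = c * \<chi> a" by (simp only: f ev_homD(7)[OF e, symmetric] g)
  qed
  have "lsum (\<lambda>s. \<phi> (fst s) * \<psi> (snd s)) (thp e x) = 0"
    by (rule lsum_Wt[OF add[OF \<phi> g1(1,2)] sc[OF \<phi> g1(1,2)] add[OF \<psi> g2(1,2)] sc[OF \<psi> g2(1,2)] x])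
  then show ?thesis
    by (simp add: thp_def lsum_fextend \<phi> \<psi> case_prod_beta')
qed

lemma gam_polys: "l < p ^ s \<Longrightarrow> gam l \<in> (polys s :: 'k pvpoly set)"
  using polys_pgamma[of s s l, where ?'a = 'k] pgamma_eq_gam[where ?'k = 'k, of l s] p3 by (simp add: char)

lemma comb_polys:
  fixes c :: "nat \<times> nat \<Rightarrow> 'k"
  assumes "D \<subseteq> {..<p ^ s} \<times> UNIV"
  shows "comb D c \<in> polys s"
  unfolding comb_def fscale_eq_mult bas_def pconst_eq[symmetric]
  using assms by (intro polys_sum polys_mult polys_const polys_power polys_V gam_polys) auto

lemma linear_lsum:
  fixes g :: "'k pvpoly \<Rightarrow> 'k"
  assumes "\<And>a b. g (a + b) = g a + g b" "\<And>c a. g (fscale c a) = c * g a"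
  shows "lsum (\<lambda>m. g (single m 1)) f = g f"
proof -
  have g0: "g 0 = 0" using assms(2)[of 0 0] by simp
  have "g (\<Sum>m\<in>S. single m (h m)) = (\<Sum>m\<in>S. h m * g (single m 1))" if "finite S" for S h
    using that
  proof (induction S rule: finite_induct)
    case (insert x S)
    then show ?case using assms(2)[of "h x" "single x 1"] by (simp add: assms(1))
  qed (simp add: g0)
  from this[of "keys f" "lookup f"] show ?thesis
    by (simp add: lsum_eq poly_mapping_expand[symmetric])
qed

text \<open>A nontrivial relation of minimal degree is killed by the coproduct up to primitive terms:
  the coefficients of all decomposable basis elements vanish.\<close>

theorem independence:
  fixes M :: nat
  defines "D \<equiv> {..<p ^ s} \<times> {..<M}"
  assumes prim: "\<And>c. comb D c \<in> K \<Longrightarrow> (\<And>x a. x \<in> D \<Longrightarrow> decomposes TYPE('k) x a \<Longrightarrow> c x = 0)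
      \<Longrightarrow> \<forall>x\<in>D. c x = 0"
    and rel: "comb D c \<in> K"
  shows "\<forall>x\<in>D. c x = (0 :: 'k)"
proof -
  let ?deg = "\<lambda>x :: nat \<times> nat. fst x + snd x"
  have fin: "finite D" by (simp add: D_def)
  have down: "a \<in> D" if "x \<in> D" "fst a \<le> fst x" "snd a \<le> snd x" for x a
    using that by (auto simp: D_def mem_Times_iff)
  \<comment> \<open>Induction on a bound \<open>d\<close> for the degrees in the relation. The
    hypothesis for smaller bounds covers all coefficient functions, so it says that the basis
    elements of degree less than \<open>d\<close> are independent modulo \<open>K\<close>.\<close>
  have "\<forall>x\<in>D. c x = 0" if "\<And>x. x \<in> D \<Longrightarrow> d < ?deg x \<Longrightarrow> c x = 0" "comb D c \<in> K" for d c
    using that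
  proof (induction d arbitrary: c rule: less_induct)
    case (less d)
    \<comment> \<open>Such a functional exists because \<open>bas a\<close> is outside the sum of
      \<open>K\<close> and the span of the other basis elements of degree less than
      \<open>d\<close>; this sum is \<open>?C\<close>.\<close>
    have dual: "\<exists>g. (\<forall>a b. g (a + b) = g a + g b) \<and> (\<forall>r a. g (fscale r a) = r * g a) \<and> (\<forall>a\<in>K. g a = 0) \<and>
        (\<forall>x\<in>D. ?deg x < d \<longrightarrow> g (bas x) = (if x = a then 1 else (0::'k)))"
      if a: "a \<in> D" "?deg a < d" for a
    proof -
      let ?T = "{x \<in> D. ?deg x < d \<and> x \<noteq> a}"
      let ?C = "{f. \<exists>c'. (\<forall>x. x \<notin> ?T \<longrightarrow> c' x = 0) \<and> f - comb D c' \<in> K}"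
      have inC: "f \<in> ?C" if "\<And>x. x \<notin> ?T \<Longrightarrow> c' x = 0" "f - comb D c' \<in> K" for f c'
        using that by blast
      have sub: "fs.subspace ?C"
        unfolding fs.subspace_def
      proof (intro conjI ballI allI)
        show "0 \<in> ?C" by (rule inC[of "\<lambda>_. 0"]) (simp_all add: pideal_0[OF ci.K])
      next
        fix f f' assume "f \<in> ?C" "f' \<in> ?C"
        then obtain c1 c2 where c: "\<And>x. x \<notin> ?T \<Longrightarrow> c1 x = 0" "f - comb D c1 \<in> K"
          "\<And>x. x \<notin> ?T \<Longrightarrow> c2 x = 0" "f' - comb D c2 \<in> K" by blast
        show "f + f' \<in> ?C"
        proof (rule inC[of "\<lambda>x. c1 x + c2 x"])
          show "f + f' - comb D (\<lambda>x. c1 x + c2 x) \<in> K"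
            using pideal_add[OF ci.K c(2,4)] by (simp add: comb_add algebra_simps)
        qed (use c in simp)
      next
        fix r f assume "f \<in> ?C"
        then obtain c1 where c: "\<And>x. x \<notin> ?T \<Longrightarrow> c1 x = 0" "f - comb D c1 \<in> K" by blast
        show "fscale r f \<in> ?C"
        proof (rule inC[of "\<lambda>x. r * c1 x"])
          have "fscale r f - comb D (\<lambda>x. r * c1 x) = single 0 r * (f - comb D c1)"
            by (simp add: comb_scale fscale_eq_mult right_diff_distrib)
          then show "fscale r f - comb D (\<lambda>x. r * c1 x) \<in> K"
            using pideal_mult_left[OF ci.K c(2)] by simp
        qed (use c in simp)
      qed
      have nin: "bas a \<notin> ?C"
      proof
        assume "bas a \<in> ?C"
        then obtain c1 where c1: "\<And>x. x \<notin> ?T \<Longrightarrow> c1 x = 0" "bas a - comb D c1 \<in> K" by blast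
        \<comment> \<open>Were \<open>bas a\<close> in \<open>?C\<close>, these would be the
          coefficients of a relation of degree less than \<open>d\<close>, with 1 at
          \<open>a\<close>.\<close>
        let ?c = "\<lambda>x. (if x = a then 1 else 0) - c1 x"
        have "comb D ?c \<in> K" using c1(2) comb_single[OF fin a(1), where ?'a = 'k] by (simp add: comb_diff)
        moreover have "?c x = 0" if "x \<in> D" "d - 1 < ?deg x" for x
          using that a c1(1)[of x] by auto
        ultimately have "\<forall>x\<in>D. ?c x = 0" using less.IH[of "d - 1" ?c] a(2) by simp
        then have "?c a = 0" using a(1) by blast
        with c1(1)[of a] show False by simp
      qed
      obtain g where g: "\<And>a b. g (a + b) = g a + g b" "\<And>r a. g (fscale r a) = r * g a"
        "\<And>f. f \<in> ?C \<Longrightarrow> g f = 0" "g (bas a) = (1::'k)"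
        by (rule exists_functional[OF sub nin]) blast
      have "g f = 0" if "f \<in> K" for f
        using that by (intro g(3) inC[of "\<lambda>_. 0"]) simp_all
      moreover have "g (bas x) = 0" if "x \<in> D" "?deg x < d" "x \<noteq> a" for x
      proof (intro g(3) inC[of "\<lambda>y. if y = x then 1 else 0"])
        show "bas x - comb D (\<lambda>y. if y = x then 1 else 0) \<in> K"
          by (simp add: comb_single[OF fin that(1)] pideal_0[OF ci.K])
      qed (use that in auto)
      ultimately show ?thesis using g by (intro exI[of _ g]) auto
    qed
    have "c x = 0" if xD: "x \<in> D" and dec: "decomposes TYPE('k) x a" for x a
    proof (cases "d < ?deg x")
      case True
      then show ?thesis using less.prems(1) xD by blast
    next
      case False
      define b where "b = (fst x - fst a, snd x - snd a)"
      have le: "fst a \<le> fst x" "snd a \<le> snd x" "a \<noteq> (0, 0)" "a \<noteq> x" and sb0: "(of_nat (sb (snd x) (snd a)) :: 'k) \<noteq> 0"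
        using dec by (auto simp: decomposes_def)
      have b0: "b \<noteq> (0, 0)" using le by (auto simp: b_def prod_eq_iff)
      have degs: "?deg a < d" "?deg b < d" "0 < d"
        using le b0 False by (auto simp: b_def prod_eq_iff)
      have aD: "a \<in> D" and bD: "b \<in> D" and zD: "(0, 0) \<in> D"
        by (rule down[OF xD]; use le in \<open>simp add: b_def\<close>)+
      obtain g1 where g1: "\<And>a b. g1 (a + b) = g1 a + g1 b" "\<And>r a. g1 (fscale r a) = r * g1 a" "\<And>a. a \<in> K \<Longrightarrow> g1 a = 0"
        "\<And>x. x \<in> D \<Longrightarrow> ?deg x < d \<Longrightarrow> g1 (bas x) = (if x = a then 1 else (0::'k))"
        using dual[OF aD degs(1)] by blast
      obtain g2 where g2: "\<And>a b. g2 (a + b) = g2 a + g2 b" "\<And>r a. g2 (fscale r a) = r * g2 a" "\<And>a. a \<in> K \<Longrightarrow> g2 a = 0"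
        "\<And>x. x \<in> D \<Longrightarrow> ?deg x < d \<Longrightarrow> g2 (bas x) = (if x = b then 1 else (0::'k))"
        using dual[OF bD degs(2)] by blast
      \<comment> \<open>The tensor product of the functionals dual to \<open>a\<close> and to its
        complement \<open>b\<close>; it reads off the coefficient of bas a \<otimes> bas b.\<close>
      define F where "F = lsum (\<lambda>(m, n). g1 (single m 1) * g2 (single n 1))"
      have F_tens: "F (tens f f') = g1 f * g2 f'" for f f'
        unfolding F_def lsum_tens linear_lsum[OF g1(1,2)] linear_lsum[OF g2(1,2)] ..
      have F_Wt: "F y = 0" if "thp e y \<in> Wt A A" for y
        unfolding F_def by (rule coproduct_functional[OF g1(1-3) g2(1-3) that])
      have F_lin: "F (y + z) = F y + F z" "F (fscale r y) = r * F y" "F (\<Sum>i\<in>I. G i) = (\<Sum>i\<in>I. F (G i))" for y z r I and G :: "nat \<times> nat \<Rightarrow> 'k dpoly"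
        by (simp_all add: F_def lsum_sum)
      have F_sum: "F (\<Sum>i\<in>I. G i) = (\<Sum>i\<in>I. F (G i))" for I and G :: "nat \<Rightarrow> 'k dpoly"
        by (simp add: F_def lsum_sum)
      have F_of_nat: "F (of_nat n * y) = of_nat n * F y" for n y
        by (simp only: single_of_nat[symmetric] fscale_eq_mult[symmetric] F_lin)
      let ?S = "\<lambda>y. \<Sum>j\<le>fst y. \<Sum>i\<le>snd y. of_nat (sb (snd y) i) *
          tens (gam j * pvar V ^ i) (gam (fst y - j) * pvar V ^ (snd y - i)) :: 'k dpoly"
      have F_bas: "F (Delta (bas y)) = (\<Sum>j\<le>fst y. \<Sum>i\<le>snd y. of_nat (sb (snd y) i) * (g1 (bas (j, i)) * g2 (bas (fst y - j, snd y - i))))"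
        if "y \<in> D" for y
      proof -
        have "fst y < p ^ s" using that by (auto simp: D_def)
        from ci.Delta_gam_V[OF this, of "snd y"]
        have "F (Delta (bas y) - ?S y) = 0" by (intro F_Wt LidD) (simp add: bas_def)
        then have "F (Delta (bas y)) = F (?S y)" using F_lin(1)[of "Delta (bas y) - ?S y" "?S y"] by simp
        then show ?thesis by (simp add: F_sum F_of_nat F_tens bas_def)
      qed
      \<comment> \<open>A tensor in the coproduct of \<open>bas y\<close> either has a slot 1,
        killed by the functional on that side as \<open>a\<close> and \<open>b\<close> differ from
        (0, 0), or has both slots of degree less than \<open>d\<close>, where the functionals are
        dual. Only bas a \<otimes> bas b survives, and it occurs for y = x alone.\<close>
      have term_eq: "c y * (of_nat (sb (snd y) i) * (g1 (bas (j, i)) * g2 (bas (fst y - j, snd y - i))))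
          = (if y = x \<and> j = fst a \<and> i = snd a then c x * of_nat (sb (snd x) (snd a)) else 0)"
        if yD: "y \<in> D" and ji: "j \<le> fst y" "i \<le> snd y" for y j i
      proof (cases "c y = 0")
        case True
        then show ?thesis by auto
      next
        case False
        then have dy: "?deg y \<le> d" using less.prems(1)[OF yD] by force
        have D1: "(j, i) \<in> D" and D2: "(fst y - j, snd y - i) \<in> D"
          by (rule down[OF yD]; use ji in simp)+
        consider "(j, i) = (0, 0)" | "(fst y - j, snd y - i) = (0, 0)"
          | "?deg (j, i) < d" "?deg (fst y - j, snd y - i) < d"
          using dy ji by force
        then show ?thesis
        proof cases
          case 1
          then have "g1 (bas (j, i)) = 0" using g1(4)[OF zD] le(3) degs(3) by auto
          then show ?thesis using 1 le(3) by (auto simp: prod_eq_iff)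
        next
          case 2
          then have "g2 (bas (fst y - j, snd y - i)) = 0" using g2(4)[OF zD] b0 degs(3) by auto
          moreover have "\<not> (y = x \<and> j = fst a \<and> i = snd a)" using 2 b0 by (auto simp: b_def)
          ultimately show ?thesis by auto
        next
          case 3
          have "(j, i) = a \<and> (fst y - j, snd y - i) = b \<longleftrightarrow> y = x \<and> j = fst a \<and> i = snd a"
            using ji le by (auto simp: b_def prod_eq_iff)
          then show ?thesis using g1(4)[OF D1 3(1)] g2(4)[OF D2 3(2)] by auto
        qed
      qed
      have sum_y: "(\<Sum>j\<le>fst y. \<Sum>i\<le>snd y. if y = x \<and> j = fst a \<and> i = snd a then r else 0) = (if y = x then r else (0::'k))" for y r
      proof (cases "y = x")
        case True
        have "(\<Sum>j\<le>fst x. \<Sum>i\<le>snd x. if j = fst a \<and> i = snd a then r else 0)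
            = (\<Sum>j\<le>fst x. if j = fst a then \<Sum>i\<le>snd x. (if i = snd a then r else 0) else 0)"
          by (intro sum.cong refl) (auto intro: sum.neutral)
        also have "\<dots> = r" using le by (simp add: sum.delta)
        finally show ?thesis using True by simp
      qed simp
      have "e (comb D c) = e 0"
        using less.prems(2) pideal_0[OF ci.K] by (simp add: in_K)
      then have "th A e (Delta (comb D c)) = th A e (Delta 0)"
        using comult_e[OF comb_polys[of D c]] comult_e[OF polys_0] by (force simp: D_def)
      then have "thp e (Delta (comb D c)) \<in> Wt A A"
        by (simp add: th_eq_iff Delta_def)
      then have "0 = F (Delta (comb D c))" by (simp only: F_Wt)
      also have "\<dots> = (\<Sum>y\<in>D. c y * F (Delta (bas y)))"
        by (simp add: comb_def Delta_sum Delta_fscale F_lin)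
      also have "\<dots> = (\<Sum>y\<in>D. \<Sum>j\<le>fst y. \<Sum>i\<le>snd y. if y = x \<and> j = fst a \<and> i = snd a then c x * of_nat (sb (snd x) (snd a)) else 0)"
      proof (rule sum.cong[OF refl])
        fix y assume y: "y \<in> D"
        show "c y * F (Delta (bas y)) = (\<Sum>j\<le>fst y. \<Sum>i\<le>snd y.
            if y = x \<and> j = fst a \<and> i = snd a then c x * of_nat (sb (snd x) (snd a)) else 0)"
          unfolding F_bas[OF y] sum_distrib_left by (intro sum.cong refl term_eq[OF y]) simp_all
      qed
      also have "\<dots> = (\<Sum>y\<in>D. if y = x then c x * of_nat (sb (snd x) (snd a)) else 0)"
        by (simp only: sum_y)
      also have "\<dots> = c x * of_nat (sb (snd x) (snd a))"
        using xD fin by (simp add: sum.delta)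
      finally show ?thesis using sb0 by simp
    qed
    then show ?case using prim[OF less.prems(2)] by blast
  qed
  \<comment> \<open>All degrees in \<open>D\<close> are below this bound, so the condition on larger
    degrees is void.\<close>
  from this[of "p ^ s + M" c] rel show ?thesis by (force simp: D_def)
qed

end

section \<open>Kernels\<close>

definition degm :: "(pvar \<Rightarrow>\<^sub>0 nat) \<Rightarrow> nat"
  where "degm m = (\<Sum>x\<in>keys m. lookup m x)"

lemma degm_add: "degm (m + n) = degm m + degm n"
  unfolding degm_def by (rule setsum_keys_plus_distrib) simp_all

lemma degm_single [simp]: "degm (single x n) = n"
  by (cases "n = 0") (simp_all add: degm_def)

text \<open>Each variable has a power \<open>B x\<close> that is congruent to terms of smaller total
  degree, so the rewriting stops at monomials with all exponents below the bounds.\<close>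

lemma reduce_monomials:
  fixes N Sp :: "'k::field pvpoly set"
  assumes N: "pideal N" and Sp: "fs.subspace Sp" and NSp: "N \<subseteq> Sp"
    and red: "\<And>x. x \<in> insert V (U ` {..<s}) \<Longrightarrow>
      \<exists>q\<in>polys s. pvar x ^ B x - q \<in> N \<and> (\<forall>y\<in>keys q. degm y < B x)"
    and base: "\<And>m. m \<in> mons s \<Longrightarrow> \<forall>x\<in>insert V (U ` {..<s}). lookup m x < B x \<Longrightarrow> single m 1 \<in> Sp"
    and f: "f \<in> polys s"
  shows "f \<in> Sp"
proof -
  have mono: "single m 1 \<in> Sp" if "m \<in> mons s" for m
    using that
  proof (induction "degm m" arbitrary: m rule: less_induct)
    case less
    show ?case
    proof (cases "\<forall>x\<in>insert V (U ` {..<s}). lookup m x < B x")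
      case True
      then show ?thesis using base less.prems by blast
    next
      case False
      then obtain x where x: "x \<in> insert V (U ` {..<s})" "B x \<le> lookup m x" by (auto simp: not_less)
      define m' where "m' = m - single x (B x)"
      have m: "m = single x (B x) + m'"
        using x(2) by (intro poly_mapping_eqI) (auto simp: m'_def lookup_add lookup_minus lookup_single when_def)
      have m's: "m' \<in> mons s" using less.prems by (auto simp: m keys_add_nat)
      obtain q where q: "q \<in> polys s" "pvar x ^ B x - q \<in> N" "\<forall>y\<in>keys q. degm y < B x" using red[OF x(1)] by blast
      have "single m 1 = (pvar x ^ B x - q) * single m' 1 + q * single m' 1"
        by (simp add: m pvar_power mult_single left_diff_distrib)
      moreover have "(pvar x ^ B x - q) * single m' 1 \<in> Sp"
        using pideal_mult_right[OF N q(2)] NSp by blast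
      moreover have "q * single m' 1 \<in> Sp"
      proof -
        have "q * single m' 1 = (\<Sum>y\<in>keys q. fscale (lookup q y) (single (y + m') 1))"
          by (subst (1) poly_mapping_expand[of q]) (simp add: sum_distrib_right mult_single)
        also have "\<dots> \<in> Sp"
        proof (intro fs.subspace_sum[OF Sp] fs.subspace_scale[OF Sp] less.hyps)
          fix y assume y: "y \<in> keys q"
          show "degm (y + m') < degm m" using q(3) y by (simp add: m degm_add)
          have "y \<in> mons s" using q(1) y unfolding polys_def by blast
          then show "y + m' \<in> mons s" using m's by (simp add: keys_add_nat)
        qed
        finally show ?thesis .
      qed
      ultimately show ?thesis using fs.subspace_add[OF Sp] by simp
    qed
  qed
  have "f = (\<Sum>m\<in>keys f. fscale (lookup f m) (single m 1))"
    by (subst (1) poly_mapping_expand[of f]) simp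
  also have "\<dots> \<in> Sp"
    using f by (intro fs.subspace_sum[OF Sp] fs.subspace_scale[OF Sp] mono) (auto simp: polys_def)
  finally show ?thesis .
qed

lemma exists_digits:
  fixes d :: "nat \<Rightarrow> nat"
  assumes "0 < p" "\<And>i. i < s \<Longrightarrow> d i < p"
  shows "\<exists>l<p ^ s. \<forall>i<s. l div p ^ i mod p = d i"
  using assms(2)
proof (induction s arbitrary: d)
  case (Suc s)
  obtain l where l: "l < p ^ s" "\<forall>i<s. l div p ^ i mod p = d (Suc i)"
    using Suc.IH[of "\<lambda>i. d (Suc i)"] Suc.prems by auto
  have d0: "d 0 < p" using Suc.prems by simp
  have "p * l + d 0 < p ^ Suc s"
  proof -
    have "p * l + d 0 < p * Suc l" using d0 by simp
    also have "\<dots> \<le> p * p ^ s" using l(1) by (intro mult_le_mono2) simp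
    finally show ?thesis by simp
  qed
  moreover have "(p * l + d 0) div p ^ i mod p = d i" if "i < Suc s" for i
    using that l(2) d0 assms(1) by (cases i) (simp_all add: div_mult2_eq)
  ultimately show ?case by blast
qed auto

text \<open>Otherwise the t_i would be arbitrarily many independent vectors in the span of a finite
  set. Solving for the last vector makes the resulting relation monic.\<close>

lemma independent_sequence_dependent:
  fixes t :: "nat \<Rightarrow> ('s \<Rightarrow>\<^sub>0 'k::field)"
  assumes "finite B" "\<And>i. t i \<in> fs.span B"
  shows "\<exists>n u. t n = (\<Sum>i<n. fscale (u i) (t i))"
proof -
  have "\<exists>n. t n \<in> fs.span (t ` {..<n})"
  proof (rule ccontr)
    assume "\<not> ?thesis"
    then have nin: "t n \<notin> fs.span (t ` {..<n})" for n by blast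
    have "fs.independent (t ` {..<n}) \<and> card (t ` {..<n}) = n" for n
    proof (induction n)
      case (Suc n)
      have "t n \<notin> t ` {..<n}"
        using nin[of n] fs.span_superset[of "t ` {..<n}"] by (rule contra_subsetD[rotated])
      moreover have "fs.independent (insert (t n) (t ` {..<n}))"
        using nin[of n] Suc by (intro fs.independent_insertI) simp_all
      moreover from calculation(1) have "card (insert (t n) (t ` {..<n})) = Suc n"
        using Suc by (subst card_insert_disjoint) simp_all
      ultimately show ?case unfolding lessThan_Suc image_insert by (intro conjI)
    qed (simp add: fs.independent_empty)
    moreover have "t ` {..<Suc (card B)} \<subseteq> fs.span B" by (rule image_subsetI) (rule assms(2))
    ultimately have ind: "fs.independent (t ` {..<Suc (card B)})" "card (t ` {..<Suc (card B)}) = Suc (card B)"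
        "t ` {..<Suc (card B)} \<subseteq> fs.span B" by simp_all
    from fs.independent_span_bound[OF assms(1) ind(1,3)] ind(2) show False by simp
  qed
  then obtain n where n: "t n \<in> fs.span (t ` {..<n})" ..
  have "\<exists>u. x = (\<Sum>i<n. fscale (u i) (t i))" if "x \<in> fs.span (t ` {..<n})" for x
    using that
  proof (induction rule: fs.span_induct_alt)
    case base
    show ?case by (rule exI[of _ "\<lambda>_. 0"]) simp
  next
    case (step c x y)
    from step(1) obtain j where j: "j < n" "x = t j" by auto
    from step(2) obtain u where u: "y = (\<Sum>i<n. fscale (u i) (t i))" by (rule exE)
    have "(\<Sum>i<n. fscale (if i = j then c else 0) (t i)) = fscale c x"
      using j by (simp add: if_distrib[of "\<lambda>c. fscale c _"] sum.delta cong: if_cong)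
    then have "fscale c x + y = (\<Sum>i<n. fscale ((if i = j then c else 0) + u i) (t i))"
      by (simp only: fs.scale_left_distrib sum.distrib u)
    then show ?case by (intro exI[of _ "\<lambda>i. (if i = j then c else 0) + u i"])
  qed
  with n show ?thesis by blast
qed

section \<open>Indecomposable basis elements and the kernel of the evaluation\<close>

context hopf_eval
begin

abbreviation u0 :: "'k pvpoly" where "u0 \<equiv> pvar (U 0)"

lemma gam_1: "gam (Suc 0) = u0"
  using ci.gam_p_power[of 0] by simp

lemma odd_p: "odd p"
  using prime_odd_nat[OF ci.prime_p] p3 by simp

text \<open>If l and n are positive, the coproduct of \<gamma>_l v^n contains \<gamma>_l \<otimes>
  v^n. That of \<gamma>_l with l > 1 contains \<gamma>_1 \<otimes> \<gamma>_(l-1), and that of an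
  odd power v^n with n > 1 contains v \<otimes> v^(n-1). An even power v^(2a) with a > 0 is
  indecomposable only if all inner binomial coefficients of a vanish, hence only if a is a power of
  p.\<close>

lemma indecomposable_cases:
  assumes "\<And>a. \<not> decomposes TYPE('k) x a"
  shows "x = (0, 0) \<or> x = (1, 0) \<or> x = (0, 1) \<or> (\<exists>i. x = (0, 2 * p ^ i))"
proof -
  obtain l n where x: "x = (l, n)" by (cases x)
  have d: "\<not> (i \<le> l \<and> j \<le> n \<and> (i, j) \<noteq> (0, 0) \<and> (i, j) \<noteq> (l, n) \<and> (of_nat (sb n j) :: 'k) \<noteq> 0)" for i j
    using assms[of "(i, j)"] by (simp add: decomposes_def x)
  have sb0: "sb n 0 = 1" by (simp add: sb_def)
  show ?thesis
  proof (cases "l = 0")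
    case False
    then have "n = 0" using d[of l 0] sb0 by auto
    moreover from this have "l = 1" using d[of 1 0] sb0 False by auto
    ultimately show ?thesis by (simp add: x)
  next
    case l: True
    show ?thesis
    proof (cases "even n")
      case False
      then have "sb n 1 = 1" by (simp add: sb_def)
      then have "n = 1" using d[of 0 1] l False by (auto elim: oddE)
      then show ?thesis using l by (simp add: x)
    next
      case True
      then obtain a where n: "n = 2 * a" by (elim evenE)
      show ?thesis
      proof (cases "a = 0 \<or> (\<exists>i. a = p ^ i)")
        case False
        then obtain k where k: "0 < k" "k < a" "(of_nat (a choose k) :: 'k) \<noteq> 0"
          using choose_not_prime_power[where ?'k = 'k, of a] p3 unfolding char by auto
        then have "sb n (2 * k) = a choose k" by (simp add: sb_def n)
        then show ?thesis using d[of 0 "2 * k"] k l n by auto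
      qed (use l n x in auto)
    qed
  qed
qed

lemma K_smult: "fscale c f \<in> K \<Longrightarrow> c \<noteq> 0 \<Longrightarrow> f \<in> K"
  using fs.subspace_scale[OF K_subspace, of "fscale c f" "1 / c"] by simp

lemma K_lookup_0: "f \<in> K \<Longrightarrow> f \<in> polys s \<Longrightarrow> lookup f 0 = 0"
  using counit_e[of f] counit_e[of 0] e_eq_iff[of f 0] by simp

text \<open>The decomposition of 0 in \<open>A\<close> into homogeneous parts is unique.\<close>

lemma K_parity:
  assumes "vpar 0 f" "vpar 1 g" "f + g \<in> K"
  shows "f \<in> K" "g \<in> K"
proof -
  have "e f \<oplus> e g = \<zero>" using assms(3) by (simp add: in_K ev_homD(2)[OF e])
  then have "component A 0 \<zero> = e f"
    using ev_homD(6)[OF e assms(1)] ev_homD(6)[OF e assms(2)] by (intro component_unique[of _ _ "e g"]) simp_all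
  then have "e f = \<zero>" using component_part[OF part_zero, of 0 0] by simp
  then show f: "f \<in> K" by (simp add: in_K)
  show "g \<in> K" using pideal_diff[OF ci.K assms(3) f] by simp
qed

text \<open>The exponents of the u_i are the base-\<open>p\<close> digits of \<open>l\<close>; the
  two sides differ by the product of their factorials, which is invertible as the digits are less
  than p.\<close>

lemma single_eq_bas:
  assumes m: "m \<in> mons s" "\<And>i. i < s \<Longrightarrow> lookup m (U i) < p"
  shows "\<exists>r l. l < p ^ s \<and> single m 1 = fscale r (bas (l, lookup m V) :: 'k pvpoly)"
proof -
  obtain l where l: "l < p ^ s" "\<forall>i<s. l div p ^ i mod p = lookup m (U i)"
    using exists_digits[of p s "\<lambda>i. lookup m (U i)"] m(2) p3 by auto
  let ?c = "\<Prod>i<s. pconst (1 / of_nat (fact (lookup m (U i)))) :: 'k pvpoly"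
  have pc: "?c = pconst (\<Prod>i<s. 1 / of_nat (fact (lookup m (U i))))"
    by (induction s) (simp_all only: lessThan_0 prod.empty prod.lessThan_Suc pconst_simps)
  have nz: "(\<Prod>i<s. 1 / of_nat (fact (lookup m (U i)))) \<noteq> (0::'k)"
  proof -
    have "of_nat (fact n) \<noteq> (0::'k)" if "n < p" for n
      using that prime_dvd_fact_iff[OF ci.prime_p, of n] by (simp add: of_nat_eq_0_iff_char_dvd char[symmetric])
    then show ?thesis using m(2) by (simp add: prod_zero_iff)
  qed
  have "gam l = (\<Prod>i<s. pconst (1 / of_nat (fact (lookup m (U i)))) * pvar (U i) ^ lookup m (U i) :: 'k pvpoly)"
    using pgamma_eq_gam[where ?'k = 'k, of l s] l p3 by (simp add: char[symmetric] pgamma_def Let_def)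
  moreover have "single m 1 = (\<Prod>i<s. pvar (U i) ^ lookup m (U i)) * (pvar V ^ lookup m V :: 'k pvpoly)"
  proof -
    have "single m 1 = (\<Prod>x\<in>insert V (U ` {..<s}). pvar x ^ lookup m x :: 'k pvpoly)"
      unfolding mval_pvar[symmetric] using m(1) by (intro mval_superset) auto
    also have "\<dots> = pvar V ^ lookup m V * (\<Prod>x\<in>U ` {..<s}. pvar x ^ lookup m x)"
      by (subst prod.insert) auto
    also have "(\<Prod>x\<in>U ` {..<s}. pvar x ^ lookup m x) = (\<Prod>i<s. pvar (U i) ^ lookup m (U i) :: 'k pvpoly)"
      by (subst prod.reindex) (auto simp: inj_on_def)
    finally show ?thesis by (simp add: mult.commute)
  qed
  ultimately have "bas (l, lookup m V) = ?c * (single m 1 :: 'k pvpoly)"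
    by (simp add: bas_def prod.distrib mult.assoc)
  then have "bas (l, lookup m V) = fscale (\<Prod>i<s. 1 / of_nat (fact (lookup m (U i)))) (single m 1 :: 'k pvpoly)"
    unfolding pc by (simp only: fscale_eq_mult pconst_eq)
  then have "single m 1 = fscale (1 / (\<Prod>i<s. 1 / of_nat (fact (lookup m (U i))))) (bas (l, lookup m V) :: 'k pvpoly)"
    using nz by (simp del: fscale_single)
  then show ?thesis using l(1) by blast
qed

text \<open>Modulo \<open>Nid g\<close> every polynomial reduces to a combination of \<gamma>_l v^n
  with l < p^s and n < M. If the polynomial is in \<open>K\<close>, so is the combination, which is
  then 0 by \<open>independence\<close>.\<close>

theorem kernel_generated:
  assumes g: "g \<in> polys s" "e g = \<zero>"
    and q: "q \<in> polys s" "pvar V ^ M - q \<in> Nid g" "\<And>y. y \<in> keys q \<Longrightarrow> degm y < M"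
    and prim: "\<And>c. comb ({..<p ^ s} \<times> {..<M}) c \<in> K \<Longrightarrow>
      (\<And>x a. x \<in> {..<p ^ s} \<times> {..<M} \<Longrightarrow> decomposes TYPE('k) x a \<Longrightarrow> c x = 0)
      \<Longrightarrow> \<forall>x\<in>{..<p ^ s} \<times> {..<M}. c x = 0"
    and f: "f \<in> K"
  shows "f \<in> Nid g"
proof -
  let ?D = "{..<p ^ s} \<times> {..<M}"
  note N = pideal_Nid[OF g] and NK = Nid_K[OF g] and JN = J_Nid[OF g]
  let ?Sp = "{f. \<exists>c. f - comb ?D c \<in> Nid g}"
  have inSp: "f \<in> ?Sp" if "f - comb ?D c \<in> Nid g" for f c using that by blast
  have Sp: "fs.subspace ?Sp"
    unfolding fs.subspace_def
  proof (intro conjI ballI allI)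
    show "0 \<in> ?Sp" by (rule inSp[of _ "\<lambda>_. 0"]) (simp add: pideal_0[OF N])
  next
    fix f f' assume "f \<in> ?Sp" "f' \<in> ?Sp"
    then obtain c c' where "f - comb ?D c \<in> Nid g" "f' - comb ?D c' \<in> Nid g" by blast
    from pideal_add[OF N this] show "f + f' \<in> ?Sp"
      by (intro inSp[of _ "\<lambda>x. c x + c' x"]) (simp add: comb_add algebra_simps)
  next
    fix r f assume "f \<in> ?Sp"
    then obtain c where "f - comb ?D c \<in> Nid g" by blast
    from pideal_mult_left[OF N this, of "single 0 r"] show "fscale r f \<in> ?Sp"
      by (intro inSp[of _ "\<lambda>x. r * c x"]) (simp add: comb_scale fscale_eq_mult right_diff_distrib)
  qed
  have relN: "\<rho> \<in> Nid g" if "\<rho> \<in> PP_rels s" for \<rho>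
    using P.rels_J JN that by blast
  have fs: "trunc s f \<in> ?Sp"
  proof (rule reduce_monomials[OF N Sp, where B = "\<lambda>x. case x of U i \<Rightarrow> p | V \<Rightarrow> M" and s = s])
    show "Nid g \<subseteq> ?Sp"
    proof
      fix f assume "f \<in> Nid g"
      then show "f \<in> ?Sp" by (intro inSp[of _ "\<lambda>_. 0"]) simp
    qed
    show "trunc s f \<in> polys s" by (rule trunc_in_polys)
  next
    fix x assume "x \<in> insert V (U ` {..<s})"
    then consider "x = V" | i where "x = U i" "Suc i < s" | "x = U (s - 1)"
    proof (cases x)
      case (U i)
      then have "i < s" using \<open>x \<in> insert V (U ` {..<s})\<close> by auto
      then show thesis using that(2)[OF U] that(3) U by (cases "Suc i < s") (auto simp: not_less le_antisym)
    qed
    then show "\<exists>q\<in>polys s. pvar x ^ (case x of U i \<Rightarrow> p | V \<Rightarrow> M) - q \<in> Nid g \<and>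
        (\<forall>y\<in>keys q. degm y < (case x of U i \<Rightarrow> p | V \<Rightarrow> M))"
    proof cases
      case 1
      then show ?thesis using q by auto
    next
      case (2 i)
      then have "pvar (U i) ^ p \<in> Nid g" by (intro relN) (auto simp: PP_rels_def char)
      then show ?thesis using 2 by (intro bexI[of _ 0]) simp_all
    next
      case 3
      have "pvar (U (s - 1)) ^ p + pvar V ^ 2 \<in> Nid g" by (intro relN) (auto simp: PP_rels_def char)
      \<comment> \<open>Replacing u_(s-1)^p by -v^2 lowers the degree because p > 2.\<close>
      moreover have "degm y < p" if "y \<in> keys (- (pvar V ^ 2) :: 'k pvpoly)" for y
        using that p3 by (auto simp: pvar_power single_uminus[symmetric] split: if_splits)
      moreover have "- (pvar V ^ 2) \<in> (polys s :: 'k pvpoly set)" by (intro polys_uminus polys_power polys_V)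
      ultimately show ?thesis
        using 3 by (intro bexI[of _ "- (pvar V ^ 2)"]) simp_all
    qed
  next
    fix m assume m: "m \<in> mons s" and lt: "\<forall>x\<in>insert V (U ` {..<s}). lookup m x < (case x of U i \<Rightarrow> p | V \<Rightarrow> M)"
    obtain r l where rl: "l < p ^ s" "single m 1 = fscale r (bas (l, lookup m V) :: 'k pvpoly)"
      using single_eq_bas[OF m] lt by auto
    have "bas (l, lookup m V) = comb ?D (\<lambda>y. if y = (l, lookup m V) then 1 else (0::'k))"
      using rl lt by (subst comb_single) auto
    then have "bas (l, lookup m V) \<in> ?Sp"
      using pideal_0[OF N] by (intro inSp[of _ "\<lambda>y. if y = (l, lookup m V) then 1 else 0"]) simp
    then show "single m 1 \<in> ?Sp" unfolding rl(2) by (rule fs.subspace_scale[OF Sp])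
  qed
  then obtain c where c: "trunc s f - comb ?D c \<in> Nid g" by blast
  have "trunc s f \<in> K" using f by (simp add: in_K e_trunc)
  moreover have "trunc s f - comb ?D c \<in> K" using c NK by (rule rev_subsetD)
  ultimately have "comb ?D c \<in> K"
    using pideal_diff[OF ci.K, of "trunc s f" "trunc s f - comb ?D c"] by simp
  from independence[OF prim this] have "\<forall>x\<in>?D. c x = 0" by blast
  then have "comb ?D c = 0" unfolding comb_def by (intro sum.neutral) auto
  with c have "trunc s f \<in> Nid g" by simp
  then show ?thesis by (simp add: Nid_def P.ecl_def trunc_polys[OF trunc_in_polys])
qed

text \<open>With \<open>g = v\<close> the bound is M = 1, so only the \<gamma>_l remain; the
  indecomposable ones are 1 and u_0. The counit removes 1, and u_0 is nonzero in
  \<open>A\<close>.\<close>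

theorem iso_kGa_case:
  assumes u: "e u0 \<noteq> \<zero>" and v: "e (pvar V) = \<zero>"
  shows "iso_kGa A s"
proof -
  have g: "pvar V \<in> polys s" "e (pvar V) = \<zero>" using v by simp_all
  have "f \<in> Nid (pvar V)" if "f \<in> K" for f
  proof (rule kernel_generated[OF g polys_0, of 1])
    show "pvar V ^ 1 - 0 \<in> Nid (pvar V)" using g_Nid[OF g] by simp
    fix c :: "nat \<times> nat \<Rightarrow> 'k"
    let ?D = "{..<p ^ s} \<times> {..<1::nat}"
    assume cK: "comb ?D c \<in> K" and dec: "\<And>x a. x \<in> ?D \<Longrightarrow> decomposes TYPE('k) x a \<Longrightarrow> c x = 0"
    have z: "c x = 0" if "x \<in> ?D" "x \<noteq> (0, 0)" "x \<noteq> (1, 0)" for x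
      using indecomposable_cases[of x] dec[OF that(1)] that p3 by auto
    have "1 < p ^ s" using p3 s1 by (intro one_less_power) auto
    then have sub: "{(0, 0), (1, 0)} \<subseteq> ?D" using p3 by auto
    have "comb ?D c = comb {(0, 0), (1, 0)} c"
      unfolding comb_def by (rule sum.mono_neutral_right) (use sub z in auto)
    also have "\<dots> = pconst (c (0, 0)) + fscale (c (1, 0)) u0"
      by (simp add: comb_def bas_def gam_1 fscale_eq_mult pconst_eq)
    finally have eq: "comb ?D c = pconst (c (0, 0)) + fscale (c (1, 0)) u0" .
    have "lookup (comb ?D c) 0 = 0" using cK comb_polys[of ?D c] by (intro K_lookup_0) auto
    moreover have "lookup u0 0 = 0"
    proof -
      have "single (U 0) 1 \<noteq> (0 :: pvar \<Rightarrow>\<^sub>0 nat)"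
      proof
        assume "single (U 0) 1 = (0 :: pvar \<Rightarrow>\<^sub>0 nat)"
        then have "lookup (single (U 0) (1::nat)) (U 0) = 0" by (simp only: lookup_zero)
        then show False by simp
      qed
      then show ?thesis by (simp add: pvar_def lookup_single)
    qed
    then have "lookup (comb ?D c) 0 = c (0, 0)" unfolding eq by (simp add: lookup_add pconst_def)
    ultimately have c0: "c (0, 0) = 0" by (simp only:)
    then have "fscale (c (1, 0)) u0 \<in> K" using cK eq by simp
    then have "c (1, 0) = 0" using K_smult u in_K by blast
    with c0 z show "\<forall>x\<in>?D. c x = 0" by blast
  qed (use that in simp_all)
  then have "A \<cong>\<^sub>H PP_quot s (pvar V)" by (rule iso_PP_quot[OF g])
  then show ?thesis using s1 by (simp add: iso_kGa_def kGa_def)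
qed

text \<open>The shape of an even relation among indecomposable basis elements, made monic: an
  additive polynomial in v^2 plus a multiple of u_0.\<close>

definition Wrel :: "nat \<Rightarrow> (nat \<Rightarrow> 'k) \<Rightarrow> 'k \<Rightarrow> 'k pvpoly"
  where "Wrel t b \<eta> = pvar V ^ (2 * p ^ t) + (\<Sum>i<t. fscale (b i) (pvar V ^ (2 * p ^ i))) + fscale \<eta> u0"

text \<open>Finite dimension makes the images of the v^(2p^i) linearly dependent. To find the
  dependence, their coordinates with respect to a finite generating set \<open>B\<close> are lifted
  to the free vector space on \<open>B\<close>.\<close>

lemma exists_Wrel:
  assumes "finite_dim A"
  shows "\<exists>t b. Wrel t b 0 \<in> K"
proof -
  define w where "w i = (pvar V ^ (2 * p ^ i) :: 'k pvpoly)" for i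
  obtain B where B: "finite B" "B \<subseteq> carrier A" "\<forall>x\<in>carrier A. \<exists>c. x = (\<Oplus>b\<in>B. c b \<odot> b)"
    using assms by (auto simp: finite_dim_def)
  have "\<forall>i. \<exists>c. e (w i) = (\<Oplus>b\<in>B. c b \<odot> b)" using B(3) ev_homD(1)[OF e] by blast
  from choice[OF this] obtain c where c: "\<And>i. e (w i) = (\<Oplus>b\<in>B. c i b \<odot> b)" by blast
  define t where "t i = (\<Sum>b\<in>B. single b (c i b))" for i
  have lt: "lookup (t i) b = c i b" if "b \<in> B" for i b
    using that B(1) by (simp add: t_def lookup_sum lookup_single when_def)
  have kt: "keys (t i) \<subseteq> B" for i
    unfolding t_def by (rule order.trans[OF keys_sum]) auto
  have id: "(\<lambda>a. a) \<in> carrier A \<rightarrow> carrier A" by simp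
  have fl: "flin A (\<lambda>a. a) (t i) = e (w i)" for i
  proof -
    have "flin A (\<lambda>a. a) (t i) = (\<Oplus>b\<in>B. lookup (t i) b \<odot> b)"
      by (rule flin_superset[OF module_axioms id B(1) kt B(2)])
    also have "\<dots> = (\<Oplus>b\<in>B. c i b \<odot> b)" using B(2) by (intro finsum_cong') (auto simp: lt)
    finally show ?thesis by (simp add: c)
  qed
  have "t i \<in> fs.span ((\<lambda>b. single b 1) ` B)" for i
  proof -
    have "single b (c i b) \<in> fs.span ((\<lambda>b. single b 1) ` B)" if "b \<in> B" for b
      using fs.span_scale[OF fs.span_base[of "single b 1" "(\<lambda>b. single b 1) ` B"], of "c i b"] that by simp
    then show ?thesis unfolding t_def by (rule fs.span_sum)
  qed
  then obtain n u where nu: "t n = (\<Sum>i<n. fscale (u i) (t i))"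
    using independent_sequence_dependent[of "(\<lambda>b. single b 1) ` B" t] B(1) by blast
  have ksum: "keys (\<Sum>i<m. fscale (u i) (t i)) \<subseteq> carrier A" for m
  proof (induction m)
    case (Suc m)
    have "keys (t m) \<subseteq> carrier A" using kt B(2) by blast
    with Suc show ?case unfolding sum.lessThan_Suc by (intro keys_add_subset keys_fscale_subset)
  qed simp
  have "flin A (\<lambda>a. a) (\<Sum>i<m. fscale (u i) (t i)) = e (\<Sum>i<m. fscale (u i) (w i))" for m
  proof (induction m)
    case 0
    then show ?case using ev_hom_zero[OF superalgebra_A e] by (simp add: flin_def)
  next
    case (Suc m)
    have k: "keys (t m) \<subseteq> carrier A" using kt B(2) by blast
    show ?case
      using Suc ksum[of m] k
      by (simp add: flin_add[OF module_axioms id] flin_fscale[OF module_axioms id] keys_fscale_subset fl ev_homD(2,7)[OF e])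
  qed
  from this[of n] have "e (w n) = e (\<Sum>i<n. fscale (u i) (w i))" unfolding nu[symmetric] fl .
  then have "w n - (\<Sum>i<n. fscale (u i) (w i)) \<in> K" by (simp add: e_eq_iff)
  then have "Wrel n (\<lambda>i. - u i) 0 \<in> K"
    by (simp add: Wrel_def w_def sum_negf)
  then show ?thesis by blast
qed

end

lemma map_poly_pconst_add: "map_poly pconst (f + g) = map_poly pconst f + map_poly pconst g"
  by (rule poly_eqI) (simp add: coeff_map_poly)

lemma poly_map_poly_pconst_sum:
  "poly (map_poly pconst (\<Sum>i\<in>I. monom (c i) (n i))) x = (\<Sum>i\<in>I. pconst (c i) * x ^ n i)"
proof (induction I rule: infinite_finite_induct)
  case (insert i I)
  then show ?case by (simp add: map_poly_pconst_add map_poly_monom poly_monom)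
qed simp_all

context hopf_eval
begin

text \<open>For the least t the power v^(2p^t) can be eliminated, while no relation is left among
  the indecomposable elements of smaller degree. So \<open>kernel_generated\<close> applies with M =
  2p^t.\<close>

lemma iso_kM_case:
  assumes u: "e u0 \<noteq> \<zero>" and v: "e (pvar V) \<noteq> \<zero>" and fin: "finite_dim A"
  shows "\<exists>f \<eta>. inseparable_p_poly f \<and> f \<noteq> 0 \<and> A \<cong>\<^sub>H kM s f \<eta>"
proof -
  have ex: "\<exists>t b \<eta>. Wrel t b \<eta> \<in> K" using exists_Wrel[OF fin] by blast
  define t where "t = (LEAST t. \<exists>b \<eta>. Wrel t b \<eta> \<in> K)"
  have t: "\<exists>b \<eta>. Wrel t b \<eta> \<in> K" unfolding t_def by (rule LeastI_ex) (rule ex)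
  have least: "\<not> (\<exists>b \<eta>. Wrel t' b \<eta> \<in> K)" if "t' < t" for t'
    using not_less_Least that unfolding t_def by blast
  from t obtain b \<eta> where W: "Wrel t b \<eta> \<in> K" by blast
  \<comment> \<open>As v^(2p^i) is -u_(s-1)^(p^(i+1)), the coefficient of index i moves to index i +
    1; the leading coefficient 1 sits at \<open>Suc t\<close>.\<close>
  define c where "c i = (if i = Suc t then 1 else b (i - 1))" for i
  define f where "f = (\<Sum>i = 1..Suc t. Polynomial.monom (c i) (p ^ i))"
  \<comment> \<open>The sign of \<eta> changes: modulo the relations, \<open>g\<close> is the
    negative of \<open>Wrel t b \<eta>\<close>.\<close>
  define g where "g = poly (map_poly pconst f) (pvar (U (s - 1))) + pconst (- \<eta>) * u0"
  let ?u = "pvar (U (s - 1)) :: 'k pvpoly"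
  have fsum: "poly (map_poly pconst f) ?u = (\<Sum>i\<le>t. pconst (c (Suc i)) * ?u ^ (p ^ Suc i))"
    unfolding f_def poly_map_poly_pconst_sum
    using sum.shift_bounds_cl_Suc_ivl[of "\<lambda>i. pconst (c i) * ?u ^ (p ^ i)" 0 t]
    by (simp add: atMost_atLeast0 del: power_Suc)
  have Wsum: "Wrel t b \<eta> = (\<Sum>i\<le>t. pconst (c (Suc i)) * pvar V ^ (2 * p ^ i)) + pconst \<eta> * u0"
  proof -
    have "(\<Sum>i\<le>t. pconst (c (Suc i)) * pvar V ^ (2 * p ^ i))
        = (\<Sum>i<t. pconst (c (Suc i)) * pvar V ^ (2 * p ^ i)) + pvar V ^ (2 * p ^ t)"
      by (simp add: lessThan_Suc_atMost[symmetric] c_def)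
    also have "(\<Sum>i<t. pconst (c (Suc i)) * pvar V ^ (2 * p ^ i)) = (\<Sum>i<t. fscale (b i) (pvar V ^ (2 * p ^ i)))"
      by (intro sum.cong refl) (simp add: c_def fscale_eq_mult pconst_eq)
    finally show ?thesis by (simp add: Wrel_def fscale_eq_mult pconst_eq)
  qed
  \<comment> \<open>Used twice: for \<open>K\<close>, to see that \<open>g\<close> vanishes in
    \<open>A\<close>, and for \<open>Nid g\<close>, to see that v^(2p^t) reduces there. It rests on
    (-v^2)^(p^i) = -v^(2p^i), p being odd.\<close>
  have gW: "g + Wrel t b \<eta> \<in> N" if N: "pideal N" and uv: "?u ^ p + pvar V ^ 2 \<in> N" for N
  proof -
    have "?u ^ (p ^ Suc i) + pvar V ^ (2 * p ^ i) \<in> N" for i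
    proof -
      have "(?u ^ p) ^ (p ^ i) - (- (pvar V ^ 2)) ^ (p ^ i) \<in> N"
        by (rule cong_power'[OF N]) (use uv in simp)
      moreover have "(- (pvar V ^ 2)) ^ (p ^ i) = - (pvar V ^ (2 * p ^ i) :: 'k pvpoly)"
        using odd_p by (simp add: power_minus_odd power_mult)
      ultimately show ?thesis by (simp add: power_mult)
    qed
    then have "(\<Sum>i\<le>t. pconst (c (Suc i)) * (?u ^ (p ^ Suc i) + pvar V ^ (2 * p ^ i))) \<in> N"
      by (intro pideal_sum[OF N] pideal_mult_left[OF N])
    moreover have "g + Wrel t b \<eta> = (\<Sum>i\<le>t. pconst (c (Suc i)) * (?u ^ (p ^ Suc i) + pvar V ^ (2 * p ^ i)))"
      unfolding g_def fsum Wsum by (simp add: distrib_left sum.distrib del: power_Suc)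
    ultimately show ?thesis by simp
  qed
  have gs: "g \<in> polys s"
    unfolding g_def fsum using s1
    by (intro polys_add polys_sum polys_mult polys_power polys_const polys_U) auto
  have "g \<in> K" using pideal_diff[OF ci.K gW[OF ci.K u_v_K] W] by simp
  then have g: "g \<in> polys s" "e g = \<zero>" using gs by (simp_all add: in_K)
  note N = pideal_Nid[OF g]
  have "?u ^ p + pvar V ^ 2 \<in> Nid g"
  proof -
    have "?u ^ p + pvar V ^ 2 \<in> PP_rels s" by (simp add: PP_rels_def char)
    then have "?u ^ p + pvar V ^ 2 \<in> P.J" by (rule subsetD[OF P.rels_J])
    then show ?thesis by (rule subsetD[OF J_Nid[OF g]])
  qed
  then have WN: "Wrel t b \<eta> \<in> Nid g" using pideal_diff[OF N gW[OF N] g_Nid[OF g]] by simp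
  define q where "q = - ((\<Sum>i<t. fscale (b i) (pvar V ^ (2 * p ^ i))) + fscale \<eta> u0)"
  let ?M = "2 * p ^ t"
  let ?D = "{..<p ^ s} \<times> {..<?M}"
  have ppos: "0 < p ^ i" for i using p3 by simp
  have kernel: "f' \<in> Nid g" if "f' \<in> K" for f'
  proof (rule kernel_generated[OF g, of q ?M])
    show "q \<in> polys s"
      unfolding q_def fscale_eq_mult pconst_eq[symmetric] using s1
      by (intro polys_uminus polys_add polys_sum polys_mult polys_power polys_const polys_U polys_V) simp
    show "pvar V ^ ?M - q \<in> Nid g" using WN unfolding q_def Wrel_def diff_minus_eq_add add.assoc .
    show "degm y < ?M" if "y \<in> keys q" for y
    proof -
      have *: "keys (pvar x ^ n :: 'k pvpoly) \<subseteq> {y. degm y < ?M}" if "n < ?M" for x n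
        using that by (simp add: pvar_power)
      have "keys q \<subseteq> {y. degm y < ?M}"
        unfolding q_def
      proof (intro keys_uminus_subset keys_add_subset keys_fscale_subset order.trans[OF keys_sum] UN_least)
        show "keys (pvar V ^ (2 * p ^ i) :: 'k pvpoly) \<subseteq> {y. degm y < ?M}" if "i \<in> {..<t}" for i
          using that p3 by (intro *) simp
        show "keys u0 \<subseteq> {y. degm y < ?M}"
          using *[of 1 "U 0"] ppos[of t] by simp
      qed
      then show ?thesis using that by blast
    qed
    show "f' \<in> K" by (rule that)
  next
    fix d :: "nat \<times> nat \<Rightarrow> 'k"
    assume dK: "comb ?D d \<in> K" and dec: "\<And>x a. x \<in> ?D \<Longrightarrow> decomposes TYPE('k) x a \<Longrightarrow> d x = 0"
    let ?I = "insert (0, 0) (insert (1, 0) (insert (0, 1) ((\<lambda>i. (0, 2 * p ^ i)) ` {..<t})))"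
    have z: "d x = 0" if x: "x \<in> ?D" "x \<notin> ?I" for x
    proof (cases "\<exists>a. decomposes TYPE('k) x a")
      case True
      then show ?thesis using dec[OF x(1)] by blast
    next
      case False
      then obtain i where i: "x = (0, 2 * p ^ i)" using indecomposable_cases[of x] x(2) by blast
      then have "p ^ i < p ^ t" using x(1) by simp
      then have "i < t" using p3 by (simp add: power_strict_increasing_iff)
      then show ?thesis using x(2) i by blast
    qed
    have p1: "1 < p ^ s" using p3 s1 by (intro one_less_power) auto
    have sub: "?I \<subseteq> ?D"
    proof -
      have M1: "0 < ?M" "1 < ?M" using ppos[of t] by linarith+
      have Mi: "2 * p ^ i < ?M" if "i < t" for i
        using that p3 by simp
      have "(0, 0) \<in> ?D" "(1, 0) \<in> ?D" "(0, 1) \<in> ?D" using M1 p1 p3 by simp_all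
      moreover have "(0, 2 * p ^ i) \<in> ?D" if "i < t" for i using Mi[OF that] p1 p3 by simp
      ultimately show ?thesis by blast
    qed
    let ?ev = "pconst (d (0, 0)) + fscale (d (1, 0)) u0 + (\<Sum>i<t. fscale (d (0, 2 * p ^ i)) (pvar V ^ (2 * p ^ i)))"
    have "comb ?D d = comb ?I d"
      unfolding comb_def by (rule sum.mono_neutral_right) (use sub z in auto)
    also have "\<dots> = ?ev + fscale (d (0, 1)) (pvar V)"
    proof -
      have "inj_on (\<lambda>i. (0::nat, 2 * p ^ i)) {..<t}"
        using p3 by (auto simp: inj_on_def)
      then have im: "(\<Sum>x\<in>(\<lambda>i. (0, 2 * p ^ i)) ` {..<t}. fscale (d x) (bas x))
          = (\<Sum>i<t. fscale (d (0, 2 * p ^ i)) (pvar V ^ (2 * p ^ i)))"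
        by (simp add: sum.reindex bas_def)
      have n1: "2 * p ^ i \<noteq> Suc 0" for i by presburger
      show ?thesis
        unfolding comb_def
        using im p3 n1 by (simp add: image_iff bas_def gam_1 fscale_eq_mult pconst_eq ac_simps)
    qed
    finally have eq: "comb ?D d = ?ev + fscale (d (0, 1)) (pvar V)" .
    have vev: "vpar 0 ?ev"
      unfolding fscale_eq_mult pconst_eq[symmetric] vpar_0_iff
    proof (intro even_v_add even_v_mult even_v_const even_v_U)
      show "even_v (\<Sum>i<t. pconst (d (0, 2 * p ^ i)) * pvar V ^ (2 * p ^ i))"
        by (induction t) (auto simp: even_v_def[of 0] power_mult intro!: even_v_add even_v_mult even_v_power[OF even_v_V2])
    qed
    have vod: "vpar 1 (fscale (d (0, 1)) (pvar V))"
      unfolding fscale_eq_mult pconst_eq[symmetric] by (intro vpar_smult vpar_V)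
    have ev: "?ev \<in> K" and od: "fscale (d (0, 1)) (pvar V) \<in> K"
      using K_parity[OF vev vod] dK unfolding eq by blast+
    have d01: "d (0, 1) = 0" using K_smult[OF od] v in_K by blast
    have lp: "lookup (pvar x ^ n :: 'k pvpoly) 0 = 0" if "0 < n" for x n
    proof -
      have "single x n \<noteq> (0 :: pvar \<Rightarrow>\<^sub>0 nat)"
      proof
        assume "single x n = (0 :: pvar \<Rightarrow>\<^sub>0 nat)"
        then have "lookup (single x n) x = lookup (0 :: pvar \<Rightarrow>\<^sub>0 nat) x" by (rule arg_cong)
        then show False using that by (simp add: lookup_single)
      qed
      then show ?thesis by (simp add: pvar_power lookup_single)
    qed
    have "lookup ?ev 0 = 0"
    proof (rule K_lookup_0[OF ev])
      show "?ev \<in> polys s"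
        unfolding fscale_eq_mult pconst_eq[symmetric] using s1
        by (intro polys_add polys_sum polys_mult polys_power polys_const polys_U polys_V) simp
    qed
    moreover have "lookup ?ev 0 = d (0, 0)"
      using lp[of 1 "U 0"] lp ppos by (simp add: lookup_add lookup_sum pconst_def)
    ultimately have d00: "d (0, 0) = 0" by simp
    \<comment> \<open>Dividing by the nonzero coefficient of largest index m would give a relation
      of the form \<open>Wrel m\<close> with m < t, against the choice of t.\<close>
    have dV: "d (0, 2 * p ^ i) = 0" if "i < t" for i
    proof (rule ccontr)
      assume "d (0, 2 * p ^ i) \<noteq> 0"
      let ?S = "{i. i < t \<and> d (0, 2 * p ^ i) \<noteq> 0}"
      define m where "m = Max ?S"
      have ne: "?S \<noteq> {}" and fS: "finite ?S" using that \<open>d (0, 2 * p ^ i) \<noteq> 0\<close> by auto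
      have "m \<in> ?S" unfolding m_def by (rule Max_in[OF fS ne])
      then have m: "m < t" "d (0, 2 * p ^ m) \<noteq> 0" by simp_all
      have big: "d (0, 2 * p ^ i) = 0" if "m < i" "i < t" for i
      proof (rule ccontr)
        assume "d (0, 2 * p ^ i) \<noteq> 0"
        then have "i \<le> m" unfolding m_def using that by (intro Max_ge[OF fS]) simp
        then show False using that by simp
      qed
      let ?r = "d (0, 2 * p ^ m)"
      let ?T = "\<lambda>i. fscale (d (0, 2 * p ^ i)) (pvar V ^ (2 * p ^ i))"
      have "(\<Sum>i<t. ?T i) = (\<Sum>i<Suc m. ?T i)"
        by (rule sum.mono_neutral_right) (use m big in auto)
      then have "?ev = fscale ?r (Wrel m (\<lambda>i. d (0, 2 * p ^ i) / ?r) (d (1, 0) / ?r))"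
        using m(2) d00 by (simp add: Wrel_def fs.scale_right_distrib fs.scale_sum_right)
      then have "Wrel m (\<lambda>i. d (0, 2 * p ^ i) / ?r) (d (1, 0) / ?r) \<in> K"
        using ev K_smult[OF _ m(2)] by simp
      then show False using least[OF m(1)] by blast
    qed
    then have "?ev = fscale (d (1, 0)) u0" by (simp add: d00)
    then have "fscale (d (1, 0)) u0 \<in> K" by (rule back_subst[of "\<lambda>x. x \<in> K", OF ev])
    then have "d (1, 0) = 0" using K_smult u in_K by blast
    with d00 d01 dV z show "\<forall>x\<in>?D. d x = 0" by blast
  qed
  have "A \<cong>\<^sub>H PP_quot s g" by (rule iso_PP_quot[OF g kernel])
  then have "A \<cong>\<^sub>H kM s f (- \<eta>)" by (simp add: kM_def g_def)
  moreover have "inseparable_p_poly f"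
    unfolding inseparable_p_poly_def f_def char by blast
  moreover have "f \<noteq> 0"
  proof -
    have "Polynomial.coeff f (p ^ Suc t) = (\<Sum>i = 1..Suc t. if i = Suc t then c i else 0)"
      unfolding f_def Polynomial.coeff_sum using p3
      by (intro sum.cong refl) (auto simp: power_inject_exp simp del: power_Suc)
    also have "\<dots> = 1" by (simp add: c_def)
    finally show ?thesis by auto
  qed
  ultimately show ?thesis by blast
qed

end

section \<open>The trivial and the purely odd case\<close>

lemma base_superalg_simps [simp]:
  "carrier base_superalg = (UNIV :: 'k::field set)" "x \<oplus>\<^bsub>base_superalg\<^esub> y = x + (y::'k)"
  "x \<otimes>\<^bsub>base_superalg\<^esub> y = x * (y::'k)" "\<zero>\<^bsub>base_superalg\<^esub> = (0::'k)" "\<one>\<^bsub>base_superalg\<^esub> = (1::'k)"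
  "c \<odot>\<^bsub>base_superalg\<^esub> x = c * (x::'k)" "part base_superalg i = (if i = 0 then UNIV else {0::'k})"
  by (simp_all add: base_superalg_def module.defs ring.defs superalg.defs ring_of_type_algebra_def)

lemma base_hopf_simps [simp]:
  "carrier base_hopf = (UNIV :: 'k::field set)" "x \<oplus>\<^bsub>base_hopf\<^esub> y = x + (y::'k)"
  "x \<otimes>\<^bsub>base_hopf\<^esub> y = x * (y::'k)" "\<zero>\<^bsub>base_hopf\<^esub> = (0::'k)" "\<one>\<^bsub>base_hopf\<^esub> = (1::'k)"
  "c \<odot>\<^bsub>base_hopf\<^esub> x = c * (x::'k)" "part base_hopf i = (if i = 0 then UNIV else {0::'k})"
  "comult base_hopf x = pure base_superalg base_superalg x 1" "counit base_hopf x = x" "antipode base_hopf x = x"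
  by (simp_all add: base_hopf_def superalg.defs hopf_superalg.defs
      base_superalg_simps[unfolded base_superalg_def module.defs ring.defs superalg.defs] base_superalg_def module.defs ring.defs superalg.defs ring_of_type_algebra_def)

lemma base_hopf_ops:
  "carrier base_hopf = carrier (base_superalg :: ('k::field, 'k) superalg)"
  "add base_hopf = add (base_superalg :: ('k::field, 'k) superalg)"
  "module.smult base_hopf = module.smult (base_superalg :: ('k::field, 'k) superalg)"
  by (simp_all add: base_hopf_def superalg.defs)

lemma superalgebra_base_hopf: "superalgebra (base_hopf :: ('k::field, 'k) hopf_superalg)"
proof -
  let ?A = "base_hopf :: ('k, 'k) hopf_superalg"
  have ag: "abelian_group ?A"
    by (rule abelian_groupI) (auto simp: algebra_simps intro: exI[of _ "- _"])
  have mod: "module \<K> ?A"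
    by (rule moduleI[OF cring_from_type_algebra ag]) (auto simp: algebra_simps)
  have ring: "ring ?A"
    by (rule ringI[OF ag]) (auto intro!: monoidI simp: algebra_simps)
  have ainv: "\<ominus>\<^bsub>?A\<^esub> x = - x" for x
    by (rule abelian_group.minus_equality[OF ag]) auto
  have sub: "submodule (part ?A i) \<K> ?A" for i
    by (rule module.submoduleI[OF mod]) (auto simp: ainv)
  show ?thesis
    by (intro superalgebra.intro superalgebra_axioms.intro mod ring sub) (auto split: if_splits)
qed

context hopf_eval
begin

text \<open>All variables vanish, so \<open>A\<close> consists of constants and the counit itself is
  the isomorphism.\<close>

lemma iso_base_case:
  assumes s: "s = 1" and u: "e u0 = \<zero>" and v: "e (pvar V) = \<zero>"
  shows "iso_kGa A 0"
proof -
  note e0 = ev_hom_zero[OF superalgebra_A e]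
  have ec: "e f = e (pconst (lookup f 0))" for f
  proof (induction f rule: pvpoly_induct)
    case (const c)
    then show ?case by (simp add: pconst_def)
  next
    case (var x)
    have "single x (Suc 0) \<noteq> 0"
    proof
      assume "single x (Suc 0) = 0"
      then have "lookup (single x (Suc 0)) x = 0" by (simp only: lookup_zero)
      then show False by simp
    qed
    then have "lookup (pvar x :: 'k pvpoly) 0 = 0" by (simp add: pvar_def lookup_single)
    moreover have "e (pvar x) = \<zero>"
    proof (cases x)
      case (U i)
      then show ?thesis using u vanish[of i] s by (cases i) auto
    qed (use v in simp)
    ultimately show ?case by (simp add: e0)
  next
    case (add f g)
    then show ?case by (simp add: lookup_add ev_homD(2)[OF e])
  next
    case (mult f g)
    then show ?case by (simp add: lookup_mult_0 ev_homD(3)[OF e])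
  qed
  have counit_c: "counit A (e (pconst c)) = c" for c
    by (simp add: counit_e) (simp add: pconst_def)
  have car: "\<exists>c. a = e (pconst c)" if "a \<in> carrier A" for a using that surj ec by (metis rangeE)
  let ?B = "base_hopf :: ('k, 'k) hopf_superalg"
  have sh: "superalg_hom A base_superalg (counit A)" by (rule counit_hom)
  have sh': "superalg_hom A ?B (counit A)"
    using sh by (simp add: superalg_hom_def even_map_def lin_map_def ring_hom_def)
  have lin: "lin_map A ?B (counit A)" using sh' by (simp add: superalg_hom_def even_map_def)
  have "comult ?B (counit A a) = tmap ?B ?B (counit A) (counit A) (comult A a)" if a: "a \<in> carrier A" for a
  proof -
    obtain c where c: "a = e (pconst c)" using car a by blast
    have "tmap ?B ?B (counit A) (counit A) (comult A a) = th ?B (\<lambda>f. counit A (e f)) (Delta (pconst c))"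
      unfolding c comult_e[OF polys_const]
      by (rule tmap_th[OF module_axioms lin]) (rule ev_homD(1)[OF e])
    also have "\<dots> = tclass ?B ?B (single (1, 1) c)"
    proof -
      have "counit A (e 1) = 1" using counit_c[of 1] by simp
      then show ?thesis by (simp add: th_def Delta_const thp_single zero_prod_def)
    qed
    also have "\<dots> = tclass ?B ?B (single (c, 1) 1)"
    proof -
      have "single (c \<odot>\<^bsub>?B\<^esub> 1, 1) 1 - single (1, 1) c \<in> Wt ?B ?B"
        by (rule Wt_bilinear(3)) simp_all
      then have "tclass ?B ?B (single (c, 1) 1) = tclass ?B ?B (single (1, 1) c)" by (simp add: tclass_eq_iff)
      then show ?thesis by (rule sym)
    qed
    also have "\<dots> = comult ?B (counit A a)"
      unfolding c counit_c base_hopf_simps pure_def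
      by (rule fun_cong[OF tclass_cong]) (simp_all add: base_hopf_ops)
    finally show ?thesis by (rule sym)
  qed
  moreover have "antipode ?B (counit A a) = counit A (antipode A a)" if a: "a \<in> carrier A" for a
  proof -
    obtain c where c: "a = e (pconst c)" using car a by blast
    have "sgnp s (pconst c) = (pconst c :: 'k pvpoly)"
    proof -
      have a: "antipode_sign s 0 = (1 :: 'k)" by (simp add: antipode_sign_def binomial_eq_0)
      show ?thesis unfolding sgnp_def pconst_def fextend_single a fscale_single by simp
    qed
    then show ?thesis by (simp add: c antipode_e counit_c)
  qed
  ultimately have "hopf_hom A ?B (counit A)"
    using sh' by (simp add: hopf_hom_def)
  moreover have "bij_betw (counit A) (carrier A) (carrier ?B)"
  proof (rule bij_betwI')
    fix x y assume "x \<in> carrier A" "y \<in> carrier A"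
    then obtain c d where cd: "x = e (pconst c)" "y = e (pconst d)" using car by blast
    show "(counit A x = counit A y) = (x = y)" using counit_c unfolding cd by metis
  next
    fix c :: 'k
    show "\<exists>x\<in>carrier A. c = counit A x"
      by (rule bexI[of _ "e (pconst c)"]) (simp_all add: counit_c ev_homD(1)[OF e])
  qed simp
  ultimately show ?thesis unfolding iso_kGa_def hopf_iso_def by auto
qed

end

text \<open>The tensor product with the trivial Hopf superalgebra; \<open>\<iota>\<close> is the isomorphism from \<open>B\<close>
  to \<open>k \<otimes> B\<close>.\<close>

context
  fixes B :: "('k::field, 'b) hopf_superalg"
  assumes B: "superalgebra B"
begin

interpretation B: superalgebra B by (rule B)

abbreviation (input) "k0 \<equiv> base_hopf :: ('k, 'k) hopf_superalg"
abbreviation (input) "T0 \<equiv> tensor k0 B"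
abbreviation (input) "TT0 \<equiv> tensor T0 T0"

definition \<iota> :: "'b \<Rightarrow> ('k \<times> 'b \<Rightarrow>\<^sub>0 'k) set"
  where "\<iota> b = pure k0 B 1 b"

lemma k0_module: "module \<K> k0"
  by (rule superalgebra.axioms(1)[OF superalgebra_base_hopf])

lemma lin_iota: "lin_map B T0 \<iota>"
  unfolding \<iota>_def by (rule lin_mapI) (simp_all add: pure_closed pure_add_right pure_smult_right)

lemma pure_eq_iota: "b \<in> carrier B \<Longrightarrow> pure k0 B a b = \<iota> (a \<odot>\<^bsub>B\<^esub> b)"
  using pure_smult_left[of 1 k0 b B a] pure_smult_right[of 1 k0 b B a] by (simp add: \<iota>_def)

lemma iota_surj:
  assumes "z \<in> carrier T0"
  shows "\<exists>b\<in>carrier B. z = \<iota> b"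
proof -
  obtain t where t: "z = tclass k0 B t" "keys t \<subseteq> carrier k0 \<times> carrier B" by (rule tensor_cases[OF assms])
  have mono: "tclass k0 B (single x r) = \<iota> (r \<odot>\<^bsub>B\<^esub> (fst x \<odot>\<^bsub>B\<^esub> snd x))" if "snd x \<in> carrier B" for x r
  proof -
    have "tclass k0 B (single x r) = r \<odot>\<^bsub>T0\<^esub> pure k0 B (fst x) (snd x)" by (simp add: pure_def)
    then show ?thesis using that lin_mapD(3)[OF lin_iota, of "fst x \<odot>\<^bsub>B\<^esub> snd x" r] by (simp add: pure_eq_iota)
  qed
  have "\<exists>b\<in>carrier B. tclass k0 B (\<Sum>x\<in>S. single x (h x)) = \<iota> b" if "finite S" "S \<subseteq> UNIV \<times> carrier B" for S h
    using that
  proof (induction S rule: finite_induct)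
    case empty
    have "tclass k0 B 0 = \<iota> (0 \<odot>\<^bsub>B\<^esub> \<zero>\<^bsub>B\<^esub>)"
      using lin_mapD(3)[OF lin_iota, of "\<zero>\<^bsub>B\<^esub>" 0] by (simp add: \<iota>_def pure_def)
    then show ?case by auto
  next
    case (insert x S)
    then obtain b where b: "b \<in> carrier B" "tclass k0 B (\<Sum>x\<in>S. single x (h x)) = \<iota> b" by blast
    have x: "snd x \<in> carrier B" using insert.prems by auto
    have "tclass k0 B (\<Sum>x\<in>insert x S. single x (h x)) = tclass k0 B (single x (h x)) \<oplus>\<^bsub>T0\<^esub> tclass k0 B (\<Sum>x\<in>S. single x (h x))"
      using insert.hyps by simp
    also have "\<dots> = \<iota> ((h x \<odot>\<^bsub>B\<^esub> (fst x \<odot>\<^bsub>B\<^esub> snd x)) \<oplus>\<^bsub>B\<^esub> b)"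
      unfolding mono[OF x] b(2) using b(1) x by (intro lin_mapD(2)[OF lin_iota, symmetric]) simp_all
    finally show ?case using b(1) x by (intro bexI[of _ "(h x \<odot>\<^bsub>B\<^esub> (fst x \<odot>\<^bsub>B\<^esub> snd x)) \<oplus>\<^bsub>B\<^esub> b"]) simp_all
  qed
  from this[of "keys t" "lookup t"] t show ?thesis by (simp add: poly_mapping_expand[symmetric])
qed

lemma tlift_pure:
  fixes P :: "('k, 'c, 'n) module_scheme"
  assumes P: "module \<K> P" and \<beta>: "bilin k0 B P \<beta>" and b: "b \<in> carrier B"
  shows "tlift P \<beta> (\<iota> b) = \<beta> 1 b"
proof -
  interpret P: module \<K> P by (rule P)
  have cl: "\<beta> a b \<in> carrier P" if "a \<in> carrier k0" "b \<in> carrier B" for a b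
    using \<beta> lin_mapD(1)[of k0 P "\<lambda>a. \<beta> a b"] that by (simp add: bilin_def)
  have "tlift P \<beta> (\<iota> b) = flin P (\<lambda>s. \<beta> (fst s) (snd s)) (single (1, b) 1)"
    unfolding \<iota>_def pure_def using b by (intro tlift_tclass[OF k0_module B.module_axioms P \<beta>]) simp
  also have "\<dots> = 1 \<odot>\<^bsub>P\<^esub> \<beta> 1 b"
    using b cl by (subst flin_single[OF P, of _ "carrier k0 \<times> carrier B"]) auto
  also have "\<dots> = \<beta> 1 b" using P.smult_one[of "\<beta> 1 b"] cl[OF _ b] by simp
  finally show ?thesis .
qed

text \<open>Scalar multiplication c \<otimes> b \<mapsto> c b is a left inverse of \<iota>.\<close>

lemma iota_inj:
  assumes "b \<in> carrier B" "b' \<in> carrier B" "\<iota> b = \<iota> b'"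
  shows "b = b'"
proof -
  have bil: "bilin k0 B B (\<lambda>c b. c \<odot>\<^bsub>B\<^esub> b)"
    unfolding bilin_def
  proof (intro conjI ballI lin_mapI)
    fix b and x y c :: 'k assume b: "b \<in> carrier B"
    show "x \<odot>\<^bsub>B\<^esub> b \<in> carrier B" using b by (rule B.smult_closed')
    show "(x \<oplus>\<^bsub>k0\<^esub> y) \<odot>\<^bsub>B\<^esub> b = x \<odot>\<^bsub>B\<^esub> b \<oplus>\<^bsub>B\<^esub> y \<odot>\<^bsub>B\<^esub> b"
      unfolding base_hopf_simps using b by (rule B.smult_l_distr')
    show "(c \<odot>\<^bsub>k0\<^esub> x) \<odot>\<^bsub>B\<^esub> b = c \<odot>\<^bsub>B\<^esub> (x \<odot>\<^bsub>B\<^esub> b)"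
      unfolding base_hopf_simps using b by (rule B.smult_assoc')
  next
    fix a c :: 'k and x assume x: "x \<in> carrier B"
    show "a \<odot>\<^bsub>B\<^esub> x \<in> carrier B" using x by (rule B.smult_closed')
    show "a \<odot>\<^bsub>B\<^esub> (c \<odot>\<^bsub>B\<^esub> x) = c \<odot>\<^bsub>B\<^esub> (a \<odot>\<^bsub>B\<^esub> x)"
      unfolding B.smult_assoc'[OF x, symmetric] by (simp only: mult.commute)
    fix y assume y: "y \<in> carrier B"
    show "a \<odot>\<^bsub>B\<^esub> (x \<oplus>\<^bsub>B\<^esub> y) = a \<odot>\<^bsub>B\<^esub> x \<oplus>\<^bsub>B\<^esub> a \<odot>\<^bsub>B\<^esub> y"
      using x y by (rule B.smult_r_distr')
  qed
  note t = tlift_pure[OF B.module_axioms bil]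
  have "1 \<odot>\<^bsub>B\<^esub> b = 1 \<odot>\<^bsub>B\<^esub> b'"
    using t[OF assms(1)] t[OF assms(2)] unfolding assms(3) by (rule trans[OF sym])
  then show ?thesis unfolding B.smult_1'[OF assms(1)] B.smult_1'[OF assms(2)] .
qed

lemma iota_part:
  assumes "b \<in> part B i"
  shows "\<iota> b \<in> part T0 i"
proof -
  have "(1, b) \<in> part k0 0 \<times> part B (i - 0)" unfolding diff_zero by (intro SigmaI assms) simp
  then have "(1, b) \<in> (\<Union>j. part k0 j \<times> part B (i - j))" by (rule UN_I[where a = 0, OF UNIV_I])
  then have keys: "keys (single (1, b) (1::'k)) \<subseteq> (\<Union>j. part k0 j \<times> part B (i - j))" by (rule keys_single_subset)
  have p: "part T0 i = {tclass k0 B t |t. keys t \<subseteq> (\<Union>j. part k0 j \<times> part B (i - j))}"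
    unfolding tensor_def by (simp only: superalg.select_convs)
  show ?thesis
    unfolding p \<iota>_def pure_def
    by (rule CollectI, rule exI[of _ "single (1, b) 1"], rule conjI[OF refl keys])
qed

text \<open>The sign rule asks for homogeneous factors, so \<open>b\<close> is split into its
  components; the first slot 1 on the right is even, hence no sign arises.\<close>

lemma iota_mult:
  assumes "b \<in> carrier B" "b' \<in> carrier B"
  shows "\<iota> (b \<otimes>\<^bsub>B\<^esub> b') = \<iota> b \<otimes>\<^bsub>T0\<^esub> \<iota> b'"
proof -
  note c = B.component(1)[OF assms(1)]
  have hom: "\<iota> (d \<otimes>\<^bsub>B\<^esub> b') = tclass k0 B (tensor_mult k0 B (single (1, d) 1) (single (1, b') 1))" if d: "d \<in> part B i" for d i
  proof -
    have "tensor_mult k0 B (single (1, d) 1) (single (1, b') 1)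
        - single (1 \<otimes>\<^bsub>k0\<^esub> 1, d \<otimes>\<^bsub>B\<^esub> b') (1 * 1 * koszul i 0) \<in> Wt k0 B"
      by (rule tensor_mult_single[OF superalgebra_base_hopf B]) (use d assms in simp_all)
    then have "tclass k0 B (tensor_mult k0 B (single (1, d) 1) (single (1, b') 1)) = \<iota> (d \<otimes>\<^bsub>B\<^esub> b')"
      by (simp add: \<iota>_def pure_def tclass_eq_iff koszul_def)
    then show ?thesis by (rule sym)
  qed
  let ?b0 = "component B 0 b" and ?b1 = "component B 1 b"
  have b: "b = ?b0 \<oplus>\<^bsub>B\<^esub> ?b1" using B.component(2)[OF assms(1), of 0] unfolding add_0_left .
  have cc: "?b0 \<in> carrier B" "?b1 \<in> carrier B" using assms by simp_all
  have ks: "keys (single (1::'k, d) (1::'k)) \<subseteq> carrier k0 \<times> carrier B" if "d \<in> carrier B" for d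
    using that by simp
  have "\<iota> b = tclass k0 B (single (1, ?b0) 1 + single (1, ?b1) 1)"
    using trans[OF arg_cong[OF b, of \<iota>] lin_mapD(2)[OF lin_iota cc]] by (simp add: \<iota>_def pure_def)
  then have "\<iota> b \<otimes>\<^bsub>T0\<^esub> \<iota> b' = tclass k0 B (tensor_mult k0 B (single (1, ?b0) 1 + single (1, ?b1) 1) (single (1, b') 1))"
    using ks cc assms by (simp add: \<iota>_def[of b'] pure_def tensor_times[OF superalgebra_base_hopf B] keys_add_subset)
  also have "\<dots> = \<iota> (?b0 \<otimes>\<^bsub>B\<^esub> b') \<oplus>\<^bsub>T0\<^esub> \<iota> (?b1 \<otimes>\<^bsub>B\<^esub> b')"
    by (simp add: tensor_mult_add_left hom[OF c])
  also have "\<dots> = \<iota> (?b0 \<otimes>\<^bsub>B\<^esub> b' \<oplus>\<^bsub>B\<^esub> ?b1 \<otimes>\<^bsub>B\<^esub> b')"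
    using cc assms by (intro lin_mapD(2)[OF lin_iota, symmetric]) simp_all
  also have "?b0 \<otimes>\<^bsub>B\<^esub> b' \<oplus>\<^bsub>B\<^esub> ?b1 \<otimes>\<^bsub>B\<^esub> b' = b \<otimes>\<^bsub>B\<^esub> b'"
    using B.l_distr[OF cc assms(2)] unfolding b[symmetric] by (rule sym)
  finally show ?thesis by (rule sym)
qed

definition Cop :: "'b \<Rightarrow> (('k \<times> 'b \<Rightarrow>\<^sub>0 'k) set \<times> ('k \<times> 'b \<Rightarrow>\<^sub>0 'k) set \<Rightarrow>\<^sub>0 'k) set"
  where "Cop b = tmap T0 T0 \<iota> \<iota> (comult B b)"

text \<open>The coproduct of k \<otimes> B is a nest of three lifts, evaluated from the inside.
  Linearity of \<open>Cop\<close> makes the outermost map bilinear, so that its lift does not depend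
  on the chosen representative.\<close>

lemma comult_tensor_base:
  assumes com: "\<And>b. b \<in> carrier B \<Longrightarrow> comult B b \<in> carrier (tensor B B)"
    and add: "\<And>b b'. b \<in> carrier B \<Longrightarrow> b' \<in> carrier B \<Longrightarrow> Cop (b \<oplus>\<^bsub>B\<^esub> b') = Cop b \<oplus>\<^bsub>TT0\<^esub> Cop b'"
    and sm: "\<And>c b. b \<in> carrier B \<Longrightarrow> Cop (c \<odot>\<^bsub>B\<^esub> b) = c \<odot>\<^bsub>TT0\<^esub> Cop b"
    and b: "b \<in> carrier B"
  shows "comult (tensor_hopf k0 B) (\<iota> b) = Cop b"
proof -
  interpret T0: module \<K> T0 by (rule module_tensor)
  interpret TT: module \<K> TT0 by (rule module_tensor)
  note iota_c = lin_mapD(1)[OF lin_iota]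
  \<comment> \<open>As k is purely even, only i = 0 contributes, without sign, and the sum over j
    puts b1 together again. What remains is a1 a2 times \<iota> b1 \<otimes> \<iota> b2.\<close>
  define \<delta> where "\<delta> a1 a2 b1 b2 = (\<Oplus>\<^bsub>TT0\<^esub>i\<in>{0, 1}. \<Oplus>\<^bsub>TT0\<^esub>j\<in>{0, 1}. koszul i j \<odot>\<^bsub>TT0\<^esub>
          pure T0 T0 (pure k0 B a1 (component B j b1)) (pure k0 B (component k0 i a2) b2))" for a1 a2 :: 'k and b1 b2
  have \<delta>: "\<delta> a1 a2 b1 b2 = tclass T0 T0 (single (\<iota> b1, \<iota> b2) (a1 * a2))" if c: "b1 \<in> carrier B" "b2 \<in> carrier B" for a1 a2 b1 b2
  proof -
    have comp: "component k0 0 a2 = a2" "component k0 1 a2 = 0"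
      using superalgebra.component_part[OF superalgebra_base_hopf, of a2 0] by simp_all
    have pc: "pure k0 B a d \<in> carrier T0" if "d \<in> carrier B" for a d using that by (intro pure_closed) simp_all
    have tc: "pure T0 T0 x y \<in> carrier TT0" if "x \<in> carrier T0" "y \<in> carrier T0" for x y
      using that by (rule pure_closed)
    have z: "pure T0 T0 x (pure k0 B 0 b2) = \<zero>\<^bsub>TT0\<^esub>" if "x \<in> carrier T0" for x
    proof -
      have "pure k0 B 0 b2 = 0 \<odot>\<^bsub>T0\<^esub> pure k0 B 1 b2"
        using pure_smult_left[of 1 k0 b2 B 0] c by simp
      then have "pure T0 T0 x (pure k0 B 0 b2) = 0 \<odot>\<^bsub>TT0\<^esub> pure T0 T0 x (pure k0 B 1 b2)"
        using pure_smult_right[OF that pc[OF c(2)], of 0 1] by simp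
      also have "\<dots> = \<zero>\<^bsub>TT0\<^esub>" using module_smult_0[OF TT.module_axioms tc[OF that pc[OF c(2)]]] .
      finally show ?thesis .
    qed
    have c1: "component B j b1 \<in> carrier B" for j using c by simp
    have two: "(\<Oplus>\<^bsub>TT0\<^esub>i\<in>{0, 1}. h i) = h 0 \<oplus>\<^bsub>TT0\<^esub> h 1"
      if "h 0 \<in> carrier TT0" "h 1 \<in> carrier TT0" for h :: "bit \<Rightarrow> _"
      using that by (simp add: TT.finsum_insert Pi_iff del: tensor_zero)
    have t: "c \<odot>\<^bsub>TT0\<^esub> pure T0 T0 (pure k0 B a1 (component B j b1)) (pure k0 B x b2) \<in> carrier TT0" for c j x
      using TT.smult_closed[OF _ tc[OF pc[OF c1] pc[OF c(2)]]] by simp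
    have o: "1 \<odot>\<^bsub>TT0\<^esub> pure T0 T0 (pure k0 B a1 (component B j b1)) (pure k0 B a2 b2)
        = pure T0 T0 (pure k0 B a1 (component B j b1)) (pure k0 B a2 b2)" for j
      using TT.smult_one[OF tc[OF pc[OF c1] pc[OF c(2)]]] by simp
    have cz: "c \<odot>\<^bsub>TT0\<^esub> \<zero>\<^bsub>TT0\<^esub> = \<zero>\<^bsub>TT0\<^esub>" for c by (simp add: fs.scale_zero_right)
    have zz: "\<zero>\<^bsub>TT0\<^esub> \<oplus>\<^bsub>TT0\<^esub> \<zero>\<^bsub>TT0\<^esub> = \<zero>\<^bsub>TT0\<^esub>" by simp
    let ?x = "\<lambda>j. pure T0 T0 (pure k0 B a1 (component B j b1)) (pure k0 B a2 b2)"
    let ?y = "\<lambda>i j. koszul i j \<odot>\<^bsub>TT0\<^esub>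
          pure T0 T0 (pure k0 B a1 (component B j b1)) (pure k0 B (component k0 i a2) b2)"
    have y0: "?y 0 j = ?x j" for j
      using o[of j] unfolding comp by (simp only: koszul_def zero_neq_one if_False simp_thms)
    have y1: "?y 1 j = \<zero>\<^bsub>TT0\<^esub>" for j
      unfolding comp by (subst z[OF pc[OF c1]]) (rule cz)
    have "(\<Oplus>\<^bsub>TT0\<^esub>j\<in>{0, 1}. ?y i j) = (if i = 0 then ?x 0 \<oplus>\<^bsub>TT0\<^esub> ?x 1 else \<zero>\<^bsub>TT0\<^esub>)" for i
    proof -
      have "(\<Oplus>\<^bsub>TT0\<^esub>j\<in>{0, 1}. ?y i j) = ?y i 0 \<oplus>\<^bsub>TT0\<^esub> ?y i 1"
        by (rule two) (rule t)+
      then show ?thesis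
        by (cases "i = 0") (simp_all only: y0 y1 zz bit_not_zero_iff if_True if_False simp_thms one_neq_zero)
    qed
    then have "\<delta> a1 a2 b1 b2 = (\<Oplus>\<^bsub>TT0\<^esub>i\<in>{0, 1::bit}. if i = 0 then ?x 0 \<oplus>\<^bsub>TT0\<^esub> ?x 1 else \<zero>\<^bsub>TT0\<^esub>)"
      unfolding \<delta>_def by (simp only:)
    also have "\<dots> = (?x 0 \<oplus>\<^bsub>TT0\<^esub> ?x 1) \<oplus>\<^bsub>TT0\<^esub> \<zero>\<^bsub>TT0\<^esub>"
      using TT.a_closed[OF tc[OF pc[OF c1[of 0]] pc[OF c(2)]] tc[OF pc[OF c1[of 1]] pc[OF c(2)]]]
      by (subst two) (simp_all del: tensor_add tensor_zero)
    also have "\<dots> = ?x 0 \<oplus>\<^bsub>TT0\<^esub> ?x 1"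
      by (rule TT.r_zero) (intro TT.a_closed tc pc c1 c(2))
    also have "\<dots> = pure T0 T0 (pure k0 B a1 (component B 0 b1) \<oplus>\<^bsub>T0\<^esub> pure k0 B a1 (component B 1 b1)) (pure k0 B a2 b2)"
      by (rule pure_add_left[symmetric]) (intro pc c1 c(2))+
    also have "pure k0 B a1 (component B 0 b1) \<oplus>\<^bsub>T0\<^esub> pure k0 B a1 (component B 1 b1) = pure k0 B a1 b1"
    proof -
      have b1: "component B 0 b1 \<oplus>\<^bsub>B\<^esub> component B 1 b1 = b1"
        using B.component(2)[OF c(1), of 0] unfolding add_0_left by (rule sym)
      show ?thesis
        using pure_add_right[of a1 k0 "component B 0 b1" B "component B 1 b1"] c1 unfolding b1 by simp
    qed
    also have "pure T0 T0 (pure k0 B a1 b1) (pure k0 B a2 b2) = pure T0 T0 (a1 \<odot>\<^bsub>T0\<^esub> \<iota> b1) (a2 \<odot>\<^bsub>T0\<^esub> \<iota> b2)"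
      using c by (simp only: pure_eq_iota lin_mapD(3)[OF lin_iota])
    also have "\<dots> = a1 \<odot>\<^bsub>TT0\<^esub> (a2 \<odot>\<^bsub>TT0\<^esub> pure T0 T0 (\<iota> b1) (\<iota> b2))"
      using iota_c c T0.smult_closed[of a2 "\<iota> b2"]
      by (simp add: pure_smult_left pure_smult_right) (simp add: pure_def mult.commute)
    finally show ?thesis by (simp add: pure_def)
  qed
  have bil_\<delta>: "bilin B B TT0 (\<delta> a1 a2)" for a1 a2
  proof -
    have *: "\<delta> a1 a2 b1 b2 = (a1 * a2) \<odot>\<^bsub>TT0\<^esub> pure T0 T0 (\<iota> b1) (\<iota> b2)" if "b1 \<in> carrier B" "b2 \<in> carrier B" for b1 b2
      using \<delta>[OF that] by (simp add: pure_def)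
    have bp: "bilin B B TT0 (\<lambda>b1 b2. pure T0 T0 (\<iota> b1) (\<iota> b2))"
      by (rule bilin_compose[OF lin_iota lin_iota bilin_pure])
    have sc: "lin_map B TT0 (\<lambda>x. r \<odot>\<^bsub>TT0\<^esub> h x)" if h: "lin_map B TT0 h" for h r
    proof (rule lin_mapI)
      fix x y c assume xy: "x \<in> carrier B" "y \<in> carrier B"
      note hh = lin_mapD[OF h]
      show "r \<odot>\<^bsub>TT0\<^esub> h (x \<oplus>\<^bsub>B\<^esub> y) = r \<odot>\<^bsub>TT0\<^esub> h x \<oplus>\<^bsub>TT0\<^esub> r \<odot>\<^bsub>TT0\<^esub> h y"
        using TT.smult_r_distr[of r "h x" "h y"] hh xy by simp
    next
      fix x c assume x: "x \<in> carrier B"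
      note hh = lin_mapD[OF h]
      show "r \<odot>\<^bsub>TT0\<^esub> h x \<in> carrier TT0" using TT.smult_closed[of r "h x"] hh(1)[OF x] by simp
      have "r \<odot>\<^bsub>TT0\<^esub> (c \<odot>\<^bsub>TT0\<^esub> h x) = c \<odot>\<^bsub>TT0\<^esub> (r \<odot>\<^bsub>TT0\<^esub> h x)"
        using TT.smult_assoc1[of r c "h x"] TT.smult_assoc1[of c r "h x"] hh(1)[OF x] by (simp add: mult.commute)
      then show "r \<odot>\<^bsub>TT0\<^esub> h (c \<odot>\<^bsub>B\<^esub> x) = c \<odot>\<^bsub>TT0\<^esub> (r \<odot>\<^bsub>TT0\<^esub> h x)" using hh(3)[OF x] by simp
    qed
    have cong: "lin_map B TT0 h" if "lin_map B TT0 h'" "\<And>x. x \<in> carrier B \<Longrightarrow> h x = h' x" for h h'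
      using that by (simp add: lin_map_def Pi_iff)
    show ?thesis
      unfolding bilin_def
    proof (intro conjI ballI)
      fix b2 assume b2: "b2 \<in> carrier B"
      have "lin_map B TT0 (\<lambda>b1. pure T0 T0 (\<iota> b1) (\<iota> b2))" using bp b2 by (simp add: bilin_def)
      from cong[OF sc[OF this]] show "lin_map B TT0 (\<lambda>b1. \<delta> a1 a2 b1 b2)" using * b2 by simp
    next
      fix b1 assume b1: "b1 \<in> carrier B"
      have "lin_map B TT0 (\<lambda>b2. pure T0 T0 (\<iota> b1) (\<iota> b2))" using bp b1 by (simp add: bilin_def)
      from cong[OF sc[OF this]] show "lin_map B TT0 (\<delta> a1 a2 b1)" using * b1 by simp
    qed
  qed
  have inner: "tlift TT0 (\<delta> a1 a2) (comult B b) = (a1 * a2) \<odot>\<^bsub>TT0\<^esub> Cop b" if b: "b \<in> carrier B" for a1 a2 b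
  proof -
    obtain t where t: "comult B b = tclass B B t" "keys t \<subseteq> carrier B \<times> carrier B"
      by (rule tensor_cases[OF com[OF b]])
    have "tlift TT0 (\<delta> a1 a2) (comult B b) = flin TT0 (\<lambda>s. \<delta> a1 a2 (fst s) (snd s)) t"
      unfolding t(1) by (rule tlift_tclass[OF B.module_axioms B.module_axioms TT.module_axioms bil_\<delta> t(2)])
    also have "\<dots> = tclass T0 T0 (fextend (\<lambda>s. single (\<iota> (fst s), \<iota> (snd s)) (a1 * a2)) t)"
      by (rule flin_tensor) (use t(2) \<delta> iota_c in auto)
    also have "(\<lambda>s. single (\<iota> (fst s), \<iota> (snd s)) (a1 * a2)) = (\<lambda>s. fscale (a1 * a2) (single (\<iota> (fst s), \<iota> (snd s)) 1))"
      by simp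
    also have "tclass T0 T0 (fextend \<dots> t) = (a1 * a2) \<odot>\<^bsub>TT0\<^esub> Cop b"
      unfolding Cop_def t(1) tmap_tclass[OF B.module_axioms B.module_axioms lin_iota lin_iota t(2)]
      by (simp only: fextend_fscale_fun tensor_smult)
    finally show ?thesis .
  qed
  have Cc: "Cop b \<in> carrier TT0" if b: "b \<in> carrier B" for b
  proof -
    obtain t where t: "comult B b = tclass B B t" "keys t \<subseteq> carrier B \<times> carrier B"
      by (rule tensor_cases[OF com[OF b]])
    show ?thesis
      unfolding Cop_def t(1) tmap_tclass[OF B.module_axioms B.module_axioms lin_iota lin_iota t(2)]
      by (intro tclass_in_tensor keys_fextend keys_single_subset) (use t(2) iota_c in auto)
  qed
  have sD: "(r + r') \<odot>\<^bsub>TT0\<^esub> Cop b = r \<odot>\<^bsub>TT0\<^esub> Cop b \<oplus>\<^bsub>TT0\<^esub> r' \<odot>\<^bsub>TT0\<^esub> Cop b"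
    "(r * r') \<odot>\<^bsub>TT0\<^esub> Cop b = r \<odot>\<^bsub>TT0\<^esub> (r' \<odot>\<^bsub>TT0\<^esub> Cop b)" "1 \<odot>\<^bsub>TT0\<^esub> Cop b = Cop b" "r \<odot>\<^bsub>TT0\<^esub> Cop b \<in> carrier TT0"
    if "b \<in> carrier B" for r r' b
    using TT.smult_l_distr[OF _ _ Cc[OF that], of r r'] TT.smult_assoc1[OF _ _ Cc[OF that], of r r']
      TT.smult_one[OF Cc[OF that]] TT.smult_closed[OF _ Cc[OF that], of r] by simp_all
  define \<beta> where "\<beta> a b = tlift TT0 (\<lambda>a1 a2. tlift TT0 (\<delta> a1 a2) (comult B b)) (comult k0 a)" for a b
  have \<beta>: "\<beta> a b = a \<odot>\<^bsub>TT0\<^esub> Cop b" if b: "b \<in> carrier B" for a b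
  proof -
    have bil: "bilin k0 k0 TT0 (\<lambda>a1 a2. (a1 * a2) \<odot>\<^bsub>TT0\<^esub> Cop b)"
      unfolding bilin_def
      by (intro conjI ballI lin_mapI)
        (simp_all add: sD[OF b] distrib_left distrib_right mult.assoc mult.left_commute flip: sD(2)[OF b])
    have "comult k0 a = tclass k0 k0 (single (a, 1) 1)"
      unfolding base_hopf_simps pure_def by (rule fun_cong[OF tclass_cong]) (simp_all add: base_hopf_ops)
    then have "\<beta> a b = flin TT0 (\<lambda>s. (fst s * snd s) \<odot>\<^bsub>TT0\<^esub> Cop b) (single (a, 1) 1)"
      unfolding \<beta>_def inner[OF b]
      by (simp only:) (rule tlift_tclass[OF k0_module k0_module TT.module_axioms bil], simp)
    also have "\<dots> = 1 \<odot>\<^bsub>TT0\<^esub> ((a * 1) \<odot>\<^bsub>TT0\<^esub> Cop b)"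
      by (subst flin_single[OF TT.module_axioms, of _ UNIV]) (use sD(4)[OF b] in auto)
    also have "\<dots> = a \<odot>\<^bsub>TT0\<^esub> Cop b" using sD(2)[OF b, of 1 a] by simp
    finally show ?thesis .
  qed
  have bil_\<beta>: "bilin k0 B TT0 \<beta>"
    unfolding bilin_def
  proof (intro conjI ballI lin_mapI)
    fix b and x y c :: 'k assume b: "b \<in> carrier B"
    show "\<beta> x b \<in> carrier TT0" using sD(4)[OF b] by (simp add: \<beta>[OF b])
    show "\<beta> (x \<oplus>\<^bsub>k0\<^esub> y) b = \<beta> x b \<oplus>\<^bsub>TT0\<^esub> \<beta> y b" by (simp add: \<beta>[OF b] sD(1)[OF b])
    show "\<beta> (c \<odot>\<^bsub>k0\<^esub> x) b = c \<odot>\<^bsub>TT0\<^esub> \<beta> x b" by (simp add: \<beta>[OF b] sD(2)[OF b])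
  next
    fix a :: 'k and x assume x: "x \<in> carrier B"
    show "\<beta> a x \<in> carrier TT0" using sD(4)[OF x] by (simp add: \<beta>[OF x])
    show "\<beta> a (c \<odot>\<^bsub>B\<^esub> x) = c \<odot>\<^bsub>TT0\<^esub> \<beta> a x" for c
      using x by (simp add: \<beta> sm flip: sD(2)[OF x]) (simp add: mult.commute)
    fix y assume y: "y \<in> carrier B"
    show "\<beta> a (x \<oplus>\<^bsub>B\<^esub> y) = \<beta> a x \<oplus>\<^bsub>TT0\<^esub> \<beta> a y"
      using x y TT.smult_r_distr[OF _ Cc[OF x] Cc[OF y], of a] by (simp add: \<beta> add)
  qed
  have "comult (tensor_hopf k0 B) = tlift TT0 \<beta>"
    unfolding tensor_hopf_def Let_def superalg.defs hopf_superalg.defs \<beta>_def \<delta>_def by simp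
  then have "comult (tensor_hopf k0 B) (\<iota> b) = \<beta> 1 b"
    using tlift_pure[OF TT.module_axioms bil_\<beta> b] by simp
  then show ?thesis by (simp add: \<beta>[OF b] sD(3)[OF b])
qed

end

lemma lookup_pvar_0 [simp]: "lookup (pvar x) 0 = (0 :: 'k::field)"
proof -
  have "single x (Suc 0) \<noteq> 0"
  proof
    assume "single x (Suc 0) = 0"
    then have "lookup (single x (Suc 0)) x = 0" by (simp only: lookup_zero)
    then show False by simp
  qed
  then show ?thesis by (simp add: pvar_def lookup_single)
qed

lemma pconst_mult_eq: "pconst c * f = fscale c f"
  by (simp only: fscale_eq_mult pconst_eq)

lemma pconst_plus: "pconst (a + b) = pconst a + pconst b"
  by (simp add: pconst_def single_add)

lemma pconst_times: "pconst (a * b) = pconst a * pconst b"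
  by (simp add: pconst_def mult_single)

lemma sgnp_smult: "sgnp s (pconst c * f) = pconst c * sgnp s f"
  unfolding pconst_mult_eq sgnp_def by (rule fextend_fscale)

section \<open>The group algebra of the odd additive supergroup scheme\<close>

lemma presentation_V2: "presentation 0 {pvar V ^ 2 :: 'k::field pvpoly}"
proof
  fix \<rho> :: "'k pvpoly" assume "\<rho> \<in> {pvar V ^ 2}"
  moreover have "lookup (pvar V ^ 2 :: 'k pvpoly) 0 = 0"
    by (simp add: power2_eq_square lookup_mult_0)
  ultimately show "\<rho> \<in> polys 0 \<and> even_v \<rho> \<and> lookup \<rho> 0 = 0"
    by (simp add: polys_power)
qed

definition mcl :: "'k::field pvpoly \<Rightarrow> 'k pvpoly set"
  where "mcl = presentation.ecl 0 {pvar V ^ 2}"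

lemmas kGa_minus_simps =
  presentation.presented_hopf_simps[OF presentation_V2, of "\<lambda>i. undefined", folded kGa_minus_def]

lemma superalgebra_kGa_minus: "superalgebra (kGa_minus :: ('k::field, 'k pvpoly set) hopf_superalg)"
  unfolding kGa_minus_def by (rule presentation.superalgebra_presented_hopf[OF presentation_V2])

lemma ev_hom_mcl: "ev_hom (kGa_minus :: ('k::field, 'k pvpoly set) hopf_superalg) mcl"
  using presentation.ev_hom_ecl[OF presentation_V2] unfolding ev_hom_def kGa_minus_simps mcl_def .

lemma mcl_eq_iff:
  "mcl f = mcl g \<longleftrightarrow> trunc 0 (f - g) \<in> Idl\<^bsub>poly_superalg 0\<^esub> {pvar V ^ 2 :: 'k::field pvpoly}"
proof -
  have "trunc 0 (f - g) = trunc 0 f - trunc 0 g" by (simp add: trunc_def fextend_diff)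
  then show ?thesis
    unfolding mcl_def presentation.ecl_def[OF presentation_V2]
    by (simp only: presentation.cl_eq_iff[OF presentation_V2 trunc_in_polys trunc_in_polys])
qed

lemma mcl_surj:
  assumes "Z \<in> carrier (kGa_minus :: ('k::field, 'k pvpoly set) hopf_superalg)"
  obtains f where "f \<in> polys 0" "Z = mcl f"
proof -
  interpret m: presentation 0 "{pvar V ^ 2 :: 'k pvpoly}" by (rule presentation_V2)
  obtain f where f: "f \<in> polys 0" "Z = m.cl f" using assms unfolding kGa_minus_simps m.Qp_simps by blast
  show ?thesis by (rule that[OF f(1)]) (simp add: mcl_def m.ecl_polys f)
qed

text \<open>\<open>Delta\<close> carries v^2 to v^2 \<otimes> 1 + 1 \<otimes> v^2 and
  \<open>sgnp\<close> carries it to its negative, so the structure maps may be computed from any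
  polynomial in the class.\<close>

lemma kGa_minus_structure:
  fixes f :: "'k::field pvpoly"
  assumes f: "f \<in> polys 0"
  shows "comult kGa_minus (mcl f) = th kGa_minus mcl (Delta f)"
    and "counit kGa_minus (mcl f) = lookup f 0"
    and "antipode kGa_minus (mcl f) = mcl (sgnp 0 f)"
proof -
  interpret m: presentation 0 "{pvar V ^ 2 :: 'k pvpoly}" by (rule presentation_V2)
  have Z: "mcl f \<in> carrier m.Qp" using ev_homD(1)[OF ev_hom_mcl, of f] unfolding kGa_minus_simps .
  obtain f' where f': "f' \<in> polys 0" "m.cl f' = mcl f" "comult kGa_minus (mcl f) = th m.Qp m.ecl (Delta f')"
    "counit kGa_minus (mcl f) = lookup f' 0" "antipode kGa_minus (mcl f) = m.cl (sgnp 0 f')"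
    by (rule m.comult_presented[of "\<lambda>i. undefined", OF _ Z, unfolded sgnp_eq, folded kGa_minus_def]) (simp, rule that, assumption+)
  note A = m.superalgebra_Qp and e = m.ev_hom_ecl
  have J: "f' - f \<in> m.J"
    using f'(2) m.cl_eq_iff[OF f'(1) f] by (simp add: mcl_def m.ecl_polys[OF f])
  have V2: "pvar V ^ 2 \<in> Kid m.Qp m.ecl"
  proof -
    have "pvar V ^ 2 \<in> m.J" by (rule subsetD[OF m.rels_J]) simp
    then have "m.cl (pvar V ^ 2) = m.cl 0"
      using m.cl_eq_iff[of "pvar V ^ 2" 0] by (simp add: polys_power)
    then show ?thesis by (simp add: Kid_def m.ecl_polys polys_power m.Qp_simps)
  qed
  have "Delta (f' - f) \<in> Lid m.Qp m.ecl"
  proof (rule ideal_mult_criterion[where F = Delta, OF m.presentation_axioms pideal_Lid Delta_add _ J])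
    fix \<rho> g :: "'k pvpoly" assume "\<rho> \<in> {pvar V ^ 2}"
    then have "Delta (\<rho> * g) = (incl1 (pvar V ^ 2) + incl2 (pvar V ^ 2)) * Delta g"
      by (simp add: Delta_mult Delta_V_power om_def tens_def)
    moreover have "\<dots> \<in> Lid m.Qp m.ecl"
      by (rule pideal_mult_right[OF pideal_Lid pideal_add[OF pideal_Lid incl_Lid[OF A e V2]]])
    ultimately show "Delta (\<rho> * g) \<in> Lid m.Qp m.ecl" by simp
  qed
  then have "Delta f' - Delta f \<in> Lid m.Qp m.ecl" by (simp add: Delta_def fextend_diff)
  then have "comult kGa_minus (mcl f) = th m.Qp m.ecl (Delta f)" using f'(3) th_cong by simp
  also have "\<dots> = th kGa_minus mcl (Delta f)"
    unfolding th_def mcl_def by (rule fun_cong[OF tclass_cong]) (simp_all add: kGa_minus_simps)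
  finally show "comult kGa_minus (mcl f) = th kGa_minus mcl (Delta f)" .
  show "counit kGa_minus (mcl f) = lookup f 0"
    using m.J_lookup_0[OF J] f'(4) by (simp add: lookup_minus)
  note K = pideal_Kid[OF A e]
  have "sgnp 0 (f' - f) \<in> Kid m.Qp m.ecl"
  proof (rule ideal_mult_criterion[where F = "sgnp 0", OF m.presentation_axioms K sgnp_add _ J])
    fix \<rho> g :: "'k pvpoly" assume \<rho>: "\<rho> \<in> {pvar V ^ 2}"
    have "sgnp 0 (\<rho> * g) = - \<rho> * sgnp 0 g"
      by (rule sgnp_mult) (use \<rho> in \<open>simp add: pvar_power antipode_sign_V2\<close>)
    moreover have "- \<rho> * sgnp 0 g \<in> Kid m.Qp m.ecl"
      using \<rho> pideal_mult_right[OF K pideal_minus[OF K V2]] by simp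
    ultimately show "sgnp 0 (\<rho> * g) \<in> Kid m.Qp m.ecl" by simp
  qed
  then have "m.ecl (sgnp 0 f' - sgnp 0 f) = \<zero>\<^bsub>m.Qp\<^esub>" by (simp add: Kid_def sgnp_def fextend_diff)
  then have "m.ecl (sgnp 0 f') = m.ecl (sgnp 0 f)" using ev_hom_eq_iff[OF A e] by simp
  then show "antipode kGa_minus (mcl f) = mcl (sgnp 0 f)"
    using f'(5) m.ecl_polys[OF sgnp_polys[OF f'(1)]] by (simp add: mcl_def)
qed

lemma tensor_hopf_simps:
  "carrier (tensor_hopf A B) = carrier (tensor A B)" "monoid.mult (tensor_hopf A B) = monoid.mult (tensor A B)"
  "one (tensor_hopf A B) = one (tensor A B)" "ring.zero (tensor_hopf A B) = ring.zero (tensor A B)"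
  "add (tensor_hopf A B) = add (tensor A B)" "module.smult (tensor_hopf A B) = module.smult (tensor A B)"
  "part (tensor_hopf A B) = part (tensor A B)"
  "counit (tensor_hopf A B) = tlift base_superalg (\<lambda>a b. counit A a * counit B b)"
  "antipode (tensor_hopf A B) = tmap A B (antipode A) (antipode B)"
  by (simp_all add: tensor_hopf_def Let_def superalg.defs hopf_superalg.defs)

definition ocl :: "'k::field pvpoly \<Rightarrow> ('k \<times> 'k pvpoly set \<Rightarrow>\<^sub>0 'k) set"
  where "ocl f = \<iota> kGa_minus (mcl f)"

text \<open>The tensor product of k with k[v]/v^2 becomes one more evaluation of polynomials, the
  form that \<open>iso_of_ev_hom\<close> expects.\<close>

lemma tensor_base_minus:
  fixes f :: "'k::field pvpoly"
  shows ev_hom_ocl: "ev_hom (tensor_hopf base_hopf (kGa_minus :: ('k, 'k pvpoly set) hopf_superalg)) ocl"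
    and ocl_range: "carrier (tensor_hopf base_hopf (kGa_minus :: ('k, 'k pvpoly set) hopf_superalg)) = range ocl"
    and ocl_eq_iff: "ocl f = ocl g \<longleftrightarrow> mcl f = mcl g"
    and comult_ocl: "f \<in> polys 0 \<Longrightarrow>
      comult (tensor_hopf base_hopf kGa_minus) (ocl f) = th (tensor_hopf base_hopf kGa_minus) ocl (Delta f)"
    and counit_ocl: "f \<in> polys 0 \<Longrightarrow> counit (tensor_hopf base_hopf kGa_minus) (ocl f) = lookup f 0"
    and antipode_ocl: "f \<in> polys 0 \<Longrightarrow> antipode (tensor_hopf base_hopf kGa_minus) (ocl f) = ocl (sgnp 0 f)"
proof -
  let ?k = "base_hopf :: ('k, 'k) hopf_superalg"
  let ?B = "kGa_minus :: ('k, 'k pvpoly set) hopf_superalg"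
  let ?T = "tensor ?k ?B"
  note B = superalgebra_kGa_minus[where 'k = 'k] and m = ev_homD[OF ev_hom_mcl[where 'k = 'k]]
  note Bm = superalgebra.axioms(1)[OF B] and lin = lin_iota[OF B]
  have car: "ocl f \<in> carrier ?T" for f :: "'k pvpoly" unfolding ocl_def by (rule lin_mapD(1)[OF lin m(1)])
  show "ev_hom (tensor_hopf ?k ?B) ocl"
    unfolding ev_hom_def tensor_hopf_simps
  proof (intro conjI allI impI)
    fix f g :: "'k pvpoly" and c :: 'k and i
    show "ocl f \<in> carrier ?T" by (rule car)
    show "ocl (f + g) = ocl f \<oplus>\<^bsub>?T\<^esub> ocl g"
      unfolding ocl_def m(2) by (rule lin_mapD(2)[OF lin m(1) m(1)])
    show "ocl (f * g) = ocl f \<otimes>\<^bsub>?T\<^esub> ocl g"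
      unfolding ocl_def m(3) by (rule iota_mult[OF B m(1) m(1)])
    show "ocl 1 = \<one>\<^bsub>?T\<^esub>"
      unfolding ocl_def m(4) \<iota>_def[OF B] by (simp add: tensor_def)
    show "ocl (pconst c * f) = c \<odot>\<^bsub>?T\<^esub> ocl f"
      unfolding ocl_def m(5) by (rule lin_mapD(3)[OF lin m(1)])
    assume "vpar i f"
    then show "ocl f \<in> part ?T i"
      unfolding ocl_def by (intro iota_part[OF B] m(6))
  qed
  show "carrier (tensor_hopf ?k ?B) = range ocl"
  proof (intro equalityI subsetI)
    fix z assume "z \<in> carrier (tensor_hopf ?k ?B)"
    then obtain b where b: "b \<in> carrier ?B" "z = \<iota> ?B b" using iota_surj[OF B, of z] unfolding tensor_hopf_simps by blast
    obtain f where "f \<in> polys 0" "b = mcl f" by (rule mcl_surj[OF b(1)])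
    then have "z = ocl f" using b(2) by (simp only: ocl_def)
    then show "z \<in> range ocl" by blast
  next
    fix z :: "('k \<times> 'k pvpoly set \<Rightarrow>\<^sub>0 'k) set" assume "z \<in> range ocl"
    then obtain f where z: "z = ocl f" by blast
    show "z \<in> carrier (tensor_hopf ?k ?B)" unfolding z tensor_hopf_simps by (rule car)
  qed
  show "ocl f = ocl g \<longleftrightarrow> mcl f = mcl g"
  proof
    assume "ocl f = ocl g"
    then show "mcl f = mcl g" unfolding ocl_def by (rule iota_inj[OF B m(1) m(1)])
  qed (simp only: ocl_def)
  have Cop: "Cop ?B (mcl f) = th ?T ocl (Delta f)" if "f \<in> polys 0" for f :: "'k pvpoly"
    unfolding Cop_def[OF B] kGa_minus_structure(1)[OF that] ocl_def
    by (rule tmap_th[OF Bm lin]) (rule m(1))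
  have com: "comult ?B b \<in> carrier (tensor ?B ?B)" if b: "b \<in> carrier ?B" for b
  proof -
    obtain f where f: "f \<in> polys 0" "b = mcl f" by (rule mcl_surj[OF b])
    show ?thesis unfolding f(2) kGa_minus_structure(1)[OF f(1)] by (rule th_closed) (rule m(1))
  qed
  have Cop_add: "Cop ?B (b \<oplus>\<^bsub>?B\<^esub> b') = Cop ?B b \<oplus>\<^bsub>tensor ?T ?T\<^esub> Cop ?B b'"
    if b: "b \<in> carrier ?B" "b' \<in> carrier ?B" for b b'
  proof -
    obtain f where f: "f \<in> polys 0" "b = mcl f" by (rule mcl_surj[OF b(1)])
    obtain f' where f': "f' \<in> polys 0" "b' = mcl f'" by (rule mcl_surj[OF b(2)])
    show ?thesis
      unfolding f(2) f'(2) m(2)[symmetric] Cop[OF f(1)] Cop[OF f'(1)] Cop[OF polys_add[OF f(1) f'(1)]]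
      by (simp add: Delta_add th_def thp_add)
  qed
  have Cop_smult: "Cop ?B (c \<odot>\<^bsub>?B\<^esub> b) = c \<odot>\<^bsub>tensor ?T ?T\<^esub> Cop ?B b" if b: "b \<in> carrier ?B" for b c
  proof -
    obtain f where f: "f \<in> polys 0" "b = mcl f" by (rule mcl_surj[OF b])
    show ?thesis
      unfolding f(2) m(5)[symmetric] Cop[OF f(1)] Cop[OF polys_mult[OF polys_const f(1)]]
      by (simp add: pconst_mult_eq Delta_fscale th_def thp_fscale)
  qed
  assume f: "f \<in> polys 0"
  have "comult (tensor_hopf ?k ?B) (ocl f) = Cop ?B (mcl f)"
    unfolding ocl_def by (rule comult_tensor_base[OF B com Cop_add Cop_smult m(1)])
  also have "\<dots> = th (tensor_hopf ?k ?B) ocl (Delta f)"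
    unfolding Cop[OF f] th_def by (rule fun_cong[OF tclass_cong]) (simp_all add: tensor_hopf_simps)
  finally show "comult (tensor_hopf ?k ?B) (ocl f) = th (tensor_hopf ?k ?B) ocl (Delta f)" .
  have base: "module \<K> (base_superalg :: ('k, 'k) superalg)"
    by (rule superalgebra.axioms(1)[OF superalgebra_cong[OF superalgebra_base_hopf]])
      (simp_all add: base_hopf_def superalg.defs)
  have lin_counit: "lin_map ?B (base_superalg :: ('k, 'k) superalg) (\<lambda>b. a * counit ?B b)" for a
  proof (rule lin_mapI)
    fix x y c assume x: "x \<in> carrier ?B" and y: "y \<in> carrier ?B"
    obtain f where f: "f \<in> polys 0" "x = mcl f" by (rule mcl_surj[OF x])
    obtain g where g: "g \<in> polys 0" "y = mcl g" by (rule mcl_surj[OF y])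
    show "a * counit ?B (x \<oplus>\<^bsub>?B\<^esub> y) = a * counit ?B x \<oplus>\<^bsub>base_superalg\<^esub> a * counit ?B y"
      unfolding f(2) g(2) m(2)[symmetric] kGa_minus_structure(2)[OF f(1)] kGa_minus_structure(2)[OF g(1)]
        kGa_minus_structure(2)[OF polys_add[OF f(1) g(1)]]
      by (simp add: lookup_add distrib_left)
  next
    fix x c assume x: "x \<in> carrier ?B"
    obtain f where f: "f \<in> polys 0" "x = mcl f" by (rule mcl_surj[OF x])
    show "a * counit ?B (c \<odot>\<^bsub>?B\<^esub> x) = c \<odot>\<^bsub>base_superalg\<^esub> (a * counit ?B x)"
      unfolding f(2) m(5)[symmetric] kGa_minus_structure(2)[OF f(1)]
        kGa_minus_structure(2)[OF polys_mult[OF polys_const f(1)]]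
      by (simp add: pconst_mult_eq)
  qed simp
  have bil: "bilin ?k ?B (base_superalg :: ('k, 'k) superalg) (\<lambda>a b. counit ?k a * counit ?B b)"
    unfolding bilin_def
  proof (intro conjI ballI)
    fix b assume "b \<in> carrier ?B"
    show "lin_map ?k (base_superalg :: ('k, 'k) superalg) (\<lambda>a. counit ?k a * counit ?B b)"
      by (rule lin_mapI) (simp_all add: distrib_right)
  next
    fix a :: 'k
    show "lin_map ?B (base_superalg :: ('k, 'k) superalg) (\<lambda>b. counit ?k a * counit ?B b)" by (rule lin_counit)
  qed
  show "counit (tensor_hopf ?k ?B) (ocl f) = lookup f 0"
    unfolding tensor_hopf_simps ocl_def tlift_pure[OF B base bil m(1)] kGa_minus_structure(2)[OF f] by simp
  have lin_k: "lin_map ?k ?k (antipode ?k)" by (rule lin_mapI) simp_all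
  have lin_anti: "lin_map ?B ?B (antipode ?B)"
  proof (rule lin_mapI)
    fix x y assume x: "x \<in> carrier ?B" and y: "y \<in> carrier ?B"
    obtain f where f: "f \<in> polys 0" "x = mcl f" by (rule mcl_surj[OF x])
    obtain g where g: "g \<in> polys 0" "y = mcl g" by (rule mcl_surj[OF y])
    show "antipode ?B (x \<oplus>\<^bsub>?B\<^esub> y) = antipode ?B x \<oplus>\<^bsub>?B\<^esub> antipode ?B y"
      unfolding f(2) g(2) m(2)[symmetric] kGa_minus_structure(3)[OF f(1)] kGa_minus_structure(3)[OF g(1)]
        kGa_minus_structure(3)[OF polys_add[OF f(1) g(1)]] sgnp_add ..
  next
    fix x c assume x: "x \<in> carrier ?B"
    obtain f where f: "f \<in> polys 0" "x = mcl f" by (rule mcl_surj[OF x])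
    show "antipode ?B x \<in> carrier ?B" unfolding f(2) kGa_minus_structure(3)[OF f(1)] by (rule m(1))
    show "antipode ?B (c \<odot>\<^bsub>?B\<^esub> x) = c \<odot>\<^bsub>?B\<^esub> antipode ?B x"
      unfolding f(2) m(5)[symmetric] kGa_minus_structure(3)[OF f(1)]
        kGa_minus_structure(3)[OF polys_mult[OF polys_const f(1)]] sgnp_smult ..
  qed
  have keys: "keys (single (1, mcl f) (1::'k)) \<subseteq> carrier ?k \<times> carrier ?B" using m(1)[of f] by simp
  have "antipode (tensor_hopf ?k ?B) (ocl f)
      = tclass ?k ?B (fextend (\<lambda>s. single (antipode ?k (fst s), antipode ?B (snd s)) 1) (single (1, mcl f) 1))"
    unfolding tensor_hopf_simps ocl_def \<iota>_def[OF B] pure_def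
    by (rule tmap_tclass[OF superalgebra.axioms(1)[OF superalgebra_base_hopf] Bm lin_k lin_anti keys])
  also have "\<dots> = ocl (sgnp 0 f)"
    unfolding ocl_def \<iota>_def[OF B] pure_def kGa_minus_structure(3)[OF f, symmetric] by simp
  finally show "antipode (tensor_hopf ?k ?B) (ocl f) = ocl (sgnp 0 f)" .
qed

context hopf_eval
begin

text \<open>The relation for s = 1 gives v^2 = 0 once u_0 = 0, so every element is a + b v. Such an
  element vanishes in \<open>A\<close> only if a and b are 0, by parity, the counit and v \<noteq>
  0; hence \<open>A\<close> and k[v]/v^2 have the same relations.\<close>

lemma iso_minus_case:
  assumes s: "s = 1" and u: "e u0 = \<zero>" and v: "e (pvar V) \<noteq> \<zero>"
  shows "iso_kGa_times_minus A 0"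
proof -
  let ?B = "kGa_minus :: ('k, 'k pvpoly set) hopf_superalg"
  interpret m: presentation 0 "{pvar V ^ 2 :: 'k pvpoly}" by (rule presentation_V2)
  note B = superalgebra_kGa_minus[where 'k = 'k] and hm = ev_hom_mcl[where 'k = 'k]
  define N where "N = Kid ?B mcl"
  have N: "pideal N" unfolding N_def by (rule pideal_Kid[OF B hm])
  have in_N: "x \<in> N \<longleftrightarrow> trunc 0 x \<in> m.J" for x :: "'k pvpoly"
    using mcl_eq_iff[of x 0] ev_hom_zero[OF B hm] by (simp add: N_def Kid_def)
  have e0: "e (trunc 0 f) = e f" for f
  proof (induction f rule: pvpoly_induct)
    case (var x)
    show ?case
    proof (cases x)
      case (U i)
      then show ?thesis using u vanish[of i] s ev_hom_zero[OF superalgebra_A e] by (cases i) (auto simp: trunc_pvar)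
    qed (simp add: trunc_pvar)
  qed (simp_all add: trunc_add trunc_mult ev_homD(2,3)[OF e])
  have V2: "pvar V ^ 2 \<in> K"
  proof -
    have "u0 \<in> K" using u by (simp add: in_K)
    then have "u0 * u0 ^ (p - 1) \<in> K" by (rule pideal_mult_right[OF ci.K])
    moreover have "u0 * u0 ^ (p - 1) = (u0 ^ p :: 'k pvpoly)" using p3 by (simp add: power_eq_if)
    ultimately have "u0 ^ p \<in> K" by simp
    from pideal_diff[OF ci.K u_v_K this] show ?thesis using s by simp
  qed
  have "ideal (K \<inter> polys 0) m.R"
    by (rule ideal_polyI) (use ci.K in \<open>auto simp: pideal_rules polys_add polys_mult\<close>)
  moreover have "{pvar V ^ 2} \<subseteq> K \<inter> polys 0" using V2 by (simp add: polys_power)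
  ultimately have "m.J \<subseteq> K \<inter> polys 0" by (rule m.J_minimal)
  then have NK: "x \<in> K" if "x \<in> N" for x using that e0[of x] by (auto simp: in_N in_K)
  have V2N: "pvar V ^ 2 \<in> N"
    unfolding in_N using subsetD[OF m.rels_J, of "pvar V ^ 2"] by (simp add: trunc_polys polys_power)
  have nf: "\<exists>a b. x - (pconst a + pconst b * pvar V) \<in> N" for x
  proof (induction x rule: pvpoly_induct)
    case (const c)
    then show ?case using pideal_0[OF N] by (intro exI[of _ c] exI[of _ 0]) (simp add: pconst_def)
  next
    case (var x)
    show ?case
    proof (cases x)
      case (U i)
      have "trunc 0 (pvar x) = (trunc 0 0 :: 'k pvpoly)" using U by (simp add: trunc_pvar) (simp add: trunc_def)
      then have "pvar x \<in> N" using pideal_0[OF N] by (simp only: in_N)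
      then show ?thesis by (intro exI[of _ 0]) (simp add: pconst_def)
    next
      case V
      have "pvar x - (pconst 0 + pconst 1 * pvar V) = (0 :: 'k pvpoly)" using V by (simp add: pconst_def)
      then have "pvar x - (pconst 0 + pconst 1 * pvar V) \<in> N" using pideal_0[OF N] by (simp only:)
      then show ?thesis by (intro exI[of _ 0] exI[of _ 1])
    qed
  next
    case (add f g)
    then obtain a b a' b' where "f - (pconst a + pconst b * pvar V) \<in> N" "g - (pconst a' + pconst b' * pvar V) \<in> N" by blast
    note ab = this
    have eq: "f + g - (pconst (a + a') + pconst (b + b') * pvar V)
        = (f - (pconst a + pconst b * pvar V)) + (g - (pconst a' + pconst b' * pvar V))"
      by (simp add: pconst_plus algebra_simps)
    have "f + g - (pconst (a + a') + pconst (b + b') * pvar V) \<in> N"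
      unfolding eq by (rule pideal_add[OF N ab])
    then show ?case by (intro exI[of _ "a + a'"] exI[of _ "b + b'"])
  next
    case (mult f g)
    then obtain a b a' b' where "f - (pconst a + pconst b * pvar V) \<in> N" "g - (pconst a' + pconst b' * pvar V) \<in> N" by blast
    then have "f * g - (pconst a + pconst b * pvar V) * (pconst a' + pconst b' * pvar V) \<in> N"
      by (rule cong_mult'[OF N])
    moreover have "(pconst a + pconst b * pvar V) * (pconst a' + pconst b' * pvar V)
        - (pconst (a * a') + pconst (a * b' + b * a') * pvar V) \<in> N"
    proof -
      have "(pconst a + pconst b * pvar V) * (pconst a' + pconst b' * pvar V)
          - (pconst (a * a') + pconst (a * b' + b * a') * pvar V) = (pconst b * pconst b') * pvar V ^ 2"
        by (simp add: pconst_plus pconst_times algebra_simps power2_eq_square)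
      then show ?thesis using pideal_mult_left[OF N V2N] by simp
    qed
    ultimately have "f * g - (pconst (a * a') + pconst (a * b' + b * a') * pvar V) \<in> N"
      by (rule cong_trans'[OF N])
    then show ?case by (intro exI[of _ "a * a'"] exI[of _ "a * b' + b * a'"])
  qed
  have KN: "x \<in> N" if x: "x \<in> K" for x
  proof -
    obtain a b where ab: "x - (pconst a + pconst b * pvar V) \<in> N" using nf by blast
    have "pconst a + pconst b * pvar V \<in> K" using pideal_diff[OF ci.K x NK[OF ab]] by simp
    then have k: "pconst a \<in> K" "pconst b * pvar V \<in> K"
      using K_parity[OF vpar_const vpar_smult[OF vpar_V]] by blast+
    have "a = 0" using K_lookup_0[OF k(1) polys_const] by (simp add: pconst_def)
    moreover have "b = 0"
      using K_smult[of b "pvar V"] k(2) v unfolding pconst_mult_eq in_K by blast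
    ultimately show ?thesis using ab by (simp add: pconst_def)
  qed
  have eq: "ocl f = ocl g \<longleftrightarrow> e f = e g" for f g
  proof -
    have "mcl f = mcl g \<longleftrightarrow> f - g \<in> N"
      using ev_hom_eq_iff[OF B hm, of f g] by (simp only: N_def Kid_def mem_Collect_eq)
    then show ?thesis unfolding ocl_eq_iff e_eq_iff using NK[of "f - g"] KN[of "f - g"] by blast
  qed
  have "A \<cong>\<^sub>H tensor_hopf (base_hopf :: ('k, 'k) hopf_superalg) ?B"
  proof (rule iso_of_ev_hom[OF ev_hom_ocl eq ocl_range])
    fix x assume "x \<in> carrier A"
    then obtain f where "x = e f" using surj by blast
    then have x: "x = e (trunc 0 f)" by (simp only: e0)
    have f0: "trunc 0 f \<in> polys 0" by (rule trunc_in_polys)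
    then have fs: "trunc 0 f \<in> polys s" unfolding polys_def by auto
    \<comment> \<open>The algebra k[v]/v^2 is presented without any u_i and \<open>A\<close> with
      u_0; on polynomials in v alone the two antipode signs agree.\<close>
    have "antipode_sign 0 y = (antipode_sign s y :: 'k)" if "y \<in> keys (trunc 0 f)" for y
    proof -
      have "y \<in> mons 0" using f0 that unfolding polys_def by blast
      then have "U 0 \<notin> keys y" by auto
      then have "lookup y (U 0) = 0" by (simp add: in_keys_iff)
      then show ?thesis by (simp add: antipode_sign_def s)
    qed
    then have sg: "sgnp 0 (trunc 0 f) = sgnp s (trunc 0 f)" unfolding sgnp_def by (intro fextend_cong) simp
    show "\<exists>f\<in>polys s. x = e f \<and>
        comult (tensor_hopf base_hopf ?B) (ocl f) = th (tensor_hopf base_hopf ?B) ocl (Delta f) \<and>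
        counit (tensor_hopf base_hopf ?B) (ocl f) = lookup f 0 \<and>
        antipode (tensor_hopf base_hopf ?B) (ocl f) = ocl (sgnp s f)"
      unfolding x using fs comult_ocl[OF f0] counit_ocl[OF f0] antipode_ocl[OF f0, unfolded sg] e0[of f]
      by (intro bexI[of _ "trunc 0 f"] conjI refl)
  qed
  then show ?thesis by (simp add: iso_kGa_times_minus_def)
qed

end

text \<open>The four terminal cases are told apart by whether u_0 and v vanish. The second
  alternative is reached only with s' = 0: for s \<ge> 1 the product with the odd additive scheme is
  the case f = T^p, \<eta> = 0 of the third.\<close>

theorem hopf_eval_classification:
  fixes A :: "('k::field, 'a) hopf_superalg"
  assumes "hopf_eval A s p e" and fin: "finite_dim A"
  shows "(\<exists>s'\<le>s. iso_kGa A s') \<or> (\<exists>s'\<le>s. iso_kGa_times_minus A s') \<or>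
    (\<exists>s' f \<eta>. 1 \<le> s' \<and> s' \<le> s \<and> inseparable_p_poly f \<and> f \<noteq> 0 \<and> A \<cong>\<^sub>H kM s' f \<eta>)"
  using assms(1)
proof (induction s arbitrary: e rule: less_induct)
  case (less s)
  interpret hopf_eval A s p e by (rule less.prems)
  show ?case
  proof (cases "e (pvar (U 0)) = \<zero>\<^bsub>A\<^esub>")
    case u: True
    show ?thesis
    proof (cases "s = 1")
      case True
      show ?thesis
      proof (cases "e (pvar V) = \<zero>\<^bsub>A\<^esub>")
        case v: True
        show ?thesis by (rule disjI1, intro exI[of _ 0] conjI le0 iso_base_case[OF True u v])
      next
        case v: False
        show ?thesis by (rule disjI2, rule disjI1, intro exI[of _ 0] conjI le0 iso_minus_case[OF True u v])
      qed
    next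
      case False
      then have s: "2 \<le> s" "s - 1 < s" using s1 by linarith+
      have le: "s' \<le> s" if "s' \<le> s - 1" for s' using that by linarith
      from less.IH[OF s(2) hopf_eval_shift[OF s(1) u]] show ?thesis
      proof (elim disjE exE conjE)
        fix s' assume s': "s' \<le> s - 1" "iso_kGa A s'"
        show ?thesis by (rule disjI1, intro exI[of _ s'] conjI le s')
      next
        fix s' assume s': "s' \<le> s - 1" "iso_kGa_times_minus A s'"
        show ?thesis by (rule disjI2, rule disjI1, intro exI[of _ s'] conjI le s')
      next
        fix s' f \<eta> assume s': "1 \<le> s'" "s' \<le> s - 1" "inseparable_p_poly f" "f \<noteq> 0" "A \<cong>\<^sub>H kM s' f \<eta>"
        show ?thesis by (rule disjI2, rule disjI2, intro exI[of _ s'] exI[of _ f] exI[of _ \<eta>] conjI le s')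
      qed
    qed
  next
    case u: False
    show ?thesis
    proof (cases "e (pvar V) = \<zero>\<^bsub>A\<^esub>")
      case v: True
      show ?thesis by (rule disjI1, intro exI[of _ s] conjI order.refl iso_kGa_case[OF u v])
    next
      case v: False
      obtain f \<eta> where f: "inseparable_p_poly f" "f \<noteq> 0" "A \<cong>\<^sub>H kM s f \<eta>"
        using iso_kM_case[OF u v fin] by (elim exE conjE)
      show ?thesis
        by (rule disjI2, rule disjI2, intro exI[of _ s] exI[of _ f] exI[of _ \<eta>] conjI s1 order.refl f)
    qed
  qed
qed

theorem proposition2p2p1:
  fixes A :: "('k::field, 'a) hopf_superalg"
    and \<pi> :: "'k pvpoly set \<Rightarrow> 'a"
    and p r :: nat
  assumes "CHAR('k) = p" and "3 \<le> p" and "1 \<le> r"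
    and "hopf_superalgebra A" and "finite_dim A"
    and "hopf_hom (PP r) A \<pi>" and "\<pi> ` carrier (PP r :: ('k, 'k pvpoly set) hopf_superalg) = carrier A"
  shows "((\<exists>s\<le>r. iso_kGa A s) \<or>
          (\<exists>s\<le>r. iso_kGa_times_minus A s) \<or>
          (\<exists>s f \<eta>. 1 \<le> s \<and> s \<le> r \<and> inseparable_p_poly f \<and> f \<noteq> 0 \<and> A \<cong>\<^sub>H kM s f \<eta>)) \<and>
         multiparameter_group_algebra A"
proof -
  have D: "(\<exists>s\<le>r. iso_kGa A s) \<or> (\<exists>s\<le>r. iso_kGa_times_minus A s) \<or>
      (\<exists>s f \<eta>. 1 \<le> s \<and> s \<le> r \<and> inseparable_p_poly f \<and> f \<noteq> 0 \<and> A \<cong>\<^sub>H kM s f \<eta>)"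
    by (rule hopf_eval_classification[OF hopf_eval_of_hom[OF assms(1-4,6,7)] assms(5)])
  then have "multiparameter_group_algebra A"
    unfolding multiparameter_group_algebra_def
    by (elim disjE exE conjE) (rule disjI1, erule exI, rule disjI2, rule disjI1, erule exI,
      rule disjI2, rule disjI2, intro exI conjI, assumption+)
  with D show ?thesis by (rule conjI)
qed

end
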